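(* Let $A$ be a brick gentle algebra. There is a bijection between $\mathrm{torshad}(\Pi(A))$ and $\mathrm{widshad}(\Pi(A))$.
   Context: Setting: $k$ a field, $A=kQ/I$, $Q$ finite connected quiver, $I$ admissible generated by paths (paths composed right to left). Gentle: (S1) each vertex has at most two incoming and two outgoing arrows; (S2) for each arrow $\alpha$ at most one $\beta$ with $\alpha\beta$ a path not in $I$ and at most one $\gamma$ with $\gamma\alpha$ a path not in $I$; (G1) $I$ generated by paths of length two; (G2) for each arrow $\alpha$ at most one $\beta$ with $\alpha\beta$ a path in $I$ and at most one $\gamma$ with $\gamma\alpha$ a path in $I$. Brick gentle: moreover every indecomposable module has endomorphism ring a division ring. Strings (for any $k\Gamma/J$, $J$ generated by paths): words $w=\gamma_d^{\epsilon_d}\cdots\gamma_1^{\epsilon_1}$ in arrows and formal inverses ($s(\gamma^{-1})=t(\gamma)$, $t(\gamma^{-1})=s(\gamma)$), consecutive letters composable, no $\gamma\gamma^{-1}$ or $\gamma^{-1}\gamma$, neither $w$ nor $w^{-1}$ containing a subword which is a path in $J$; plus length-zero strings; $w\sim w^{-1}$. String module $M(w)$: basis $b_1,\dots,b_{d+1}$, $b_j$ at vertex $x_j$ ($x_1=s(\gamma_1^{\epsilon_1})$, $x_{i+1}=t(\gamma_i^{\epsilon_i})$); $\gamma_i$ sends $b_i\mapsto b_{i+1}$ if $\epsilon_i=1$, $b_{i+1}\mapsto b_i$ if $\epsilon_i=-1$, other actions zero. $\Pi(A)=k\overline Q/\overline I$: $\overline Q$ has vertices $Q_0$ and arrows $Q_1$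 together with $\gamma^*:t(\gamma)\to s(\gamma)$ for each $\gamma\in Q_1$; $\overline I$ generated by $\beta\alpha,\alpha^*\beta^*$ for all paths $\beta\alpha\in I$ of length two. A string of $\Pi(A)$ specializes to the word obtained by replacing $\gamma^*$ by $\gamma^{-1}$ and $(\gamma^* )^{-1}$ by $\gamma$. $\mathcal M\subseteq\mathrm{mod}(\Pi(A))$ is the additive closure of all string modules $M(\widetilde w)$ with $\widetilde w$ a string of $\Pi(A)$ specializing to a string of $A$. $\mathrm{torshad}(\Pi(A))$ is the set of $\mathcal T\cap\mathcal M$ with $\mathcal T$ a torsion class (subcategory closed under quotients and extensions) of $\mathrm{mod}(\Pi(A))$; $\mathrm{widshad}(\Pi(A))$ is the set of $\mathcal W\cap\mathcal M$ with $\mathcal W$ a wide subcategory (abelian, closed under extensions) of $\mathrm{mod}(\Pi(A))$. *)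

theory Defs
  imports Main "Jordan_Normal_Form.Matrix"
begin

section \<open>Bound quivers with path relations\<close>

text \<open>A bound quiver (Q, I) with I generated by paths.  The field rels is the set of
  paths lying in I; since I is generated by paths, I is the span of these paths, so I is
  determined by this set.  Paths are lists of arrows in the order in which they are
  traversed: the composite path beta alpha (first alpha, then beta) is the list [alpha, beta].\<close>

record ('v, 'a) bquiver =
  verts :: "'v set"
  arrs  :: "'a set"
  src   :: "'a \<Rightarrow> 'v"
  tgt   :: "'a \<Rightarrow> 'v"
  rels  :: "'a list set"

definition is_path :: "('v, 'a) bquiver \<Rightarrow> 'a list \<Rightarrow> bool" where
  "is_path Q p \<longleftrightarrow> p \<noteq> [] \<and> set p \<subseteq> arrs Q \<and>
     (\<forall>i. Suc i < length p \<longrightarrow> tgt Q (p ! i) = src Q (p ! Suc i))"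

definition connected_quiver :: "('v, 'a) bquiver \<Rightarrow> bool" where
  "connected_quiver Q \<longleftrightarrow> verts Q \<noteq> {} \<and>
     (\<forall>x\<in>verts Q. \<forall>y\<in>verts Q.
        (x, y) \<in> ({(src Q a, tgt Q a) | a. a \<in> arrs Q} \<union> {(tgt Q a, src Q a) | a. a \<in> arrs Q})\<^sup>*)"

text \<open>Finite quiver, rels is the set of paths of a two-sided ideal generated by paths,
  and the ideal is admissible.\<close>
definition admissible_path_bquiver :: "('v, 'a) bquiver \<Rightarrow> bool" where
  "admissible_path_bquiver Q \<longleftrightarrow>
     finite (verts Q) \<and> finite (arrs Q) \<and>
     (\<forall>a\<in>arrs Q. src Q a \<in> verts Q \<and> tgt Q a \<in> verts Q) \<and>
     (\<forall>p\<in>rels Q. is_path Q p) \<and>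
     (\<forall>p\<in>rels Q. \<forall>u v. is_path Q (u @ p @ v) \<longrightarrow> u @ p @ v \<in> rels Q) \<and>
     (\<forall>p\<in>rels Q. 2 \<le> length p) \<and>
     (\<exists>N. \<forall>p. is_path Q p \<and> N \<le> length p \<longrightarrow> p \<in> rels Q)"

text \<open>Gentle conditions (S1), (S2), (G1), (G2).  Here "alpha beta is a path" means
  first beta then alpha, i.e. the list [beta, alpha].\<close>
definition gentle :: "('v, 'a) bquiver \<Rightarrow> bool" where
  "gentle Q \<longleftrightarrow>
     (\<forall>x\<in>verts Q. card {a\<in>arrs Q. tgt Q a = x} \<le> 2 \<and> card {a\<in>arrs Q. src Q a = x} \<le> 2) \<and>
     (\<forall>\<alpha>\<in>arrs Q.
        card {\<beta>\<in>arrs Q. tgt Q \<beta> = src Q \<alpha> \<and> [\<beta>, \<alpha>] \<notin> rels Q} \<le> 1 \<and>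
        card {\<gamma>\<in>arrs Q. src Q \<gamma> = tgt Q \<alpha> \<and> [\<alpha>, \<gamma>] \<notin> rels Q} \<le> 1) \<and>
     (\<forall>p. p \<in> rels Q \<longleftrightarrow>
        is_path Q p \<and> (\<exists>u a b v. p = u @ [a, b] @ v \<and> [a, b] \<in> rels Q)) \<and>
     (\<forall>\<alpha>\<in>arrs Q.
        card {\<beta>\<in>arrs Q. tgt Q \<beta> = src Q \<alpha> \<and> [\<beta>, \<alpha>] \<in> rels Q} \<le> 1 \<and>
        card {\<gamma>\<in>arrs Q. src Q \<gamma> = tgt Q \<alpha> \<and> [\<alpha>, \<gamma>] \<in> rels Q} \<le> 1)"

section \<open>Finite-dimensional representations (= modules)\<close>

record ('v, 'a, 'k) rep =
  rdim :: "'v \<Rightarrow> nat"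
  rmap :: "'a \<Rightarrow> 'k mat"

fun path_mat :: "('v, 'a, 'k::field) rep \<Rightarrow> 'a list \<Rightarrow> 'k mat" where
  "path_mat M [] = undefined"
| "path_mat M [a] = rmap M a"
| "path_mat M (a # p) = path_mat M p * rmap M a"

definition is_rep :: "('v, 'a) bquiver \<Rightarrow> ('v, 'a, 'k::field) rep \<Rightarrow> bool" where
  "is_rep Q M \<longleftrightarrow>
     (\<forall>a\<in>arrs Q. rmap M a \<in> carrier_mat (rdim M (tgt Q a)) (rdim M (src Q a))) \<and>
     (\<forall>p\<in>rels Q. path_mat M p = 0\<^sub>m (rdim M (tgt Q (last p))) (rdim M (src Q (hd p))))"

definition mods :: "('v, 'a) bquiver \<Rightarrow> ('v, 'a, 'k::field) rep set" where
  "mods Q = {M. is_rep Q M}"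

definition is_hom :: "('v, 'a) bquiver \<Rightarrow> ('v, 'a, 'k::field) rep \<Rightarrow> ('v, 'a, 'k) rep
     \<Rightarrow> ('v \<Rightarrow> 'k mat) \<Rightarrow> bool" where
  "is_hom Q M N f \<longleftrightarrow>
     (\<forall>v\<in>verts Q. f v \<in> carrier_mat (rdim N v) (rdim M v)) \<and>
     (\<forall>a\<in>arrs Q. f (tgt Q a) * rmap M a = rmap N a * f (src Q a))"

definition inj_mat :: "'k::field mat \<Rightarrow> bool" where
  "inj_mat A \<longleftrightarrow> (\<forall>x\<in>carrier_vec (dim_col A). A *\<^sub>v x = 0\<^sub>v (dim_row A) \<longrightarrow> x = 0\<^sub>v (dim_col A))"

definition surj_mat :: "'k::field mat \<Rightarrow> bool" where
  "surj_mat A \<longleftrightarrow> (\<forall>y\<in>carrier_vec (dim_row A). \<exists>x\<in>carrier_vec (dim_col A). A *\<^sub>v x = y)"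

text \<open>exact_mat f g: image of f equals kernel of g (f : U -> V, g : V -> W).\<close>
definition exact_mat :: "'k::field mat \<Rightarrow> 'k mat \<Rightarrow> bool" where
  "exact_mat f g \<longleftrightarrow> (\<forall>y\<in>carrier_vec (dim_col g).
     g *\<^sub>v y = 0\<^sub>v (dim_row g) \<longleftrightarrow> (\<exists>x\<in>carrier_vec (dim_col f). f *\<^sub>v x = y))"

definition is_mono :: "('v, 'a) bquiver \<Rightarrow> ('v, 'a, 'k::field) rep \<Rightarrow> ('v, 'a, 'k) rep
     \<Rightarrow> ('v \<Rightarrow> 'k mat) \<Rightarrow> bool" where
  "is_mono Q M N f \<longleftrightarrow> is_hom Q M N f \<and> (\<forall>v\<in>verts Q. inj_mat (f v))"

definition is_epi :: "('v, 'a) bquiver \<Rightarrow> ('v, 'a, 'k::field) rep \<Rightarrow> ('v, 'a, 'k) rep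
     \<Rightarrow> ('v \<Rightarrow> 'k mat) \<Rightarrow> bool" where
  "is_epi Q M N f \<longleftrightarrow> is_hom Q M N f \<and> (\<forall>v\<in>verts Q. surj_mat (f v))"

definition is_iso :: "('v, 'a) bquiver \<Rightarrow> ('v, 'a, 'k::field) rep \<Rightarrow> ('v, 'a, 'k) rep
     \<Rightarrow> ('v \<Rightarrow> 'k mat) \<Rightarrow> bool" where
  "is_iso Q M N f \<longleftrightarrow> is_mono Q M N f \<and> is_epi Q M N f"

definition isomorphic :: "('v, 'a) bquiver \<Rightarrow> ('v, 'a, 'k::field) rep \<Rightarrow> ('v, 'a, 'k) rep \<Rightarrow> bool" where
  "isomorphic Q M N \<longleftrightarrow> (\<exists>f. is_iso Q M N f)"

definition is_zero_rep :: "('v, 'a) bquiver \<Rightarrow> ('v, 'a, 'k::field) rep \<Rightarrow> bool" where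
  "is_zero_rep Q M \<longleftrightarrow> (\<forall>v\<in>verts Q. rdim M v = 0)"

definition zero_rep :: "('v, 'a, 'k::field) rep" where
  "zero_rep = \<lparr> rdim = (\<lambda>v. 0), rmap = (\<lambda>a. 0\<^sub>m 0 0) \<rparr>"

definition dsum :: "('v, 'a) bquiver \<Rightarrow> ('v, 'a, 'k::field) rep \<Rightarrow> ('v, 'a, 'k) rep \<Rightarrow> ('v, 'a, 'k) rep" where
  "dsum Q M N = \<lparr> rdim = (\<lambda>v. rdim M v + rdim N v),
     rmap = (\<lambda>a. four_block_mat (rmap M a) (0\<^sub>m (rdim M (tgt Q a)) (rdim N (src Q a)))
                               (0\<^sub>m (rdim N (tgt Q a)) (rdim M (src Q a))) (rmap N a)) \<rparr>"

fun dsum_list :: "('v, 'a) bquiver \<Rightarrow> ('v, 'a, 'k::field) rep list \<Rightarrow> ('v, 'a, 'k) rep" where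
  "dsum_list Q [] = zero_rep"
| "dsum_list Q (M # Ms) = dsum Q M (dsum_list Q Ms)"

text \<open>Additive closure: direct summands (up to isomorphism) of finite direct sums.\<close>
definition add_closure :: "('v, 'a) bquiver \<Rightarrow> ('v, 'a, 'k::field) rep set \<Rightarrow> ('v, 'a, 'k) rep set" where
  "add_closure Q S = {X \<in> mods Q. \<exists>Y\<in>mods Q. \<exists>Ms. set Ms \<subseteq> S \<and>
       isomorphic Q (dsum Q X Y) (dsum_list Q Ms)}"

definition indecomposable :: "('v, 'a) bquiver \<Rightarrow> ('v, 'a, 'k::field) rep \<Rightarrow> bool" where
  "indecomposable Q M \<longleftrightarrow> M \<in> mods Q \<and> \<not> is_zero_rep Q M \<and>
     (\<forall>X\<in>mods Q. \<forall>Y\<in>mods Q. isomorphic Q M (dsum Q X Y) \<longrightarrow> is_zero_rep Q X \<or> is_zero_rep Q Y)"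

text \<open>End(M) is a division ring: every nonzero endomorphism is invertible.\<close>
definition end_division :: "('v, 'a) bquiver \<Rightarrow> ('v, 'a, 'k::field) rep \<Rightarrow> bool" where
  "end_division Q M \<longleftrightarrow> \<not> is_zero_rep Q M \<and>
     (\<forall>f. is_hom Q M M f \<and> \<not> (\<forall>v\<in>verts Q. f v = 0\<^sub>m (rdim M v) (rdim M v)) \<longrightarrow> is_iso Q M M f)"

definition brick_gentle :: "'k::field itself \<Rightarrow> ('v, 'a) bquiver \<Rightarrow> bool" where
  "brick_gentle TYPE('k) Q \<longleftrightarrow> admissible_path_bquiver Q \<and> connected_quiver Q \<and> gentle Q \<and>
     (\<forall>M :: ('v, 'a, 'k) rep. indecomposable Q M \<longrightarrow> end_division Q M)"

section \<open>Subcategories\<close>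

definition short_exact :: "('v, 'a) bquiver \<Rightarrow> ('v, 'a, 'k::field) rep \<Rightarrow> ('v, 'a, 'k) rep
     \<Rightarrow> ('v, 'a, 'k) rep \<Rightarrow> ('v \<Rightarrow> 'k mat) \<Rightarrow> ('v \<Rightarrow> 'k mat) \<Rightarrow> bool" where
  "short_exact Q X Y Z f g \<longleftrightarrow> is_mono Q X Y f \<and> is_epi Q Y Z g \<and>
     (\<forall>v\<in>verts Q. exact_mat (f v) (g v))"

definition ext_closed :: "('v, 'a) bquiver \<Rightarrow> ('v, 'a, 'k::field) rep set \<Rightarrow> bool" where
  "ext_closed Q C \<longleftrightarrow> (\<forall>X\<in>C. \<forall>Z\<in>C. \<forall>Y\<in>mods Q. \<forall>f g.
      short_exact Q X Y Z f g \<longrightarrow> Y \<in> C)"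

definition quot_closed :: "('v, 'a) bquiver \<Rightarrow> ('v, 'a, 'k::field) rep set \<Rightarrow> bool" where
  "quot_closed Q C \<longleftrightarrow> (\<forall>X\<in>C. \<forall>Y\<in>mods Q. \<forall>f. is_epi Q X Y f \<longrightarrow> Y \<in> C)"

definition iso_closed :: "('v, 'a) bquiver \<Rightarrow> ('v, 'a, 'k::field) rep set \<Rightarrow> bool" where
  "iso_closed Q C \<longleftrightarrow> (\<forall>X\<in>C. \<forall>Y\<in>mods Q. isomorphic Q X Y \<longrightarrow> Y \<in> C)"

definition ker_closed :: "('v, 'a) bquiver \<Rightarrow> ('v, 'a, 'k::field) rep set \<Rightarrow> bool" where
  "ker_closed Q C \<longleftrightarrow> (\<forall>X\<in>C. \<forall>Y\<in>C. \<forall>h. is_hom Q X Y h \<longrightarrow>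
      (\<forall>K\<in>mods Q. \<forall>i. is_mono Q K X i \<and> (\<forall>v\<in>verts Q. exact_mat (i v) (h v)) \<longrightarrow> K \<in> C))"

definition coker_closed :: "('v, 'a) bquiver \<Rightarrow> ('v, 'a, 'k::field) rep set \<Rightarrow> bool" where
  "coker_closed Q C \<longleftrightarrow> (\<forall>X\<in>C. \<forall>Y\<in>C. \<forall>h. is_hom Q X Y h \<longrightarrow>
      (\<forall>K\<in>mods Q. \<forall>p. is_epi Q Y K p \<and> (\<forall>v\<in>verts Q. exact_mat (h v) (p v)) \<longrightarrow> K \<in> C))"

text \<open>Torsion class: (nonempty, hence containing 0) full subcategory closed under quotients
  and extensions.\<close>
definition torsion_class :: "('v, 'a) bquiver \<Rightarrow> ('v, 'a, 'k::field) rep set \<Rightarrow> bool" where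
  "torsion_class Q C \<longleftrightarrow> C \<subseteq> mods Q \<and> C \<noteq> {} \<and> quot_closed Q C \<and> ext_closed Q C"

text \<open>Wide subcategory: exact abelian subcategory closed under extensions, i.e. a (nonempty)
  full subcategory closed under isomorphisms, kernels, cokernels and extensions.\<close>
definition wide_subcat :: "('v, 'a) bquiver \<Rightarrow> ('v, 'a, 'k::field) rep set \<Rightarrow> bool" where
  "wide_subcat Q C \<longleftrightarrow> C \<subseteq> mods Q \<and> C \<noteq> {} \<and> iso_closed Q C \<and>
     ker_closed Q C \<and> coker_closed Q C \<and> ext_closed Q C"

section \<open>Strings and string modules\<close>

text \<open>A word gamma_d^eps_d ... gamma_1^eps_1 is stored as (x, [(gamma_1,eps_1), ..., (gamma_d,eps_d)])
  where x is the start vertex x_1 and eps = True means a direct letter.\<close>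

definition letter_src :: "('v, 'a) bquiver \<Rightarrow> 'a \<times> bool \<Rightarrow> 'v" where
  "letter_src Q l = (if snd l then src Q (fst l) else tgt Q (fst l))"

definition letter_tgt :: "('v, 'a) bquiver \<Rightarrow> 'a \<times> bool \<Rightarrow> 'v" where
  "letter_tgt Q l = (if snd l then tgt Q (fst l) else src Q (fst l))"

definition word_verts :: "('v, 'a) bquiver \<Rightarrow> 'v \<times> ('a \<times> bool) list \<Rightarrow> 'v list" where
  "word_verts Q w = fst w # map (letter_tgt Q) (snd w)"

definition inv_word :: "('v, 'a) bquiver \<Rightarrow> 'v \<times> ('a \<times> bool) list \<Rightarrow> 'v \<times> ('a \<times> bool) list" where
  "inv_word Q w = (last (word_verts Q w), rev (map (\<lambda>(a, e). (a, \<not> e)) (snd w)))"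

text \<open>No subword consisting of direct letters is a path in the relation ideal.\<close>
definition no_rel_subword :: "('v, 'a) bquiver \<Rightarrow> ('a \<times> bool) list \<Rightarrow> bool" where
  "no_rel_subword Q ws \<longleftrightarrow> (\<forall>i j. i < j \<and> j \<le> length ws \<and>
      (\<forall>l\<in>set (take (j - i) (drop i ws)). snd l) \<longrightarrow>
      map fst (take (j - i) (drop i ws)) \<notin> rels Q)"

definition is_string :: "('v, 'a) bquiver \<Rightarrow> 'v \<times> ('a \<times> bool) list \<Rightarrow> bool" where
  "is_string Q w \<longleftrightarrow> (let x = fst w; ws = snd w in
     x \<in> verts Q \<and> (\<forall>l\<in>set ws. fst l \<in> arrs Q) \<and>
     (ws \<noteq> [] \<longrightarrow> letter_src Q (ws ! 0) = x) \<and>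
     (\<forall>i. Suc i < length ws \<longrightarrow> letter_tgt Q (ws ! i) = letter_src Q (ws ! Suc i)) \<and>
     (\<forall>i. Suc i < length ws \<longrightarrow> \<not> (fst (ws ! i) = fst (ws ! Suc i) \<and> snd (ws ! i) \<noteq> snd (ws ! Suc i))) \<and>
     no_rel_subword Q ws \<and> no_rel_subword Q (snd (inv_word Q w)))"

definition string_module :: "('v, 'a) bquiver \<Rightarrow> 'v \<times> ('a \<times> bool) list \<Rightarrow> ('v, 'a, 'k::field) rep" where
  "string_module Q w = (let ws = snd w; xs = word_verts Q w;
       dm = (\<lambda>v. length (filter (\<lambda>u. u = v) xs));
       idx = (\<lambda>j. length (filter (\<lambda>u. u = xs ! j) (take j xs)))
     in \<lparr> rdim = dm,
          rmap = (\<lambda>a. mat (dm (tgt Q a)) (dm (src Q a)) (\<lambda>(r, c).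
             if (\<exists>i<length ws. fst (ws ! i) = a \<and>
                   (if snd (ws ! i) then r = idx (Suc i) \<and> c = idx i
                    else r = idx i \<and> c = idx (Suc i))) then 1 else 0)) \<rparr>)"

section \<open>The algebra Pi(A) and shadows\<close>

definition Pi_quiver :: "('v, 'a) bquiver \<Rightarrow> ('v, 'a + 'a) bquiver" where
  "Pi_quiver Q = (let Q0 = \<lparr> verts = verts Q, arrs = Inl ` arrs Q \<union> Inr ` arrs Q,
        src = case_sum (src Q) (tgt Q), tgt = case_sum (tgt Q) (src Q), rels = {} \<rparr>
     in Q0 \<lparr> rels := {p. is_path Q0 p \<and> (\<exists>u x y v. p = u @ [x, y] @ v \<and>
             (\<exists>\<alpha> \<beta>. [\<alpha>, \<beta>] \<in> rels Q \<and> ([x, y] = [Inl \<alpha>, Inl \<beta>] \<or> [x, y] = [Inr \<beta>, Inr \<alpha>])))} \<rparr>)"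

definition specialize :: "'v \<times> (('a + 'a) \<times> bool) list \<Rightarrow> 'v \<times> ('a \<times> bool) list" where
  "specialize w = (fst w, map (\<lambda>(b, e). case b of Inl g \<Rightarrow> (g, e) | Inr g \<Rightarrow> (g, \<not> e)) (snd w))"

definition Mcat :: "'k::field itself \<Rightarrow> ('v, 'a) bquiver \<Rightarrow> ('v, 'a + 'a, 'k) rep set" where
  "Mcat TYPE('k) Q = add_closure (Pi_quiver Q)
     {string_module (Pi_quiver Q) w | w. is_string (Pi_quiver Q) w \<and> is_string Q (specialize w)}"

definition torshad :: "'k::field itself \<Rightarrow> ('v, 'a) bquiver \<Rightarrow> ('v, 'a + 'a, 'k) rep set set" where
  "torshad TYPE('k) Q = {T \<inter> Mcat TYPE('k) Q | T. torsion_class (Pi_quiver Q) T}"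

definition widshad :: "'k::field itself \<Rightarrow> ('v, 'a) bquiver \<Rightarrow> ('v, 'a + 'a, 'k) rep set set" where
  "widshad TYPE('k) Q = {W \<inter> Mcat TYPE('k) Q | W. wide_subcat (Pi_quiver Q) W}"

end

theory Submission
  imports Defs "Jordan_Normal_Form.Determinant"
begin

text \<open>Both kinds of shadows are parametrized by semibricks of string modules. In a brick gentle
  algebra no string meets a vertex twice: a shortest closed substring yields either a band module or
  a string module with a nilpotent endomorphism. Hence the string modules generating M are thin,
  submodules and quotients of such a module are sums of modules of the same kind, and only finitely
  many dimensions occur. A semibrick B of such modules generates a torsion class T(B) and a wide
  subcategory W(B), which is contained in the wide subcategory of all X in T(B) such that every
  map to X from an object of T(B) has its kernel in T(B). In both cases B is recovered as
  the set of strings that receive only zero or surjective maps (with kernel in T(B), for torsion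
  classes), and inductions on dimension show that every shadow is obtained in this way.\<close>

section \<open>Linear algebra of matrices\<close>

text \<open>As soon as Q has an arrow, Pi(A) is infinite-dimensional and different torsion classes
  can have the same shadow. A shadow is therefore compared only through the string modules in it.
  Kernels enter for the following reason. Over the quiver with one arrow let P be the module of
  length two, S its top, and T the class of sums of copies of P and S. All maps from T to P and all
  maps from T to S are zero or surjective, but P and S do not form a semibrick. S is discarded
  because the kernel of P -> S is not in T. A torsion class need not contain kernels, so it is not
  clear that W(B) lies in T(B). The auxiliary wide subcategory provides this inclusion, and with it
  a nonzero map from B to every string module in W(B). Conditions on the maps to a fixed module are
  written as classes of their sources. These classes are again torsion classes, so testing them on
  generators is enough. The brick hypothesis concerns A, the strings in question live over Pi(A);
  specialization connects them because it keeps the sequence of vertices.\<close>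

definition subspace_vec :: "nat \<Rightarrow> 'k::field vec set \<Rightarrow> bool" where
  "subspace_vec n U \<longleftrightarrow> U \<subseteq> carrier_vec n \<and> 0\<^sub>v n \<in> U \<and>
     (\<forall>x\<in>U. \<forall>y\<in>U. x + y \<in> U) \<and> (\<forall>c. \<forall>x\<in>U. c \<cdot>\<^sub>v x \<in> U)"

definition mat_range :: "'k::field mat \<Rightarrow> 'k vec set" where
  "mat_range A = (\<lambda>x. A *\<^sub>v x) ` carrier_vec (dim_col A)"

definition mat_ker :: "'k::field mat \<Rightarrow> 'k vec set" where
  "mat_ker A = {x \<in> carrier_vec (dim_col A). A *\<^sub>v x = 0\<^sub>v (dim_row A)}"

lemma mat_rangeI: "A \<in> carrier_mat m n \<Longrightarrow> x \<in> carrier_vec n \<Longrightarrow> A *\<^sub>v x \<in> mat_range A"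
  by (auto simp: mat_range_def)

lemma mat_rangeE:
  assumes "y \<in> mat_range A" "A \<in> carrier_mat m n"
  obtains x where "x \<in> carrier_vec n" "y = A *\<^sub>v x"
  using assms by (auto simp: mat_range_def)

lemma mem_mat_ker: "A \<in> carrier_mat m n \<Longrightarrow> x \<in> mat_ker A \<longleftrightarrow> x \<in> carrier_vec n \<and> A *\<^sub>v x = 0\<^sub>v m"
  by (auto simp: mat_ker_def)

lemma mat_range_carrier: "A \<in> carrier_mat m n \<Longrightarrow> mat_range A \<subseteq> carrier_vec m"
  by (auto simp: mat_range_def)

lemma inj_mat_ker: "A \<in> carrier_mat m n \<Longrightarrow> inj_mat A \<longleftrightarrow> mat_ker A \<subseteq> {0\<^sub>v n}"
  by (auto simp: inj_mat_def mat_ker_def)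

lemma surj_mat_range: "A \<in> carrier_mat m n \<Longrightarrow> surj_mat A \<longleftrightarrow> mat_range A = carrier_vec m"
proof -
  assume A: "A \<in> carrier_mat m n"
  have "surj_mat A \<longleftrightarrow> carrier_vec m \<subseteq> mat_range A"
    unfolding surj_mat_def mat_range_def using A by (auto simp: image_iff subset_iff)
  then show ?thesis using mat_range_carrier[OF A] by auto
qed

lemma exact_mat_iff:
  assumes "f \<in> carrier_mat m n" "g \<in> carrier_mat l m"
  shows "exact_mat f g \<longleftrightarrow> mat_range f = mat_ker g"
proof -
  have "mat_range f \<subseteq> carrier_vec m" by (rule mat_range_carrier[OF assms(1)])
  moreover have "mat_ker g \<subseteq> carrier_vec m" using assms by (auto simp: mat_ker_def)
  moreover have "exact_mat f g \<longleftrightarrow> (\<forall>y\<in>carrier_vec m. y \<in> mat_ker g \<longleftrightarrow> y \<in> mat_range f)"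
    unfolding exact_mat_def mat_ker_def mat_range_def using assms
    by (auto simp: image_iff)
  ultimately show ?thesis by blast
qed

lemma mult_mat_vec_zero: "A \<in> carrier_mat m n \<Longrightarrow> A *\<^sub>v 0\<^sub>v n = (0\<^sub>v m :: 'k::field vec)"
  by (intro eq_vecI) auto

lemma mat_range_subspace:
  assumes A: "(A :: 'k::field mat) \<in> carrier_mat m n"
  shows "subspace_vec m (mat_range A)"
  unfolding subspace_vec_def
proof (intro conjI ballI allI)
  show "mat_range A \<subseteq> carrier_vec m" by (rule mat_range_carrier[OF A])
  show "0\<^sub>v m \<in> mat_range A"
    using mat_rangeI[OF A, of "0\<^sub>v n"] by (simp add: mult_mat_vec_zero[OF A])
next
  fix x y assume "x \<in> mat_range A" "y \<in> mat_range A"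
  then obtain u v where "u \<in> carrier_vec n" "v \<in> carrier_vec n" "x = A *\<^sub>v u" "y = A *\<^sub>v v"
    using A by (auto elim!: mat_rangeE)
  then show "x + y \<in> mat_range A"
    using mat_rangeI[OF A, of "u + v"] by (simp add: mult_add_distrib_mat_vec[OF A])
next
  fix c x assume "x \<in> mat_range A"
  then obtain u where "u \<in> carrier_vec n" "x = A *\<^sub>v u" using A by (auto elim!: mat_rangeE)
  then show "c \<cdot>\<^sub>v x \<in> mat_range A"
    using mat_rangeI[OF A, of "c \<cdot>\<^sub>v u"] by (simp add: mult_mat_vec[OF A])
qed

lemma mat_ker_subspace: "A \<in> carrier_mat m n \<Longrightarrow> subspace_vec n (mat_ker A)"
  unfolding subspace_vec_def mat_ker_def
  by (auto simp: mult_mat_vec_zero mult_add_distrib_mat_vec mult_mat_vec)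

lemma mat_eqI_vec:
  assumes A: "(A :: 'k::field mat) \<in> carrier_mat m n" and B: "B \<in> carrier_mat m n"
    and eq: "\<And>x. x \<in> carrier_vec n \<Longrightarrow> A *\<^sub>v x = B *\<^sub>v x"
  shows "A = B"
proof (rule eq_matI)
  fix i j assume ij: "i < dim_row B" "j < dim_col B"
  have "A *\<^sub>v unit_vec n j = B *\<^sub>v unit_vec n j" by (rule eq) simp
  then have "(A *\<^sub>v unit_vec n j) $ i = (B *\<^sub>v unit_vec n j) $ i" by simp
  then show "A $$ (i, j) = B $$ (i, j)" using ij A B by (auto simp: row_def)
qed (use A B in auto)

lemma inj_matD:
  assumes A: "A \<in> carrier_mat m n" and inj: "inj_mat A" and x: "x \<in> carrier_vec n" "y \<in> carrier_vec n"
    and eq: "A *\<^sub>v x = A *\<^sub>v (y :: 'k::field vec)"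
  shows "x = y"
proof -
  have "A *\<^sub>v (x - y) = 0\<^sub>v m" using A x eq by (simp add: mult_minus_distrib_mat_vec)
  then have "x - y = 0\<^sub>v n" using inj A x unfolding inj_mat_def by auto
  then have "(x - y) $ i = 0" if "i < n" for i using that by simp
  then show ?thesis using x by (intro eq_vecI) auto
qed

lemma inj_mat_cancel:
  assumes A: "A \<in> carrier_mat m n" and inj: "inj_mat A" and X: "X \<in> carrier_mat n l" "Y \<in> carrier_mat n l"
    and eq: "A * X = A * (Y :: 'k::field mat)"
  shows "X = Y"
proof (rule mat_eqI_vec[OF X])
  fix x :: "'k vec" assume x: "x \<in> carrier_vec l"
  have "A *\<^sub>v (X *\<^sub>v x) = A *\<^sub>v (Y *\<^sub>v x)"
    using assoc_mult_mat_vec[OF A X(1) x] assoc_mult_mat_vec[OF A X(2) x] unfolding eq by argo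
  then show "X *\<^sub>v x = Y *\<^sub>v x"
    by (rule inj_matD[OF A inj mult_mat_vec_carrier[OF X(1) x] mult_mat_vec_carrier[OF X(2) x]])
qed

lemma surj_mat_cancel:
  assumes A: "A \<in> carrier_mat m n" and surj: "surj_mat A" and X: "X \<in> carrier_mat l m" "Y \<in> carrier_mat l m"
    and eq: "X * A = Y * (A :: 'k::field mat)"
  shows "X = Y"
proof (rule mat_eqI_vec[OF X])
  fix y :: "'k vec" assume y: "y \<in> carrier_vec m"
  then obtain x where x: "x \<in> carrier_vec n" "y = A *\<^sub>v x"
    using surj A unfolding surj_mat_def by auto
  then show "X *\<^sub>v y = Y *\<^sub>v y"
    using assoc_mult_mat_vec[OF X(1) A x(1)] assoc_mult_mat_vec[OF X(2) A x(1)]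
    unfolding eq x(2) by argo
qed

lemma left_inverse_inj_mat:
  assumes "A \<in> carrier_mat m n" "P \<in> carrier_mat n m" "P * A = 1\<^sub>m n"
  shows "inj_mat (A :: 'k::field mat)"
  unfolding inj_mat_def
proof (intro ballI impI)
  fix x :: "'k vec" assume x: "x \<in> carrier_vec (dim_col A)" "A *\<^sub>v x = 0\<^sub>v (dim_row A)"
  then have "P *\<^sub>v (A *\<^sub>v x) = 0\<^sub>v n" using assms by (simp add: mult_mat_vec_zero)
  moreover have "(P * A) *\<^sub>v x = P *\<^sub>v (A *\<^sub>v x)"
    using assms x by (intro assoc_mult_mat_vec) auto
  ultimately show "x = 0\<^sub>v (dim_col A)" using assms x by simp
qed

lemma right_inverse_surj_mat:
  assumes "A \<in> carrier_mat m n" "S \<in> carrier_mat n m" "A * S = 1\<^sub>m m"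
  shows "surj_mat (A :: 'k::field mat)"
  unfolding surj_mat_def
proof (intro ballI)
  fix y :: "'k vec" assume y: "y \<in> carrier_vec (dim_row A)"
  have "(A * S) *\<^sub>v y = A *\<^sub>v (S *\<^sub>v y)"
    using assms y by (intro assoc_mult_mat_vec) auto
  then have "A *\<^sub>v (S *\<^sub>v y) = y" using assms y by simp
  then show "\<exists>x\<in>carrier_vec (dim_col A). A *\<^sub>v x = y"
    using assms y by (intro bexI[of _ "S *\<^sub>v y"]) auto
qed

lemma surj_mat_right_inverse:
  assumes A: "A \<in> carrier_mat m n" and surj: "surj_mat (A :: 'k::field mat)"
  shows "\<exists>S\<in>carrier_mat n m. A * S = 1\<^sub>m m"
proof -
  have "\<forall>j. \<exists>x\<in>carrier_vec n. A *\<^sub>v x = unit_vec m j"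
    using surj A unfolding surj_mat_def by auto
  then obtain s where s: "\<And>j. s j \<in> carrier_vec n" "\<And>j. A *\<^sub>v s j = unit_vec m j" by metis
  let ?S = "mat n m (\<lambda>(i, j). s j $ i)"
  have col: "col ?S j = s j" if "j < m" for j 
    using that carrier_vecD[OF s(1)] by (auto intro!: eq_vecI)
  have "A * ?S = 1\<^sub>m m"
  proof (rule eq_matI)
    fix i j assume ij: "i < dim_row (1\<^sub>m m :: 'k mat)" "j < dim_col (1\<^sub>m m :: 'k mat)"
    then have "(A * ?S) $$ (i, j) = (A *\<^sub>v s j) $ i" using A col by simp
    then show "(A * ?S) $$ (i, j) = 1\<^sub>m m $$ (i, j)" using ij s by (auto simp: unit_vec_def)
  qed (use A in auto)
  then show ?thesis by auto
qed

text \<open>With more columns than rows, zero rows can be added to make \<open>A\<close> square. The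
  transpose then kills the unit vector of an added row, so the determinant vanishes and the padded
  matrix, hence \<open>A\<close>, has a nonzero kernel.\<close>

lemma inj_mat_dim_le:
  assumes A: "A \<in> carrier_mat n m" and inj: "inj_mat (A :: 'k::field mat)"
  shows "m \<le> n"
proof (rule ccontr)
  assume "\<not> m \<le> n"
  then have nm: "n < m" by simp
  let ?B = "mat m m (\<lambda>(i, j). if i < n then A $$ (i, j) else 0)"
  have "det (transpose_mat ?B) = 0"
  proof (subst det_0_iff_vec_prod_zero_field[of _ m])
    show "\<exists>v. v \<in> carrier_vec m \<and> v \<noteq> 0\<^sub>v m \<and> transpose_mat ?B *\<^sub>v v = 0\<^sub>v m"
      using nm by (intro exI[of _ "unit_vec m n"]) auto
  qed simp
  then have "det ?B = 0" by (simp add: det_transpose[of _ m])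
  then obtain v where v: "v \<in> carrier_vec m" "v \<noteq> 0\<^sub>v m" "?B *\<^sub>v v = 0\<^sub>v m"
    using det_0_iff_vec_prod_zero_field[of ?B m] by auto
  have "A *\<^sub>v v = 0\<^sub>v n"
  proof (rule eq_vecI)
    fix i assume i: "i < dim_vec (0\<^sub>v n :: 'k vec)"
    have "row A i = row ?B i" using i nm A by (auto intro!: eq_vecI)
    then have "(A *\<^sub>v v) $ i = (?B *\<^sub>v v) $ i" using i nm A by simp
    then show "(A *\<^sub>v v) $ i = 0\<^sub>v n $ i" using v i nm by simp
  qed (use A in auto)
  then show False using inj v A unfolding inj_mat_def by auto
qed

lemma append_col_mult_vec:
  assumes A: "(A :: 'k::field mat) \<in> carrier_mat n m" and u: "u \<in> carrier_vec n" and x: "x \<in> carrier_vec (Suc m)"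
  shows "mat n (Suc m) (\<lambda>(i, j). if j < m then A $$ (i, j) else u $ i) *\<^sub>v x
     = A *\<^sub>v vec m (\<lambda>j. x $ j) + x $ m \<cdot>\<^sub>v u"
proof (rule eq_vecI)
  fix i assume "i < dim_vec (A *\<^sub>v vec m (\<lambda>j. x $ j) + x $ m \<cdot>\<^sub>v u)"
  then have i: "i < n" using A u by simp
  show "(mat n (Suc m) (\<lambda>(i, j). if j < m then A $$ (i, j) else u $ i) *\<^sub>v x) $ i
     = (A *\<^sub>v vec m (\<lambda>j. x $ j) + x $ m \<cdot>\<^sub>v u) $ i"
    using i A u x by (simp add: scalar_prod_def)
qed (use A u in auto)

text \<open>Completion to a basis: the columns of \<open>L\<close> form a basis of \<open>U\<close>
  that begins with the columns of \<open>L0\<close>. Take \<open>m\<close> maximal, which is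
  possible by \<open>inj_mat_dim_le\<close>; a vector of \<open>U\<close> outside the range could be
  appended as one more column.\<close>

lemma inj_mat_extend:
  assumes L0: "L0 \<in> carrier_mat n r" "inj_mat L0" and U: "subspace_vec n U"
    and L0U: "mat_range L0 \<subseteq> U"
  shows "\<exists>m L. r \<le> m \<and> L \<in> carrier_mat n m \<and> inj_mat L \<and> mat_range L = (U :: 'k::field vec set)
     \<and> (\<forall>i<n. \<forall>j<r. L $$ (i, j) = L0 $$ (i, j))"
proof -
  define P where "P m \<longleftrightarrow> (\<exists>L\<in>carrier_mat n m. r \<le> m \<and> inj_mat L \<and> mat_range L \<subseteq> U
     \<and> (\<forall>i<n. \<forall>j<r. L $$ (i, j) = L0 $$ (i, j)))" for m
  have P0: "P r" using assms unfolding P_def by auto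
  have "m \<le> n" if "P m" for m using that inj_mat_dim_le unfolding P_def by blast
  then obtain m where m: "P m" "\<And>k. P k \<Longrightarrow> k \<le> m"
    using Nat.ex_has_greatest_nat[of P r n] P0 by blast
  from m(1) obtain L where L: "L \<in> carrier_mat n m" "r \<le> m" "inj_mat L" "mat_range L \<subseteq> U"
    "\<forall>i<n. \<forall>j<r. L $$ (i, j) = L0 $$ (i, j)" unfolding P_def by auto
  have "U \<subseteq> mat_range L"
  proof (rule ccontr)
    assume "\<not> U \<subseteq> mat_range L"
    then obtain u where u: "u \<in> U" "u \<notin> mat_range L" by auto
    have uc: "u \<in> carrier_vec n" using u U by (auto simp: subspace_vec_def)
    let ?L = "mat n (Suc m) (\<lambda>(i, j). if j < m then L $$ (i, j) else u $ i)"
    note mult = append_col_mult_vec[OF L(1) uc]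
    have "inj_mat ?L" unfolding inj_mat_def
    proof (intro ballI impI)
      fix x :: "'k vec" assume x': "x \<in> carrier_vec (dim_col ?L)" and z: "?L *\<^sub>v x = 0\<^sub>v (dim_row ?L)"
      then have x: "x \<in> carrier_vec (Suc m)" by simp
      let ?y = "vec m (\<lambda>j. x $ j)"
      have eq: "L *\<^sub>v ?y + x $ m \<cdot>\<^sub>v u = 0\<^sub>v n" using mult[OF x] z by simp
      have xm: "x $ m = 0"
      proof (rule ccontr)
        assume c: "x $ m \<noteq> 0"
        have "u = L *\<^sub>v ((- (1 / x $ m)) \<cdot>\<^sub>v ?y)"
        proof (rule eq_vecI)
          fix i assume "i < dim_vec (L *\<^sub>v ((- (1 / x $ m)) \<cdot>\<^sub>v ?y))"
          then have i: "i < n" using L by simp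
          have "(L *\<^sub>v ?y + x $ m \<cdot>\<^sub>v u) $ i = 0" using eq i by simp
          then have "(L *\<^sub>v ?y) $ i + x $ m * u $ i = 0" using i L uc by simp
          then have "x $ m * u $ i = - (L *\<^sub>v ?y) $ i" by (simp add: eq_neg_iff_add_eq_0 add.commute)
          then have "u $ i = (- (L *\<^sub>v ?y) $ i) / x $ m" using c by (metis nonzero_mult_div_cancel_left)
          then have "u $ i = - (1 / x $ m) * (L *\<^sub>v ?y) $ i" by simp
          moreover have "L *\<^sub>v ((- (1 / x $ m)) \<cdot>\<^sub>v ?y) = (- (1 / x $ m)) \<cdot>\<^sub>v (L *\<^sub>v ?y)"
            using L by (intro mult_mat_vec) auto
          ultimately show "u $ i = (L *\<^sub>v ((- (1 / x $ m)) \<cdot>\<^sub>v ?y)) $ i" using i L by simp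
        qed (use L uc in auto)
        then have "u \<in> mat_range L" using L by (auto simp: mat_range_def)
        then show False using u by simp
      qed
      have "x $ m \<cdot>\<^sub>v u = 0\<^sub>v n" using xm uc by (intro eq_vecI) auto
      then have "L *\<^sub>v ?y = 0\<^sub>v n" using eq L by simp
      then have "?y = 0\<^sub>v m" using L unfolding inj_mat_def by auto
      then have "\<And>j. j < m \<Longrightarrow> x $ j = 0" by (metis index_vec index_zero_vec(1))
      then show "x = 0\<^sub>v (dim_col ?L)" using xm x by (intro eq_vecI) (auto simp: less_Suc_eq)
    qed
    moreover have "mat_range ?L \<subseteq> U"
    proof
      fix y assume "y \<in> mat_range ?L"
      then obtain x where x: "x \<in> carrier_vec (Suc m)" "y = ?L *\<^sub>v x" by (auto simp: mat_range_def)
      then have y: "y = L *\<^sub>v vec m (\<lambda>j. x $ j) + x $ m \<cdot>\<^sub>v u" using mult by simp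
      have "L *\<^sub>v vec m (\<lambda>j. x $ j) \<in> U" using L by (auto simp: mat_range_def)
      then show "y \<in> U" unfolding y using U u by (auto simp: subspace_vec_def)
    qed
    ultimately have "P (Suc m)" using L unfolding P_def by (intro bexI[of _ ?L]) auto
    from m(2)[OF this] show False by simp
  qed
  then show ?thesis using L by (intro exI[of _ m] exI[of _ L]) simp
qed

lemma subspace_vec_range:
  assumes U: "subspace_vec n (U :: 'k::field vec set)"
  shows "\<exists>r. \<exists>L\<in>carrier_mat n r. inj_mat L \<and> mat_range L = U"
proof -
  \<comment> \<open>The empty basis, to be completed to a basis of \<open>U\<close>.\<close>
  let ?L = "0\<^sub>m n 0 :: 'k mat"
  have "inj_mat ?L" by (auto simp: inj_mat_def)
  moreover have "mat_range ?L \<subseteq> U"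
  proof -
    have "?L *\<^sub>v x = 0\<^sub>v n" if "x \<in> carrier_vec 0" for x using that by (intro eq_vecI) (auto simp: scalar_prod_def)
    then show ?thesis using U by (auto simp: mat_range_def subspace_vec_def)
  qed
  ultimately show ?thesis 
    using inj_mat_extend[of ?L n 0 U] U by force
qed

text \<open>Completing the columns of \<open>A\<close> to a basis of the whole space gives an
  invertible \<open>L\<close>; the first \<open>r\<close> rows of its inverse form a left inverse of
  \<open>A\<close>.\<close>

lemma inj_mat_left_inverse:
  assumes A: "A \<in> carrier_mat n r" and inj: "inj_mat (A :: 'k::field mat)"
  shows "\<exists>P\<in>carrier_mat r n. P * A = 1\<^sub>m r"
proof -
  have "subspace_vec n (carrier_vec n :: 'k vec set)" by (auto simp: subspace_vec_def)
  then obtain m L where L: "r \<le> m" "L \<in> carrier_mat n m" "inj_mat L"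
    "mat_range L = (carrier_vec n :: 'k vec set)" "\<forall>i<n. \<forall>j<r. L $$ (i, j) = A $$ (i, j)"
    using inj_mat_extend[OF A inj, of "carrier_vec n"] mat_range_carrier[OF A] by auto
  then have "surj_mat L" using surj_mat_range by blast
  then obtain S where S: "S \<in> carrier_mat m n" "L * S = 1\<^sub>m n" using surj_mat_right_inverse L by blast
  \<comment> \<open>A right inverse of the injective matrix \<open>L\<close> is also a left inverse;
    this avoids comparing \<open>m\<close> with \<open>n\<close>.\<close>
  have "L * (S * L) = L * 1\<^sub>m m"
    using assoc_mult_mat[OF L(2) S(1) L(2)] L(2) S by simp
  then have SL: "S * L = 1\<^sub>m m" using inj_mat_cancel[OF L(2,3), of "S * L" m] S L by simp
  let ?P = "mat r n (\<lambda>(i, j). S $$ (i, j))"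
  have "?P * A = 1\<^sub>m r"
  proof (rule eq_matI)
    fix i j assume ij: "i < dim_row (1\<^sub>m r :: 'k mat)" "j < dim_col (1\<^sub>m r :: 'k mat)"
    have "row ?P i = row S i" using ij L S by (auto intro!: eq_vecI)
    moreover have "col A j = col L j" using ij L A by (auto intro!: eq_vecI)
    ultimately have "(?P * A) $$ (i, j) = (S * L) $$ (i, j)" using ij A L S by auto
    then show "(?P * A) $$ (i, j) = 1\<^sub>m r $$ (i, j)" using ij L SL by simp
  qed (use A in auto)
  then show ?thesis by auto
qed

lemma inj_mat_left_inverse_range:
  assumes A: "A \<in> carrier_mat n r" and P: "P \<in> carrier_mat r n" "P * A = 1\<^sub>m r"
    and y: "y \<in> mat_range (A :: 'k::field mat)"
  shows "A *\<^sub>v (P *\<^sub>v y) = y"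
proof -
  obtain x where x: "x \<in> carrier_vec r" "y = A *\<^sub>v x" using y A by (rule mat_rangeE)
  have "P *\<^sub>v y = x" using assoc_mult_mat_vec[OF P(1) A x(1)] x P by simp
  then show ?thesis using x by simp
qed

text \<open>If \<open>P\<close> is a left inverse of a basis \<open>L\<close> of \<open>U\<close>,
  then \<open>1 - L P\<close> is the projection along \<open>U\<close> onto the kernel of
  \<open>P\<close>. Coordinates \<open>R\<close> on that kernel turn it into a surjection with
  kernel \<open>U\<close>.\<close>

lemma subspace_vec_quotient:
  assumes U: "subspace_vec n (U :: 'k::field vec set)"
  shows "\<exists>s. \<exists>p\<in>carrier_mat s n. surj_mat p \<and> mat_ker p = U"
proof -
  obtain r L where L: "L \<in> carrier_mat n r" "inj_mat L" "mat_range L = U"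
    using subspace_vec_range[OF U] by blast
  obtain P where P: "P \<in> carrier_mat r n" "P * L = 1\<^sub>m r" using inj_mat_left_inverse[OF L(1,2)] by blast
  obtain s M where M: "M \<in> carrier_mat n s" "inj_mat M" "mat_range M = mat_ker P"
    using subspace_vec_range[OF mat_ker_subspace[OF P(1)]] by blast
  obtain R where R: "R \<in> carrier_mat s n" "R * M = 1\<^sub>m s" using inj_mat_left_inverse[OF M(1,2)] by blast
  let ?E = "1\<^sub>m n - L * P"
  let ?p = "R * ?E"
  have E: "?E \<in> carrier_mat n n" using L P by (simp add: minus_carrier_mat)
  have Ex: "?E *\<^sub>v x = x - L *\<^sub>v (P *\<^sub>v x)" if "x \<in> carrier_vec n" for x
    using that L P by (simp add: minus_mult_distrib_mat_vec[of _ n n])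
  have PE: "?E *\<^sub>v x \<in> mat_ker P" if "x \<in> carrier_vec n" for x
  proof -
    have "P *\<^sub>v (L *\<^sub>v (P *\<^sub>v x)) = P *\<^sub>v x"
      using that L P assoc_mult_mat_vec[OF P(1) L(1), of "P *\<^sub>v x"] by simp
    then have "P *\<^sub>v (?E *\<^sub>v x) = 0\<^sub>v r"
      using that L P by (simp add: Ex mult_minus_distrib_mat_vec[of _ r n])
    moreover have "?E *\<^sub>v x \<in> carrier_vec n" using E that by simp
    ultimately show ?thesis using P by (simp add: mem_mat_ker)
  qed
  have px: "?p *\<^sub>v x = R *\<^sub>v (?E *\<^sub>v x)" if "x \<in> carrier_vec n" for x
    using that R E by (intro assoc_mult_mat_vec) auto
  have "?p * M = 1\<^sub>m s"
  proof (rule mat_eqI_vec[of _ s s])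
    fix x :: "'k vec" assume x: "x \<in> carrier_vec s"
    have Mx: "M *\<^sub>v x \<in> carrier_vec n" using M x by simp
    have "P *\<^sub>v (M *\<^sub>v x) = 0\<^sub>v r" using M x P mat_rangeI[OF M(1) x] by (simp add: mem_mat_ker)
    then have "?E *\<^sub>v (M *\<^sub>v x) = M *\<^sub>v x"
      using Mx L by (simp add: Ex mult_mat_vec_zero)
    then have "?p *\<^sub>v (M *\<^sub>v x) = R *\<^sub>v (M *\<^sub>v x)" by (simp add: px[OF Mx])
    then show "(?p * M) *\<^sub>v x = 1\<^sub>m s *\<^sub>v x"
      using x M R E assoc_mult_mat_vec[of ?p s n M s x] assoc_mult_mat_vec[OF R(1) M(1) x] by simp
  qed (use R E M in auto)
  then have "surj_mat ?p" using right_inverse_surj_mat[of ?p s n M] R E M by auto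
  moreover have "mat_ker ?p = U"
  proof (intro equalityI subsetI)
    fix x assume "x \<in> mat_ker ?p"
    then have x: "x \<in> carrier_vec n" "?p *\<^sub>v x = 0\<^sub>v s" using R E by (auto simp: mat_ker_def)
    have "M *\<^sub>v (R *\<^sub>v (?E *\<^sub>v x)) = ?E *\<^sub>v x"
      using inj_mat_left_inverse_range[OF M(1) R] PE[OF x(1)] M by simp
    then have "?E *\<^sub>v x = 0\<^sub>v n" using x px M by (simp add: mult_mat_vec_zero)
    then have z: "x - L *\<^sub>v (P *\<^sub>v x) = 0\<^sub>v n" using Ex x by simp
    have "x = L *\<^sub>v (P *\<^sub>v x)"
    proof (rule eq_vecI)
      fix i assume "i < dim_vec (L *\<^sub>v (P *\<^sub>v x))"
      then have i: "i < n" using L by simp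
      then have "(x - L *\<^sub>v (P *\<^sub>v x)) $ i = 0" using z by simp
      then show "x $ i = (L *\<^sub>v (P *\<^sub>v x)) $ i" using i L by simp
    qed (use x L in auto)
    then show "x \<in> U" using L(3) mat_rangeI[OF L(1), of "P *\<^sub>v x"] P x by simp
  next
    fix x assume x: "x \<in> U"
    then have xc: "x \<in> carrier_vec n" using U by (auto simp: subspace_vec_def)
    have "L *\<^sub>v (P *\<^sub>v x) = x" using inj_mat_left_inverse_range[OF L(1) P] L x by simp
    then have "?E *\<^sub>v x = 0\<^sub>v n" using Ex xc by simp
    then have "?p *\<^sub>v x = 0\<^sub>v s" using px xc R by (simp add: mult_mat_vec_zero)
    then show "x \<in> mat_ker ?p" using xc R E by (auto simp: mat_ker_def)
  qed
  moreover have "?p \<in> carrier_mat s n" using R E by simp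
  ultimately show ?thesis by blast
qed

section \<open>Homomorphisms, submodules and quotients\<close>

text \<open>The assumptions are weaker than admissibility because they must also hold for
  \<open>Pi_quiver\<close>: there, paths that alternate between an arrow and its starred arrow never
  become relations, however long they are.\<close>

locale bound_quiver =
  fixes Q :: "('v, 'a) bquiver"
  assumes src_in: "a \<in> arrs Q \<Longrightarrow> src Q a \<in> verts Q"
    and tgt_in: "a \<in> arrs Q \<Longrightarrow> tgt Q a \<in> verts Q"
    and rels_path: "p \<in> rels Q \<Longrightarrow> is_path Q p"
    and finite_verts: "finite (verts Q)"
begin

lemma is_path_Cons2: "is_path Q (a # b # p) \<longleftrightarrow> a \<in> arrs Q \<and> tgt Q a = src Q b \<and> is_path Q (b # p)"
  unfolding is_path_def by (auto simp: nth_Cons split: nat.splits)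

text \<open>Separated from \<open>mods\<close> so that a sub- or quotient object can first be built
  as bare matrices; its relations then follow along the map, by \<open>rep_of_mono\<close> or
  \<open>rep_of_epi\<close>.\<close>

definition rep_carrier :: "('v, 'a, 'k::field) rep \<Rightarrow> bool" where
  "rep_carrier M \<longleftrightarrow> (\<forall>a\<in>arrs Q. rmap M a \<in> carrier_mat (rdim M (tgt Q a)) (rdim M (src Q a)))"

lemma mods_carrier: "M \<in> mods Q \<Longrightarrow> rep_carrier M"
  by (simp add: mods_def is_rep_def rep_carrier_def)

lemma path_mat_carrier:
  assumes "rep_carrier M" "is_path Q p"
  shows "path_mat M p \<in> carrier_mat (rdim M (tgt Q (last p))) (rdim M (src Q (hd p)))"
  using assms(2)
proof (induction p rule: induct_list012)
  case (2 a)
  then show ?case using assms(1) by (auto simp: rep_carrier_def is_path_def)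
next
  case (3 a b p)
  then have *: "a \<in> arrs Q" "tgt Q a = src Q b" "is_path Q (b # p)" by (auto simp: is_path_Cons2)
  then show ?case using 3(2) assms(1) by (auto simp: rep_carrier_def)
qed (simp add: is_path_def)

lemma hom_carrier:
  "is_hom Q M N f \<Longrightarrow> v \<in> verts Q \<Longrightarrow> f v \<in> carrier_mat (rdim N v) (rdim M v)"
  by (simp add: is_hom_def)

lemma hom_arr: "is_hom Q M N f \<Longrightarrow> a \<in> arrs Q \<Longrightarrow> f (tgt Q a) * rmap M a = rmap N a * f (src Q a)"
  by (simp add: is_hom_def)

lemma hom_path_mat:
  assumes M: "rep_carrier M" and N: "rep_carrier N" and f: "is_hom Q M N f" and p: "is_path Q p"
  shows "f (tgt Q (last p)) * path_mat M p = path_mat N p * f (src Q (hd p))"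
  using p
proof (induction p rule: induct_list012)
  case (2 a)
  then show ?case using f by (auto simp: is_hom_def is_path_def)
next
  case (3 a b p)
  then have *: "a \<in> arrs Q" "tgt Q a = src Q b" "is_path Q (b # p)" by (auto simp: is_path_Cons2)
  let ?q = "b # p" and ?t = "tgt Q (last (b # p))"
  have t: "?t \<in> verts Q" using *(3) tgt_in[of "last (b # p)"] last_in_set[of "b # p"] unfolding is_path_def by blast
  have carr: "f ?t \<in> carrier_mat (rdim N ?t) (rdim M ?t)"
    "f (src Q b) \<in> carrier_mat (rdim N (src Q b)) (rdim M (src Q b))"
    "f (src Q a) \<in> carrier_mat (rdim N (src Q a)) (rdim M (src Q a))"
    using f t src_in[OF *(1)] tgt_in[OF *(1)] *(2) by (auto simp: is_hom_def)
  have pc: "path_mat M ?q \<in> carrier_mat (rdim M ?t) (rdim M (src Q b))"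
    "path_mat N ?q \<in> carrier_mat (rdim N ?t) (rdim N (src Q b))"
    using path_mat_carrier[OF M *(3)] path_mat_carrier[OF N *(3)] by simp_all
  have ac: "rmap M a \<in> carrier_mat (rdim M (src Q b)) (rdim M (src Q a))"
    "rmap N a \<in> carrier_mat (rdim N (src Q b)) (rdim N (src Q a))"
    using M N *(1,2) by (auto simp: rep_carrier_def)
  have "f ?t * (path_mat M ?q * rmap M a) = (f ?t * path_mat M ?q) * rmap M a"
    using assoc_mult_mat[OF carr(1) pc(1) ac(1)] by simp
  also have "\<dots> = path_mat N ?q * f (src Q b) * rmap M a" using 3(2)[OF *(3)] by simp
  also have "\<dots> = path_mat N ?q * (f (src Q b) * rmap M a)"
    by (rule assoc_mult_mat[OF pc(2) carr(2) ac(1)])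
  also have "f (src Q b) * rmap M a = rmap N a * f (src Q a)" using hom_arr[OF f *(1)] *(2) by simp
  also have "path_mat N ?q * (rmap N a * f (src Q a)) = path_mat N ?q * rmap N a * f (src Q a)"
    using assoc_mult_mat[OF pc(2) ac(2) carr(3)] by simp
  finally show ?case by simp
qed (simp add: is_path_def)

lemma rel_ends: "p \<in> rels Q \<Longrightarrow> tgt Q (last p) \<in> verts Q \<and> src Q (hd p) \<in> verts Q"
  using rels_path[of p] src_in tgt_in unfolding is_path_def
  by (metis hd_in_set last_in_set subsetD)

text \<open>A relation acts as zero on \<open>X\<close>, so \<open>i\<close> composed with its
  action on \<open>K\<close> is zero, and the injective \<open>i\<close> can be cancelled.\<close>

lemma rep_of_mono:
  assumes K: "rep_carrier K" and X: "X \<in> mods Q" and i: "is_mono Q K X i"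
  shows "K \<in> mods Q"
  unfolding mods_def is_rep_def
proof (intro CollectI conjI ballI)
  fix p assume p: "p \<in> rels Q"
  let ?t = "tgt Q (last p)" and ?s = "src Q (hd p)"
  note e = rel_ends[OF p]
  have h: "is_hom Q K X i" and inj: "inj_mat (i ?t)" using i e by (auto simp: is_mono_def)
  have c: "path_mat K p \<in> carrier_mat (rdim K ?t) (rdim K ?s)"
    using path_mat_carrier[OF K rels_path[OF p]] .
  have "i ?t * path_mat K p = path_mat X p * i ?s"
    by (rule hom_path_mat[OF K mods_carrier[OF X] h rels_path[OF p]])
  also have "path_mat X p = 0\<^sub>m (rdim X ?t) (rdim X ?s)" using X p by (auto simp: mods_def is_rep_def)
  also have "\<dots> * i ?s = i ?t * 0\<^sub>m (rdim K ?t) (rdim K ?s)"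
    using hom_carrier[OF h, of ?s] hom_carrier[OF h, of ?t] e by simp
  finally show "path_mat K p = 0\<^sub>m (rdim K ?t) (rdim K ?s)"
    using inj_mat_cancel[OF hom_carrier[OF h] inj c] e by simp
qed (use K in \<open>auto simp: rep_carrier_def\<close>)

lemma rep_of_epi:
  assumes C: "rep_carrier C" and X: "X \<in> mods Q" and q: "is_epi Q X C q"
  shows "C \<in> mods Q"
  unfolding mods_def is_rep_def
proof (intro CollectI conjI ballI)
  fix p assume p: "p \<in> rels Q"
  let ?t = "tgt Q (last p)" and ?s = "src Q (hd p)"
  note e = rel_ends[OF p]
  have h: "is_hom Q X C q" and surj: "surj_mat (q ?s)" using q e by (auto simp: is_epi_def)
  have c: "path_mat C p \<in> carrier_mat (rdim C ?t) (rdim C ?s)"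
    using path_mat_carrier[OF C rels_path[OF p]] .
  have "path_mat C p * q ?s = q ?t * path_mat X p"
    by (rule hom_path_mat[OF mods_carrier[OF X] C h rels_path[OF p], symmetric])
  also have "path_mat X p = 0\<^sub>m (rdim X ?t) (rdim X ?s)" using X p by (auto simp: mods_def is_rep_def)
  also have "q ?t * \<dots> = 0\<^sub>m (rdim C ?t) (rdim C ?s) * q ?s"
    using hom_carrier[OF h, of ?s] hom_carrier[OF h, of ?t] e by simp
  finally show "path_mat C p = 0\<^sub>m (rdim C ?t) (rdim C ?s)"
    using surj_mat_cancel[OF hom_carrier[OF h] surj c] e by simp
qed (use C in \<open>auto simp: rep_carrier_def\<close>)

section \<open>Sub- and quotient representations given by families of subspaces\<close>

definition subrep :: "('v, 'a, 'k::field) rep \<Rightarrow> ('v \<Rightarrow> 'k vec set) \<Rightarrow> bool" where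
  "subrep X U \<longleftrightarrow> (\<forall>v\<in>verts Q. subspace_vec (rdim X v) (U v)) \<and>
     (\<forall>a\<in>arrs Q. \<forall>x\<in>U (src Q a). rmap X a *\<^sub>v x \<in> U (tgt Q a))"

definition has_image :: "('v \<Rightarrow> 'k::field mat) \<Rightarrow> ('v \<Rightarrow> 'k vec set) \<Rightarrow> bool" where
  "has_image i U \<longleftrightarrow> (\<forall>v\<in>verts Q. mat_range (i v) = U v)"

definition has_kernel :: "('v \<Rightarrow> 'k::field mat) \<Rightarrow> ('v \<Rightarrow> 'k vec set) \<Rightarrow> bool" where
  "has_kernel i U \<longleftrightarrow> (\<forall>v\<in>verts Q. mat_ker (i v) = U v)"

text \<open>Bases \<open>L v\<close> of the subspaces, with left inverses \<open>P v\<close>, let an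
  arrow act on coordinates by its action on \<open>X\<close> between \<open>L\<close> and
  \<open>P\<close>. Since \<open>L P\<close> fixes \<open>U\<close> and \<open>U\<close> is stable
  under arrows, \<open>L\<close> is a morphism.\<close>

lemma subrep_exists:
  fixes X :: "('v, 'a, 'k::field) rep"
  assumes X: "X \<in> mods Q" and U: "subrep X U"
  shows "\<exists>K\<in>mods Q. \<exists>i. is_mono Q K X i \<and> has_image i U"
proof -
  have "\<forall>v. \<exists>r L P. v \<in> verts Q \<longrightarrow> L \<in> carrier_mat (rdim X v) r \<and> inj_mat L \<and> mat_range L = U v \<and>
      P \<in> carrier_mat r (rdim X v) \<and> P * L = 1\<^sub>m r"
    using U subspace_vec_range inj_mat_left_inverse unfolding subrep_def by metis
  then obtain r L P where L: "\<And>v. v \<in> verts Q \<Longrightarrow> L v \<in> carrier_mat (rdim X v) (r v)"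
    "\<And>v. v \<in> verts Q \<Longrightarrow> inj_mat (L v)" "\<And>v. v \<in> verts Q \<Longrightarrow> mat_range (L v) = U v"
    and P: "\<And>v. v \<in> verts Q \<Longrightarrow> P v \<in> carrier_mat (r v) (rdim X v)"
    "\<And>v. v \<in> verts Q \<Longrightarrow> P v * L v = 1\<^sub>m (r v)" by metis
  define K where "K = \<lparr> rdim = r, rmap = (\<lambda>a. P (tgt Q a) * (rmap X a * L (src Q a))) \<rparr>"
  have Xa: "rmap X a \<in> carrier_mat (rdim X (tgt Q a)) (rdim X (src Q a))" if "a \<in> arrs Q" for a
    using mods_carrier[OF X] that by (simp add: rep_carrier_def)
  have K: "rep_carrier K"
    unfolding rep_carrier_def K_def rep.simps
    using mult_carrier_mat[OF P(1) mult_carrier_mat[OF Xa L(1)]] src_in tgt_in by blast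
  have "is_hom Q K X L"
    unfolding is_hom_def
  proof (intro conjI ballI)
    fix a assume a: "a \<in> arrs Q"
    let ?s = "src Q a" and ?t = "tgt Q a"
    note st = src_in[OF a] tgt_in[OF a]
    have c: "rmap X a * L ?s \<in> carrier_mat (rdim X ?t) (r ?s)" using Xa[OF a] L(1)[OF st(1)] by simp
    have "L ?t * (P ?t * (rmap X a * L ?s)) = rmap X a * L ?s"
    proof (rule mat_eqI_vec[OF _ c])
      show "L ?t * (P ?t * (rmap X a * L ?s)) \<in> carrier_mat (rdim X ?t) (r ?s)"
        using c L(1) P(1) st by (meson mult_carrier_mat)
      fix x :: "'k vec" assume x: "x \<in> carrier_vec (r ?s)"
      have "L ?s *\<^sub>v x \<in> U ?s" using L(3)[OF st(1)] mat_rangeI[OF L(1)[OF st(1)] x] by simp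
      then have "rmap X a *\<^sub>v (L ?s *\<^sub>v x) \<in> mat_range (L ?t)"
        using U a L(3)[OF st(2)] by (auto simp: subrep_def)
      then have y: "(rmap X a * L ?s) *\<^sub>v x \<in> mat_range (L ?t)"
        using assoc_mult_mat_vec[OF Xa[OF a] L(1)[OF st(1)] x] by simp
      have "(L ?t * (P ?t * (rmap X a * L ?s))) *\<^sub>v x = L ?t *\<^sub>v ((P ?t * (rmap X a * L ?s)) *\<^sub>v x)"
        by (rule assoc_mult_mat_vec[OF L(1)[OF st(2)] mult_carrier_mat[OF P(1)[OF st(2)] c] x])
      also have "(P ?t * (rmap X a * L ?s)) *\<^sub>v x = P ?t *\<^sub>v ((rmap X a * L ?s) *\<^sub>v x)"
        by (rule assoc_mult_mat_vec[OF P(1)[OF st(2)] c x])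
      also have "L ?t *\<^sub>v \<dots> = (rmap X a * L ?s) *\<^sub>v x"
        by (rule inj_mat_left_inverse_range[OF L(1)[OF st(2)] P(1)[OF st(2)] P(2)[OF st(2)] y])
      finally show "(L ?t * (P ?t * (rmap X a * L ?s))) *\<^sub>v x = (rmap X a * L ?s) *\<^sub>v x" .
    qed
    then show "L ?t * rmap K a = rmap X a * L ?s" by (simp add: K_def)
  qed (use L(1) in \<open>simp add: K_def\<close>)
  then have mono: "is_mono Q K X L" using L(2) by (simp add: is_mono_def)
  moreover have "has_image L U" using L(3) by (simp add: has_image_def)
  ultimately show ?thesis using rep_of_mono[OF K X mono] by blast
qed

lemma quotient_exists:
  fixes X :: "('v, 'a, 'k::field) rep"
  assumes X: "X \<in> mods Q" and U: "subrep X U"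
  shows "\<exists>C\<in>mods Q. \<exists>p. is_epi Q X C p \<and> has_kernel p U"
proof -
  have "\<forall>v. \<exists>r p S. v \<in> verts Q \<longrightarrow> p \<in> carrier_mat r (rdim X v) \<and> surj_mat p \<and> mat_ker p = U v \<and>
      S \<in> carrier_mat (rdim X v) r \<and> p * S = 1\<^sub>m r"
    using U subspace_vec_quotient surj_mat_right_inverse unfolding subrep_def by metis
  then obtain r p S where p: "\<And>v. v \<in> verts Q \<Longrightarrow> p v \<in> carrier_mat (r v) (rdim X v)"
    "\<And>v. v \<in> verts Q \<Longrightarrow> surj_mat (p v)" "\<And>v. v \<in> verts Q \<Longrightarrow> mat_ker (p v) = U v"
    and S: "\<And>v. v \<in> verts Q \<Longrightarrow> S v \<in> carrier_mat (rdim X v) (r v)"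
    "\<And>v. v \<in> verts Q \<Longrightarrow> p v * S v = 1\<^sub>m (r v)" by metis
  define C where "C = \<lparr> rdim = r, rmap = (\<lambda>a. p (tgt Q a) * (rmap X a * S (src Q a))) \<rparr>"
  have Xa: "rmap X a \<in> carrier_mat (rdim X (tgt Q a)) (rdim X (src Q a))" if "a \<in> arrs Q" for a
    using mods_carrier[OF X] that by (simp add: rep_carrier_def)
  have C: "rep_carrier C"
    unfolding rep_carrier_def C_def rep.simps
    using mult_carrier_mat[OF p(1) mult_carrier_mat[OF Xa S(1)]] src_in tgt_in by blast
  have "is_hom Q X C p"
    unfolding is_hom_def
  proof (intro conjI ballI)
    fix a assume a: "a \<in> arrs Q"
    let ?s = "src Q a" and ?t = "tgt Q a"
    note st = src_in[OF a] tgt_in[OF a]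
    note pt = p(1)[OF st(2)] and ps = p(1)[OF st(1)] and Ss = S(1)[OF st(1)] and Xa' = Xa[OF a]
    have c: "rmap X a * S ?s \<in> carrier_mat (rdim X ?t) (r ?s)" using Xa' Ss by simp
    have c2: "p ?t * (rmap X a * S ?s) \<in> carrier_mat (r ?t) (r ?s)" using pt c by simp
    have "p ?t * rmap X a = p ?t * (rmap X a * S ?s) * p ?s"
    proof (rule mat_eqI_vec[of _ "r ?t" "rdim X ?s"])
      fix x :: "'k vec" assume x: "x \<in> carrier_vec (rdim X ?s)"
      \<comment> \<open>\<open>?y\<close> has the same class as \<open>x\<close>, so
        \<open>x - ?y\<close> lies in \<open>U\<close>; the arrow keeps it in \<open>U\<close>,
        where \<open>p\<close> vanishes. The action defined through the section \<open>S\<close> is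
        therefore compatible with \<open>p\<close>.\<close>
      let ?y = "S ?s *\<^sub>v (p ?s *\<^sub>v x)"
      have px: "p ?s *\<^sub>v x \<in> carrier_vec (r ?s)" using ps x by simp
      have y: "?y \<in> carrier_vec (rdim X ?s)" using Ss px by simp
      have "p ?s *\<^sub>v ?y = p ?s *\<^sub>v x"
        using assoc_mult_mat_vec[OF ps Ss px] S(2)[OF st(1)] px by simp
      then have "p ?s *\<^sub>v (x - ?y) = 0\<^sub>v (r ?s)"
        using mult_minus_distrib_mat_vec[OF ps x y] px by simp
      then have "x - ?y \<in> U ?s" using p(3)[OF st(1)] mem_mat_ker[OF ps] x y by auto
      then have "rmap X a *\<^sub>v (x - ?y) \<in> mat_ker (p ?t)" using U a p(3)[OF st(2)] by (auto simp: subrep_def)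
      then have "p ?t *\<^sub>v (rmap X a *\<^sub>v (x - ?y)) = 0\<^sub>v (r ?t)" using mem_mat_ker[OF pt] by simp
      then have z: "p ?t *\<^sub>v (rmap X a *\<^sub>v x) - p ?t *\<^sub>v (rmap X a *\<^sub>v ?y) = 0\<^sub>v (r ?t)"
        using mult_minus_distrib_mat_vec[OF Xa' x y] mult_minus_distrib_mat_vec[OF pt, of "rmap X a *\<^sub>v x" "rmap X a *\<^sub>v ?y"]
          Xa' x y by simp
      have "p ?t *\<^sub>v (rmap X a *\<^sub>v x) = p ?t *\<^sub>v (rmap X a *\<^sub>v ?y)"
      proof (rule eq_vecI)
        fix i assume "i < dim_vec (p ?t *\<^sub>v (rmap X a *\<^sub>v ?y))"
        then have i: "i < r ?t" using pt by simp
        then have "(p ?t *\<^sub>v (rmap X a *\<^sub>v x) - p ?t *\<^sub>v (rmap X a *\<^sub>v ?y)) $ i = 0" using z by simp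
        then show "(p ?t *\<^sub>v (rmap X a *\<^sub>v x)) $ i = (p ?t *\<^sub>v (rmap X a *\<^sub>v ?y)) $ i" using i pt by simp
      qed (use pt in simp)
      then show "(p ?t * rmap X a) *\<^sub>v x = (p ?t * (rmap X a * S ?s) * p ?s) *\<^sub>v x"
        using assoc_mult_mat_vec[OF pt Xa' x] assoc_mult_mat_vec[OF c2 ps x]
          assoc_mult_mat_vec[OF pt c px] assoc_mult_mat_vec[OF Xa' Ss px] by simp
    qed (use pt ps Xa' c2 in auto)
    then show "p ?t * rmap X a = rmap C a * p ?s" by (simp add: C_def)
  qed (use p(1) in \<open>simp add: C_def\<close>)
  then have epi: "is_epi Q X C p" using p(2) by (simp add: is_epi_def)
  moreover have "has_kernel p U" using p(3) by (simp add: has_kernel_def)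
  ultimately show ?thesis using rep_of_epi[OF C X epi] by blast
qed

section \<open>Morphisms acting on vectors, and factorization through monos and epis\<close>

lemma hom_app: "is_hom Q M N f \<Longrightarrow> v \<in> verts Q \<Longrightarrow> x \<in> carrier_vec (rdim M v) \<Longrightarrow>
    f v *\<^sub>v x \<in> carrier_vec (rdim N v)"
  by (meson hom_carrier mult_mat_vec_carrier)

lemma hom_comp_app: "is_hom Q X Y f \<Longrightarrow> is_hom Q Y Z g \<Longrightarrow> v \<in> verts Q \<Longrightarrow> x \<in> carrier_vec (rdim X v) \<Longrightarrow>
    (g v * f v) *\<^sub>v x = g v *\<^sub>v (f v *\<^sub>v x)"
  by (rule assoc_mult_mat_vec[OF hom_carrier hom_carrier])

lemma hom_arr_app:
  assumes "M \<in> mods Q" "N \<in> mods Q" and f: "is_hom Q M N f" and a: "a \<in> arrs Q"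
    and x: "x \<in> carrier_vec (rdim M (src Q a))"
  shows "f (tgt Q a) *\<^sub>v (rmap M a *\<^sub>v x) = rmap N a *\<^sub>v (f (src Q a) *\<^sub>v x)"
proof -
  have c: "rmap M a \<in> carrier_mat (rdim M (tgt Q a)) (rdim M (src Q a))"
    "rmap N a \<in> carrier_mat (rdim N (tgt Q a)) (rdim N (src Q a))"
    using assms mods_carrier by (auto simp: rep_carrier_def)
  show ?thesis
    using assoc_mult_mat_vec[OF hom_carrier[OF f tgt_in[OF a]] c(1) x]
      assoc_mult_mat_vec[OF c(2) hom_carrier[OF f src_in[OF a]] x] hom_arr[OF f a] by argo
qed

lemma hom_comp:
  assumes X: "X \<in> mods Q" and Y: "Y \<in> mods Q" and Z: "Z \<in> mods Q"
    and f: "is_hom Q X Y f" and g: "is_hom Q Y Z g"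
  shows "is_hom Q X Z (\<lambda>v. g v * f v)"
  unfolding is_hom_def
proof (intro conjI ballI)
  fix v assume v: "v \<in> verts Q"
  show "g v * f v \<in> carrier_mat (rdim Z v) (rdim X v)"
    by (rule mult_carrier_mat[OF hom_carrier[OF g v] hom_carrier[OF f v]])
next
  fix a assume a: "a \<in> arrs Q"
  note st = src_in[OF a] tgt_in[OF a]
  have c: "rmap X a \<in> carrier_mat (rdim X (tgt Q a)) (rdim X (src Q a))"
    "rmap Y a \<in> carrier_mat (rdim Y (tgt Q a)) (rdim Y (src Q a))"
    "rmap Z a \<in> carrier_mat (rdim Z (tgt Q a)) (rdim Z (src Q a))"
    using X Y Z a mods_carrier by (auto simp: rep_carrier_def)
  show "g (tgt Q a) * f (tgt Q a) * rmap X a = rmap Z a * (g (src Q a) * f (src Q a))"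
    using assoc_mult_mat[OF hom_carrier[OF g st(2)] hom_carrier[OF f st(2)] c(1)]
      assoc_mult_mat[OF hom_carrier[OF g st(2)] c(2) hom_carrier[OF f st(1)]]
      assoc_mult_mat[OF c(3) hom_carrier[OF g st(1)] hom_carrier[OF f st(1)]]
      hom_arr[OF f a] hom_arr[OF g a] by argo
qed

lemma hom_id: "X \<in> mods Q \<Longrightarrow> is_hom Q X X (\<lambda>v. 1\<^sub>m (rdim X v))"
  using mods_carrier[of X] src_in tgt_in unfolding is_hom_def rep_carrier_def
  by (auto simp: left_mult_one_mat right_mult_one_mat)

lemma hom_add:
  assumes X: "X \<in> mods Q" and Y: "Y \<in> mods Q" and f: "is_hom Q X Y f" and g: "is_hom Q X Y g"
  shows "is_hom Q X Y (\<lambda>v. f v + g v)"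
  unfolding is_hom_def
proof (intro conjI ballI)
  fix v assume v: "v \<in> verts Q"
  show "f v + g v \<in> carrier_mat (rdim Y v) (rdim X v)" using hom_carrier[OF g v] by simp
next
  fix a assume a: "a \<in> arrs Q"
  note st = src_in[OF a] tgt_in[OF a]
  have c: "rmap X a \<in> carrier_mat (rdim X (tgt Q a)) (rdim X (src Q a))"
    "rmap Y a \<in> carrier_mat (rdim Y (tgt Q a)) (rdim Y (src Q a))"
    using X Y a mods_carrier by (auto simp: rep_carrier_def)
  show "(f (tgt Q a) + g (tgt Q a)) * rmap X a = rmap Y a * (f (src Q a) + g (src Q a))"
    using add_mult_distrib_mat[OF hom_carrier[OF f st(2)] hom_carrier[OF g st(2)] c(1)]
      mult_add_distrib_mat[OF c(2) hom_carrier[OF f st(1)] hom_carrier[OF g st(1)]]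
      hom_arr[OF f a] hom_arr[OF g a] by argo
qed

lemma hom_smult:
  assumes X: "X \<in> mods Q" and Y: "Y \<in> mods Q" and f: "is_hom Q X Y f"
  shows "is_hom Q X Y (\<lambda>v. c \<cdot>\<^sub>m f v)"
  unfolding is_hom_def
proof (intro conjI ballI)
  fix v assume v: "v \<in> verts Q"
  show "c \<cdot>\<^sub>m f v \<in> carrier_mat (rdim Y v) (rdim X v)" using hom_carrier[OF f v] by simp
next
  fix a assume a: "a \<in> arrs Q"
  note st = src_in[OF a] tgt_in[OF a]
  have c: "rmap X a \<in> carrier_mat (rdim X (tgt Q a)) (rdim X (src Q a))"
    "rmap Y a \<in> carrier_mat (rdim Y (tgt Q a)) (rdim Y (src Q a))"
    using X Y a mods_carrier by (auto simp: rep_carrier_def)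
  show "c \<cdot>\<^sub>m f (tgt Q a) * rmap X a = rmap Y a * (c \<cdot>\<^sub>m f (src Q a))"
    using mult_smult_assoc_mat[OF hom_carrier[OF f st(2)] c(1)]
      mult_smult_distrib[OF c(2) hom_carrier[OF f st(1)]] hom_arr[OF f a] by simp
qed

lemma hom_zero: 
  assumes X: "X \<in> mods Q" and Y: "Y \<in> mods Q"
  shows "is_hom Q X Y (\<lambda>v. 0\<^sub>m (rdim Y v) (rdim X v))"
  unfolding is_hom_def
proof (intro conjI ballI)
  fix a assume a: "a \<in> arrs Q"
  have c: "rmap X a \<in> carrier_mat (rdim X (tgt Q a)) (rdim X (src Q a))"
    "rmap Y a \<in> carrier_mat (rdim Y (tgt Q a)) (rdim Y (src Q a))"
    using X Y a mods_carrier by (auto simp: rep_carrier_def)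
  show "0\<^sub>m (rdim Y (tgt Q a)) (rdim X (tgt Q a)) * rmap X a
      = rmap Y a * 0\<^sub>m (rdim Y (src Q a)) (rdim X (src Q a))"
    by (simp add: left_mult_zero_mat[OF c(1)] right_mult_zero_mat[OF c(2)])
qed simp

lemma mono_hom: "is_mono Q M N f \<Longrightarrow> is_hom Q M N f" by (simp add: is_mono_def)

lemma epi_hom: "is_epi Q M N f \<Longrightarrow> is_hom Q M N f" by (simp add: is_epi_def)

lemma mono_eqD:
  assumes "is_mono Q M N f" "v \<in> verts Q" "x \<in> carrier_vec (rdim M v)" "y \<in> carrier_vec (rdim M v)"
    "f v *\<^sub>v x = f v *\<^sub>v y"
  shows "x = y"
  by (rule inj_matD[OF hom_carrier[OF mono_hom[OF assms(1)] assms(2)] _ assms(3-5)])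
    (use assms(1,2) in \<open>simp add: is_mono_def\<close>)

lemma epiE:
  assumes "is_epi Q M N f" "v \<in> verts Q" "y \<in> carrier_vec (rdim N v)"
  obtains x where "x \<in> carrier_vec (rdim M v)" "f v *\<^sub>v x = y"
proof -
  have "surj_mat (f v)" "f v \<in> carrier_mat (rdim N v) (rdim M v)"
    using assms by (auto simp: is_epi_def is_hom_def)
  then show thesis using that assms(3) unfolding surj_mat_def by auto
qed

lemma epiI:
  assumes "is_hom Q M N f"
    "\<And>v y. v \<in> verts Q \<Longrightarrow> y \<in> carrier_vec (rdim N v) \<Longrightarrow> \<exists>x\<in>carrier_vec (rdim M v). f v *\<^sub>v x = y"
  shows "is_epi Q M N f"
  unfolding is_epi_def surj_mat_def using assms carrier_matD[OF hom_carrier[OF assms(1)]] by simp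

lemma monoI:
  assumes "is_hom Q M N f"
    "\<And>v x. v \<in> verts Q \<Longrightarrow> x \<in> carrier_vec (rdim M v) \<Longrightarrow> f v *\<^sub>v x = 0\<^sub>v (rdim N v) \<Longrightarrow> x = 0\<^sub>v (rdim M v)"
  shows "is_mono Q M N f"
  unfolding is_mono_def inj_mat_def using assms carrier_matD[OF hom_carrier[OF assms(1)]] by simp

lemma hom_app_zero: "is_hom Q M N f \<Longrightarrow> v \<in> verts Q \<Longrightarrow> f v *\<^sub>v 0\<^sub>v (rdim M v) = 0\<^sub>v (rdim N v)"
  by (meson hom_carrier mult_mat_vec_zero)

lemma hom_ker: "is_hom Q M N f \<Longrightarrow> v \<in> verts Q \<Longrightarrow>
    x \<in> mat_ker (f v) \<longleftrightarrow> x \<in> carrier_vec (rdim M v) \<and> f v *\<^sub>v x = 0\<^sub>v (rdim N v)"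
  by (meson hom_carrier mem_mat_ker)

lemma hom_range: "is_hom Q M N f \<Longrightarrow> v \<in> verts Q \<Longrightarrow>
    y \<in> mat_range (f v) \<longleftrightarrow> (\<exists>x\<in>carrier_vec (rdim M v). y = f v *\<^sub>v x)"
  using hom_carrier[of M N f v] by (auto simp: mat_range_def)

text \<open>The factor is \<open>g\<close> followed by pointwise left inverses of \<open>i\<close>.
  These left inverses need not commute with the arrows; that the factor does is checked after
  composing with the mono \<open>i\<close>.\<close>

lemma mono_factor:
  fixes X :: "('v, 'a, 'k::field) rep"
  assumes K: "K \<in> mods Q" and X: "X \<in> mods Q" and Z: "Z \<in> mods Q"
    and i: "is_mono Q K X i" and g: "is_hom Q Z X g"
    and im: "\<And>v z. v \<in> verts Q \<Longrightarrow> z \<in> carrier_vec (rdim Z v) \<Longrightarrow> g v *\<^sub>v z \<in> mat_range (i v)"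
  shows "\<exists>g'. is_hom Q Z K g' \<and> (\<forall>v\<in>verts Q. \<forall>z\<in>carrier_vec (rdim Z v). i v *\<^sub>v (g' v *\<^sub>v z) = g v *\<^sub>v z)"
proof -
  note ih = mono_hom[OF i]
  have "\<forall>v. \<exists>P. v \<in> verts Q \<longrightarrow> P \<in> carrier_mat (rdim K v) (rdim X v) \<and> P * i v = 1\<^sub>m (rdim K v)"
    using inj_mat_left_inverse[OF hom_carrier[OF ih]] i unfolding is_mono_def by metis
  then obtain P where P: "\<And>v. v \<in> verts Q \<Longrightarrow> P v \<in> carrier_mat (rdim K v) (rdim X v)"
    "\<And>v. v \<in> verts Q \<Longrightarrow> P v * i v = 1\<^sub>m (rdim K v)" by metis
  let ?g = "\<lambda>v. P v * g v"
  have c: "?g v \<in> carrier_mat (rdim K v) (rdim Z v)" if "v \<in> verts Q" for v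
    using P(1)[OF that] hom_carrier[OF g that] by simp
  have eq: "i v *\<^sub>v (?g v *\<^sub>v z) = g v *\<^sub>v z" if v: "v \<in> verts Q" and z: "z \<in> carrier_vec (rdim Z v)" for v z
    using inj_mat_left_inverse_range[OF hom_carrier[OF ih v] P[OF v] im[OF v z]]
      assoc_mult_mat_vec[OF P(1)[OF v] hom_carrier[OF g v] z] by simp
  have "is_hom Q Z K ?g"
    unfolding is_hom_def
  proof (intro conjI ballI)
    fix a assume a: "a \<in> arrs Q"
    let ?s = "src Q a" and ?t = "tgt Q a"
    note st = src_in[OF a] tgt_in[OF a]
    have ac: "rmap Z a \<in> carrier_mat (rdim Z ?t) (rdim Z ?s)"
      "rmap K a \<in> carrier_mat (rdim K ?t) (rdim K ?s)"
      "rmap X a \<in> carrier_mat (rdim X ?t) (rdim X ?s)"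
      using K X Z a mods_carrier by (auto simp: rep_carrier_def)
    show "?g ?t * rmap Z a = rmap K a * ?g ?s"
    proof (rule mat_eqI_vec[of _ "rdim K ?t" "rdim Z ?s"])
      fix x :: "'k vec" assume x: "x \<in> carrier_vec (rdim Z ?s)"
      have Zx: "rmap Z a *\<^sub>v x \<in> carrier_vec (rdim Z ?t)" using ac x by simp
      have gx: "?g ?s *\<^sub>v x \<in> carrier_vec (rdim K ?s)" using c[OF st(1)] x by (rule mult_mat_vec_carrier)
      have "i ?t *\<^sub>v (?g ?t *\<^sub>v (rmap Z a *\<^sub>v x)) = g ?t *\<^sub>v (rmap Z a *\<^sub>v x)" by (rule eq[OF st(2) Zx])
      also have "\<dots> = rmap X a *\<^sub>v (g ?s *\<^sub>v x)" by (rule hom_arr_app[OF Z X g a x])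
      also have "g ?s *\<^sub>v x = i ?s *\<^sub>v (?g ?s *\<^sub>v x)" using eq[OF st(1) x] by simp
      also have "rmap X a *\<^sub>v \<dots> = i ?t *\<^sub>v (rmap K a *\<^sub>v (?g ?s *\<^sub>v x))"
        using hom_arr_app[OF K X ih a gx] by simp
      finally have "?g ?t *\<^sub>v (rmap Z a *\<^sub>v x) = rmap K a *\<^sub>v (?g ?s *\<^sub>v x)"
        by (rule mono_eqD[OF i st(2) mult_mat_vec_carrier[OF c[OF st(2)] Zx] mult_mat_vec_carrier[OF ac(2) gx]])
      then show "(?g ?t * rmap Z a) *\<^sub>v x = (rmap K a * ?g ?s) *\<^sub>v x"
        using assoc_mult_mat_vec[OF c[OF st(2)] ac(1) x] assoc_mult_mat_vec[OF ac(2) c[OF st(1)] x] by simp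
    qed (use mult_carrier_mat[OF c[OF st(2)] ac(1)] mult_carrier_mat[OF ac(2) c[OF st(1)]] in simp_all)
  qed (rule c)
  then show ?thesis using eq by blast
qed

lemma epi_factor:
  fixes X :: "('v, 'a, 'k::field) rep"
  assumes X: "X \<in> mods Q" and C: "C \<in> mods Q" and Z: "Z \<in> mods Q"
    and p: "is_epi Q X C p" and g: "is_hom Q X Z g"
    and ker: "\<And>v x. v \<in> verts Q \<Longrightarrow> x \<in> carrier_vec (rdim X v) \<Longrightarrow> p v *\<^sub>v x = 0\<^sub>v (rdim C v) \<Longrightarrow> g v *\<^sub>v x = 0\<^sub>v (rdim Z v)"
  shows "\<exists>g'. is_hom Q C Z g' \<and> (\<forall>v\<in>verts Q. \<forall>x\<in>carrier_vec (rdim X v). g' v *\<^sub>v (p v *\<^sub>v x) = g v *\<^sub>v x)"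
proof -
  note ph = epi_hom[OF p]
  have "\<forall>v. \<exists>S. v \<in> verts Q \<longrightarrow> S \<in> carrier_mat (rdim X v) (rdim C v) \<and> p v * S = 1\<^sub>m (rdim C v)"
    using surj_mat_right_inverse[OF hom_carrier[OF ph]] p unfolding is_epi_def by metis
  then obtain S where S: "\<And>v. v \<in> verts Q \<Longrightarrow> S v \<in> carrier_mat (rdim X v) (rdim C v)"
    "\<And>v. v \<in> verts Q \<Longrightarrow> p v * S v = 1\<^sub>m (rdim C v)" by metis
  let ?g = "\<lambda>v. g v * S v"
  have c: "?g v \<in> carrier_mat (rdim Z v) (rdim C v)" if "v \<in> verts Q" for v
    using S(1)[OF that] hom_carrier[OF g that] by simp
  have eq: "?g v *\<^sub>v (p v *\<^sub>v x) = g v *\<^sub>v x" if v: "v \<in> verts Q" and x: "x \<in> carrier_vec (rdim X v)" for v x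
  proof -
    have px: "p v *\<^sub>v x \<in> carrier_vec (rdim C v)" by (rule hom_app[OF ph v x])
    let ?y = "S v *\<^sub>v (p v *\<^sub>v x)"
    have y: "?y \<in> carrier_vec (rdim X v)" using S(1)[OF v] px by simp
    have "p v *\<^sub>v ?y = p v *\<^sub>v x"
      using assoc_mult_mat_vec[OF hom_carrier[OF ph v] S(1)[OF v] px] S(2)[OF v] px by simp
    then have "p v *\<^sub>v (x - ?y) = 0\<^sub>v (rdim C v)"
      using mult_minus_distrib_mat_vec[OF hom_carrier[OF ph v] x y] px by simp
    then have "g v *\<^sub>v (x - ?y) = 0\<^sub>v (rdim Z v)" using ker[OF v] x y by simp
    then have z: "g v *\<^sub>v x - g v *\<^sub>v ?y = 0\<^sub>v (rdim Z v)"
      using mult_minus_distrib_mat_vec[OF hom_carrier[OF g v] x y] by simp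
    have "g v *\<^sub>v ?y = g v *\<^sub>v x"
    proof (rule eq_vecI)
      fix i assume "i < dim_vec (g v *\<^sub>v x)"
      then have i: "i < rdim Z v" using hom_carrier[OF g v] by simp
      then have "(g v *\<^sub>v x - g v *\<^sub>v ?y) $ i = 0" using z by simp
      then show "(g v *\<^sub>v ?y) $ i = (g v *\<^sub>v x) $ i" using i hom_carrier[OF g v] by simp
    qed simp
    then show ?thesis using assoc_mult_mat_vec[OF hom_carrier[OF g v] S(1)[OF v] px] by simp
  qed
  have "is_hom Q C Z ?g"
    unfolding is_hom_def
  proof (intro conjI ballI)
    fix a assume a: "a \<in> arrs Q"
    let ?s = "src Q a" and ?t = "tgt Q a"
    note st = src_in[OF a] tgt_in[OF a]
    have ac: "rmap C a \<in> carrier_mat (rdim C ?t) (rdim C ?s)"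
      "rmap Z a \<in> carrier_mat (rdim Z ?t) (rdim Z ?s)"
      "rmap X a \<in> carrier_mat (rdim X ?t) (rdim X ?s)"
      using C X Z a mods_carrier by (auto simp: rep_carrier_def)
    show "?g ?t * rmap C a = rmap Z a * ?g ?s"
    proof (rule mat_eqI_vec[of _ "rdim Z ?t" "rdim C ?s"])
      fix y :: "'k vec" assume y: "y \<in> carrier_vec (rdim C ?s)"
      obtain x where x: "x \<in> carrier_vec (rdim X ?s)" "p ?s *\<^sub>v x = y" by (rule epiE[OF p st(1) y])
      have Xx: "rmap X a *\<^sub>v x \<in> carrier_vec (rdim X ?t)" using ac x by simp
      have "?g ?t *\<^sub>v (rmap C a *\<^sub>v y) = ?g ?t *\<^sub>v (p ?t *\<^sub>v (rmap X a *\<^sub>v x))"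
        using hom_arr_app[OF X C ph a x(1)] x(2) by simp
      also have "\<dots> = g ?t *\<^sub>v (rmap X a *\<^sub>v x)" by (rule eq[OF st(2) Xx])
      also have "\<dots> = rmap Z a *\<^sub>v (g ?s *\<^sub>v x)" by (rule hom_arr_app[OF X Z g a x(1)])
      also have "g ?s *\<^sub>v x = ?g ?s *\<^sub>v y" using eq[OF st(1) x(1)] x(2) by simp
      finally show "(?g ?t * rmap C a) *\<^sub>v y = (rmap Z a * ?g ?s) *\<^sub>v y"
        using assoc_mult_mat_vec[OF c[OF st(2)] ac(1) y] assoc_mult_mat_vec[OF ac(2) c[OF st(1)] y] by simp
    qed (use mult_carrier_mat[OF c[OF st(2)] ac(1)] mult_carrier_mat[OF ac(2) c[OF st(1)]] in simp_all)
  qed (rule c)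
  then show ?thesis using eq by blast
qed

lemma subrep_ker:
  assumes X: "X \<in> mods Q" and Y: "Y \<in> mods Q" and h: "is_hom Q X Y h"
  shows "subrep X (\<lambda>v. mat_ker (h v))"
  unfolding subrep_def
proof (intro conjI ballI)
  fix v assume "v \<in> verts Q"
  then show "subspace_vec (rdim X v) (mat_ker (h v))" by (rule mat_ker_subspace[OF hom_carrier[OF h]])
next
  fix a x assume a: "a \<in> arrs Q" and x: "x \<in> mat_ker (h (src Q a))"
  have ac: "rmap X a \<in> carrier_mat (rdim X (tgt Q a)) (rdim X (src Q a))"
    "rmap Y a \<in> carrier_mat (rdim Y (tgt Q a)) (rdim Y (src Q a))"
      using X Y a mods_carrier by (auto simp: rep_carrier_def)
  have "x \<in> carrier_vec (rdim X (src Q a))" "h (src Q a) *\<^sub>v x = 0\<^sub>v (rdim Y (src Q a))"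
    using x hom_ker[OF h src_in[OF a]] by auto
  then show "rmap X a *\<^sub>v x \<in> mat_ker (h (tgt Q a))"
    using hom_arr_app[OF X Y h a] ac mult_mat_vec_zero[OF ac(2)] by (simp add: hom_ker[OF h tgt_in[OF a]])
qed

lemma subrep_range:
  assumes X: "X \<in> mods Q" and Y: "Y \<in> mods Q" and h: "is_hom Q X Y h"
  shows "subrep Y (\<lambda>v. mat_range (h v))"
  unfolding subrep_def
proof (intro conjI ballI)
  fix v assume "v \<in> verts Q"
  then show "subspace_vec (rdim Y v) (mat_range (h v))" by (rule mat_range_subspace[OF hom_carrier[OF h]])
next
  fix a y assume a: "a \<in> arrs Q" and y: "y \<in> mat_range (h (src Q a))"
  have ac: "rmap X a \<in> carrier_mat (rdim X (tgt Q a)) (rdim X (src Q a))"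
      using X a mods_carrier by (auto simp: rep_carrier_def)
  obtain x where x: "x \<in> carrier_vec (rdim X (src Q a))" "y = h (src Q a) *\<^sub>v x"
    using y hom_range[OF h src_in[OF a]] by auto
  then have "rmap Y a *\<^sub>v y = h (tgt Q a) *\<^sub>v (rmap X a *\<^sub>v x)" using hom_arr_app[OF X Y h a] by simp
  then show "rmap Y a *\<^sub>v y \<in> mat_range (h (tgt Q a))"
    using hom_range[OF h tgt_in[OF a]] ac x by auto
qed

end

section \<open>Torsion classes and wide subcategories\<close>

context bound_quiver
begin

text \<open>Being a direct summand up to isomorphism, expressed by split morphisms so that no
  complement has to be chosen. The equation is stated on vectors at the vertices, since components
  elsewhere are arbitrary.\<close>

definition retract :: "('v, 'a, 'k::field) rep \<Rightarrow> ('v, 'a, 'k) rep \<Rightarrow> bool" where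
  "retract X Y \<longleftrightarrow> (\<exists>i p. is_hom Q X Y i \<and> is_hom Q Y X p \<and>
     (\<forall>v\<in>verts Q. \<forall>x\<in>carrier_vec (rdim X v). p v *\<^sub>v (i v *\<^sub>v x) = x))"

text \<open>The closure properties common to torsion classes and wide subcategories; arguments that
  serve both are made for this notion.\<close>

definition summand_ext_closed :: "('v, 'a, 'k::field) rep set \<Rightarrow> bool" where
  "summand_ext_closed C \<longleftrightarrow> C \<subseteq> mods Q \<and> ext_closed Q C \<and>
     (\<forall>X\<in>mods Q. is_zero_rep Q X \<longrightarrow> X \<in> C) \<and>
     (\<forall>X\<in>mods Q. \<forall>Y\<in>C. retract X Y \<longrightarrow> X \<in> C)"

lemma summand_ext_closedD:
  assumes "summand_ext_closed C"
  shows "C \<subseteq> mods Q" "\<And>X. X \<in> mods Q \<Longrightarrow> is_zero_rep Q X \<Longrightarrow> X \<in> C"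
    "\<And>X Y. X \<in> mods Q \<Longrightarrow> Y \<in> C \<Longrightarrow> retract X Y \<Longrightarrow> X \<in> C"
  using assms by (auto simp: summand_ext_closed_def)

lemma exact_iff:
  assumes "is_hom Q X Y f" "is_hom Q Y Z g" "v \<in> verts Q"
  shows "exact_mat (f v) (g v) \<longleftrightarrow> mat_range (f v) = mat_ker (g v)"
  by (rule exact_mat_iff[OF hom_carrier[OF assms(1,3)] hom_carrier[OF assms(2,3)]])

lemma ext_closedD:
  assumes C: "ext_closed Q C" and "X \<in> C" "Z \<in> C" "Y \<in> mods Q" and f: "is_mono Q X Y f" and g: "is_epi Q Y Z g"
    and ex: "\<And>v. v \<in> verts Q \<Longrightarrow> mat_range (f v) = mat_ker (g v)"
  shows "Y \<in> C"
proof -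
  have "short_exact Q X Y Z f g"
    unfolding short_exact_def using f g ex exact_iff[OF mono_hom[OF f] epi_hom[OF g]] by simp
  then show ?thesis using assms unfolding ext_closed_def by blast
qed

text \<open>Two monos with the same image factor through each other. For a class closed under
  retracts, membership of a kernel or an image thus depends only on the subspaces and not on the
  module representing them.\<close>

lemma retract_of_same_image:
  assumes K: "K \<in> mods Q" "is_mono Q K X i" and L: "L \<in> mods Q" "is_mono Q L X j" and X: "X \<in> mods Q"
    and eq: "\<And>v. v \<in> verts Q \<Longrightarrow> mat_range (i v) = mat_range (j v)"
  shows "retract K L"
proof -
  have "i v *\<^sub>v z \<in> mat_range (j v)" if "v \<in> verts Q" "z \<in> carrier_vec (rdim K v)" for v z
    using that mat_rangeI[OF hom_carrier[OF mono_hom[OF K(2)] that(1)] that(2)] eq by simp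
  from mono_factor[OF L(1) X K(1) L(2) mono_hom[OF K(2)] this]
  obtain f where f: "is_hom Q K L f"
    "\<And>v z. v \<in> verts Q \<Longrightarrow> z \<in> carrier_vec (rdim K v) \<Longrightarrow> j v *\<^sub>v (f v *\<^sub>v z) = i v *\<^sub>v z" by blast
  have "j v *\<^sub>v z \<in> mat_range (i v)" if "v \<in> verts Q" "z \<in> carrier_vec (rdim L v)" for v z
    using that mat_rangeI[OF hom_carrier[OF mono_hom[OF L(2)] that(1)] that(2)] eq by simp
  from mono_factor[OF K(1) X L(1) K(2) mono_hom[OF L(2)] this]
  obtain g where g: "is_hom Q L K g"
    "\<And>v z. v \<in> verts Q \<Longrightarrow> z \<in> carrier_vec (rdim L v) \<Longrightarrow> i v *\<^sub>v (g v *\<^sub>v z) = j v *\<^sub>v z" by blast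
  have "g v *\<^sub>v (f v *\<^sub>v x) = x" if "v \<in> verts Q" "x \<in> carrier_vec (rdim K v)" for v x
  proof (rule mono_eqD[OF K(2) that(1) _ that(2)])
    show "g v *\<^sub>v (f v *\<^sub>v x) \<in> carrier_vec (rdim K v)"
      using that f(1) g(1) by (meson hom_app)
    show "i v *\<^sub>v (g v *\<^sub>v (f v *\<^sub>v x)) = i v *\<^sub>v x"
      using that f g hom_app[OF f(1) that] by simp
  qed
  then show ?thesis unfolding retract_def using f(1) g(1) by blast
qed

lemma retract_of_same_kernel:
  assumes K: "K \<in> mods Q" "is_epi Q X K p" and L: "L \<in> mods Q" "is_epi Q X L q" and X: "X \<in> mods Q"
    and eq: "\<And>v. v \<in> verts Q \<Longrightarrow> mat_ker (p v) = mat_ker (q v)"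
  shows "retract K L"
proof -
  have ker: "q v *\<^sub>v x = 0\<^sub>v (rdim L v) \<longleftrightarrow> p v *\<^sub>v x = 0\<^sub>v (rdim K v)"
    if "v \<in> verts Q" "x \<in> carrier_vec (rdim X v)" for v x
    using that eq[OF that(1)] hom_ker[OF epi_hom[OF K(2)] that(1)] hom_ker[OF epi_hom[OF L(2)] that(1)] by blast
  obtain f where f: "is_hom Q K L f"
    "\<And>v z. v \<in> verts Q \<Longrightarrow> z \<in> carrier_vec (rdim X v) \<Longrightarrow> f v *\<^sub>v (p v *\<^sub>v z) = q v *\<^sub>v z"
    using epi_factor[OF X K(1) L(1) K(2) epi_hom[OF L(2)]] ker by blast
  obtain g where g: "is_hom Q L K g"
    "\<And>v z. v \<in> verts Q \<Longrightarrow> z \<in> carrier_vec (rdim X v) \<Longrightarrow> g v *\<^sub>v (q v *\<^sub>v z) = p v *\<^sub>v z"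
    using epi_factor[OF X L(1) K(1) L(2) epi_hom[OF K(2)]] ker by blast
  have "g v *\<^sub>v (f v *\<^sub>v y) = y" if v: "v \<in> verts Q" and y: "y \<in> carrier_vec (rdim K v)" for v y
  proof -
    obtain x where "x \<in> carrier_vec (rdim X v)" "p v *\<^sub>v x = y" by (rule epiE[OF K(2) v y])
    then show ?thesis using f(2) g(2) v by metis
  qed
  then show ?thesis unfolding retract_def using f(1) g(1) by blast
qed

text \<open>\<open>f\<close> is a mono whose image is all of \<open>Y\<close>, so the identity of
  \<open>Y\<close> factors through it.\<close>

lemma iso_inverse:
  assumes X: "X \<in> mods Q" and Y: "Y \<in> mods Q" and f: "is_iso Q X Y f"
  obtains g where "is_hom Q Y X g"
    "\<And>v x. v \<in> verts Q \<Longrightarrow> x \<in> carrier_vec (rdim X v) \<Longrightarrow> g v *\<^sub>v (f v *\<^sub>v x) = x"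
    "\<And>v y. v \<in> verts Q \<Longrightarrow> y \<in> carrier_vec (rdim Y v) \<Longrightarrow> f v *\<^sub>v (g v *\<^sub>v y) = y"
proof -
  have m: "is_mono Q X Y f" and e: "is_epi Q X Y f" using f by (auto simp: is_iso_def)
  have im: "1\<^sub>m (rdim Y v) *\<^sub>v y \<in> mat_range (f v)" if v: "v \<in> verts Q" and y: "y \<in> carrier_vec (rdim Y v)" for v y
    using epiE[OF e v y] y hom_range[OF mono_hom[OF m] v] by (metis one_mult_mat_vec)
  obtain g where g: "is_hom Q Y X g"
    "\<And>v y. v \<in> verts Q \<Longrightarrow> y \<in> carrier_vec (rdim Y v) \<Longrightarrow> f v *\<^sub>v (g v *\<^sub>v y) = 1\<^sub>m (rdim Y v) *\<^sub>v y"
    using mono_factor[OF X Y Y m hom_id[OF Y] im] by blast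
  have fg: "f v *\<^sub>v (g v *\<^sub>v y) = y" if "v \<in> verts Q" "y \<in> carrier_vec (rdim Y v)" for v y
    using g(2)[OF that] that(2) by simp
  have "g v *\<^sub>v (f v *\<^sub>v x) = x" if v: "v \<in> verts Q" and x: "x \<in> carrier_vec (rdim X v)" for v x
    using fg[OF v hom_app[OF mono_hom[OF m] v x]]
    by (intro mono_eqD[OF m v hom_app[OF g(1) v hom_app[OF mono_hom[OF m] v x]] x])
  then show thesis using that g(1) fg by blast
qed

lemma retract_of_isomorphic:
  assumes X: "X \<in> mods Q" and Y: "Y \<in> mods Q" and "isomorphic Q X Y"
  shows "retract X Y" "retract Y X"
proof -
  obtain f where f: "is_iso Q X Y f" using assms by (auto simp: isomorphic_def)
  then have h: "is_hom Q X Y f" by (auto simp: is_iso_def is_mono_def)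
  obtain g where g: "is_hom Q Y X g"
    "\<And>v x. v \<in> verts Q \<Longrightarrow> x \<in> carrier_vec (rdim X v) \<Longrightarrow> g v *\<^sub>v (f v *\<^sub>v x) = x"
    "\<And>v y. v \<in> verts Q \<Longrightarrow> y \<in> carrier_vec (rdim Y v) \<Longrightarrow> f v *\<^sub>v (g v *\<^sub>v y) = y"
    using iso_inverse[OF X Y f] by blast
  show "retract X Y" "retract Y X" unfolding retract_def using g h by blast+
qed

lemma zero_rep_vec: "is_zero_rep Q X \<Longrightarrow> v \<in> verts Q \<Longrightarrow> x \<in> carrier_vec (rdim X v) \<Longrightarrow> x = 0\<^sub>v (rdim X v)"
  unfolding is_zero_rep_def by (metis carrier_vecD eq_vecI index_zero_vec(2) less_nat_zero_code)

lemma retract_zero: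
  assumes "is_zero_rep Q X" "X \<in> mods Q" "Y \<in> mods Q"
  shows "retract X Y"
proof -
  have "\<forall>v\<in>verts Q. \<forall>x\<in>carrier_vec (rdim X v).
      0\<^sub>m (rdim X v) (rdim Y v) *\<^sub>v (0\<^sub>m (rdim Y v) (rdim X v) *\<^sub>v x) = x"
    using assms zero_rep_vec[OF assms(1)]
    by (metis mult_mat_vec_carrier zero_carrier_mat)
  then show ?thesis
    unfolding retract_def using hom_zero[OF assms(2,3)] hom_zero[OF assms(3,2)] by blast
qed

lemma retraction_epi:
  assumes "is_hom Q X Y i" "is_hom Q Y X p"
    "\<forall>v\<in>verts Q. \<forall>x\<in>carrier_vec (rdim X v). p v *\<^sub>v (i v *\<^sub>v x) = x"
  shows "is_epi Q Y X p"
  by (rule epiI[OF assms(2)]) (use assms(3) hom_app[OF assms(1)] in blast)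

lemma section_mono:
  assumes "is_hom Q X Y i" "is_hom Q Y X p"
    "\<forall>v\<in>verts Q. \<forall>x\<in>carrier_vec (rdim X v). p v *\<^sub>v (i v *\<^sub>v x) = x"
  shows "is_mono Q X Y i"
  by (rule monoI[OF assms(1)]) (use assms(3) hom_app_zero[OF assms(2)] in metis)

lemma torsion_quot:
  "torsion_class Q T \<Longrightarrow> X \<in> T \<Longrightarrow> Y \<in> mods Q \<Longrightarrow> is_epi Q X Y f \<Longrightarrow> Y \<in> T"
  unfolding torsion_class_def quot_closed_def by blast

text \<open>A summand is a quotient, and a zero module is a summand of every module.\<close>

lemma torsion_summand_ext_closed:
  assumes T: "torsion_class Q T"
  shows "summand_ext_closed T"
proof -
  have r: "X \<in> T" if "X \<in> mods Q" "Y \<in> T" "retract X Y" for X Y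
    using that retraction_epi torsion_quot[OF T] unfolding retract_def by blast
  moreover have "X \<in> T" if "X \<in> mods Q" "is_zero_rep Q X" for X
  proof -
    obtain Z where Z: "Z \<in> T" "Z \<in> mods Q" using T unfolding torsion_class_def by blast
    then show ?thesis using r retract_zero that by blast
  qed
  ultimately show ?thesis
    using T unfolding summand_ext_closed_def torsion_class_def by blast
qed

lemma hom_minus:
  fixes X :: "('v, 'a, 'k::field) rep"
  assumes X: "X \<in> mods Q" and Y: "Y \<in> mods Q" and f: "is_hom Q X Y f" and g: "is_hom Q X Y g"
  shows "\<exists>h. is_hom Q X Y h \<and> (\<forall>v\<in>verts Q. \<forall>x\<in>carrier_vec (rdim X v). h v *\<^sub>v x = f v *\<^sub>v x - g v *\<^sub>v x)"
proof (intro exI conjI ballI)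
  show "is_hom Q X Y (\<lambda>v. f v + (-1) \<cdot>\<^sub>m g v)"
    by (intro hom_add hom_smult assms)
  fix v and x :: "'k vec" assume v: "v \<in> verts Q" and x: "x \<in> carrier_vec (rdim X v)"
  note c = hom_carrier[OF f v] hom_carrier[OF g v]
  have "(f v + (-1) \<cdot>\<^sub>m g v) *\<^sub>v x = f v *\<^sub>v x + ((-1) \<cdot>\<^sub>m g v) *\<^sub>v x"
    by (rule add_mult_distrib_mat_vec[OF c(1) smult_carrier_mat[OF c(2)] x])
  also have "\<dots> = f v *\<^sub>v x - g v *\<^sub>v x"
    using c x by (intro eq_vecI) auto
  finally show "(f v + (-1) \<cdot>\<^sub>m g v) *\<^sub>v x = f v *\<^sub>v x - g v *\<^sub>v x" .
qed

lemma vec_minus_eq_zero: "x \<in> carrier_vec n \<Longrightarrow> y \<in> carrier_vec n \<Longrightarrow> x - y = 0\<^sub>v n \<longleftrightarrow> x = (y :: 'k::field vec)"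
proof
  assume c: "x \<in> carrier_vec n" "y \<in> carrier_vec n" and z: "x - y = 0\<^sub>v n"
  have "(x - y) $ i = 0" if "i < n" for i using z that by simp
  then show "x = y" using c by (intro eq_vecI) auto
qed simp

lemma hom_app_minus:
  "is_hom Q X Y f \<Longrightarrow> v \<in> verts Q \<Longrightarrow> x \<in> carrier_vec (rdim X v) \<Longrightarrow> y \<in> carrier_vec (rdim X v) \<Longrightarrow>
   f v *\<^sub>v (x - y) = f v *\<^sub>v x - f v *\<^sub>v y"
  by (rule mult_minus_distrib_mat_vec[OF hom_carrier])

text \<open>A summand \<open>X\<close> of \<open>Y\<close> is the kernel of the complementary
  idempotent \<open>1 - i p\<close> of \<open>Y\<close>.\<close>

lemma wide_summand_ext_closed:
  assumes W: "wide_subcat Q W"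
  shows "summand_ext_closed W"
proof -
  have Wm: "W \<subseteq> mods Q" and kc: "ker_closed Q W" using W by (auto simp: wide_subcat_def)
  have r: "X \<in> W" if X: "X \<in> mods Q" and Y: "Y \<in> W" and "retract X Y" for X Y
  proof -
    have Ym: "Y \<in> mods Q" using Y Wm by blast
    obtain i p where ip: "is_hom Q X Y i" "is_hom Q Y X p"
      "\<forall>v\<in>verts Q. \<forall>x\<in>carrier_vec (rdim X v). p v *\<^sub>v (i v *\<^sub>v x) = x"
      using \<open>retract X Y\<close> unfolding retract_def by blast
    note hc = hom_comp[OF Ym X Ym ip(2,1)]
    obtain h where h: "is_hom Q Y Y h"
      "\<And>v y. v \<in> verts Q \<Longrightarrow> y \<in> carrier_vec (rdim Y v) \<Longrightarrow> h v *\<^sub>v y = 1\<^sub>m (rdim Y v) *\<^sub>v y - (i v * p v) *\<^sub>v y"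
      using hom_minus[OF Ym Ym hom_id[OF Ym] hc] by blast
    have hy: "h v *\<^sub>v y = y - i v *\<^sub>v (p v *\<^sub>v y)" if "v \<in> verts Q" "y \<in> carrier_vec (rdim Y v)" for v y
      using h(2)[OF that] hom_comp_app[OF ip(2,1) that] that(2) by simp
    have "exact_mat (i v) (h v)" if v: "v \<in> verts Q" for v
    proof -
      have "y \<in> mat_range (i v) \<longleftrightarrow> y \<in> mat_ker (h v)" for y
      proof
        assume "y \<in> mat_range (i v)"
        then obtain x where x: "x \<in> carrier_vec (rdim X v)" "y = i v *\<^sub>v x" using hom_range[OF ip(1) v] by blast
        then have yc: "y \<in> carrier_vec (rdim Y v)" using hom_app[OF ip(1) v] by simp
        have "h v *\<^sub>v y = 0\<^sub>v (rdim Y v)" using hy[OF v yc] x ip(3) v yc by simp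
        then show "y \<in> mat_ker (h v)" using hom_ker[OF h(1) v] yc by blast
      next
        assume "y \<in> mat_ker (h v)"
        then have y: "y \<in> carrier_vec (rdim Y v)" "h v *\<^sub>v y = 0\<^sub>v (rdim Y v)" using hom_ker[OF h(1) v] by blast+
        have py: "p v *\<^sub>v y \<in> carrier_vec (rdim X v)" by (rule hom_app[OF ip(2) v y(1)])
        have "y = i v *\<^sub>v (p v *\<^sub>v y)"
          using hy[OF v y(1)] y vec_minus_eq_zero[OF y(1) hom_app[OF ip(1) v py]] by simp
        then show "y \<in> mat_range (i v)" using hom_range[OF ip(1) v] py by blast
      qed
      then show ?thesis using exact_iff[OF ip(1) h(1) v] by blast
    qed
    then show ?thesis using kc X Y h(1) section_mono[OF ip] unfolding ker_closed_def by blast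
  qed
  moreover have "X \<in> W" if "X \<in> mods Q" "is_zero_rep Q X" for X
  proof -
    obtain Z where Z: "Z \<in> W" "Z \<in> mods Q" using W unfolding wide_subcat_def by blast
    then show ?thesis using r retract_zero that by blast
  qed
  ultimately show ?thesis
    using W unfolding summand_ext_closed_def wide_subcat_def by blast
qed

section \<open>Kernels and images as members of a class\<close>

lemma wide_ker:
  assumes W: "wide_subcat Q W" and "X \<in> W" "Y \<in> W" and h: "is_hom Q X Y h" and K: "K \<in> mods Q"
    and i: "is_mono Q K X i" and im: "\<And>v. v \<in> verts Q \<Longrightarrow> mat_range (i v) = mat_ker (h v)"
  shows "K \<in> W"
proof -
  have "\<forall>v\<in>verts Q. exact_mat (i v) (h v)" using exact_iff[OF mono_hom[OF i] h] im by simp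
  then show ?thesis using assms unfolding wide_subcat_def ker_closed_def by blast
qed

lemma wide_coker:
  assumes W: "wide_subcat Q W" and "X \<in> W" "Y \<in> W" and h: "is_hom Q X Y h" and K: "K \<in> mods Q"
    and p: "is_epi Q Y K p" and im: "\<And>v. v \<in> verts Q \<Longrightarrow> mat_range (h v) = mat_ker (p v)"
  shows "K \<in> W"
proof -
  have "\<forall>v\<in>verts Q. exact_mat (h v) (p v)" using exact_iff[OF h epi_hom[OF p]] im by simp
  then show ?thesis using assms unfolding wide_subcat_def coker_closed_def by blast
qed

text \<open>A subobject is given by its subspaces only, so the definition speaks of all modules that
  represent it; by \<open>sub_inI\<close> a single one suffices when \<open>C\<close> is closed
  under retracts.\<close>

definition sub_in :: "('v, 'a, 'k::field) rep set \<Rightarrow> ('v, 'a, 'k) rep \<Rightarrow> ('v \<Rightarrow> 'k vec set) \<Rightarrow> bool" where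
  "sub_in C X U \<longleftrightarrow> (\<forall>K\<in>mods Q. \<forall>i. is_mono Q K X i \<and> has_image i U \<longrightarrow> K \<in> C)"

lemma sub_inI:
  assumes C: "summand_ext_closed C" and X: "X \<in> mods Q" and K: "K \<in> C" "is_mono Q K X i" "has_image i U"
  shows "sub_in C X U"
  unfolding sub_in_def
proof (intro ballI allI impI, elim conjE)
  fix L j assume L: "L \<in> mods Q" "is_mono Q L X j" "has_image j U"
  have Km: "K \<in> mods Q" using K summand_ext_closedD(1)[OF C] by blast
  have "retract L K"
    by (rule retract_of_same_image[OF L(1,2) Km K(2) X]) (use L(3) K(3) in \<open>simp add: has_image_def\<close>)
  then show "L \<in> C" using summand_ext_closedD(3)[OF C L(1) K(1)] by blast
qed

lemma sub_inE:
  assumes "sub_in C X U" "X \<in> mods Q" "subrep X U"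
  obtains K i where "K \<in> mods Q" "K \<in> C" "is_mono Q K X i" "has_image i U"
  using subrep_exists[OF assms(2,3)] assms(1) unfolding sub_in_def by blast

lemma image_factorization:
  fixes X :: "('v, 'a, 'k::field) rep"
  assumes X: "X \<in> mods Q" and Y: "Y \<in> mods Q" and h: "is_hom Q X Y h"
  obtains I m e where "I \<in> mods Q" "is_mono Q I Y m" "has_image m (\<lambda>v. mat_range (h v))" "is_epi Q X I e"
proof -
  obtain I m where I: "I \<in> mods Q" "is_mono Q I Y m" "\<And>v. v \<in> verts Q \<Longrightarrow> mat_range (m v) = mat_range (h v)"
    using subrep_exists[OF Y subrep_range[OF X Y h]] unfolding has_image_def by blast
  have im: "h v *\<^sub>v z \<in> mat_range (m v)" if "v \<in> verts Q" "z \<in> carrier_vec (rdim X v)" for v z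
    using I(3)[OF that(1)] hom_range[OF h that(1)] that(2) by blast
  obtain e where e: "is_hom Q X I e"
    "\<And>v x. v \<in> verts Q \<Longrightarrow> x \<in> carrier_vec (rdim X v) \<Longrightarrow> m v *\<^sub>v (e v *\<^sub>v x) = h v *\<^sub>v x"
    using mono_factor[OF I(1) Y X I(2) h im] by blast
  have "is_epi Q X I e"
  proof (rule epiI[OF e(1)])
    fix v and y :: "'k vec" assume v: "v \<in> verts Q" and y: "y \<in> carrier_vec (rdim I v)"
    have "m v *\<^sub>v y \<in> mat_range (h v)" using I(3)[OF v] hom_range[OF mono_hom[OF I(2)] v] y by blast
    then obtain x where x: "x \<in> carrier_vec (rdim X v)" "m v *\<^sub>v y = h v *\<^sub>v x" using hom_range[OF h v] by blast
    then have "e v *\<^sub>v x = y" using e(2)[OF v x(1)]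
      by (intro mono_eqD[OF I(2) v hom_app[OF e(1) v x(1)] y]) simp
    then show "\<exists>x\<in>carrier_vec (rdim X v). e v *\<^sub>v x = y" using x(1) by blast
  qed
  then show thesis using that[OF I(1,2)] I(3) by (simp add: has_image_def)
qed

lemma torsion_image_in:
  assumes T: "torsion_class Q T" and X: "X \<in> T" and Y: "Y \<in> mods Q" and h: "is_hom Q X Y h"
  shows "sub_in T Y (\<lambda>v. mat_range (h v))"
proof -
  have Xm: "X \<in> mods Q" using X T by (auto simp: torsion_class_def)
  obtain I m e where I: "I \<in> mods Q" "is_mono Q I Y m" "has_image m (\<lambda>v. mat_range (h v))"
    "is_epi Q X I e" by (rule image_factorization[OF Xm Y h])
  have "I \<in> T" by (rule torsion_quot[OF T X I(1,4)])
  then show ?thesis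
    using sub_inI[OF torsion_summand_ext_closed[OF T] Y _ I(2,3)] by simp
qed

text \<open>The image is the kernel of the cokernel, and a wide subcategory contains both.\<close>

lemma wide_image_in:
  assumes W: "wide_subcat Q W" and X: "X \<in> W" and Y: "Y \<in> W" and h: "is_hom Q X Y h"
  shows "sub_in W Y (\<lambda>v. mat_range (h v))"
proof -
  have Xm: "X \<in> mods Q" and Ym: "Y \<in> mods Q" using X Y W by (auto simp: wide_subcat_def)
  obtain C p where C: "C \<in> mods Q" "is_epi Q Y C p" "\<And>v. v \<in> verts Q \<Longrightarrow> mat_ker (p v) = mat_range (h v)"
    using quotient_exists[OF Ym subrep_range[OF Xm Ym h]] unfolding has_kernel_def by blast
  have "C \<in> W" by (rule wide_coker[OF W X Y h C(1,2)]) (simp add: C(3))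
  then show ?thesis unfolding sub_in_def has_image_def
    using wide_ker[OF W Y _ epi_hom[OF C(2)]] C(3) by auto
qed

abbreviation ker_in :: "('v, 'a, 'k::field) rep set \<Rightarrow> ('v, 'a, 'k) rep \<Rightarrow> ('v \<Rightarrow> 'k mat) \<Rightarrow> bool" where
  "ker_in C X g \<equiv> sub_in C X (\<lambda>v. mat_ker (g v))"

lemma ker_inE:
  assumes "ker_in C X g" "X \<in> mods Q" "Y \<in> mods Q" "is_hom Q X Y g"
  obtains K i where "K \<in> mods Q" "K \<in> C" "is_mono Q K X i" "\<forall>v\<in>verts Q. mat_range (i v) = mat_ker (g v)"
  by (rule sub_inE[OF assms(1,2) subrep_ker[OF assms(2-4)]]) (rule that, auto simp: has_image_def)

lemma kernel_exists:
  assumes "X \<in> mods Q" "Y \<in> mods Q" "is_hom Q X Y g"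
  obtains K i where "K \<in> mods Q" "is_mono Q K X i" "\<forall>v\<in>verts Q. mat_range (i v) = mat_ker (g v)"
  using subrep_exists[OF assms(1) subrep_ker[OF assms]] unfolding has_image_def by blast

lemma kernel_app:
  assumes "is_mono Q K X i" "is_hom Q X Y g" "\<forall>v\<in>verts Q. mat_range (i v) = mat_ker (g v)"
  shows "v \<in> verts Q \<Longrightarrow> k \<in> carrier_vec (rdim K v) \<Longrightarrow> g v *\<^sub>v (i v *\<^sub>v k) = 0\<^sub>v (rdim Y v)"
    "v \<in> verts Q \<Longrightarrow> x \<in> carrier_vec (rdim X v) \<Longrightarrow> g v *\<^sub>v x = 0\<^sub>v (rdim Y v) \<Longrightarrow>
      \<exists>k\<in>carrier_vec (rdim K v). x = i v *\<^sub>v k"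
proof -
  assume v: "v \<in> verts Q"
  note im = bspec[OF assms(3) v] and ih = mono_hom[OF assms(1)]
  { assume k: "k \<in> carrier_vec (rdim K v)"
    then have "i v *\<^sub>v k \<in> mat_ker (g v)"
      using mat_rangeI[OF hom_carrier[OF ih v] k] im by simp
    then show "g v *\<^sub>v (i v *\<^sub>v k) = 0\<^sub>v (rdim Y v)" using hom_ker[OF assms(2) v] by simp }
  { assume "x \<in> carrier_vec (rdim X v)" "g v *\<^sub>v x = 0\<^sub>v (rdim Y v)"
    then have "x \<in> mat_range (i v)" using hom_ker[OF assms(2) v] im by simp
    then show "\<exists>k\<in>carrier_vec (rdim K v). x = i v *\<^sub>v k" using hom_range[OF ih v] by simp }
qed

lemma has_imageI: "(\<forall>v\<in>verts Q. mat_range (i v) = U v) \<Longrightarrow> has_image i U"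
  by (simp add: has_image_def)

lemma ker_inI:
  assumes C: "summand_ext_closed C" and X: "X \<in> mods Q" and g: "is_hom Q X Y g"
    and K: "K \<in> C" "is_mono Q K X i"
    and "\<And>v k. v \<in> verts Q \<Longrightarrow> k \<in> carrier_vec (rdim K v) \<Longrightarrow> g v *\<^sub>v (i v *\<^sub>v k) = 0\<^sub>v (rdim Y v)"
    and "\<And>v x. v \<in> verts Q \<Longrightarrow> x \<in> carrier_vec (rdim X v) \<Longrightarrow> g v *\<^sub>v x = 0\<^sub>v (rdim Y v) \<Longrightarrow>
      \<exists>k\<in>carrier_vec (rdim K v). x = i v *\<^sub>v k"
  shows "ker_in C X g"
proof (rule sub_inI[OF C X K], rule has_imageI, rule ballI)
  fix v assume v: "v \<in> verts Q"
  note ih = mono_hom[OF K(2)]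
  show "mat_range (i v) = mat_ker (g v)"
    using assms(6,7)[OF v] hom_app[OF ih v]
    by (intro equalityI subsetI) (auto simp: hom_range[OF ih v] hom_ker[OF g v])
qed

definition zero_hom :: "('v, 'a, 'k::field) rep \<Rightarrow> ('v, 'a, 'k) rep \<Rightarrow> ('v \<Rightarrow> 'k mat) \<Rightarrow> bool" where
  "zero_hom X Y g \<longleftrightarrow> (\<forall>v\<in>verts Q. \<forall>x\<in>carrier_vec (rdim X v). g v *\<^sub>v x = 0\<^sub>v (rdim Y v))"

lemma ker_in_zero:
  assumes "summand_ext_closed C" "X \<in> C" "is_hom Q X Y g" "zero_hom X Y g"
  shows "ker_in C X g"
proof -
  have X: "X \<in> mods Q" using assms summand_ext_closedD(1) by blast
  have "is_mono Q X X (\<lambda>v. 1\<^sub>m (rdim X v))"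
    by (rule monoI[OF hom_id[OF X]]) simp
  then show ?thesis
    by (rule ker_inI[OF assms(1) X assms(3,2)]) (use assms(4) in \<open>auto simp: zero_hom_def\<close>)
qed

lemma ker_in_mono:
  fixes X :: "('v, 'a, 'k::field) rep"
  assumes C: "summand_ext_closed C" and X: "X \<in> mods Q" and Y: "Y \<in> mods Q" and g: "is_mono Q X Y g"
  shows "ker_in C X g"
  unfolding sub_in_def
proof (intro ballI allI impI, elim conjE)
  fix K i assume K: "K \<in> mods Q" "is_mono Q K X i" "has_image i (\<lambda>v. mat_ker (g v))"
  note ka = kernel_app[OF K(2) mono_hom[OF g] K(3)[unfolded has_image_def]]
  have z: "k = 0\<^sub>v (rdim K v)" if v: "v \<in> verts Q" and k: "k \<in> carrier_vec (rdim K v)" for v and k :: "'k vec"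
  proof (rule mono_eqD[OF K(2) v k zero_carrier_vec])
    show "i v *\<^sub>v k = i v *\<^sub>v 0\<^sub>v (rdim K v)"
      using ka(1)[OF v k] hom_app_zero[OF mono_hom[OF g] v] hom_app_zero[OF mono_hom[OF K(2)] v]
      by (intro mono_eqD[OF g v hom_app[OF mono_hom[OF K(2)] v k]]) simp_all
  qed
  have "rdim K v = 0" if v: "v \<in> verts Q" for v
  proof (rule ccontr)
    assume "rdim K v \<noteq> 0"
    then show False using z[OF v unit_vec_carrier[of "rdim K v" 0]]
      by (metis gr_zeroI unit_vec_nonzero)
  qed
  then show "K \<in> C" using summand_ext_closedD(2)[OF C K(1)] by (simp add: is_zero_rep_def)
qed

text \<open>The kernel of \<open>g\<close> is the image under \<open>q\<close> of the kernel of
  \<open>g q\<close>, hence a quotient of a module in \<open>T\<close>.\<close>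

lemma ker_in_quotient:
  fixes X :: "('v, 'a, 'k::field) rep"
  assumes T: "torsion_class Q T" and Y: "Y \<in> mods Q" and Y': "Y' \<in> mods Q" and X: "X \<in> mods Q"
    and q: "is_epi Q Y Y' q" and g: "is_hom Q Y' X g" and k: "ker_in T Y (\<lambda>v. g v * q v)"
  shows "ker_in T Y' g"
proof -
  note qh = epi_hom[OF q] and gq = hom_comp[OF Y Y' X epi_hom[OF q] g]
  note gq_app = hom_comp_app[OF qh g]
  obtain K i where K: "K \<in> mods Q" "K \<in> T" "is_mono Q K Y i"
    and Ki: "\<forall>v\<in>verts Q. mat_range (i v) = mat_ker (g v * q v)"
    by (rule ker_inE[OF k Y X gq])
  note Ka = kernel_app[OF K(3) gq Ki]
  note ih = mono_hom[OF K(3)]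
  obtain L j where L: "L \<in> mods Q" "is_mono Q L Y' j"
    and Lj: "\<forall>v\<in>verts Q. mat_range (j v) = mat_ker (g v)"
    by (rule kernel_exists[OF Y' X g])
  note La = kernel_app[OF L(2) g Lj]
  note qi = hom_comp[OF K(1) Y Y' ih qh]
  have im: "(q v * i v) *\<^sub>v z \<in> mat_range (j v)" if "v \<in> verts Q" "z \<in> carrier_vec (rdim K v)" for v z
    using Ka(1)[OF that] hom_app[OF ih that] hom_app[OF qi that]
    by (simp add: hom_comp_app[OF ih qh that] gq_app[OF that(1)] bspec[OF Lj that(1)] hom_ker[OF g that(1)])
  obtain e where e: "is_hom Q K L e"
    "\<And>v z. v \<in> verts Q \<Longrightarrow> z \<in> carrier_vec (rdim K v) \<Longrightarrow> j v *\<^sub>v (e v *\<^sub>v z) = (q v * i v) *\<^sub>v z"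
    using mono_factor[OF L(1) Y' K(1) L(2) qi im] by blast
  have "is_epi Q K L e"
  proof (rule epiI[OF e(1)])
    fix v and l :: "'k vec" assume v: "v \<in> verts Q" and l: "l \<in> carrier_vec (rdim L v)"
    have jl: "j v *\<^sub>v l \<in> carrier_vec (rdim Y' v)" by (rule hom_app[OF mono_hom[OF L(2)] v l])
    obtain y where y: "y \<in> carrier_vec (rdim Y v)" "q v *\<^sub>v y = j v *\<^sub>v l" by (rule epiE[OF q v jl])
    then have "(g v * q v) *\<^sub>v y = 0\<^sub>v (rdim X v)" using La(1)[OF v l] gq_app[OF v y(1)] by simp
    then obtain k where k: "k \<in> carrier_vec (rdim K v)" "y = i v *\<^sub>v k" using Ka(2)[OF v y(1)] by blast
    have "e v *\<^sub>v k = l"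
      using e(2)[OF v k(1)] k y hom_comp_app[OF ih qh v k(1)]
      by (intro mono_eqD[OF L(2) v hom_app[OF e(1) v k(1)] l]) simp
    then show "\<exists>x\<in>carrier_vec (rdim K v). e v *\<^sub>v x = l" using k(1) by blast
  qed
  then have "L \<in> T" by (rule torsion_quot[OF T K(2) L(1)])
  then show ?thesis
    using sub_inI[OF torsion_summand_ext_closed[OF T] Y' _ L(2) has_imageI[OF Lj]] by blast
qed

text \<open>Here \<open>g\<close> vanishes on \<open>Y1\<close> and descends to \<open>g2\<close> on
  \<open>Y2\<close>, which gives an exact sequence 0 -> Y1 -> ker g -> ker g2 -> 0.\<close>

lemma ker_in_ext_zero:
  fixes X :: "('v, 'a, 'k::field) rep"
  assumes C: "summand_ext_closed C" and Y1: "Y1 \<in> C" and Y: "Y \<in> mods Q" and Y2: "Y2 \<in> mods Q" and X: "X \<in> mods Q"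
    and f: "is_mono Q Y1 Y f" and p: "is_epi Q Y Y2 p"
    and ex: "\<forall>v\<in>verts Q. mat_range (f v) = mat_ker (p v)"
    and g: "is_hom Q Y X g" and g2: "is_hom Q Y2 X g2"
    and gp: "\<And>v y. v \<in> verts Q \<Longrightarrow> y \<in> carrier_vec (rdim Y v) \<Longrightarrow> g2 v *\<^sub>v (p v *\<^sub>v y) = g v *\<^sub>v y"
    and k: "ker_in C Y2 g2"
  shows "ker_in C Y g"
proof -
  have Y1m: "Y1 \<in> mods Q" using Y1 C summand_ext_closedD(1) by blast
  note fa = kernel_app[OF f epi_hom[OF p] ex]
  obtain K i where K: "K \<in> mods Q" "is_mono Q K Y i"
    and Ki: "\<forall>v\<in>verts Q. mat_range (i v) = mat_ker (g v)"
    by (rule kernel_exists[OF Y X g])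
  note Ka = kernel_app[OF K(2) g Ki]
  note ih = mono_hom[OF K(2)] and ph = epi_hom[OF p] and fh = mono_hom[OF f]
  obtain L j where L: "L \<in> mods Q" "L \<in> C" "is_mono Q L Y2 j"
    and Lj: "\<forall>v\<in>verts Q. mat_range (j v) = mat_ker (g2 v)"
    by (rule ker_inE[OF k Y2 X g2])
  note La = kernel_app[OF L(3) g2 Lj]
  have im1: "f v *\<^sub>v z \<in> mat_range (i v)" if "v \<in> verts Q" "z \<in> carrier_vec (rdim Y1 v)" for v z
    using gp[OF that(1) hom_app[OF fh that]] fa(1)[OF that] hom_app_zero[OF g2 that(1)] hom_app[OF fh that]
    by (simp add: bspec[OF Ki that(1)] hom_ker[OF g that(1)])
  obtain m where m: "is_hom Q Y1 K m"
    "\<And>v z. v \<in> verts Q \<Longrightarrow> z \<in> carrier_vec (rdim Y1 v) \<Longrightarrow> i v *\<^sub>v (m v *\<^sub>v z) = f v *\<^sub>v z"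
    using mono_factor[OF K(1) Y Y1m K(2) fh im1] by blast
  note pih = hom_comp[OF K(1) Y Y2 ih ph]
  have im2: "(p v * i v) *\<^sub>v z \<in> mat_range (j v)" if "v \<in> verts Q" "z \<in> carrier_vec (rdim K v)" for v z
    using gp[OF that(1) hom_app[OF ih that]] Ka(1)[OF that] hom_app[OF pih that]
    by (simp add: hom_comp_app[OF ih ph that] bspec[OF Lj that(1)] hom_ker[OF g2 that(1)])
  obtain e where e: "is_hom Q K L e"
    "\<And>v z. v \<in> verts Q \<Longrightarrow> z \<in> carrier_vec (rdim K v) \<Longrightarrow> j v *\<^sub>v (e v *\<^sub>v z) = (p v * i v) *\<^sub>v z"
    using mono_factor[OF L(1) Y2 K(1) L(3) pih im2] by blast
  have je: "j v *\<^sub>v (e v *\<^sub>v z) = p v *\<^sub>v (i v *\<^sub>v z)" if "v \<in> verts Q" "z \<in> carrier_vec (rdim K v)" for v z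
    using e(2)[OF that] hom_comp_app[OF ih ph that] by simp
  have me: "is_mono Q Y1 K m"
  proof (rule monoI[OF m(1)])
    fix v and x :: "'k vec" assume v: "v \<in> verts Q" and x: "x \<in> carrier_vec (rdim Y1 v)" "m v *\<^sub>v x = 0\<^sub>v (rdim K v)"
    then have "f v *\<^sub>v x = f v *\<^sub>v 0\<^sub>v (rdim Y1 v)"
      using m(2)[OF v x(1)] hom_app_zero[OF ih v] hom_app_zero[OF fh v] by simp
    then show "x = 0\<^sub>v (rdim Y1 v)" by (rule mono_eqD[OF f v x(1) zero_carrier_vec])
  qed
  have ep: "is_epi Q K L e"
  proof (rule epiI[OF e(1)])
    fix v and l :: "'k vec" assume v: "v \<in> verts Q" and l: "l \<in> carrier_vec (rdim L v)"
    obtain y where y: "y \<in> carrier_vec (rdim Y v)" "p v *\<^sub>v y = j v *\<^sub>v l"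
      by (rule epiE[OF p v hom_app[OF mono_hom[OF L(3)] v l]])
    then have "g v *\<^sub>v y = 0\<^sub>v (rdim X v)" using gp[OF v y(1)] La(1)[OF v l] by simp
    then obtain k where k: "k \<in> carrier_vec (rdim K v)" "y = i v *\<^sub>v k" using Ka(2)[OF v y(1)] by blast
    have "e v *\<^sub>v k = l" using je[OF v k(1)] k y
      by (intro mono_eqD[OF L(3) v hom_app[OF e(1) v k(1)] l]) simp
    then show "\<exists>x\<in>carrier_vec (rdim K v). e v *\<^sub>v x = l" using k(1) by blast
  qed
  have "mat_range (m v) = mat_ker (e v)" if v: "v \<in> verts Q" for v
  proof -
    have "e v *\<^sub>v (m v *\<^sub>v x) = 0\<^sub>v (rdim L v)" if x: "x \<in> carrier_vec (rdim Y1 v)" for x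
    proof -
      have mx: "m v *\<^sub>v x \<in> carrier_vec (rdim K v)" by (rule hom_app[OF m(1) v x])
      show ?thesis
        using je[OF v mx] m(2)[OF v x] fa(1)[OF v x] hom_app_zero[OF mono_hom[OF L(3)] v]
        by (intro mono_eqD[OF L(3) v hom_app[OF e(1) v mx] zero_carrier_vec]) simp
    qed
    moreover have "\<exists>x\<in>carrier_vec (rdim Y1 v). z = m v *\<^sub>v x"
      if z: "z \<in> carrier_vec (rdim K v)" "e v *\<^sub>v z = 0\<^sub>v (rdim L v)" for z
    proof -
      have "p v *\<^sub>v (i v *\<^sub>v z) = 0\<^sub>v (rdim Y2 v)"
        using je[OF v z(1)] z(2) hom_app_zero[OF mono_hom[OF L(3)] v] by simp
      then obtain x where x: "x \<in> carrier_vec (rdim Y1 v)" "i v *\<^sub>v z = f v *\<^sub>v x"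
        using fa(2)[OF v hom_app[OF ih v z(1)]] by blast
      then have "z = m v *\<^sub>v x" using m(2)[OF v x(1)]
        by (intro mono_eqD[OF K(2) v z(1) hom_app[OF m(1) v x(1)]]) simp
      then show ?thesis using x(1) by blast
    qed
    ultimately show ?thesis
      by (intro equalityI subsetI) (auto simp: hom_range[OF m(1) v] hom_ker[OF e(1) v] hom_app[OF m(1) v])
  qed
  then have "K \<in> C"
    using ext_closedD[OF _ Y1 L(2) K(1) me ep] C unfolding summand_ext_closed_def by blast
  then show ?thesis using sub_inI[OF C Y _ K(2) has_imageI[OF Ki]] by blast
qed

text \<open>Here \<open>g\<close> is already surjective on \<open>Y1\<close>, which gives an exact
  sequence 0 -> ker (g f) -> ker g -> Y2 -> 0.\<close>

lemma ker_in_ext_epi: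
  fixes X :: "('v, 'a, 'k::field) rep"
  assumes C: "summand_ext_closed C" and Y1: "Y1 \<in> mods Q" and Y: "Y \<in> mods Q" and Y2: "Y2 \<in> C" and X: "X \<in> mods Q"
    and f: "is_mono Q Y1 Y f" and p: "is_epi Q Y Y2 p"
    and ex: "\<forall>v\<in>verts Q. mat_range (f v) = mat_ker (p v)"
    and g: "is_hom Q Y X g" and e1: "is_epi Q Y1 X (\<lambda>v. g v * f v)" and k: "ker_in C Y1 (\<lambda>v. g v * f v)"
  shows "ker_in C Y g"
proof -
  have Y2m: "Y2 \<in> mods Q" using Y2 C summand_ext_closedD(1) by blast
  note fa = kernel_app[OF f epi_hom[OF p] ex]
  note ph = epi_hom[OF p] and fh = mono_hom[OF f]
  obtain K i where K: "K \<in> mods Q" "is_mono Q K Y i"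
    and Ki: "\<forall>v\<in>verts Q. mat_range (i v) = mat_ker (g v)"
    by (rule kernel_exists[OF Y X g])
  note Ka = kernel_app[OF K(2) g Ki]
  note ih = mono_hom[OF K(2)]
  obtain L j where L: "L \<in> mods Q" "L \<in> C" "is_mono Q L Y1 j"
    and Lj: "\<forall>v\<in>verts Q. mat_range (j v) = mat_ker (g v * f v)"
    by (rule ker_inE[OF k Y1 X epi_hom[OF e1]])
  note La = kernel_app[OF L(3) epi_hom[OF e1] Lj]
  note jh = mono_hom[OF L(3)]
  note gf = hom_comp_app[OF fh g]
  note fjh = hom_comp[OF L(1) Y1 Y jh fh]
  have im: "(f v * j v) *\<^sub>v z \<in> mat_range (i v)" if "v \<in> verts Q" "z \<in> carrier_vec (rdim L v)" for v z
    using La(1)[OF that] hom_app[OF fjh that] gf[OF that(1) hom_app[OF jh that]]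
    by (simp add: hom_comp_app[OF jh fh that] bspec[OF Ki that(1)] hom_ker[OF g that(1)])
  obtain m where m: "is_hom Q L K m"
    "\<And>v z. v \<in> verts Q \<Longrightarrow> z \<in> carrier_vec (rdim L v) \<Longrightarrow> i v *\<^sub>v (m v *\<^sub>v z) = (f v * j v) *\<^sub>v z"
    using mono_factor[OF K(1) Y L(1) K(2) fjh im] by blast
  have im': "i v *\<^sub>v (m v *\<^sub>v z) = f v *\<^sub>v (j v *\<^sub>v z)" if "v \<in> verts Q" "z \<in> carrier_vec (rdim L v)" for v z
    using m(2)[OF that] hom_comp_app[OF jh fh that] by simp
  note pih = hom_comp[OF K(1) Y Y2m ih ph]
  note pi = hom_comp_app[OF ih ph]
  have mo: "is_mono Q L K m"
  proof (rule monoI[OF m(1)])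
    fix v and x :: "'k vec" assume v: "v \<in> verts Q" and x: "x \<in> carrier_vec (rdim L v)" "m v *\<^sub>v x = 0\<^sub>v (rdim K v)"
    have "f v *\<^sub>v (j v *\<^sub>v x) = f v *\<^sub>v (0\<^sub>v (rdim Y1 v))"
      using im'[OF v x(1)] x(2) hom_app_zero[OF ih v] hom_app_zero[OF fh v] by simp
    then have "j v *\<^sub>v x = 0\<^sub>v (rdim Y1 v)" by (rule mono_eqD[OF f v hom_app[OF jh v x(1)] zero_carrier_vec])
    then show "x = 0\<^sub>v (rdim L v)" using hom_app_zero[OF jh v]
      by (intro mono_eqD[OF L(3) v x(1) zero_carrier_vec]) simp
  qed
  have ep: "is_epi Q K Y2 (\<lambda>v. p v * i v)"
  proof (rule epiI[OF pih])
    fix v and z :: "'k vec" assume v: "v \<in> verts Q" and z: "z \<in> carrier_vec (rdim Y2 v)"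
    obtain y where y: "y \<in> carrier_vec (rdim Y v)" "p v *\<^sub>v y = z" by (rule epiE[OF p v z])
    \<comment> \<open>The preimage \<open>y\<close> of \<open>z\<close> is corrected by an element
      of \<open>Y1\<close> with the same image in \<open>X\<close>. This moves it into the kernel of
      \<open>g\<close> without changing its class in \<open>Y2\<close>.\<close>
    obtain u where u: "u \<in> carrier_vec (rdim Y1 v)" "(g v * f v) *\<^sub>v u = g v *\<^sub>v y"
      by (rule epiE[OF e1 v hom_app[OF g v y(1)]])
    have fu: "f v *\<^sub>v u \<in> carrier_vec (rdim Y v)" by (rule hom_app[OF fh v u(1)])
    have "g v *\<^sub>v (y - f v *\<^sub>v u) = 0\<^sub>v (rdim X v)"
      using hom_app_minus[OF g v y(1) fu] u(2) gf[OF v u(1)] hom_app[OF g v y(1)] by simp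
    then obtain k where k: "k \<in> carrier_vec (rdim K v)" "y - f v *\<^sub>v u = i v *\<^sub>v k"
      using Ka(2)[OF v] y(1) fu by (metis minus_carrier_vec)
    have "p v *\<^sub>v (i v *\<^sub>v k) = z"
      using hom_app_minus[OF ph v y(1) fu] fa(1)[OF v u(1)] y(2) z by (simp flip: k(2))
    then show "\<exists>x\<in>carrier_vec (rdim K v). (p v * i v) *\<^sub>v x = z" using pi[OF v k(1)] k(1) by auto
  qed
  have "mat_range (m v) = mat_ker (p v * i v)" if v: "v \<in> verts Q" for v
  proof -
    have "(p v * i v) *\<^sub>v (m v *\<^sub>v x) = 0\<^sub>v (rdim Y2 v)" if x: "x \<in> carrier_vec (rdim L v)" for x
      using pi[OF v hom_app[OF m(1) v x]] im'[OF v x] fa(1)[OF v hom_app[OF jh v x]] by simp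
    moreover have "\<exists>x\<in>carrier_vec (rdim L v). z = m v *\<^sub>v x"
      if z: "z \<in> carrier_vec (rdim K v)" "(p v * i v) *\<^sub>v z = 0\<^sub>v (rdim Y2 v)" for z
    proof -
      obtain u where u: "u \<in> carrier_vec (rdim Y1 v)" "i v *\<^sub>v z = f v *\<^sub>v u"
        using fa(2)[OF v hom_app[OF ih v z(1)]] z(2) pi[OF v z(1)] by auto
      have "(g v * f v) *\<^sub>v u = 0\<^sub>v (rdim X v)" using gf[OF v u(1)] u(2) Ka(1)[OF v z(1)] by simp
      then obtain x where x: "x \<in> carrier_vec (rdim L v)" "u = j v *\<^sub>v x" using La(2)[OF v u(1)] by blast
      have "z = m v *\<^sub>v x" using im'[OF v x(1)] u x
        by (intro mono_eqD[OF K(2) v z(1) hom_app[OF m(1) v x(1)]]) simp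
      then show ?thesis using x(1) by blast
    qed
    ultimately show ?thesis
      by (intro equalityI subsetI) (auto simp: hom_range[OF m(1) v] hom_ker[OF pih v] hom_app[OF m(1) v])
  qed
  then have "K \<in> C"
    using ext_closedD[OF _ L(2) Y2 K(1) mo ep] C unfolding summand_ext_closed_def by blast
  then show ?thesis using sub_inI[OF C Y _ K(2) has_imageI[OF Ki]] by blast
qed

end

section \<open>Direct sums of representations\<close>

definition fst_mat :: "nat \<Rightarrow> nat \<Rightarrow> 'k::field mat" where
  "fst_mat m n = mat m (m + n) (\<lambda>(i, j). if i = j then 1 else 0)"

definition snd_mat :: "nat \<Rightarrow> nat \<Rightarrow> 'k::field mat" where
  "snd_mat m n = mat n (m + n) (\<lambda>(i, j). if m + i = j then 1 else 0)"

definition inl_mat :: "nat \<Rightarrow> nat \<Rightarrow> 'k::field mat" where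
  "inl_mat m n = mat (m + n) m (\<lambda>(i, j). if i = j then 1 else 0)"

definition inr_mat :: "nat \<Rightarrow> nat \<Rightarrow> 'k::field mat" where
  "inr_mat m n = mat (m + n) n (\<lambda>(i, j). if i = m + j then 1 else 0)"

lemma sum_if_one: "finite A \<Longrightarrow> i \<in> A \<Longrightarrow> (\<Sum>j\<in>A. (if i = j then 1 else 0) * f j) = (f i :: 'k::field)"
  by (simp add: if_distrib[of "\<lambda>x. x * _"] cong: if_cong)

lemma dsum_mat_mult:
  assumes u: "(u :: 'k::field vec) \<in> carrier_vec m" and w: "w \<in> carrier_vec n"
  shows "fst_mat m n *\<^sub>v (u @\<^sub>v w) = u" "snd_mat m n *\<^sub>v (u @\<^sub>v w) = w"
    "inl_mat m n *\<^sub>v u = u @\<^sub>v 0\<^sub>v n" "inr_mat m n *\<^sub>v w = 0\<^sub>v m @\<^sub>v w"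
proof -
  have dims: "dim_vec u = m" "dim_vec w = n" using u w by auto
  show "fst_mat m n *\<^sub>v (u @\<^sub>v w) = u"
  proof (rule eq_vecI)
    fix i assume "i < dim_vec u"
    then have i: "i < m" using dims by simp
    have "(fst_mat m n *\<^sub>v (u @\<^sub>v w)) $ i = (\<Sum>j\<in>{0..<m + n}. (if i = j then 1 else 0) * (u @\<^sub>v w) $ j)"
      using i dims by (simp add: fst_mat_def scalar_prod_def)
    also have "\<dots> = (u @\<^sub>v w) $ i" by (rule sum_if_one) (use i in auto)
    finally show "(fst_mat m n *\<^sub>v (u @\<^sub>v w)) $ i = u $ i" using i dims by simp
  qed (simp add: fst_mat_def dims)
  show "snd_mat m n *\<^sub>v (u @\<^sub>v w) = w"
  proof (rule eq_vecI)
    fix i assume "i < dim_vec w"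
    then have i: "i < n" using dims by simp
    have "(snd_mat m n *\<^sub>v (u @\<^sub>v w)) $ i = (\<Sum>j\<in>{0..<m + n}. (if m + i = j then 1 else 0) * (u @\<^sub>v w) $ j)"
      using i dims by (simp add: snd_mat_def scalar_prod_def)
    also have "\<dots> = (u @\<^sub>v w) $ (m + i)" by (rule sum_if_one) (use i in auto)
    finally show "(snd_mat m n *\<^sub>v (u @\<^sub>v w)) $ i = w $ i" using i dims by simp
  qed (simp add: snd_mat_def dims)
  show "inl_mat m n *\<^sub>v u = u @\<^sub>v 0\<^sub>v n"
  proof (rule eq_vecI)
    fix i assume "i < dim_vec (u @\<^sub>v 0\<^sub>v n)"
    then have i: "i < m + n" using dims by simp
    have *: "(inl_mat m n *\<^sub>v u) $ i = (\<Sum>j\<in>{0..<m}. (if i = j then 1 else 0) * u $ j)"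
      using i dims by (simp add: inl_mat_def scalar_prod_def)
    show "(inl_mat m n *\<^sub>v u) $ i = (u @\<^sub>v 0\<^sub>v n) $ i"
    proof (cases "i < m")
      case True
      then have "(\<Sum>j\<in>{0..<m}. (if i = j then 1 else 0) * u $ j) = u $ i" by (intro sum_if_one) auto
      then show ?thesis using * True i dims by simp
    next
      case False
      then have "(\<Sum>j\<in>{0..<m}. (if i = j then 1 else 0) * u $ j) = 0" by (intro sum.neutral) auto
      then show ?thesis using * False i dims by simp
    qed
  qed (simp add: inl_mat_def dims)
  show "inr_mat m n *\<^sub>v w = 0\<^sub>v m @\<^sub>v w"
  proof (rule eq_vecI)
    fix i assume "i < dim_vec (0\<^sub>v m @\<^sub>v w)"
    then have i: "i < m + n" using dims by simp
    have *: "(inr_mat m n *\<^sub>v w) $ i = (\<Sum>j\<in>{0..<n}. (if i = m + j then 1 else 0) * w $ j)"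
      using i dims by (simp add: inr_mat_def scalar_prod_def)
    show "(inr_mat m n *\<^sub>v w) $ i = (0\<^sub>v m @\<^sub>v w) $ i"
    proof (cases "i < m")
      case True
      then have "(\<Sum>j\<in>{0..<n}. (if i = m + j then 1 else 0) * w $ j) = 0" by (intro sum.neutral) auto
      then show ?thesis using * True i dims by simp
    next
      case False
      then have "(\<Sum>j\<in>{0..<n}. (if i = m + j then 1 else 0) * w $ j)
          = (\<Sum>j\<in>{0..<n}. (if i - m = j then 1 else 0) * w $ j)" by (intro sum.cong) auto
      also have "\<dots> = w $ (i - m)" using False i by (intro sum_if_one) auto
      finally show ?thesis using * False i dims by simp
    qed
  qed (simp add: inr_mat_def dims)
qed

lemma zero_mat_mult_vec: "(x :: 'k::field vec) \<in> carrier_vec n \<Longrightarrow> 0\<^sub>m m n *\<^sub>v x = 0\<^sub>v m"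
  by (intro eq_vecI) (auto simp: scalar_prod_def)

lemma append_vec_cases:
  assumes "(x :: 'k vec) \<in> carrier_vec (m + n)"
  obtains u w where "u \<in> carrier_vec m" "w \<in> carrier_vec n" "x = u @\<^sub>v w"
  using vec_first_last_append[OF assms] vec_first_carrier vec_last_carrier by metis

lemma mat_zero_cols_eq:
  "A \<in> carrier_mat 0 n \<Longrightarrow> B \<in> carrier_mat 0 n \<Longrightarrow> A = B"
  by (intro eq_matI) auto

context bound_quiver
begin

abbreviation "ds_fst X Y v \<equiv> fst_mat (rdim X v) (rdim Y v)"
abbreviation "ds_snd X Y v \<equiv> snd_mat (rdim X v) (rdim Y v)"
abbreviation "ds_inl X Y v \<equiv> inl_mat (rdim X v) (rdim Y v)"
abbreviation "ds_inr X Y v \<equiv> inr_mat (rdim X v) (rdim Y v)"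

lemma rdim_dsum [simp]: "rdim (dsum Q X Y) v = rdim X v + rdim Y v"
  by (simp add: dsum_def)

lemma dsum_carrier: "rep_carrier X \<Longrightarrow> rep_carrier Y \<Longrightarrow> rep_carrier (dsum Q X Y)"
  unfolding rep_carrier_def dsum_def by auto

lemma rmap_dsum_app:
  assumes "rep_carrier X" "rep_carrier Y" "a \<in> arrs Q"
    "u \<in> carrier_vec (rdim X (src Q a))" "w \<in> carrier_vec (rdim Y (src Q a))"
  shows "rmap (dsum Q X Y) a *\<^sub>v (u @\<^sub>v w) = (rmap X a *\<^sub>v u) @\<^sub>v (rmap Y a *\<^sub>v w)"
proof -
  have c: "rmap X a \<in> carrier_mat (rdim X (tgt Q a)) (rdim X (src Q a))"
    "rmap Y a \<in> carrier_mat (rdim Y (tgt Q a)) (rdim Y (src Q a))"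
    using assms by (auto simp: rep_carrier_def)
  have "rmap (dsum Q X Y) a *\<^sub>v (u @\<^sub>v w)
    = (rmap X a *\<^sub>v u + 0\<^sub>m (rdim X (tgt Q a)) (rdim Y (src Q a)) *\<^sub>v w)
      @\<^sub>v (0\<^sub>m (rdim Y (tgt Q a)) (rdim X (src Q a)) *\<^sub>v u + rmap Y a *\<^sub>v w)"
    unfolding dsum_def rep.simps
    by (rule four_block_mat_mult_vec[OF c(1) zero_carrier_mat zero_carrier_mat c(2) assms(4,5)])
  also have "\<dots> = (rmap X a *\<^sub>v u) @\<^sub>v (rmap Y a *\<^sub>v w)"
    using mult_mat_vec_carrier[OF c(1) assms(4)] mult_mat_vec_carrier[OF c(2) assms(5)]
    by (simp add: zero_mat_mult_vec[OF assms(4)] zero_mat_mult_vec[OF assms(5)])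
  finally show ?thesis .
qed

lemma hom_of_app:
  fixes X :: "('v, 'a, 'k::field) rep"
  assumes X: "rep_carrier X" and Y: "rep_carrier Y"
    and c: "\<And>v. v \<in> verts Q \<Longrightarrow> f v \<in> carrier_mat (rdim Y v) (rdim X v)"
    and e: "\<And>a x. a \<in> arrs Q \<Longrightarrow> x \<in> carrier_vec (rdim X (src Q a)) \<Longrightarrow>
      f (tgt Q a) *\<^sub>v (rmap X a *\<^sub>v x) = rmap Y a *\<^sub>v (f (src Q a) *\<^sub>v x)"
  shows "is_hom Q X Y f"
  unfolding is_hom_def
proof (intro conjI ballI)
  fix a assume a: "a \<in> arrs Q"
  have ac: "rmap X a \<in> carrier_mat (rdim X (tgt Q a)) (rdim X (src Q a))"
    "rmap Y a \<in> carrier_mat (rdim Y (tgt Q a)) (rdim Y (src Q a))"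
    using X Y a by (auto simp: rep_carrier_def)
  note fc = c[OF src_in[OF a]] c[OF tgt_in[OF a]]
  show "f (tgt Q a) * rmap X a = rmap Y a * f (src Q a)"
  proof (rule mat_eqI_vec[OF mult_carrier_mat[OF fc(2) ac(1)] mult_carrier_mat[OF ac(2) fc(1)]])
    fix x :: "'k vec" assume x: "x \<in> carrier_vec (rdim X (src Q a))"
    show "(f (tgt Q a) * rmap X a) *\<^sub>v x = (rmap Y a * f (src Q a)) *\<^sub>v x"
      using e[OF a x] assoc_mult_mat_vec[OF fc(2) ac(1) x] assoc_mult_mat_vec[OF ac(2) fc(1) x] by simp
  qed
qed (rule c)

lemma dsum_homs:
  fixes X :: "('v, 'a, 'k::field) rep"
  assumes X: "rep_carrier X" and Y: "rep_carrier Y"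
  shows "is_hom Q (dsum Q X Y) X (ds_fst X Y)" "is_hom Q (dsum Q X Y) Y (ds_snd X Y)"
    "is_hom Q X (dsum Q X Y) (ds_inl X Y)" "is_hom Q Y (dsum Q X Y) (ds_inr X Y)"
proof -
  note D = dsum_carrier[OF X Y]
  have c: "rmap X a *\<^sub>v u \<in> carrier_vec (rdim X (tgt Q a))" "rmap Y a *\<^sub>v w \<in> carrier_vec (rdim Y (tgt Q a))"
    if "a \<in> arrs Q" "u \<in> carrier_vec (rdim X (src Q a))" "w \<in> carrier_vec (rdim Y (src Q a))" for a u w
    using X Y that by (auto simp: rep_carrier_def intro: mult_mat_vec_carrier)
  have z: "rmap X a *\<^sub>v 0\<^sub>v (rdim X (src Q a)) = 0\<^sub>v (rdim X (tgt Q a))"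
    "rmap Y a *\<^sub>v 0\<^sub>v (rdim Y (src Q a)) = 0\<^sub>v (rdim Y (tgt Q a))" if "a \<in> arrs Q" for a
    using X Y that by (auto simp: rep_carrier_def intro: mult_mat_vec_zero)
  show "is_hom Q (dsum Q X Y) X (ds_fst X Y)"
  proof (rule hom_of_app[OF D X])
    fix a and x :: "'k vec" assume a: "a \<in> arrs Q" and "x \<in> carrier_vec (rdim (dsum Q X Y) (src Q a))"
    then have "x \<in> carrier_vec (rdim X (src Q a) + rdim Y (src Q a))" by simp
    then obtain u w where uw: "u \<in> carrier_vec (rdim X (src Q a))" "w \<in> carrier_vec (rdim Y (src Q a))" "x = u @\<^sub>v w"
      by (rule append_vec_cases)
    show "ds_fst X Y (tgt Q a) *\<^sub>v (rmap (dsum Q X Y) a *\<^sub>v x) = rmap X a *\<^sub>v (ds_fst X Y (src Q a) *\<^sub>v x)"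
      unfolding uw(3) rmap_dsum_app[OF X Y a uw(1,2)] dsum_mat_mult(1)[OF uw(1,2)] dsum_mat_mult(1)[OF c[OF a uw(1,2)]] ..
  qed (simp add: fst_mat_def)
  show "is_hom Q (dsum Q X Y) Y (ds_snd X Y)"
  proof (rule hom_of_app[OF D Y])
    fix a and x :: "'k vec" assume a: "a \<in> arrs Q" and "x \<in> carrier_vec (rdim (dsum Q X Y) (src Q a))"
    then have "x \<in> carrier_vec (rdim X (src Q a) + rdim Y (src Q a))" by simp
    then obtain u w where uw: "u \<in> carrier_vec (rdim X (src Q a))" "w \<in> carrier_vec (rdim Y (src Q a))" "x = u @\<^sub>v w"
      by (rule append_vec_cases)
    show "ds_snd X Y (tgt Q a) *\<^sub>v (rmap (dsum Q X Y) a *\<^sub>v x) = rmap Y a *\<^sub>v (ds_snd X Y (src Q a) *\<^sub>v x)"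
      unfolding uw(3) rmap_dsum_app[OF X Y a uw(1,2)] dsum_mat_mult(2)[OF uw(1,2)] dsum_mat_mult(2)[OF c[OF a uw(1,2)]] ..
  qed (simp add: snd_mat_def)
  show "is_hom Q X (dsum Q X Y) (ds_inl X Y)"
  proof (rule hom_of_app[OF X D])
    fix a and u :: "'k vec" assume a: "a \<in> arrs Q" and u: "u \<in> carrier_vec (rdim X (src Q a))"
    show "ds_inl X Y (tgt Q a) *\<^sub>v (rmap X a *\<^sub>v u) = rmap (dsum Q X Y) a *\<^sub>v (ds_inl X Y (src Q a) *\<^sub>v u)"
      using dsum_mat_mult(3)[OF u zero_carrier_vec, of "rdim Y (src Q a)"]
        dsum_mat_mult(3)[OF c(1)[OF a u zero_carrier_vec] zero_carrier_vec, of "rdim Y (tgt Q a)"]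
        rmap_dsum_app[OF X Y a u zero_carrier_vec] z[OF a] by simp
  qed (simp add: inl_mat_def)
  show "is_hom Q Y (dsum Q X Y) (ds_inr X Y)"
  proof (rule hom_of_app[OF Y D])
    fix a and w :: "'k vec" assume a: "a \<in> arrs Q" and w: "w \<in> carrier_vec (rdim Y (src Q a))"
    show "ds_inr X Y (tgt Q a) *\<^sub>v (rmap Y a *\<^sub>v w) = rmap (dsum Q X Y) a *\<^sub>v (ds_inr X Y (src Q a) *\<^sub>v w)"
      using dsum_mat_mult(4)[OF zero_carrier_vec w, of "rdim X (src Q a)"]
        dsum_mat_mult(4)[OF zero_carrier_vec c(2)[OF a zero_carrier_vec w], of "rdim X (tgt Q a)"]
        rmap_dsum_app[OF X Y a zero_carrier_vec w] z[OF a] by simp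
  qed (simp add: inr_mat_def)
qed

text \<open>A relation acts as zero on the sum because its composite with each projection is its
  action on that summand, preceded by a projection.\<close>

lemma dsum_mods:
  fixes X :: "('v, 'a, 'k::field) rep"
  assumes X: "X \<in> mods Q" and Y: "Y \<in> mods Q"
  shows "dsum Q X Y \<in> mods Q"
  unfolding mods_def is_rep_def
proof (intro CollectI conjI ballI)
  fix p assume p: "p \<in> rels Q"
  let ?D = "dsum Q X Y" and ?t = "tgt Q (last p)" and ?s = "src Q (hd p)"
  note Xc = mods_carrier[OF X] and Yc = mods_carrier[OF Y]
  note D = dsum_carrier[OF Xc Yc] and h = dsum_homs[OF Xc Yc]
  note e = rel_ends[OF p] and pp = rels_path[OF p]
  have pc: "path_mat ?D p \<in> carrier_mat (rdim X ?t + rdim Y ?t) (rdim X ?s + rdim Y ?s)"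
    using path_mat_carrier[OF D pp] by simp
  have zX: "path_mat X p = 0\<^sub>m (rdim X ?t) (rdim X ?s)" and zY: "path_mat Y p = 0\<^sub>m (rdim Y ?t) (rdim Y ?s)"
    using X Y p by (auto simp: mods_def is_rep_def)
  have f: "ds_fst X Y ?t \<in> carrier_mat (rdim X ?t) (rdim X ?t + rdim Y ?t)"
    "ds_snd X Y ?t \<in> carrier_mat (rdim Y ?t) (rdim X ?t + rdim Y ?t)"
    "ds_fst X Y ?s \<in> carrier_mat (rdim X ?s) (rdim X ?s + rdim Y ?s)"
    "ds_snd X Y ?s \<in> carrier_mat (rdim Y ?s) (rdim X ?s + rdim Y ?s)"
    by (auto simp: fst_mat_def snd_mat_def)
  have eq: "ds_fst X Y ?t * path_mat ?D p = 0\<^sub>m (rdim X ?t) (rdim X ?s + rdim Y ?s)"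
    "ds_snd X Y ?t * path_mat ?D p = 0\<^sub>m (rdim Y ?t) (rdim X ?s + rdim Y ?s)"
    using hom_path_mat[OF D Xc h(1) pp] hom_path_mat[OF D Yc h(2) pp] 
      left_mult_zero_mat[OF f(3)] left_mult_zero_mat[OF f(4)] unfolding zX zY by simp_all
  show "path_mat ?D p = 0\<^sub>m (rdim ?D ?t) (rdim ?D ?s)"
  proof (rule mat_eqI_vec)
    fix x :: "'k vec" assume "x \<in> carrier_vec (rdim ?D ?s)"
    then have x: "x \<in> carrier_vec (rdim X ?s + rdim Y ?s)" by simp
    have "path_mat ?D p *\<^sub>v x \<in> carrier_vec (rdim X ?t + rdim Y ?t)" using pc x by (rule mult_mat_vec_carrier)
    then obtain u w where uw: "u \<in> carrier_vec (rdim X ?t)" "w \<in> carrier_vec (rdim Y ?t)"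
      "path_mat ?D p *\<^sub>v x = u @\<^sub>v w" by (rule append_vec_cases)
    have "u = 0\<^sub>v (rdim X ?t)"
      using assoc_mult_mat_vec[OF f(1) pc x] eq(1) uw zero_mat_mult_vec[OF x] dsum_mat_mult(1)[OF uw(1,2)] by simp
    moreover have "w = 0\<^sub>v (rdim Y ?t)"
      using assoc_mult_mat_vec[OF f(2) pc x] eq(2) uw zero_mat_mult_vec[OF x] dsum_mat_mult(2)[OF uw(1,2)] by simp
    ultimately have "path_mat ?D p *\<^sub>v x = 0\<^sub>v (rdim X ?t + rdim Y ?t)"
      unfolding uw(3) by (intro eq_vecI) auto
    then show "path_mat ?D p *\<^sub>v x = 0\<^sub>m (rdim ?D ?t) (rdim ?D ?s) *\<^sub>v x"
      by (simp add: zero_mat_mult_vec[OF x])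
  next
    show "path_mat ?D p \<in> carrier_mat (rdim ?D ?t) (rdim ?D ?s)" using pc by simp
  qed (rule zero_carrier_mat)
qed (use dsum_carrier[OF mods_carrier[OF X] mods_carrier[OF Y]] in \<open>simp add: rep_carrier_def\<close>)

lemma zero_rep_mods: "(zero_rep :: ('v, 'a, 'k::field) rep) \<in> mods Q"
  unfolding mods_def is_rep_def
proof (intro CollectI conjI ballI)
  fix p assume p: "p \<in> rels Q"
  have "rep_carrier (zero_rep :: ('v, 'a, 'k) rep)" by (simp add: rep_carrier_def zero_rep_def)
  from path_mat_carrier[OF this rels_path[OF p]]
  show "path_mat (zero_rep :: ('v, 'a, 'k) rep) p = 0\<^sub>m (rdim zero_rep (tgt Q (last p))) (rdim zero_rep (src Q (hd p)))"
    by (intro mat_zero_cols_eq[where n = 0]) (auto simp: zero_rep_def)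
qed (simp add: zero_rep_def)

lemma is_zero_zero_rep: "is_zero_rep Q zero_rep"
  by (simp add: is_zero_rep_def zero_rep_def)

lemma dsum_list_mods: "set Ms \<subseteq> mods Q \<Longrightarrow> dsum_list Q Ms \<in> mods Q"
  by (induction Ms) (auto simp: zero_rep_mods dsum_mods)

section \<open>Torsion classes cut out by conditions on the maps to a fixed module\<close>

lemma short_exactD:
  assumes "short_exact Q X Y Z f g"
  shows "is_mono Q X Y f" "is_epi Q Y Z g" "\<forall>v\<in>verts Q. mat_range (f v) = mat_ker (g v)"
  using assms exact_iff[OF mono_hom epi_hom, of X Y f Z g] by (auto simp: short_exact_def)

lemma zero_hom_comp_epi:
  fixes X :: "('v, 'a, 'k::field) rep"
  assumes q: "is_epi Q Y Y' q" and g: "is_hom Q Y' X g"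
  shows "zero_hom Y X (\<lambda>v. g v * q v) \<longleftrightarrow> zero_hom Y' X g"
proof
  assume z: "zero_hom Y X (\<lambda>v. g v * q v)"
  show "zero_hom Y' X g"
    unfolding zero_hom_def
  proof (intro ballI)
    fix v and y :: "'k vec" assume v: "v \<in> verts Q" and y: "y \<in> carrier_vec (rdim Y' v)"
    obtain x where x: "x \<in> carrier_vec (rdim Y v)" "q v *\<^sub>v x = y" by (rule epiE[OF q v y])
    then show "g v *\<^sub>v y = 0\<^sub>v (rdim X v)"
      using z v hom_comp_app[OF epi_hom[OF q] g v x(1)] by (simp add: zero_hom_def)
  qed
next
  assume "zero_hom Y' X g"
  then show "zero_hom Y X (\<lambda>v. g v * q v)"
    unfolding zero_hom_def using hom_comp_app[OF epi_hom[OF q] g] hom_app[OF epi_hom[OF q]] by simp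
qed

lemma epi_of_comp:
  fixes X :: "('v, 'a, 'k::field) rep"
  assumes f: "is_hom Q Y Y' f" and g: "is_hom Q Y' X g" and e: "is_epi Q Y X (\<lambda>v. g v * f v)"
  shows "is_epi Q Y' X g"
proof (rule epiI[OF g])
  fix v and y :: "'k vec" assume v: "v \<in> verts Q" and y: "y \<in> carrier_vec (rdim X v)"
  obtain x where x: "x \<in> carrier_vec (rdim Y v)" "(g v * f v) *\<^sub>v x = y" by (rule epiE[OF e v y])
  then show "\<exists>x\<in>carrier_vec (rdim Y' v). g v *\<^sub>v x = y"
    using hom_comp_app[OF f g v x(1)] hom_app[OF f v x(1)] by (intro bexI[of _ "f v *\<^sub>v x"]) auto
qed

lemma mono_comp:
  fixes X :: "('v, 'a, 'k::field) rep"
  assumes mods: "Y \<in> mods Q" "Y' \<in> mods Q" "X \<in> mods Q"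
    and f: "is_mono Q Y Y' f" and g: "is_mono Q Y' X g"
  shows "is_mono Q Y X (\<lambda>v. g v * f v)"
proof (rule monoI[OF hom_comp[OF mods mono_hom[OF f] mono_hom[OF g]]])
  fix v and x :: "'k vec" assume v: "v \<in> verts Q" and x: "x \<in> carrier_vec (rdim Y v)" and z: "(g v * f v) *\<^sub>v x = 0\<^sub>v (rdim X v)"
  note fh = mono_hom[OF f] and gh = mono_hom[OF g]
  have "f v *\<^sub>v x = 0\<^sub>v (rdim Y' v)"
    by (rule mono_eqD[OF g v hom_app[OF fh v x] zero_carrier_vec])
      (use z hom_comp_app[OF fh gh v x] hom_app_zero[OF gh v] in simp)
  then show "x = 0\<^sub>v (rdim Y v)"
    using mono_eqD[OF f v x zero_carrier_vec] hom_app_zero[OF fh v] by simp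
qed

lemma quot_factor:
  fixes X :: "('v, 'a, 'k::field) rep"
  assumes mods: "Y \<in> mods Q" "Y2 \<in> mods Q" "X \<in> mods Q" and f: "is_hom Q Y1 Y f" and p: "is_epi Q Y Y2 p"
    and ex: "\<forall>v\<in>verts Q. mat_range (f v) = mat_ker (p v)"
    and g: "is_hom Q Y X g" and z: "zero_hom Y1 X (\<lambda>v. g v * f v)"
  shows "\<exists>g2. is_hom Q Y2 X g2 \<and> (\<forall>v\<in>verts Q. \<forall>y\<in>carrier_vec (rdim Y v). g2 v *\<^sub>v (p v *\<^sub>v y) = g v *\<^sub>v y)"
proof (rule epi_factor[OF mods p g])
  fix v and y :: "'k vec" assume v: "v \<in> verts Q" and y: "y \<in> carrier_vec (rdim Y v)" "p v *\<^sub>v y = 0\<^sub>v (rdim Y2 v)"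
  then have "y \<in> mat_range (f v)" using ex hom_ker[OF epi_hom[OF p] v] by simp
  then obtain x where x: "x \<in> carrier_vec (rdim Y1 v)" "y = f v *\<^sub>v x" using hom_range[OF f v] by blast
  then show "g v *\<^sub>v y = 0\<^sub>v (rdim X v)" using z v hom_comp_app[OF f g v x(1)] by (simp add: zero_hom_def)
qed

lemma quot_factor_cases:
  fixes X :: "('v, 'a, 'k::field) rep"
  assumes mods: "Y \<in> mods Q" "Y2 \<in> mods Q" "X \<in> mods Q" and p: "is_epi Q Y Y2 p" and g: "is_hom Q Y X g" and g2: "is_hom Q Y2 X g2"
    and e: "\<forall>v\<in>verts Q. \<forall>y\<in>carrier_vec (rdim Y v). g2 v *\<^sub>v (p v *\<^sub>v y) = g v *\<^sub>v y"
  shows "zero_hom Y2 X g2 \<Longrightarrow> zero_hom Y X g" "is_epi Q Y2 X g2 \<Longrightarrow> is_epi Q Y X g"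
proof -
  show "zero_hom Y X g" if "zero_hom Y2 X g2"
    using that e hom_app[OF epi_hom[OF p]] unfolding zero_hom_def by metis
  show "is_epi Q Y X g" if e2: "is_epi Q Y2 X g2"
  proof (rule epiI[OF g])
    fix v and y :: "'k vec" assume v: "v \<in> verts Q" and y: "y \<in> carrier_vec (rdim X v)"
    obtain x where x: "x \<in> carrier_vec (rdim Y2 v)" "g2 v *\<^sub>v x = y" by (rule epiE[OF e2 v y])
    obtain z where z: "z \<in> carrier_vec (rdim Y v)" "p v *\<^sub>v z = x" by (rule epiE[OF p v x(1)])
    show "\<exists>z\<in>carrier_vec (rdim Y v). g v *\<^sub>v z = y" using e v z x by (intro bexI[of _ z]) auto
  qed
qed

lemma zero_hom_to_zero: "is_zero_rep Q X \<Longrightarrow> is_hom Q Y X g \<Longrightarrow> zero_hom Y X g"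
  unfolding zero_hom_def using hom_app zero_rep_vec by blast

lemma zero_hom_from_zero: "is_zero_rep Q Y \<Longrightarrow> is_hom Q Y X g \<Longrightarrow> zero_hom Y X g"
  unfolding zero_hom_def using hom_app_zero zero_rep_vec by metis

text \<open>\<open>X\<close> is simple relative to \<open>T\<close> when \<open>T\<close> is
  contained in \<open>epi_class T X\<close>. Here and in the next two definitions the condition
  collects the sources \<open>Y\<close> of maps to a fixed \<open>X\<close>; the resulting classes
  are torsion classes, so the condition can be tested on generators of \<open>T\<close>.\<close>

definition epi_class :: "('v, 'a, 'k::field) rep set \<Rightarrow> ('v, 'a, 'k) rep \<Rightarrow> ('v, 'a, 'k) rep set" where
  "epi_class T X = {Y \<in> T. \<forall>g. is_hom Q Y X g \<longrightarrow> zero_hom Y X g \<or> is_epi Q Y X g}"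

definition epi_ker_class :: "('v, 'a, 'k::field) rep set \<Rightarrow> ('v, 'a, 'k) rep \<Rightarrow> ('v, 'a, 'k) rep set" where
  "epi_ker_class T X = {Y \<in> T. \<forall>g. is_hom Q Y X g \<longrightarrow> (zero_hom Y X g \<or> is_epi Q Y X g) \<and> ker_in T Y g}"

definition left_perp :: "('v, 'a, 'k::field) rep \<Rightarrow> ('v, 'a, 'k) rep set" where
  "left_perp X = {Y \<in> mods Q. \<forall>g. is_hom Q Y X g \<longrightarrow> zero_hom Y X g}"

lemma torsion_classD:
  assumes "torsion_class Q T"
  shows "T \<subseteq> mods Q" "ext_closed Q T"
    "\<And>X Y Z f g. X \<in> T \<Longrightarrow> Z \<in> T \<Longrightarrow> Y \<in> mods Q \<Longrightarrow> short_exact Q X Y Z f g \<Longrightarrow> Y \<in> T"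
    "\<And>X. X \<in> mods Q \<Longrightarrow> is_zero_rep Q X \<Longrightarrow> X \<in> T"
  using assms summand_ext_closedD(2)[OF torsion_summand_ext_closed[OF assms]]
  unfolding torsion_class_def ext_closed_def by blast+

lemma torsion_left_perp:
  assumes X: "X \<in> mods Q"
  shows "torsion_class Q (left_perp X)"
  unfolding torsion_class_def
proof (intro conjI)
  show "left_perp X \<noteq> {}" using zero_rep_mods zero_hom_from_zero[OF is_zero_zero_rep] by (auto simp: left_perp_def)
  show "quot_closed Q (left_perp X)"
    unfolding quot_closed_def left_perp_def
    using zero_hom_comp_epi hom_comp[OF _ _ X epi_hom] by blast
  show "ext_closed Q (left_perp X)"
    unfolding ext_closed_def
  proof (intro ballI allI impI)
    fix Y1 Y2 Y f p assume Y1: "Y1 \<in> left_perp X" and Y2: "Y2 \<in> left_perp X" and Y: "Y \<in> mods Q"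
      and s: "short_exact Q Y1 Y Y2 f p"
    note s = short_exactD[OF s]
    have m: "Y1 \<in> mods Q" "Y2 \<in> mods Q" using Y1 Y2 by (auto simp: left_perp_def)
    have "zero_hom Y X g" if g: "is_hom Q Y X g" for g
    proof -
      have "zero_hom Y1 X (\<lambda>v. g v * f v)"
        using Y1 hom_comp[OF m(1) Y X mono_hom[OF s(1)] g] by (simp add: left_perp_def)
      then obtain g2 where g2: "is_hom Q Y2 X g2"
        "\<forall>v\<in>verts Q. \<forall>y\<in>carrier_vec (rdim Y v). g2 v *\<^sub>v (p v *\<^sub>v y) = g v *\<^sub>v y"
        using quot_factor[OF Y m(2) X mono_hom[OF s(1)] s(2,3) g] by blast
      then have "zero_hom Y2 X g2" using Y2 by (simp add: left_perp_def)
      then show ?thesis by (rule quot_factor_cases(1)[OF Y m(2) X s(2) g g2])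
    qed
    then show "Y \<in> left_perp X" using Y by (simp add: left_perp_def)
  qed
qed (auto simp: left_perp_def)

text \<open>For an extension of \<open>Y2\<close> by \<open>Y1\<close>, the restriction of
  \<open>g\<close> to \<open>Y1\<close> is zero, and then \<open>g\<close> factors through
  \<open>Y2\<close>, or it is surjective, and then so is \<open>g\<close>.\<close>

lemma torsion_epi_class:
  assumes T: "torsion_class Q T" and X: "X \<in> mods Q"
  shows "torsion_class Q (epi_class T X)"
  unfolding torsion_class_def
proof (intro conjI)
  show "epi_class T X \<subseteq> mods Q" using torsion_classD(1)[OF T] by (auto simp: epi_class_def)
  show "epi_class T X \<noteq> {}"
    using torsion_classD(4)[OF T zero_rep_mods is_zero_zero_rep] zero_hom_from_zero[OF is_zero_zero_rep]
    by (auto simp: epi_class_def)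
  show "quot_closed Q (epi_class T X)"
    unfolding quot_closed_def
  proof (intro ballI allI impI)
    fix Y Y' q assume Y: "Y \<in> epi_class T X" and Y': "Y' \<in> mods Q" and q: "is_epi Q Y Y' q"
    have Ym: "Y \<in> mods Q" "Y \<in> T" using Y torsion_classD(1)[OF T] by (auto simp: epi_class_def)
    have "zero_hom Y' X g \<or> is_epi Q Y' X g" if g: "is_hom Q Y' X g" for g
      using Y hom_comp[OF Ym(1) Y' X epi_hom[OF q] g] zero_hom_comp_epi[OF q g] epi_of_comp[OF epi_hom[OF q] g]
      unfolding epi_class_def by blast
    then show "Y' \<in> epi_class T X" using torsion_quot[OF T Ym(2) Y' q] by (simp add: epi_class_def)
  qed
  show "ext_closed Q (epi_class T X)"
    unfolding ext_closed_def
  proof (intro ballI allI impI)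
    fix Y1 Y2 Y f p assume Y1: "Y1 \<in> epi_class T X" and Y2: "Y2 \<in> epi_class T X" and Y: "Y \<in> mods Q"
      and s': "short_exact Q Y1 Y Y2 f p"
    note s = short_exactD[OF s']
    have t: "Y1 \<in> T" "Y2 \<in> T" using Y1 Y2 by (auto simp: epi_class_def)
    then have m: "Y1 \<in> mods Q" "Y2 \<in> mods Q" using torsion_classD(1)[OF T] by auto
    have "zero_hom Y X g \<or> is_epi Q Y X g" if g: "is_hom Q Y X g" for g
    proof (cases "zero_hom Y1 X (\<lambda>v. g v * f v)")
      case True
      then obtain g2 where g2: "is_hom Q Y2 X g2"
        "\<forall>v\<in>verts Q. \<forall>y\<in>carrier_vec (rdim Y v). g2 v *\<^sub>v (p v *\<^sub>v y) = g v *\<^sub>v y"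
        using quot_factor[OF Y m(2) X mono_hom[OF s(1)] s(2,3) g] by blast
      then show ?thesis using Y2 quot_factor_cases[OF Y m(2) X s(2) g g2] by (auto simp: epi_class_def)
    next
      case False
      then have "is_epi Q Y1 X (\<lambda>v. g v * f v)"
        using Y1 hom_comp[OF m(1) Y X mono_hom[OF s(1)] g] by (auto simp: epi_class_def)
      then show ?thesis using epi_of_comp[OF mono_hom[OF s(1)] g] by simp
    qed
    then show "Y \<in> epi_class T X"
      using torsion_classD(3)[OF T t Y s'] by (simp add: epi_class_def)
  qed
qed

text \<open>The alternative of zero or surjective makes the kernel condition pass to extensions: it
  decides whether \<open>ker_in_ext_zero\<close> or \<open>ker_in_ext_epi\<close> describes the
  kernel.\<close>

lemma torsion_epi_ker_class:
  assumes T: "torsion_class Q T" and X: "X \<in> mods Q"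
  shows "torsion_class Q (epi_ker_class T X)"
proof -
  note C = torsion_summand_ext_closed[OF T]
  note EC = torsion_epi_class[OF T X]
  have sub: "epi_ker_class T X = {Y \<in> epi_class T X. \<forall>g. is_hom Q Y X g \<longrightarrow> ker_in T Y g}"
    by (auto simp: epi_ker_class_def epi_class_def)
  show ?thesis
    unfolding torsion_class_def
  proof (intro conjI)
    show "epi_ker_class T X \<subseteq> mods Q" using torsion_classD(1)[OF T] by (auto simp: epi_ker_class_def)
    have "zero_rep \<in> T" by (rule torsion_classD(4)[OF T zero_rep_mods is_zero_zero_rep])
    then have "zero_rep \<in> epi_ker_class T X"
      by (simp add: epi_ker_class_def zero_hom_from_zero[OF is_zero_zero_rep] ker_in_zero[OF C])
    then show "epi_ker_class T X \<noteq> {}" by blast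
    show "quot_closed Q (epi_ker_class T X)"
      unfolding quot_closed_def
    proof (intro ballI allI impI)
      fix Y Y' q assume Y: "Y \<in> epi_ker_class T X" and Y': "Y' \<in> mods Q" and q: "is_epi Q Y Y' q"
      have Ym: "Y \<in> mods Q" "Y \<in> epi_class T X" using Y torsion_classD(1)[OF EC] by (auto simp: sub)
      have "ker_in T Y' g" if g: "is_hom Q Y' X g" for g
      proof (rule ker_in_quotient[OF T Ym(1) Y' X q g])
        show "ker_in T Y (\<lambda>v. g v * q v)"
          using Y hom_comp[OF Ym(1) Y' X epi_hom[OF q] g] by (simp add: epi_ker_class_def)
      qed
      then show "Y' \<in> epi_ker_class T X" using torsion_quot[OF EC Ym(2) Y' q] by (simp add: sub)
    qed
    show "ext_closed Q (epi_ker_class T X)"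
      unfolding ext_closed_def
    proof (intro ballI allI impI)
      fix Y1 Y2 Y f p assume Y1: "Y1 \<in> epi_ker_class T X" and Y2: "Y2 \<in> epi_ker_class T X" and Y: "Y \<in> mods Q"
        and s': "short_exact Q Y1 Y Y2 f p"
      note s = short_exactD[OF s']
      have t: "Y1 \<in> T" "Y2 \<in> T" using Y1 Y2 by (auto simp: epi_ker_class_def)
      then have m: "Y1 \<in> mods Q" "Y2 \<in> mods Q" using torsion_classD(1)[OF T] by auto
      have "ker_in T Y g" if g: "is_hom Q Y X g" for g
      proof (cases "zero_hom Y1 X (\<lambda>v. g v * f v)")
        case True
        then obtain g2 where g2: "is_hom Q Y2 X g2"
          "\<forall>v\<in>verts Q. \<forall>y\<in>carrier_vec (rdim Y v). g2 v *\<^sub>v (p v *\<^sub>v y) = g v *\<^sub>v y"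
          using quot_factor[OF Y m(2) X mono_hom[OF s(1)] s(2,3) g] by blast
        show ?thesis
          by (rule ker_in_ext_zero[OF C t(1) Y m(2) X s(1,2,3) g g2(1)])
            (use g2 Y2 in \<open>auto simp: epi_ker_class_def\<close>)
      next
        case False
        have gf: "is_hom Q Y1 X (\<lambda>v. g v * f v)" by (rule hom_comp[OF m(1) Y X mono_hom[OF s(1)] g])
        then have "is_epi Q Y1 X (\<lambda>v. g v * f v)" "ker_in T Y1 (\<lambda>v. g v * f v)"
          using Y1 False by (auto simp: epi_ker_class_def)
        then show ?thesis by (rule ker_in_ext_epi[OF C m(1) Y t(2) X s g])
      qed
      moreover have "Y \<in> epi_class T X"
        by (rule torsion_classD(3)[OF EC _ _ Y s']) (use Y1 Y2 in \<open>auto simp: sub\<close>)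
      ultimately show "Y \<in> epi_ker_class T X" by (simp add: sub)
    qed
  qed
qed

end

lemma vec_add_eq_minus:
  "(a :: 'k::field vec) \<in> carrier_vec n \<Longrightarrow> b \<in> carrier_vec n \<Longrightarrow> a + b = x \<Longrightarrow> b = x - a"
  by (intro eq_vecI) auto

lemma vec_minus_add: "(a :: 'k::field vec) \<in> carrier_vec n \<Longrightarrow> x \<in> carrier_vec n \<Longrightarrow> (x - a) + a = x"
  by (intro eq_vecI) auto

context bound_quiver
begin

section \<open>The wide subcategory of modules with stable kernels\<close>

lemma sub_in_cong: "(\<And>v. v \<in> verts Q \<Longrightarrow> U v = U' v) \<Longrightarrow> sub_in C X U = sub_in C X U'"
  by (simp add: sub_in_def has_image_def)

lemma ker_in_mono_comp:
  assumes g: "is_hom Q Y X g" and m: "is_mono Q X X' m"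
  shows "ker_in C Y (\<lambda>v. m v * g v) \<longleftrightarrow> ker_in C Y g"
proof (rule sub_in_cong)
  fix v assume v: "v \<in> verts Q"
  note mh = mono_hom[OF m]
  have mg: "m v * g v \<in> carrier_mat (rdim X' v) (rdim Y v)"
    using mult_carrier_mat[OF hom_carrier[OF mh v] hom_carrier[OF g v]] .
  have *: "m v *\<^sub>v (g v *\<^sub>v y) = 0\<^sub>v (rdim X' v) \<longleftrightarrow> g v *\<^sub>v y = 0\<^sub>v (rdim X v)"
    if y: "y \<in> carrier_vec (rdim Y v)" for y
    using mono_eqD[OF m v hom_app[OF g v y] zero_carrier_vec] hom_app_zero[OF mh v] by auto
  show "mat_ker (m v * g v) = mat_ker (g v)"
    by (intro equalityI subsetI)
      (auto simp: mem_mat_ker[OF mg] hom_ker[OF g v] hom_comp_app[OF g mh v] * hom_app_zero[OF mh v])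
qed

lemma retract_trans:
  assumes mods: "X \<in> mods Q" "Y \<in> mods Q" "Z \<in> mods Q" and XY: "retract X Y" and YZ: "retract Y Z"
  shows "retract X Z"
proof -
  obtain i p where 1: "is_hom Q X Y i" "is_hom Q Y X p"
    "\<forall>v\<in>verts Q. \<forall>x\<in>carrier_vec (rdim X v). p v *\<^sub>v (i v *\<^sub>v x) = x" using XY by (auto simp: retract_def)
  obtain j q where 2: "is_hom Q Y Z j" "is_hom Q Z Y q"
    "\<forall>v\<in>verts Q. \<forall>x\<in>carrier_vec (rdim Y v). q v *\<^sub>v (j v *\<^sub>v x) = x" using YZ by (auto simp: retract_def)
  note h = hom_comp[OF mods 1(1) 2(1)] hom_comp[OF mods(3,2,1) 2(2) 1(2)]
  have "(p v * q v) *\<^sub>v ((j v * i v) *\<^sub>v x) = x" if v: "v \<in> verts Q" and x: "x \<in> carrier_vec (rdim X v)" for v x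
    using hom_comp_app[OF 1(1) 2(1) v x] hom_comp_app[OF 2(2) 1(2) v hom_app[OF h(1) v x]]
      2(3) 1(3) v x hom_app[OF 1(1) v x] by simp
  then show ?thesis unfolding retract_def using h by blast
qed

lemma hom_app_add:
  "is_hom Q X Y f \<Longrightarrow> v \<in> verts Q \<Longrightarrow> x \<in> carrier_vec (rdim X v) \<Longrightarrow> y \<in> carrier_vec (rdim X v) \<Longrightarrow>
   f v *\<^sub>v (x + y) = f v *\<^sub>v x + f v *\<^sub>v y"
  by (rule mult_add_distrib_mat_vec[OF hom_carrier])

text \<open>The wide subcategory that Ingalls and Thomas associate with a torsion class.\<close>

definition stable_kernels :: "('v, 'a, 'k::field) rep set \<Rightarrow> ('v, 'a, 'k) rep set" where
  "stable_kernels T = {X \<in> T. \<forall>Y\<in>T. \<forall>g. is_hom Q Y X g \<longrightarrow> ker_in T Y g}"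

lemma stable_kernelsD: "X \<in> stable_kernels T \<Longrightarrow> Y \<in> T \<Longrightarrow> is_hom Q Y X g \<Longrightarrow> ker_in T Y g"
  by (simp add: stable_kernels_def)

text \<open>Given a map \<open>g\<close> from \<open>V\<close> to the extension, the kernel
  \<open>K\<close> of its composite to \<open>Z\<close> lies in \<open>T\<close> because
  \<open>Z\<close> is stable. On \<open>K\<close> the map lands in \<open>X\<close>, and its kernel
  there, which is the kernel of \<open>g\<close>, lies in \<open>T\<close> because \<open>X\<close>
  is stable.\<close>

lemma ext_closed_stable_kernels:
  fixes T :: "('v, 'a, 'k::field) rep set"
  assumes T: "torsion_class Q T"
  shows "ext_closed Q (stable_kernels T)"
  unfolding ext_closed_def
proof (intro ballI allI impI)
  fix X Z Y :: "('v, 'a, 'k) rep" and f p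
  assume X: "X \<in> stable_kernels T" and Z: "Z \<in> stable_kernels T" and Y: "Y \<in> mods Q"
    and s': "short_exact Q X Y Z f p"
  note s = short_exactD[OF s'] and C = torsion_summand_ext_closed[OF T]
  have XT: "X \<in> T" "Z \<in> T" using X Z by (auto simp: stable_kernels_def)
  then have m: "X \<in> mods Q" "Z \<in> mods Q" using torsion_classD(1)[OF T] by auto
  note fa = kernel_app[OF s(1) epi_hom[OF s(2)] s(3)]
  have "ker_in T V g" if V: "V \<in> T" and g: "is_hom Q V Y g" for V g
  proof -
    have Vm: "V \<in> mods Q" using V torsion_classD(1)[OF T] by auto
    note pg = hom_comp[OF Vm Y m(2) g epi_hom[OF s(2)]]
    have "ker_in T V (\<lambda>v. p v * g v)" by (rule stable_kernelsD[OF Z V pg])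
    then obtain K k where K: "K \<in> mods Q" "K \<in> T" "is_mono Q K V k"
      and Kk: "\<forall>v\<in>verts Q. mat_range (k v) = mat_ker (p v * g v)"
      by (rule ker_inE[OF _ Vm m(2) pg])
    note ka = kernel_app[OF K(3) pg Kk]
    note kh = mono_hom[OF K(3)] and ph = epi_hom[OF s(2)] and fh = mono_hom[OF s(1)]
    note gk = hom_comp[OF K(1) Vm Y kh g]
    have im: "(g v * k v) *\<^sub>v z \<in> mat_range (f v)" if "v \<in> verts Q" "z \<in> carrier_vec (rdim K v)" for v z
      using ka(1)[OF that] hom_comp_app[OF g ph that(1) hom_app[OF kh that]] hom_comp_app[OF kh g that]
        hom_app[OF gk that] by (simp add: bspec[OF s(3) that(1)] hom_ker[OF ph that(1)])
    obtain g' where g': "is_hom Q K X g'"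
      "\<forall>v\<in>verts Q. \<forall>z\<in>carrier_vec (rdim K v). f v *\<^sub>v (g' v *\<^sub>v z) = (g v * k v) *\<^sub>v z"
      using mono_factor[OF m(1) Y K(1) s(1) gk im] by blast
    have fg': "f v *\<^sub>v (g' v *\<^sub>v z) = g v *\<^sub>v (k v *\<^sub>v z)" if "v \<in> verts Q" "z \<in> carrier_vec (rdim K v)" for v z
      using g'(2) that hom_comp_app[OF kh g that] by simp
    have "ker_in T K g'" by (rule stable_kernelsD[OF X K(2) g'(1)])
    then obtain L l where L: "L \<in> mods Q" "L \<in> T" "is_mono Q L K l"
      and Ll: "\<forall>v\<in>verts Q. mat_range (l v) = mat_ker (g' v)"
      by (rule ker_inE[OF _ K(1) m(1) g'(1)])
    note la = kernel_app[OF L(3) g'(1) Ll] and lh = mono_hom[OF L(3)]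
    note kl = hom_comp_app[OF lh kh]
    show ?thesis
    proof (rule ker_inI[OF C Vm g L(2) mono_comp[OF L(1) K(1) Vm L(3) K(3)]])
      fix v and x :: "'k vec" assume v: "v \<in> verts Q" and x: "x \<in> carrier_vec (rdim L v)"
      have lx: "l v *\<^sub>v x \<in> carrier_vec (rdim K v)" by (rule hom_app[OF lh v x])
      show "g v *\<^sub>v ((k v * l v) *\<^sub>v x) = 0\<^sub>v (rdim Y v)"
        using fg'[OF v lx] la(1)[OF v x] hom_app_zero[OF fh v] kl[OF v x] by simp
    next
      fix v and x :: "'k vec" assume v: "v \<in> verts Q" and x: "x \<in> carrier_vec (rdim V v)" and z: "g v *\<^sub>v x = 0\<^sub>v (rdim Y v)"
      have "(p v * g v) *\<^sub>v x = 0\<^sub>v (rdim Z v)"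
        using hom_comp_app[OF g ph v x] z hom_app_zero[OF ph v] by simp
      then obtain y where y: "y \<in> carrier_vec (rdim K v)" "x = k v *\<^sub>v y" using ka(2)[OF v x] by blast
      have "f v *\<^sub>v (g' v *\<^sub>v y) = f v *\<^sub>v 0\<^sub>v (rdim X v)"
        using fg'[OF v y(1)] y(2) z hom_app_zero[OF fh v] by simp
      then have "g' v *\<^sub>v y = 0\<^sub>v (rdim X v)"
        by (rule mono_eqD[OF s(1) v hom_app[OF g'(1) v y(1)] zero_carrier_vec])
      then obtain w where "w \<in> carrier_vec (rdim L v)" "y = l v *\<^sub>v w" using la(2)[OF v y(1)] by blast
      then show "\<exists>w\<in>carrier_vec (rdim L v). x = (k v * l v) *\<^sub>v w" using kl[OF v] y(2) by auto
    qed
  qed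
  then show "Y \<in> stable_kernels T"
    using torsion_classD(3)[OF T XT Y s'] by (simp add: stable_kernels_def)
qed

text \<open>The kernel lies in \<open>T\<close> because \<open>Y\<close> is stable; a map into it
  has the same kernel as its composite into \<open>X\<close>, which is stable too.\<close>

lemma ker_closed_stable_kernels:
  fixes T :: "('v, 'a, 'k::field) rep set"
  assumes T: "torsion_class Q T"
  shows "ker_closed Q (stable_kernels T)"
  unfolding ker_closed_def
proof (intro ballI allI impI, elim conjE)
  fix X Y K :: "('v, 'a, 'k) rep" and h i
  assume X: "X \<in> stable_kernels T" and Y: "Y \<in> stable_kernels T" and h: "is_hom Q X Y h"
    and K: "K \<in> mods Q" and i: "is_mono Q K X i" and ex: "\<forall>v\<in>verts Q. exact_mat (i v) (h v)"
  have XT: "X \<in> T" "X \<in> mods Q" using X torsion_classD(1)[OF T] by (auto simp: stable_kernels_def)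
  have "\<forall>v\<in>verts Q. mat_range (i v) = mat_ker (h v)" using ex exact_iff[OF mono_hom[OF i] h] by simp
  then have "K \<in> T"
    using stable_kernelsD[OF Y XT(1) h] K i unfolding sub_in_def has_image_def by blast
  moreover have "ker_in T Z g" if Z: "Z \<in> T" and g: "is_hom Q Z K g" for Z g
  proof -
    have Zm: "Z \<in> mods Q" using Z torsion_classD(1)[OF T] by auto
    show ?thesis
      using stable_kernelsD[OF X Z hom_comp[OF Zm K XT(2) g mono_hom[OF i]]] ker_in_mono_comp[OF g i] by blast
  qed
  ultimately show "K \<in> stable_kernels T" by (simp add: stable_kernels_def)
qed

text \<open>Given Z in T mapping to the cokernel C of X \<rightarrow> Y, the pullback P of Y \<rightarrow> C \<leftarrow> Z is an
  extension of Z by the image of X, so it lies in T; and ker(P \<rightarrow> Y) = ker(Z \<rightarrow> C).\<close>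
lemma coker_closed_stable_kernels:
  fixes T :: "('v, 'a, 'k::field) rep set"
  assumes T: "torsion_class Q T"
  shows "coker_closed Q (stable_kernels T)"
  unfolding coker_closed_def
proof (intro ballI allI impI, elim conjE)
  fix X Y C :: "('v, 'a, 'k) rep" and h p
  assume X: "X \<in> stable_kernels T" and Y: "Y \<in> stable_kernels T" and h: "is_hom Q X Y h"
    and C: "C \<in> mods Q" and p: "is_epi Q Y C p" and ex: "\<forall>v\<in>verts Q. exact_mat (h v) (p v)"
  note S = torsion_summand_ext_closed[OF T]
  note ph = epi_hom[OF p]
  have XT: "X \<in> T" "X \<in> mods Q" using X torsion_classD(1)[OF T] by (auto simp: stable_kernels_def)
  have YT: "Y \<in> T" "Y \<in> mods Q" using Y torsion_classD(1)[OF T] by (auto simp: stable_kernels_def)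
  have hp: "\<forall>v\<in>verts Q. mat_range (h v) = mat_ker (p v)" using ex exact_iff[OF h ph] by simp
  obtain I m e where I: "I \<in> mods Q" "is_mono Q I Y m" "has_image m (\<lambda>v. mat_range (h v))" "is_epi Q X I e"
    by (rule image_factorization[OF XT(2) YT(2) h])
  have IT: "I \<in> T" by (rule torsion_quot[OF T XT(1) I(1,4)])
  have mp: "\<forall>v\<in>verts Q. mat_range (m v) = mat_ker (p v)" using I(3) hp by (simp add: has_image_def)
  note ma = kernel_app[OF I(2) ph mp] and mh = mono_hom[OF I(2)]
  have "C \<in> T" by (rule torsion_quot[OF T YT(1) C p])
  moreover have "ker_in T Z g" if Z: "Z \<in> T" and g: "is_hom Q Z C g" for Z g
  proof -
    have Zm: "Z \<in> mods Q" using Z torsion_classD(1)[OF T] by auto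
    let ?D = "dsum Q Y Z" and ?f = "ds_fst Y Z" and ?s = "ds_snd Y Z"
    note D = dsum_mods[OF YT(2) Zm] and dh = dsum_homs[OF mods_carrier[OF YT(2)] mods_carrier[OF Zm]]
    \<comment> \<open>The pullback is realised as the kernel of the difference of the two maps from
      the direct sum to \<open>C\<close>, that is, by the pairs (u, w) with p u = g w.\<close>
    obtain d where d: "is_hom Q ?D C d"
      "\<forall>v\<in>verts Q. \<forall>x\<in>carrier_vec (rdim ?D v). d v *\<^sub>v x = (p v * ?f v) *\<^sub>v x - (g v * ?s v) *\<^sub>v x"
      using hom_minus[OF D C hom_comp[OF D YT(2) C dh(1) ph] hom_comp[OF D Zm C dh(2) g]] by blast
    have uw_c: "u @\<^sub>v w \<in> carrier_vec (rdim ?D v)"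
      if "u \<in> carrier_vec (rdim Y v)" "w \<in> carrier_vec (rdim Z v)" for u w v using that by simp
    have duw: "d v *\<^sub>v (u @\<^sub>v w) = p v *\<^sub>v u - g v *\<^sub>v w"
      if v: "v \<in> verts Q" and u: "u \<in> carrier_vec (rdim Y v)" and w: "w \<in> carrier_vec (rdim Z v)" for v u w
      using d(2) v uw_c[OF u w] hom_comp_app[OF dh(1) ph v uw_c[OF u w]] hom_comp_app[OF dh(2) g v uw_c[OF u w]]
        dsum_mat_mult(1,2)[OF u w] by simp
    have duw0: "d v *\<^sub>v (u @\<^sub>v w) = 0\<^sub>v (rdim C v) \<longleftrightarrow> p v *\<^sub>v u = g v *\<^sub>v w"
      if v: "v \<in> verts Q" and u: "u \<in> carrier_vec (rdim Y v)" and w: "w \<in> carrier_vec (rdim Z v)" for v u w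
      unfolding duw[OF that] by (rule vec_minus_eq_zero[OF hom_app[OF ph v u] hom_app[OF g v w]])
    obtain P k where P: "P \<in> mods Q" "is_mono Q P ?D k" "\<forall>v\<in>verts Q. mat_range (k v) = mat_ker (d v)"
      by (rule kernel_exists[OF D C d(1)])
    note ka = kernel_app[OF P(2) d(1) P(3)] and kh = mono_hom[OF P(2)]
    note fk = hom_comp[OF P(1) D YT(2) kh dh(1)] and sk = hom_comp[OF P(1) D Zm kh dh(2)]
    note fk_app = hom_comp_app[OF kh dh(1)] and sk_app = hom_comp_app[OF kh dh(2)]
    have split: "\<exists>u w. u \<in> carrier_vec (rdim Y v) \<and> w \<in> carrier_vec (rdim Z v) \<and> k v *\<^sub>v x = u @\<^sub>v w \<and>
        (?f v * k v) *\<^sub>v x = u \<and> (?s v * k v) *\<^sub>v x = w \<and> p v *\<^sub>v u = g v *\<^sub>v w"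
      if v: "v \<in> verts Q" and x: "x \<in> carrier_vec (rdim P v)" for v x
    proof -
      have "k v *\<^sub>v x \<in> carrier_vec (rdim Y v + rdim Z v)" using hom_app[OF kh v x] by simp
      then obtain u w where uw: "u \<in> carrier_vec (rdim Y v)" "w \<in> carrier_vec (rdim Z v)" "k v *\<^sub>v x = u @\<^sub>v w"
        by (rule append_vec_cases)
      then show ?thesis
        using fk_app[OF v x] sk_app[OF v x] dsum_mat_mult(1,2)[OF uw(1,2)] ka(1)[OF v x] duw0[OF v uw(1,2)] by auto
    qed
    have lift: "\<exists>x\<in>carrier_vec (rdim P v). u @\<^sub>v w = k v *\<^sub>v x \<and> (?f v * k v) *\<^sub>v x = u \<and> (?s v * k v) *\<^sub>v x = w"
      if v: "v \<in> verts Q" and u: "u \<in> carrier_vec (rdim Y v)" and w: "w \<in> carrier_vec (rdim Z v)"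
        and e: "p v *\<^sub>v u = g v *\<^sub>v w" for v u w
    proof -
      obtain x where x: "x \<in> carrier_vec (rdim P v)" "u @\<^sub>v w = k v *\<^sub>v x"
        using ka(2)[OF v uw_c[OF u w]] duw0[OF v u w] e by blast
      then show ?thesis
        using fk_app[OF v x(1)] sk_app[OF v x(1)] dsum_mat_mult(1,2)[OF u w] by auto
    qed
    have kz: "k v *\<^sub>v x = 0\<^sub>v (rdim ?D v) \<Longrightarrow> x = 0\<^sub>v (rdim P v)"
      if v: "v \<in> verts Q" and x: "x \<in> carrier_vec (rdim P v)" for v x
      using mono_eqD[OF P(2) v x zero_carrier_vec] hom_app_zero[OF kh v] by simp
    have zz: "0\<^sub>v (rdim Y v) @\<^sub>v 0\<^sub>v (rdim Z v) = (0\<^sub>v (rdim ?D v) :: 'k vec)" for v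
      by (intro eq_vecI) auto
    have im: "(ds_inl Y Z v * m v) *\<^sub>v z \<in> mat_range (k v)" if v: "v \<in> verts Q" and z: "z \<in> carrier_vec (rdim I v)" for v z
    proof -
      have mz: "m v *\<^sub>v z \<in> carrier_vec (rdim Y v)" by (rule hom_app[OF mh v z])
      have "p v *\<^sub>v (m v *\<^sub>v z) = g v *\<^sub>v 0\<^sub>v (rdim Z v)" using ma(1)[OF v z] hom_app_zero[OF g v] by simp
      then obtain x where "x \<in> carrier_vec (rdim P v)" "m v *\<^sub>v z @\<^sub>v 0\<^sub>v (rdim Z v) = k v *\<^sub>v x"
        using lift[OF v mz zero_carrier_vec] by blast
      then show ?thesis
        using hom_comp_app[OF mh dh(3) v z] dsum_mat_mult(3)[OF mz zero_carrier_vec] hom_range[OF kh v] by auto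
    qed
    obtain j where j: "is_hom Q I P j"
      "\<forall>v\<in>verts Q. \<forall>z\<in>carrier_vec (rdim I v). k v *\<^sub>v (j v *\<^sub>v z) = (ds_inl Y Z v * m v) *\<^sub>v z"
      using mono_factor[OF P(1) D I(1) P(2) hom_comp[OF I(1) YT(2) D mh dh(3)] im] by blast
    have kj: "k v *\<^sub>v (j v *\<^sub>v z) = (m v *\<^sub>v z) @\<^sub>v 0\<^sub>v (rdim Z v)"
      if v: "v \<in> verts Q" and z: "z \<in> carrier_vec (rdim I v)" for v z
      using j(2) v z hom_comp_app[OF mh dh(3) v z] dsum_mat_mult(3)[OF hom_app[OF mh v z] zero_carrier_vec] by simp
    have jm: "is_mono Q I P j"
    proof (rule monoI[OF j(1)])
      fix v and x :: "'k vec" assume v: "v \<in> verts Q" and x: "x \<in> carrier_vec (rdim I v)" "j v *\<^sub>v x = 0\<^sub>v (rdim P v)"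
      then have "(m v *\<^sub>v x) @\<^sub>v 0\<^sub>v (rdim Z v) = 0\<^sub>v (rdim Y v) @\<^sub>v (0\<^sub>v (rdim Z v) :: 'k vec)"
        using kj[OF v x(1)] hom_app_zero[OF kh v] zz[of v] by simp
      then have "m v *\<^sub>v x = 0\<^sub>v (rdim Y v)"
        using append_vec_eq[OF hom_app[OF mh v x(1)] zero_carrier_vec] by blast
      then show "x = 0\<^sub>v (rdim I v)"
        using mono_eqD[OF I(2) v x(1) zero_carrier_vec] hom_app_zero[OF mh v] by simp
    qed
    have ske: "is_epi Q P Z (\<lambda>v. ?s v * k v)"
    proof (rule epiI[OF sk])
      fix v and w :: "'k vec" assume v: "v \<in> verts Q" and w: "w \<in> carrier_vec (rdim Z v)"
      obtain u where u: "u \<in> carrier_vec (rdim Y v)" "p v *\<^sub>v u = g v *\<^sub>v w"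
        by (rule epiE[OF p v hom_app[OF g v w]])
      show "\<exists>x\<in>carrier_vec (rdim P v). (?s v * k v) *\<^sub>v x = w" using lift[OF v u(1) w u(2)] by blast
    qed
    have "mat_range (j v) = mat_ker (?s v * k v)" if v: "v \<in> verts Q" for v
    proof -
      have 1: "(?s v * k v) *\<^sub>v (j v *\<^sub>v x) = 0\<^sub>v (rdim Z v)" if x: "x \<in> carrier_vec (rdim I v)" for x
        using sk_app[OF v hom_app[OF j(1) v x]] kj[OF v x] dsum_mat_mult(2)[OF hom_app[OF mh v x] zero_carrier_vec] by simp
      have 2: "\<exists>x\<in>carrier_vec (rdim I v). y = j v *\<^sub>v x"
        if y: "y \<in> carrier_vec (rdim P v)" "(?s v * k v) *\<^sub>v y = 0\<^sub>v (rdim Z v)" for y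
      proof -
        obtain u where u: "u \<in> carrier_vec (rdim Y v)" "k v *\<^sub>v y = u @\<^sub>v 0\<^sub>v (rdim Z v)" "p v *\<^sub>v u = g v *\<^sub>v 0\<^sub>v (rdim Z v)"
          using split[OF v y(1)] y(2) by auto
        then obtain x where x: "x \<in> carrier_vec (rdim I v)" "u = m v *\<^sub>v x"
          using ma(2)[OF v u(1)] hom_app_zero[OF g v] by auto
        have "k v *\<^sub>v y = k v *\<^sub>v (j v *\<^sub>v x)" using kj[OF v x(1)] u(2) x(2) by simp
        then have "y = j v *\<^sub>v x" by (rule mono_eqD[OF P(2) v y(1) hom_app[OF j(1) v x(1)]])
        then show ?thesis using x(1) by blast
      qed
      show ?thesis
        using 1 2 by (intro equalityI subsetI) (auto simp: hom_range[OF j(1) v] hom_ker[OF sk v] hom_app[OF j(1) v])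
    qed
    then have PT: "P \<in> T" by (rule ext_closedD[OF torsion_classD(2)[OF T] IT Z P(1) jm ske])
    have "ker_in T P (\<lambda>v. ?f v * k v)" by (rule stable_kernelsD[OF Y PT fk])
    then obtain L l where L: "L \<in> mods Q" "L \<in> T" "is_mono Q L P l"
      and Ll: "\<forall>v\<in>verts Q. mat_range (l v) = mat_ker (?f v * k v)"
      by (rule ker_inE[OF _ P(1) YT(2) fk])
    note la = kernel_app[OF L(3) fk Ll] and lh = mono_hom[OF L(3)]
    note skl = hom_comp[OF L(1) P(1) Zm lh sk]
    note skl_app = hom_comp_app[OF lh sk]
    have eq: "k v *\<^sub>v (l v *\<^sub>v x) = 0\<^sub>v (rdim Y v) @\<^sub>v ((?s v * k v * l v) *\<^sub>v x)"
      "g v *\<^sub>v ((?s v * k v * l v) *\<^sub>v x) = 0\<^sub>v (rdim C v)"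
      if v: "v \<in> verts Q" and x: "x \<in> carrier_vec (rdim L v)" for v x
      using split[OF v hom_app[OF lh v x]] la(1)[OF v x] skl_app[OF v x] hom_app_zero[OF ph v] by auto
    show ?thesis
    proof (rule ker_inI[OF S Zm g L(2) monoI[OF skl]])
      fix v and x :: "'k vec" assume v: "v \<in> verts Q" and x: "x \<in> carrier_vec (rdim L v)"
        and z: "(?s v * k v * l v) *\<^sub>v x = 0\<^sub>v (rdim Z v)"
      have "l v *\<^sub>v x = 0\<^sub>v (rdim P v)"
        using eq(1)[OF v x] z zz[of v] by (intro kz[OF v hom_app[OF lh v x]]) simp
      then show "x = 0\<^sub>v (rdim L v)"
        using mono_eqD[OF L(3) v x zero_carrier_vec] hom_app_zero[OF lh v] by simp
    next
      fix v and x :: "'k vec" assume v: "v \<in> verts Q" and x: "x \<in> carrier_vec (rdim L v)"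
      show "g v *\<^sub>v ((?s v * k v * l v) *\<^sub>v x) = 0\<^sub>v (rdim C v)" by (rule eq(2)[OF v x])
    next
      fix v and w :: "'k vec" assume v: "v \<in> verts Q" and w: "w \<in> carrier_vec (rdim Z v)" and z: "g v *\<^sub>v w = 0\<^sub>v (rdim C v)"
      have "p v *\<^sub>v 0\<^sub>v (rdim Y v) = g v *\<^sub>v w" using z hom_app_zero[OF ph v] by simp
      then obtain x where x: "x \<in> carrier_vec (rdim P v)" "(?f v * k v) *\<^sub>v x = 0\<^sub>v (rdim Y v)" "(?s v * k v) *\<^sub>v x = w"
        using lift[OF v zero_carrier_vec w] by blast
      obtain y where y: "y \<in> carrier_vec (rdim L v)" "x = l v *\<^sub>v y" using la(2)[OF v x(1,2)] by blast
      then show "\<exists>y\<in>carrier_vec (rdim L v). w = (?s v * k v * l v) *\<^sub>v y"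
        using skl_app[OF v y(1)] x(3) by auto
    qed
  qed
  ultimately show "C \<in> stable_kernels T" by (simp add: stable_kernels_def)
qed

lemma wide_stable_kernels:
  assumes T: "torsion_class Q T"
  shows "wide_subcat Q (stable_kernels T)"
  unfolding wide_subcat_def
proof (intro conjI ext_closed_stable_kernels[OF T] ker_closed_stable_kernels[OF T] coker_closed_stable_kernels[OF T])
  note C = torsion_summand_ext_closed[OF T]
  show "stable_kernels T \<subseteq> mods Q" using torsion_classD(1)[OF T] by (auto simp: stable_kernels_def)
  have "zero_rep \<in> stable_kernels T"
    using torsion_classD(4)[OF T zero_rep_mods is_zero_zero_rep]
    by (simp add: stable_kernels_def ker_in_zero[OF C] zero_hom_to_zero[OF is_zero_zero_rep])
  then show "stable_kernels T \<noteq> {}" by blast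
  show "iso_closed Q (stable_kernels T)"
    unfolding iso_closed_def
  proof (intro ballI impI)
    fix X Y assume X: "X \<in> stable_kernels T" and Y: "Y \<in> mods Q" and "isomorphic Q X Y"
    then obtain f where f: "is_iso Q X Y f" by (auto simp: isomorphic_def)
    have XT: "X \<in> T" "X \<in> mods Q" using X torsion_classD(1)[OF T] by (auto simp: stable_kernels_def)
    have fh: "is_hom Q X Y f" and fe: "is_epi Q X Y f" using f by (auto simp: is_iso_def is_mono_def)
    obtain g where g: "is_hom Q Y X g" "\<forall>v\<in>verts Q. \<forall>y\<in>carrier_vec (rdim Y v). f v *\<^sub>v (g v *\<^sub>v y) = y"
      by (rule iso_inverse[OF XT(2) Y f]) blast
    have gm: "is_mono Q Y X g" by (rule section_mono[OF g(1) fh g(2)])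
    have "ker_in T Z h" if Z: "Z \<in> T" and h: "is_hom Q Z Y h" for Z h
    proof -
      have Zm: "Z \<in> mods Q" using Z torsion_classD(1)[OF T] by auto
      show ?thesis
        using stable_kernelsD[OF X Z hom_comp[OF Zm Y XT(2) h g(1)]] ker_in_mono_comp[OF h gm] by blast
    qed
    then show "Y \<in> stable_kernels T" using torsion_quot[OF T XT(1) Y fe] by (simp add: stable_kernels_def)
  qed
qed

section \<open>Additive closure of modules with scalar endomorphisms\<close>

definition scalar_endos :: "('v, 'a, 'k::field) rep \<Rightarrow> bool" where
  "scalar_endos M \<longleftrightarrow> (\<forall>f. is_hom Q M M f \<longrightarrow>
     (\<exists>c. \<forall>v\<in>verts Q. \<forall>x\<in>carrier_vec (rdim M v). f v *\<^sub>v x = c \<cdot>\<^sub>v x))"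

text \<open>A Krull--Schmidt argument: peel off the summand M, which by locality of its endomorphism
  ring is either a summand of X or can be cancelled from the ambient direct sum.\<close>
lemma retract_dsum_list_in:
  fixes S :: "('v, 'a, 'k::field) rep set"
  assumes C: "summand_ext_closed C" and C': "summand_ext_closed C'"
    and S: "S \<subseteq> mods Q" "\<forall>M\<in>S. scalar_endos M" "S \<inter> C \<subseteq> C'"
  shows "set Ms \<subseteq> S \<Longrightarrow> X \<in> C \<Longrightarrow> retract X (dsum_list Q Ms) \<Longrightarrow> X \<in> C'"
proof (induction Ms arbitrary: X)
  case Nil
  have X: "X \<in> mods Q" using Nil summand_ext_closedD(1)[OF C] by blast
  have "zero_rep \<in> C'" by (rule summand_ext_closedD(2)[OF C' zero_rep_mods is_zero_zero_rep])
  then show ?case using summand_ext_closedD(3)[OF C' X] Nil by simp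
next
  case (Cons M Ms)
  let ?D' = "dsum_list Q Ms"
  let ?D = "dsum Q M ?D'"
  have X: "X \<in> mods Q" using Cons.prems summand_ext_closedD(1)[OF C] by blast
  have M: "M \<in> mods Q" "M \<in> S" and Ms: "set Ms \<subseteq> S" using Cons.prems S by auto
  have D': "?D' \<in> mods Q" using dsum_list_mods[of Ms] Ms S by blast
  note D = dsum_mods[OF M(1) D'] and dh = dsum_homs[OF mods_carrier[OF M(1)] mods_carrier[OF D']]
  obtain i p where ip: "is_hom Q X ?D i" "is_hom Q ?D X p"
    "\<forall>v\<in>verts Q. \<forall>x\<in>carrier_vec (rdim X v). p v *\<^sub>v (i v *\<^sub>v x) = x"
    using Cons.prems(3) by (auto simp: retract_def)
  \<comment> \<open>The components of the splitting along the two summands; they satisfy p1 i1 + p2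
    i2 = 1 on \<open>X\<close>.\<close>
  define i1 where "i1 v = ds_fst M ?D' v * i v" for v
  define i2 where "i2 v = ds_snd M ?D' v * i v" for v
  define p1 where "p1 v = p v * ds_inl M ?D' v" for v
  define p2 where "p2 v = p v * ds_inr M ?D' v" for v
  have i1: "is_hom Q X M i1" unfolding i1_def by (rule hom_comp[OF X D M(1) ip(1) dh(1)])
  have i2: "is_hom Q X ?D' i2" unfolding i2_def by (rule hom_comp[OF X D D' ip(1) dh(2)])
  have p1: "is_hom Q M X p1" unfolding p1_def by (rule hom_comp[OF M(1) D X dh(3) ip(2)])
  have p2: "is_hom Q ?D' X p2" unfolding p2_def by (rule hom_comp[OF D' D X dh(4) ip(2)])
  have sum: "p1 v *\<^sub>v (i1 v *\<^sub>v x) + p2 v *\<^sub>v (i2 v *\<^sub>v x) = x"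
    if v: "v \<in> verts Q" and x: "x \<in> carrier_vec (rdim X v)" for v x
  proof -
    have "i v *\<^sub>v x \<in> carrier_vec (rdim M v + rdim ?D' v)" using hom_app[OF ip(1) v x] by simp
    then obtain u w where uw: "u \<in> carrier_vec (rdim M v)" "w \<in> carrier_vec (rdim ?D' v)" "i v *\<^sub>v x = u @\<^sub>v w"
      by (rule append_vec_cases)
    have "i1 v *\<^sub>v x = u" "i2 v *\<^sub>v x = w"
      unfolding i1_def i2_def using hom_comp_app[OF ip(1) dh(1) v x] hom_comp_app[OF ip(1) dh(2) v x]
        dsum_mat_mult(1,2)[OF uw(1,2)] uw(3) by auto
    moreover have "p1 v *\<^sub>v u = p v *\<^sub>v (u @\<^sub>v 0\<^sub>v (rdim ?D' v))" "p2 v *\<^sub>v w = p v *\<^sub>v (0\<^sub>v (rdim M v) @\<^sub>v w)"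
      unfolding p1_def p2_def using hom_comp_app[OF dh(3) ip(2) v uw(1)] hom_comp_app[OF dh(4) ip(2) v uw(2)]
        dsum_mat_mult(3)[OF uw(1) zero_carrier_vec] dsum_mat_mult(4)[OF zero_carrier_vec uw(2)] by auto
    moreover have "p v *\<^sub>v (u @\<^sub>v 0\<^sub>v (rdim ?D' v)) + p v *\<^sub>v (0\<^sub>v (rdim M v) @\<^sub>v w) = p v *\<^sub>v (u @\<^sub>v w)"
      using hom_app_add[OF ip(2) v, of "u @\<^sub>v 0\<^sub>v (rdim ?D' v)" "0\<^sub>v (rdim M v) @\<^sub>v w"] uw
        append_vec_add[OF uw(1) zero_carrier_vec zero_carrier_vec uw(2)] by simp
    moreover have "p v *\<^sub>v (u @\<^sub>v w) = x" using bspec[OF bspec[OF ip(3) v] x] uw(3) by simp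
    ultimately show ?thesis by simp
  qed
  have "scalar_endos M" using S M by blast
  then obtain c where "\<forall>v\<in>verts Q. \<forall>x\<in>carrier_vec (rdim M v). (i1 v * p1 v) *\<^sub>v x = c \<cdot>\<^sub>v x"
    using hom_comp[OF M(1) X M(1) p1 i1] unfolding scalar_endos_def by blast
  then have c: "i1 v *\<^sub>v (p1 v *\<^sub>v x) = c \<cdot>\<^sub>v x" if "v \<in> verts Q" "x \<in> carrier_vec (rdim M v)" for v x
    using that hom_comp_app[OF p1 i1 that] by simp
  show ?case
  proof (cases "c = 0")
    \<comment> \<open>\<open>M\<close> is a summand of \<open>X\<close> whose complement is the
      kernel \<open>X'\<close> of \<open>i1\<close>. As \<open>M\<close> lies in \<open>S\<close>
      and in \<open>C\<close>, it lies in \<open>C'\<close>; the induction hypothesis takes care of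
      \<open>X'\<close>, and \<open>X\<close> is an extension of the two.\<close>
    case False
    have ci: "(1 / c) \<cdot>\<^sub>v (c \<cdot>\<^sub>v x) = x" for x :: "'k vec" using False by (simp add: smult_smult_assoc)
    have ci1: "is_hom Q X M (\<lambda>v. (1 / c) \<cdot>\<^sub>m i1 v)" by (rule hom_smult[OF X M(1) i1])
    have ci1_app: "((1 / c) \<cdot>\<^sub>m i1 v) *\<^sub>v x = (1 / c) \<cdot>\<^sub>v (i1 v *\<^sub>v x)"
      if "v \<in> verts Q" "x \<in> carrier_vec (rdim X v)" for v x
      using hom_carrier[OF i1 that(1)] that(2) by (intro eq_vecI) auto
    have MC: "M \<in> C'"
    proof -
      have "((1 / c) \<cdot>\<^sub>m i1 v) *\<^sub>v (p1 v *\<^sub>v x) = x" if "v \<in> verts Q" "x \<in> carrier_vec (rdim M v)" for v x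
        using ci1_app[OF that(1) hom_app[OF p1 that]] c[OF that] ci by simp
      then have "retract M X" unfolding retract_def using p1 ci1 by blast
      then show ?thesis using summand_ext_closedD(3)[OF C M(1) Cons.prems(2)] M S by blast
    qed
    have i1e: "is_epi Q X M i1"
    proof (rule epiI[OF i1])
      fix v and y :: "'k vec" assume v: "v \<in> verts Q" and y: "y \<in> carrier_vec (rdim M v)"
      have y': "(1 / c) \<cdot>\<^sub>v y \<in> carrier_vec (rdim M v)" using y by simp
      have "i1 v *\<^sub>v (p1 v *\<^sub>v ((1 / c) \<cdot>\<^sub>v y)) = y" using c[OF v y'] False by (simp add: smult_smult_assoc)
      then show "\<exists>x\<in>carrier_vec (rdim X v). i1 v *\<^sub>v x = y" using hom_app[OF p1 v y'] by blast
    qed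
    obtain X' j where X': "X' \<in> mods Q" "is_mono Q X' X j" "\<forall>v\<in>verts Q. mat_range (j v) = mat_ker (i1 v)"
      by (rule kernel_exists[OF X M(1) i1])
    note ja = kernel_app[OF X'(2) i1 X'(3)] and jh = mono_hom[OF X'(2)]
    \<comment> \<open>The projection of \<open>X\<close> onto \<open>X'\<close> along the copy of
      \<open>M\<close>; dividing by \<open>c\<close> makes it idempotent.\<close>
    obtain e where e: "is_hom Q X X e" "\<forall>v\<in>verts Q. \<forall>x\<in>carrier_vec (rdim X v).
        e v *\<^sub>v x = 1\<^sub>m (rdim X v) *\<^sub>v x - (p1 v * ((1 / c) \<cdot>\<^sub>m i1 v)) *\<^sub>v x"
      using hom_minus[OF X X hom_id[OF X] hom_comp[OF X M(1) X ci1 p1]] by blast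
    have ex: "e v *\<^sub>v x = x - p1 v *\<^sub>v ((1 / c) \<cdot>\<^sub>v (i1 v *\<^sub>v x))" if "v \<in> verts Q" "x \<in> carrier_vec (rdim X v)" for v x
      using e(2) that hom_comp_app[OF ci1 p1 that] ci1_app[OF that] by simp
    have im: "e v *\<^sub>v x \<in> mat_range (j v)" if v: "v \<in> verts Q" and x: "x \<in> carrier_vec (rdim X v)" for v x
    proof -
      have y: "(1 / c) \<cdot>\<^sub>v (i1 v *\<^sub>v x) \<in> carrier_vec (rdim M v)" using hom_app[OF i1 v x] by simp
      have "i1 v *\<^sub>v (e v *\<^sub>v x) = i1 v *\<^sub>v x - c \<cdot>\<^sub>v ((1 / c) \<cdot>\<^sub>v (i1 v *\<^sub>v x))"
        using ex[OF v x] hom_app_minus[OF i1 v x hom_app[OF p1 v y]] c[OF v y] by simp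
      also have "\<dots> = 0\<^sub>v (rdim M v)" using False hom_app[OF i1 v x] by (simp add: smult_smult_assoc)
      finally show ?thesis using bspec[OF X'(3) v] hom_ker[OF i1 v] hom_app[OF e(1) v x] by simp
    qed
    obtain q where q: "is_hom Q X X' q" "\<forall>v\<in>verts Q. \<forall>x\<in>carrier_vec (rdim X v). j v *\<^sub>v (q v *\<^sub>v x) = e v *\<^sub>v x"
      using mono_factor[OF X'(1) X X X'(2) e(1) im] by blast
    have qj: "q v *\<^sub>v (j v *\<^sub>v x) = x" if v: "v \<in> verts Q" and x: "x \<in> carrier_vec (rdim X' v)" for v x
    proof (rule mono_eqD[OF X'(2) v _ x])
      have jx: "j v *\<^sub>v x \<in> carrier_vec (rdim X v)" by (rule hom_app[OF jh v x])
      show "q v *\<^sub>v (j v *\<^sub>v x) \<in> carrier_vec (rdim X' v)" by (rule hom_app[OF q(1) v jx])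
      have "(1 / c) \<cdot>\<^sub>v 0\<^sub>v (rdim M v) = (0\<^sub>v (rdim M v) :: 'k vec)" by (intro eq_vecI) auto
      then show "j v *\<^sub>v (q v *\<^sub>v (j v *\<^sub>v x)) = j v *\<^sub>v x"
        using q(2) v jx ex[OF v jx] ja(1)[OF v x] hom_app_zero[OF p1 v] by simp
    qed
    have "retract X' X" unfolding retract_def using jh q(1) qj by blast
    then have X'C: "X' \<in> C" using summand_ext_closedD(3)[OF C X'(1) Cons.prems(2)] by blast
    \<comment> \<open>On \<open>X'\<close> the component \<open>i1\<close> vanishes, so p2 i2 is
      already the identity there.\<close>
    have "retract X' ?D'"
      unfolding retract_def
    proof (intro exI conjI ballI)
      show "is_hom Q X' ?D' (\<lambda>v. i2 v * j v)" by (rule hom_comp[OF X'(1) X D' jh i2])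
      show "is_hom Q ?D' X' (\<lambda>v. q v * p2 v)" by (rule hom_comp[OF D' X X'(1) p2 q(1)])
      fix v and x :: "'k vec" assume v: "v \<in> verts Q" and x: "x \<in> carrier_vec (rdim X' v)"
      have jx: "j v *\<^sub>v x \<in> carrier_vec (rdim X v)" by (rule hom_app[OF jh v x])
      have "p2 v *\<^sub>v (i2 v *\<^sub>v (j v *\<^sub>v x)) = j v *\<^sub>v x"
        using sum[OF v jx] ja(1)[OF v x] hom_app_zero[OF p1 v] hom_app[OF p2 v hom_app[OF i2 v jx]] by simp
      then show "(q v * p2 v) *\<^sub>v ((i2 v * j v) *\<^sub>v x) = x"
        using hom_comp_app[OF jh i2 v x] hom_comp_app[OF p2 q(1) v hom_app[OF i2 v jx]] qj[OF v x] by simp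
    qed
    then have "X' \<in> C'" by (rule Cons.IH[OF Ms X'C])
    then show ?thesis
      using ext_closedD[OF _ _ MC X X'(2) i1e] X'(3) C' by (auto simp: summand_ext_closed_def)
  next
    case True
    \<comment> \<open>With c = 0 the endomorphism n = p1 i1 has square zero, so p2 i2 = 1 - n is
      inverted by 1 + n, and (1 + n) p2 splits \<open>i2\<close>.\<close>
    have "retract X ?D'"
      unfolding retract_def
    proof (intro exI conjI ballI)
      show "is_hom Q X ?D' i2" by (rule i2)
      show "is_hom Q ?D' X (\<lambda>v. p2 v + p1 v * (i1 v * p2 v))"
        by (intro hom_add hom_comp[where Y = M] hom_comp[where Y = X] p1 p2 i1 X D' M(1))
      fix v and x :: "'k vec" assume v: "v \<in> verts Q" and x: "x \<in> carrier_vec (rdim X v)"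
      let ?y = "i2 v *\<^sub>v x" and ?n = "p1 v *\<^sub>v (i1 v *\<^sub>v x)"
      have y: "?y \<in> carrier_vec (rdim ?D' v)" by (rule hom_app[OF i2 v x])
      have n: "?n \<in> carrier_vec (rdim X v)" by (rule hom_app[OF p1 v hom_app[OF i1 v x]])
      note c1 = hom_carrier[OF p1 v] and c2 = hom_carrier[OF p2 v] and ci = hom_carrier[OF i1 v]
      have p2y: "p2 v *\<^sub>v ?y = x - ?n"
        by (rule vec_add_eq_minus[OF n hom_app[OF p2 v y] sum[OF v x]])
      have "i1 v *\<^sub>v (p2 v *\<^sub>v ?y) = i1 v *\<^sub>v x - c \<cdot>\<^sub>v (i1 v *\<^sub>v x)"
        unfolding p2y using hom_app_minus[OF i1 v x n] c[OF v hom_app[OF i1 v x]] by simp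
      also have "\<dots> = i1 v *\<^sub>v x" using True hom_app[OF i1 v x] by (intro eq_vecI) auto
      finally have "p1 v *\<^sub>v (i1 v *\<^sub>v (p2 v *\<^sub>v ?y)) = ?n" by simp
      moreover have "(p2 v + p1 v * (i1 v * p2 v)) *\<^sub>v ?y = p2 v *\<^sub>v ?y + p1 v *\<^sub>v (i1 v *\<^sub>v (p2 v *\<^sub>v ?y))"
        using add_mult_distrib_mat_vec[OF c2 mult_carrier_mat[OF c1 mult_carrier_mat[OF ci c2]] y]
          assoc_mult_mat_vec[OF c1 mult_carrier_mat[OF ci c2] y] assoc_mult_mat_vec[OF ci c2 y] by simp
      ultimately show "(p2 v + p1 v * (i1 v * p2 v)) *\<^sub>v ?y = x"
        using p2y vec_minus_add[OF n x] by simp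
    qed
    then show ?thesis by (rule Cons.IH[OF Ms Cons.prems(2)])
  qed
qed

lemma add_closure_retract:
  assumes S: "S \<subseteq> mods Q" and X: "X \<in> add_closure Q S"
  obtains Ms where "set Ms \<subseteq> S" "retract X (dsum_list Q Ms)"
proof -
  obtain Y Ms where Y: "X \<in> mods Q" "Y \<in> mods Q" "set Ms \<subseteq> S" "isomorphic Q (dsum Q X Y) (dsum_list Q Ms)"
    using X by (auto simp: add_closure_def)
  note D = dsum_mods[OF Y(1,2)] and dh = dsum_homs[OF mods_carrier[OF Y(1)] mods_carrier[OF Y(2)]]
  have L: "dsum_list Q Ms \<in> mods Q" using dsum_list_mods Y(3) S by blast
  have "ds_fst X Y v *\<^sub>v (ds_inl X Y v *\<^sub>v x) = x" if "x \<in> carrier_vec (rdim X v)" for v x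
    using dsum_mat_mult(3)[OF that zero_carrier_vec] dsum_mat_mult(1)[OF that zero_carrier_vec] by simp
  then have "retract X (dsum Q X Y)" unfolding retract_def using dh(1,3) by blast
  then have "retract X (dsum_list Q Ms)"
    by (rule retract_trans[OF Y(1) D L _ retract_of_isomorphic(1)[OF D L Y(4)]])
  then show thesis using that Y(3) by blast
qed

text \<open>This reduces the comparison of two shadows to the string modules in them: an object of
  the additive closure is peeled into generators without leaving the two classes.\<close>

lemma add_closure_Int_subset:
  assumes C: "summand_ext_closed C" and C': "summand_ext_closed C'"
    and S: "S \<subseteq> mods Q" "\<forall>M\<in>S. scalar_endos M" "S \<inter> C \<subseteq> C'"
  shows "C \<inter> add_closure Q S \<subseteq> C'"
proof
  fix X assume X: "X \<in> C \<inter> add_closure Q S"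
  obtain Ms where "set Ms \<subseteq> S" "retract X (dsum_list Q Ms)"
    by (rule add_closure_retract[OF S(1)]) (use X in auto)
  then show "X \<in> C'" using retract_dsum_list_in[OF C C' S] X by blast
qed

lemma subset_add_closure:
  assumes S: "S \<subseteq> mods Q"
  shows "S \<subseteq> add_closure Q S"
proof
  fix X assume X: "X \<in> S"
  then have Xm: "X \<in> mods Q" using S by blast
  note D = dsum_mods[OF Xm zero_rep_mods]
  have "is_iso Q (dsum Q X zero_rep) (dsum Q X zero_rep) (\<lambda>v. 1\<^sub>m (rdim (dsum Q X zero_rep) v))"
    unfolding is_iso_def
    by (intro conjI monoI[OF hom_id[OF D]] epiI[OF hom_id[OF D]]) auto
  then have "isomorphic Q (dsum Q X zero_rep) (dsum_list Q [X])" by (auto simp: isomorphic_def)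
  then show "X \<in> add_closure Q S"
    unfolding add_closure_def using Xm X zero_rep_mods by (intro CollectI conjI bexI[of _ zero_rep] exI[of _ "[X]"]) auto
qed

end

section \<open>Self-avoiding strings of brick gentle algebras\<close>

context bound_quiver
begin

section \<open>Quadratic relations, indecomposability and division rings\<close>

lemma zero_repI:
  assumes "\<And>v x. v \<in> verts Q \<Longrightarrow> x \<in> carrier_vec (rdim X v) \<Longrightarrow> x = (0\<^sub>v (rdim X v) :: 'k::field vec)"
  shows "is_zero_rep Q (X :: ('v, 'a, 'k) rep)"
  unfolding is_zero_rep_def
proof (intro ballI, rule ccontr)
  fix v assume v: "v \<in> verts Q" and "rdim X v \<noteq> 0"
  then have "(unit_vec (rdim X v) 0 :: 'k vec) \<noteq> 0\<^sub>v (rdim X v)" by (intro unit_vec_nonzero) simp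
  then show False using assms[OF v unit_vec_carrier] by blast
qed

lemma is_path_appendD:
  assumes "is_path Q (p @ q)"
  shows "p \<noteq> [] \<Longrightarrow> is_path Q p" "q \<noteq> [] \<Longrightarrow> is_path Q q"
    "p \<noteq> [] \<Longrightarrow> q \<noteq> [] \<Longrightarrow> tgt Q (last p) = src Q (hd q)"
proof -
  have l: "\<And>i. Suc i < length (p @ q) \<Longrightarrow> tgt Q ((p @ q) ! i) = src Q ((p @ q) ! Suc i)"
    using assms by (simp add: is_path_def)
  show "is_path Q p" if "p \<noteq> []"
  proof -
    have "tgt Q (p ! i) = src Q (p ! Suc i)" if "Suc i < length p" for i
      using l[of i] that by (simp add: nth_append)
    then show ?thesis using assms that by (auto simp: is_path_def)
  qed
  show "is_path Q q" if "q \<noteq> []"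
  proof -
    have "tgt Q (q ! i) = src Q (q ! Suc i)" if "Suc i < length q" for i
      using l[of "length p + i"] that by (simp add: nth_append)
    then show ?thesis using assms that by (auto simp: is_path_def)
  qed
  show "tgt Q (last p) = src Q (hd q)" if "p \<noteq> []" "q \<noteq> []"
  proof -
    have "tgt Q ((p @ q) ! (length p - 1)) = src Q ((p @ q) ! Suc (length p - 1))" using l[of "length p - 1"] that by simp
    then show ?thesis using that by (simp add: nth_append last_conv_nth hd_conv_nth)
  qed
qed

lemma path_mat_append:
  assumes "rep_carrier M" "is_path Q (p @ q)" "p \<noteq> []" "q \<noteq> []"
  shows "path_mat M (p @ q) = path_mat M q * path_mat M p"
  using assms(2,3)
proof (induction p rule: induct_list012)
  case (2 b)
  then show ?case using assms(4) by (cases q) auto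
next
  case (3 b c p)
  then have *: "b \<in> arrs Q" "tgt Q b = src Q c" "is_path Q ((c # p) @ q)" by (auto simp: is_path_Cons2)
  have cp: "is_path Q (c # p)" and qq: "is_path Q q" and qc: "tgt Q (last (c # p)) = src Q (hd q)"
    using is_path_appendD[OF *(3)] assms(4) by simp_all
  have rb: "rmap M b \<in> carrier_mat (rdim M (src Q c)) (rdim M (src Q b))"
    using assms(1) *(1,2) by (auto simp: rep_carrier_def)
  have pc: "path_mat M (c # p) \<in> carrier_mat (rdim M (src Q (hd q))) (rdim M (src Q c))"
    using path_mat_carrier[OF assms(1) cp] qc by simp
  have "path_mat M ((b # c # p) @ q) = path_mat M ((c # p) @ q) * rmap M b" by simp
  also have "\<dots> = path_mat M q * path_mat M (c # p) * rmap M b" using 3(2)[OF *(3)] by simp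
  also have "\<dots> = path_mat M q * (path_mat M (c # p) * rmap M b)"
    by (rule assoc_mult_mat[OF path_mat_carrier[OF assms(1) qq] pc rb])
  finally show ?case by simp
qed simp

lemma path_mat_zero:
  assumes M: "rep_carrier M" and p: "is_path Q (u @ [b, c] @ w)"
    and z: "rmap M c * rmap M b = 0\<^sub>m (rdim M (tgt Q c)) (rdim M (src Q b))"
  shows "path_mat M (u @ [b, c] @ w)
    = 0\<^sub>m (rdim M (tgt Q (last (u @ [b, c] @ w)))) (rdim M (src Q (hd (u @ [b, c] @ w))))"
proof -
  have bcw: "is_path Q ([b, c] @ w)" using is_path_appendD(2)[OF p] by simp
  have 1: "path_mat M ([b, c] @ w) = 0\<^sub>m (rdim M (tgt Q (last ([b, c] @ w)))) (rdim M (src Q b))"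
  proof (cases "w = []")
    case True
    then show ?thesis using z by simp
  next
    case False
    have t: "tgt Q c = src Q (hd w)" using is_path_appendD(3)[OF bcw] False by simp
    have "path_mat M ([b, c] @ w) = path_mat M w * path_mat M [b, c]"
      by (rule path_mat_append[OF M bcw]) (use False in auto)
    also have "\<dots> = path_mat M w * 0\<^sub>m (rdim M (src Q (hd w))) (rdim M (src Q b))" using z t by simp
    also have "\<dots> = 0\<^sub>m (rdim M (tgt Q (last w))) (rdim M (src Q b))"
      using path_mat_carrier[OF M is_path_appendD(2)[OF bcw False]] by simp
    finally show ?thesis using False by simp
  qed
  show ?thesis
  proof (cases "u = []")
    case True
    then show ?thesis using 1 by simp
  next
    case False
    have t: "tgt Q (last u) = src Q b" using is_path_appendD(3)[OF p False] by simp
    have "path_mat M (u @ [b, c] @ w) = path_mat M ([b, c] @ w) * path_mat M u"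
      by (rule path_mat_append[OF M p]) (use False in auto)
    also have "\<dots> = 0\<^sub>m (rdim M (tgt Q (last ([b, c] @ w)))) (rdim M (tgt Q (last u))) * path_mat M u"
      using 1 t by simp
    also have "\<dots> = 0\<^sub>m (rdim M (tgt Q (last ([b, c] @ w)))) (rdim M (src Q (hd u)))"
      using path_mat_carrier[OF M is_path_appendD(1)[OF p False]] by simp
    finally show ?thesis using False by simp
  qed
qed

lemma mods_of_quadratic:
  assumes quad: "\<And>p. p \<in> rels Q \<Longrightarrow> \<exists>u b c w. p = u @ [b, c] @ w \<and> [b, c] \<in> rels Q"
    and M: "rep_carrier M"
    and z: "\<And>b c. [b, c] \<in> rels Q \<Longrightarrow> rmap M c * rmap M b = 0\<^sub>m (rdim M (tgt Q c)) (rdim M (src Q b))"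
  shows "M \<in> mods Q"
  unfolding mods_def is_rep_def
proof (intro CollectI conjI ballI)
  fix p assume p: "p \<in> rels Q"
  obtain u b c w where u: "p = u @ [b, c] @ w" "[b, c] \<in> rels Q" using quad[OF p] by blast
  show "path_mat M p = 0\<^sub>m (rdim M (tgt Q (last p))) (rdim M (src Q (hd p)))"
    using path_mat_zero[OF M _ z[OF u(2)]] rels_path[OF p] unfolding u(1) by blast
qed (use M in \<open>simp add: rep_carrier_def\<close>)

text \<open>The hypothesis says that (f - p)^2 = 0. An idempotent \<open>e\<close> then satisfies (1
  - 2 p) e = - p^2, so it is a scalar and equals 0 or 1. Applied to the projection onto one summand,
  this makes one of the two summands zero.\<close>

lemma indecomposable_of_endos:
  fixes M :: "('v, 'a, 'k::field) rep"
  assumes M: "M \<in> mods Q" and nz: "\<not> is_zero_rep Q M"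
    and H: "\<And>f. is_hom Q M M f \<Longrightarrow> \<exists>p. \<forall>v\<in>verts Q. \<forall>x\<in>carrier_vec (rdim M v).
      f v *\<^sub>v (f v *\<^sub>v x) = (2 * p) \<cdot>\<^sub>v (f v *\<^sub>v x) - (p * p) \<cdot>\<^sub>v x"
  shows "indecomposable Q M"
  unfolding indecomposable_def
proof (intro conjI ballI impI)
  fix X Y :: "('v, 'a, 'k) rep"
  assume X: "X \<in> mods Q" and Y: "Y \<in> mods Q" and "isomorphic Q M (dsum Q X Y)"
  then obtain f where f: "is_iso Q M (dsum Q X Y) f" by (auto simp: isomorphic_def)
  note D = dsum_mods[OF X Y] and dh = dsum_homs[OF mods_carrier[OF X] mods_carrier[OF Y]]
  have fh: "is_hom Q M (dsum Q X Y) f" using f by (auto simp: is_iso_def is_mono_def)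
  obtain g where g: "is_hom Q (dsum Q X Y) M g"
    "\<forall>v\<in>verts Q. \<forall>x\<in>carrier_vec (rdim (dsum Q X Y) v). f v *\<^sub>v (g v *\<^sub>v x) = x"
    "\<forall>v\<in>verts Q. \<forall>x\<in>carrier_vec (rdim M v). g v *\<^sub>v (f v *\<^sub>v x) = x"
    by (rule iso_inverse[OF M D f]) blast
  define a where "a v = ds_fst X Y v * f v" for v
  define b where "b v = g v * ds_inl X Y v" for v
  have a: "is_hom Q M X a" unfolding a_def by (rule hom_comp[OF M D X fh dh(1)])
  have b: "is_hom Q X M b" unfolding b_def by (rule hom_comp[OF X D M dh(3) g(1)])
  have ab: "a v *\<^sub>v (b v *\<^sub>v u) = u" if v: "v \<in> verts Q" and u: "u \<in> carrier_vec (rdim X v)" for v u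
  proof -
    have c: "u @\<^sub>v 0\<^sub>v (rdim Y v) \<in> carrier_vec (rdim (dsum Q X Y) v)" using u by simp
    have "b v *\<^sub>v u = g v *\<^sub>v (u @\<^sub>v 0\<^sub>v (rdim Y v))"
      unfolding b_def using hom_comp_app[OF dh(3) g(1) v u] dsum_mat_mult(3)[OF u zero_carrier_vec] by simp
    then show ?thesis
      unfolding a_def using hom_comp_app[OF fh dh(1) v hom_app[OF g(1) v c]] bspec[OF bspec[OF g(2) v] c]
        dsum_mat_mult(1)[OF u zero_carrier_vec] by simp
  qed
  have aw: "a v *\<^sub>v (g v *\<^sub>v (0\<^sub>v (rdim X v) @\<^sub>v w)) = 0\<^sub>v (rdim X v)"
    if v: "v \<in> verts Q" and w: "w \<in> carrier_vec (rdim Y v)" for v w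
  proof -
    have c: "0\<^sub>v (rdim X v) @\<^sub>v w \<in> carrier_vec (rdim (dsum Q X Y) v)" using w by simp
    show ?thesis
      unfolding a_def using hom_comp_app[OF fh dh(1) v hom_app[OF g(1) v c]] bspec[OF bspec[OF g(2) v] c]
        dsum_mat_mult(1)[OF zero_carrier_vec w] by simp
  qed
  define e where "e v = b v * a v" for v
  have e: "is_hom Q M M e" unfolding e_def by (rule hom_comp[OF M X M a b])
  have e_app: "e v *\<^sub>v x = b v *\<^sub>v (a v *\<^sub>v x)" if "v \<in> verts Q" "x \<in> carrier_vec (rdim M v)" for v x
    unfolding e_def by (rule hom_comp_app[OF a b that])
  have ee: "e v *\<^sub>v (e v *\<^sub>v x) = e v *\<^sub>v x" if v: "v \<in> verts Q" and x: "x \<in> carrier_vec (rdim M v)" for v x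
    using e_app[OF v x] e_app[OF v hom_app[OF e v x]] ab[OF v hom_app[OF a v x]] by simp
  obtain p where p: "\<And>v x. v \<in> verts Q \<Longrightarrow> x \<in> carrier_vec (rdim M v) \<Longrightarrow>
      e v *\<^sub>v (e v *\<^sub>v x) = (2 * p) \<cdot>\<^sub>v (e v *\<^sub>v x) - (p * p) \<cdot>\<^sub>v x" using H[OF e] by blast
  have p1: "(1 - 2 * p) * (e v *\<^sub>v x) $ i = - (p * p) * x $ i"
    if v: "v \<in> verts Q" and x: "x \<in> carrier_vec (rdim M v)" and i: "i < rdim M v" for v x i
  proof -
    have "(e v *\<^sub>v x) $ i = ((2 * p) \<cdot>\<^sub>v (e v *\<^sub>v x) - (p * p) \<cdot>\<^sub>v x) $ i" using p[OF v x] ee[OF v x] by simp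
    also have "\<dots> = (2 * p) * (e v *\<^sub>v x) $ i - (p * p) * x $ i"
      using x i hom_carrier[OF e v] by simp
    finally show ?thesis by (simp add: algebra_simps)
  qed
  obtain v0 where v0: "v0 \<in> verts Q" "0 < rdim M v0" using nz by (auto simp: is_zero_rep_def)
  define q where "q = - (p * p) / (1 - 2 * p)"
  \<comment> \<open>If 1 - 2 p were zero, then p would be nonzero while the equation for
    \<open>e\<close> gives p^2 = 0.\<close>
  have np: "1 - 2 * p \<noteq> 0"
  proof
    assume 0: "1 - 2 * p = 0"
    then have "p \<noteq> 0" by auto
    moreover have "- (p * p) * (unit_vec (rdim M v0) 0 :: 'k vec) $ 0 = 0"
      using p1[OF v0(1) unit_vec_carrier v0(2), of 0] 0 by simp
    ultimately show False using v0(2) by simp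
  qed
  have eq: "e v *\<^sub>v x = q \<cdot>\<^sub>v x" if v: "v \<in> verts Q" and x: "x \<in> carrier_vec (rdim M v)" for v x
  proof (rule eq_vecI)
    fix i assume "i < dim_vec (q \<cdot>\<^sub>v x)"
    then have i: "i < rdim M v" using x by simp
    have "(e v *\<^sub>v x) $ i = q * x $ i" using p1[OF v x i] np by (simp add: q_def field_simps)
    then show "(e v *\<^sub>v x) $ i = (q \<cdot>\<^sub>v x) $ i" using x i by simp
  qed (use hom_carrier[OF e v] x in simp)
  have "q * q = q"
  proof -
    let ?x = "unit_vec (rdim M v0) 0 :: 'k vec"
    have "e v0 *\<^sub>v (e v0 *\<^sub>v ?x) = e v0 *\<^sub>v ?x" by (rule ee[OF v0(1)]) simp
    then have "(q \<cdot>\<^sub>v (q \<cdot>\<^sub>v ?x)) $ 0 = (q \<cdot>\<^sub>v ?x) $ 0" using eq[OF v0(1)] by simp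
    then show ?thesis using v0(2) by simp
  qed
  then consider "q = 0" | "q = 1" by auto
  then show "is_zero_rep Q X \<or> is_zero_rep Q Y"
  proof cases
    case 1
    have "is_zero_rep Q X"
    proof (rule zero_repI)
      fix v and u :: "'k vec" assume v: "v \<in> verts Q" and u: "u \<in> carrier_vec (rdim X v)"
      have bu: "b v *\<^sub>v u \<in> carrier_vec (rdim M v)" by (rule hom_app[OF b v u])
      have "b v *\<^sub>v u = 0 \<cdot>\<^sub>v (b v *\<^sub>v u)" using eq[OF v bu] e_app[OF v bu] ab[OF v u] 1 by simp
      also have "\<dots> = 0\<^sub>v (rdim M v)" using hom_carrier[OF b v] by (intro eq_vecI) auto
      finally show "u = 0\<^sub>v (rdim X v)" using ab[OF v u] hom_app_zero[OF a v] by simp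
    qed
    then show ?thesis ..
  next
    case 2
    have "is_zero_rep Q Y"
    proof (rule zero_repI)
      fix v and w :: "'k vec" assume v: "v \<in> verts Q" and w: "w \<in> carrier_vec (rdim Y v)"
      have c: "0\<^sub>v (rdim X v) @\<^sub>v w \<in> carrier_vec (rdim (dsum Q X Y) v)" using w by simp
      let ?y = "g v *\<^sub>v (0\<^sub>v (rdim X v) @\<^sub>v w)"
      have y: "?y \<in> carrier_vec (rdim M v)" by (rule hom_app[OF g(1) v c])
      have "?y = 0\<^sub>v (rdim M v)" using eq[OF v y] e_app[OF v y] aw[OF v w] hom_app_zero[OF b v] 2 by simp
      then have "0\<^sub>v (rdim X v) @\<^sub>v w = 0\<^sub>v (rdim (dsum Q X Y) v)"
        using bspec[OF bspec[OF g(2) v] c] hom_app_zero[OF fh v] by simp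
      then have "snd_mat (rdim X v) (rdim Y v) *\<^sub>v (0\<^sub>v (rdim X v) @\<^sub>v w) = 0\<^sub>v (rdim Y v)"
        using hom_app_zero[OF dh(2) v] by simp
      then show "w = 0\<^sub>v (rdim Y v)" using dsum_mat_mult(2)[OF zero_carrier_vec w] by simp
    qed
    then show ?thesis ..
  qed
qed (use M nz in auto)

lemma no_square_zero_endo:
  fixes M :: "('v, 'a, 'k::field) rep"
  assumes div: "end_division Q M" and g: "is_hom Q M M g"
    and sq: "\<And>v. v \<in> verts Q \<Longrightarrow> g v * g v = 0\<^sub>m (rdim M v) (rdim M v)" and v: "v \<in> verts Q"
  shows "g v = 0\<^sub>m (rdim M v) (rdim M v)"
proof (rule ccontr)
  assume "g v \<noteq> 0\<^sub>m (rdim M v) (rdim M v)"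
  then have "is_iso Q M M g" using div g v unfolding end_division_def by blast
  then have m: "is_mono Q M M g" by (simp add: is_iso_def)
  have "is_zero_rep Q M"
  proof (rule zero_repI)
    fix w and x :: "'k vec" assume w: "w \<in> verts Q" and x: "x \<in> carrier_vec (rdim M w)"
    have "g w *\<^sub>v (g w *\<^sub>v x) = 0\<^sub>v (rdim M w)"
      using hom_comp_app[OF g g w x] sq[OF w] zero_mat_mult_vec[OF x] by simp
    then have "g w *\<^sub>v x = 0\<^sub>v (rdim M w)"
      using mono_eqD[OF m w hom_app[OF g w x] zero_carrier_vec] hom_app_zero[OF g w] by simp
    then show "x = 0\<^sub>v (rdim M w)"
      using mono_eqD[OF m w x zero_carrier_vec] hom_app_zero[OF g w] by simp
  qed
  then show False using div by (simp add: end_division_def)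
qed

end

section \<open>Modules on a simple cycle that are not bricks\<close>

lemma sum_upto_2: "sum f {0..<2} = f 0 + f (1 :: nat)"
  by (simp add: numeral_2_eq_2)

lemma mult_mat_index:
  assumes "A \<in> carrier_mat m n" "B \<in> carrier_mat n l" "i < m" "j < l"
  shows "(A * B) $$ (i, j) = (\<Sum>k\<in>{0..<n}. A $$ (i, k) * B $$ (k, j))"
  using assms by (auto simp: scalar_prod_def intro!: sum.cong)

text \<open>Cayley-Hamilton for a lower triangular matrix with double eigenvalue \<open>p\<close>,
  in the form that \<open>indecomposable_of_endos\<close> requires.\<close>

lemma char_eq_lower_triangular:
  fixes F :: "'k::field mat"
  assumes F: "F \<in> carrier_mat 2 2" "F $$ (0, 1) = 0" "F $$ (0, 0) = p" "F $$ (1, 1) = p" and x: "x \<in> carrier_vec 2"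
  shows "F *\<^sub>v (F *\<^sub>v x) = (2 * p) \<cdot>\<^sub>v (F *\<^sub>v x) - (p * p) \<cdot>\<^sub>v x"
proof (rule eq_vecI)
  have r: "(F *\<^sub>v y) $ i = F $$ (i, 0) * y $ 0 + F $$ (i, 1) * y $ 1" if "y \<in> carrier_vec 2" "i < 2" for y i
    using that F(1) by (auto simp: scalar_prod_def sum_upto_2)
  have Fx: "F *\<^sub>v x \<in> carrier_vec 2" using F(1) x by simp
  fix i assume "i < dim_vec ((2 * p) \<cdot>\<^sub>v (F *\<^sub>v x) - (p * p) \<cdot>\<^sub>v x)"
  then have i: "i < 2" using x by simp
  then have "i = 0 \<or> i = 1" by auto
  then show "(F *\<^sub>v (F *\<^sub>v x)) $ i = ((2 * p) \<cdot>\<^sub>v (F *\<^sub>v x) - (p * p) \<cdot>\<^sub>v x) $ i"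
    using r[OF Fx i] r[OF x, of 0] r[OF x, of 1] F x Fx i by (auto simp: algebra_simps)
qed (use F x in auto)

text \<open>A closed walk without repeated inner vertices: the letter m joins y m to y (m + 1), in the
  direction of the arrow iff e m.\<close>
locale simple_cycle = bound_quiver Q
  for Q :: "('v, 'a) bquiver" +
  fixes y :: "nat \<Rightarrow> 'v" and a :: "nat \<Rightarrow> 'a" and e :: "nat \<Rightarrow> bool" and d :: nat
  assumes d_pos: "0 < d" and y_inj: "inj_on y {..<d}" and y_closed: "y d = y 0"
    and a_arr: "m < d \<Longrightarrow> a m \<in> arrs Q"
    and a_src: "m < d \<Longrightarrow> src Q (a m) = (if e m then y m else y (Suc m))"
    and a_tgt: "m < d \<Longrightarrow> tgt Q (a m) = (if e m then y (Suc m) else y m)"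
    and reduced: "Suc m < d \<Longrightarrow> a m = a (Suc m) \<Longrightarrow> e m = e (Suc m)"
    and no_rel: "Suc m < d \<Longrightarrow> e m \<Longrightarrow> e (Suc m) \<Longrightarrow> [a m, a (Suc m)] \<notin> rels Q"
    and no_rel_inv: "Suc m < d \<Longrightarrow> \<not> e m \<Longrightarrow> \<not> e (Suc m) \<Longrightarrow> [a (Suc m), a m] \<notin> rels Q"
    and quadratic: "p \<in> rels Q \<Longrightarrow> \<exists>u b c w. p = u @ [b, c] @ w \<and> [b, c] \<in> rels Q"
begin

lemma y_eqD:
  assumes "y m = y n" "m \<le> d" "n \<le> d"
  shows "m = n \<or> m = 0 \<and> n = d \<or> m = d \<and> n = 0"
proof -
  define r where "r k = (if k = d then 0 else k)" for k
  have "y (r k) = y k" "k \<le> d \<Longrightarrow> r k < d" for k using y_closed d_pos by (auto simp: r_def)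
  then have "r m = r n" using assms by (intro inj_onD[OF y_inj]) auto
  then show ?thesis by (auto simp: r_def split: if_splits)
qed

text \<open>Equal letters have equal ends. In the same direction this repeats a vertex; in opposite
  directions it forces a cycle of length two that runs back along its first arrow, which
  \<open>reduced\<close> excludes.\<close>

lemma a_neq:
  assumes mn: "m < n" and n: "n < d"
  shows "a m \<noteq> a n"
proof
  assume eq: "a m = a n"
  have m: "m < d" using mn n by simp
  have s: "(if e m then y m else y (Suc m)) = (if e n then y n else y (Suc n))"
    using a_src[OF m] a_src[OF n] unfolding eq by metis
  have t: "(if e m then y (Suc m) else y m) = (if e n then y (Suc n) else y n)"
    using a_tgt[OF m] a_tgt[OF n] unfolding eq by metis
  show False
  proof (cases "e m = e n")
    case True
    then have "y m = y n" using s t by (cases "e n") simp_all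
    then show False using y_eqD[of m n] mn n by auto
  next
    case False
    then have "y m = y (Suc n)" "y (Suc m) = y n" using s t by (cases "e n"; simp)+
    then have "m = 0" "Suc m = n"
      using y_eqD[of m "Suc n"] y_eqD[of "Suc m" n] mn n by auto
    then show False using reduced[of m] n eq False by auto
  qed
qed

lemma a_inj: "m < d \<Longrightarrow> n < d \<Longrightarrow> a m = a n \<Longrightarrow> m = n"
  using a_neq[of m n] a_neq[of n m] by (cases m n rule: linorder_cases) auto

text \<open>Composable letters are neighbours on the cycle, and neighbours inside the walk form no
  relation; what remains passes through the base point.\<close>

lemma rel_wrap:
  assumes "m < d" "n < d" "[a m, a n] \<in> rels Q"
  shows "e m \<and> e n \<and> m = d - 1 \<and> n = 0 \<or> \<not> e m \<and> \<not> e n \<and> m = 0 \<and> n = d - 1"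
proof -
  have eq: "tgt Q (a m) = src Q (a n)" using rels_path[OF assms(3)] by (auto simp: is_path_def)
  note s = a_src[OF assms(2)] a_tgt[OF assms(1)]
  consider "e m" "e n" | "e m" "\<not> e n" | "\<not> e m" "e n" | "\<not> e m" "\<not> e n" by blast
  then show ?thesis
  proof cases
    case 1
    then have "y (Suc m) = y n" using eq s by simp
    then have "Suc m = n \<or> Suc m = d \<and> n = 0" using y_eqD[of "Suc m" n] assms by auto
    then show ?thesis using no_rel[of m] 1 assms by auto
  next
    case 2
    then have "y (Suc m) = y (Suc n)" using eq s by simp
    then have "m = n" using y_eqD[of "Suc m" "Suc n"] assms by auto
    then show ?thesis using 2 by simp
  next
    case 3
    then have "y m = y n" using eq s by simp
    then have "m = n" using y_eqD[of m n] assms by auto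
    then show ?thesis using 3 by simp
  next
    case 4
    then have "y m = y (Suc n)" using eq s by simp
    then have "m = Suc n \<or> m = 0 \<and> Suc n = d" using y_eqD[of m "Suc n"] assms by auto
    then show ?thesis using no_rel_inv[of n] 4 assms by auto
  qed
qed

definition V where "V = y ` {..<d}"

lemma y_in_V: "m \<le> d \<Longrightarrow> y m \<in> V"
  unfolding V_def using y_closed d_pos by (cases "m = d") auto

lemma V_verts: "V \<subseteq> verts Q"
proof
  fix v assume "v \<in> V"
  then obtain m where m: "m < d" "v = y m" by (auto simp: V_def)
  then show "v \<in> verts Q" using a_src[OF m(1)] a_tgt[OF m(1)] src_in[OF a_arr[OF m(1)]] tgt_in[OF a_arr[OF m(1)]]
    by (auto split: if_splits)
qed

lemma y0: "y 0 \<in> V" "y 0 \<in> verts Q" using y_in_V[of 0] V_verts by auto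

definition nil_mat :: "'k::field mat" where
  "nil_mat = mat 2 2 (\<lambda>(i, j). if i = 1 \<and> j = 0 then 1 else 0)"

definition jordan_mat :: "'k::field mat" where
  "jordan_mat = mat 2 2 (\<lambda>(i, j). if i = 0 \<and> j = 1 then 0 else 1)"

lemma nil_jordan:
  "(nil_mat :: 'k::field mat) \<in> carrier_mat 2 2" "(jordan_mat :: 'k mat) \<in> carrier_mat 2 2"
  "nil_mat * nil_mat = (0\<^sub>m 2 2 :: 'k mat)" "nil_mat * jordan_mat = (jordan_mat * nil_mat :: 'k mat)"
  "(nil_mat :: 'k mat) \<noteq> 0\<^sub>m 2 2"
proof -
  show "(nil_mat :: 'k::field mat) \<in> carrier_mat 2 2" "(jordan_mat :: 'k mat) \<in> carrier_mat 2 2"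
    by (auto simp: nil_mat_def jordan_mat_def)
  show "nil_mat * nil_mat = (0\<^sub>m 2 2 :: 'k mat)" "nil_mat * jordan_mat = (jordan_mat * nil_mat :: 'k mat)"
    by (rule eq_matI; auto simp: nil_mat_def jordan_mat_def scalar_prod_def sum_upto_2 less_2_cases_iff)+
  have "(nil_mat :: 'k mat) $$ (1, 0) \<noteq> 0\<^sub>m 2 2 $$ (1, 0)" by (simp add: nil_mat_def)
  then show "(nil_mat :: 'k mat) \<noteq> 0\<^sub>m 2 2" by metis
qed

lemma commute_nil:
  fixes F :: "'k::field mat"
  assumes F: "F \<in> carrier_mat 2 2" and c: "F * nil_mat = nil_mat * F"
  shows "F $$ (0, 1) = 0" "F $$ (1, 1) = F $$ (0, 0)"
proof -
  have "(F * nil_mat) $$ (i, j) = (nil_mat * F) $$ (i, j)" for i j using c by simp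
  from this[of 0 0] this[of 1 0] show "F $$ (0, 1) = 0" "F $$ (1, 1) = F $$ (0, 0)"
    using F by (auto simp: nil_mat_def scalar_prod_def sum_upto_2)
qed

lemma commute_jordan:
  fixes F :: "'k::field mat"
  assumes F: "F \<in> carrier_mat 2 2" and c: "F * jordan_mat = jordan_mat * F"
  shows "F $$ (0, 1) = 0" "F $$ (1, 1) = F $$ (0, 0)"
proof -
  have "(F * jordan_mat) $$ (i, j) = (jordan_mat * F) $$ (i, j)" for i j using c by simp
  from this[of 0 0] this[of 1 0] show "F $$ (0, 1) = 0" "F $$ (1, 1) = F $$ (0, 0)"
    using F by (auto simp: jordan_mat_def scalar_prod_def sum_upto_2)
qed

lemma char_eq_dim_zero:
  "F \<in> carrier_mat 0 0 \<Longrightarrow> x \<in> carrier_vec 0 \<Longrightarrow>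
    F *\<^sub>v (F *\<^sub>v x) = (2 * p) \<cdot>\<^sub>v (F *\<^sub>v x) - (p * p) \<cdot>\<^sub>v (x :: 'k::field vec)"
  by (intro eq_vecI) auto

text \<open>If the cycle carries no relation across its base point, it is a band; use a band module
  whose monodromy is a Jordan block of size two.\<close>
lemma band_not_brick:
  assumes band: "\<And>m n. m < d \<Longrightarrow> n < d \<Longrightarrow> [a m, a n] \<notin> rels Q"
  shows "\<exists>M :: ('v, 'a, 'k::field) rep. indecomposable Q M \<and> \<not> end_division Q M"
proof -
  define E where "E = a ` {..<d}"
  note nj = nil_jordan[where ?'k = 'k]
  \<comment> \<open>The monodromy sits on the last letter. With a block of size one all
    endomorphisms would be scalars; size two leaves room for a nilpotent one.\<close>
  define M :: "('v, 'a, 'k) rep" where "M = \<lparr> rdim = (\<lambda>v. if v \<in> V then 2 else 0),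
    rmap = (\<lambda>b. if b \<in> E then (if b = a (d - 1) then jordan_mat else 1\<^sub>m 2)
        else 0\<^sub>m (if tgt Q b \<in> V then 2 else 0) (if src Q b \<in> V then 2 else 0)) \<rparr>"
  have EV: "src Q b \<in> V \<and> tgt Q b \<in> V" if "b \<in> E" for b
    using that a_src a_tgt y_in_V unfolding E_def by (auto split: if_splits)
  have rd: "rdim M v = (if v \<in> V then 2 else 0)" for v by (simp add: M_def)
  have rm: "rmap M b = (if b = a (d - 1) then jordan_mat else 1\<^sub>m 2)" if "b \<in> E" for b using that by (simp add: M_def)
  have rm0: "rmap M b = 0\<^sub>m (rdim M (tgt Q b)) (rdim M (src Q b))" if "b \<notin> E" for b using that by (simp add: M_def)
  have Mc: "rep_carrier M"
    unfolding rep_carrier_def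
  proof (intro ballI)
    fix b show "rmap M b \<in> carrier_mat (rdim M (tgt Q b)) (rdim M (src Q b))"
      using EV[of b] rm[of b] rm0[of b] nil_jordan(2) by (cases "b \<in> E") (auto simp: rd)
  qed
  have Mm: "M \<in> mods Q"
  proof (rule mods_of_quadratic[OF quadratic Mc])
    fix b c assume r: "[b, c] \<in> rels Q"
    have bc: "tgt Q b = src Q c" "b \<in> arrs Q" "c \<in> arrs Q" using rels_path[OF r] by (auto simp: is_path_def)
    have cb: "rmap M b \<in> carrier_mat (rdim M (src Q c)) (rdim M (src Q b))"
      "rmap M c \<in> carrier_mat (rdim M (tgt Q c)) (rdim M (src Q c))"
      using Mc bc by (auto simp: rep_carrier_def)
    have "b \<notin> E \<or> c \<notin> E" using band r by (auto simp: E_def)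
    then show "rmap M c * rmap M b = 0\<^sub>m (rdim M (tgt Q c)) (rdim M (src Q b))"
      using rm0[of b] rm0[of c] left_mult_zero_mat[OF cb(1)] right_mult_zero_mat[OF cb(2)] bc(1) by auto
  qed
  have nz: "\<not> is_zero_rep Q M" using y0 by (auto simp: is_zero_rep_def rd)
  have "indecomposable Q M"
  proof (rule indecomposable_of_endos[OF Mm nz])
    fix f assume f: "is_hom Q M M f"
    have fc: "f v \<in> carrier_mat 2 2" if "v \<in> V" for v using hom_carrier[OF f, of v] that V_verts by (auto simp: rd)
    \<comment> \<open>The letters that act as the identity make all components of an endomorphism
      equal; the last letter makes the common matrix commute with the Jordan block.\<close>
    have step: "f (y (Suc m)) = f (y m)" if m: "Suc m < d" for m
    proof -
      have "a m \<noteq> a (d - 1)" using a_inj[of m "d - 1"] m by auto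
      moreover have "a m \<in> E" using m by (auto simp: E_def)
      ultimately have "f (tgt Q (a m)) * 1\<^sub>m 2 = 1\<^sub>m 2 * f (src Q (a m))"
        using hom_arr[OF f a_arr[of m]] rm[of "a m"] m by simp
      then have "f (tgt Q (a m)) = f (src Q (a m))"
        using EV[OF \<open>a m \<in> E\<close>] left_mult_one_mat[OF fc] right_mult_one_mat[OF fc] by simp
      then show ?thesis using a_src[of m] a_tgt[of m] m by (auto split: if_splits)
    qed
    have fy: "f (y m) = f (y 0)" if "m < d" for m using that
      by (induction m) (auto simp: step)
    have fy': "f (y m) = f (y 0)" if "m \<le> d" for m
      using fy[of m] that y_closed by (cases "m = d") simp_all
    have last: "a (d - 1) \<in> E" "d - 1 < d" using d_pos by (auto simp: E_def)
    have "f (tgt Q (a (d - 1))) * jordan_mat = jordan_mat * f (src Q (a (d - 1)))"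
      using hom_arr[OF f a_arr[OF last(2)]] rm[OF last(1)] by simp
    then have "f (y 0) * jordan_mat = jordan_mat * f (y 0)"
      using a_src[OF last(2)] a_tgt[OF last(2)] fy'[of "d - 1"] fy'[of d] d_pos by (auto split: if_splits)
    note cj = commute_jordan[OF fc[OF y0(1)] this]
    show "\<exists>p. \<forall>v\<in>verts Q. \<forall>x\<in>carrier_vec (rdim M v).
        f v *\<^sub>v (f v *\<^sub>v x) = (2 * p) \<cdot>\<^sub>v (f v *\<^sub>v x) - (p * p) \<cdot>\<^sub>v x"
    proof (intro exI[of _ "f (y 0) $$ (0, 0)"] ballI)
      fix v and x :: "'k vec" assume v: "v \<in> verts Q" and x: "x \<in> carrier_vec (rdim M v)"
      show "f v *\<^sub>v (f v *\<^sub>v x) = (2 * f (y 0) $$ (0, 0)) \<cdot>\<^sub>v (f v *\<^sub>v x) - (f (y 0) $$ (0, 0) * f (y 0) $$ (0, 0)) \<cdot>\<^sub>v x"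
      proof (cases "v \<in> V")
        case True
        then obtain m where "m < d" "v = y m" by (auto simp: V_def)
        then have "f v = f (y 0)" using fy[of m] by simp
        then show ?thesis
          using char_eq_lower_triangular[OF fc[OF y0(1)] cj(1) refl cj(2)] x True by (simp add: rd)
      next
        case False
        then show ?thesis using hom_carrier[OF f v] x by (intro char_eq_dim_zero) (simp_all add: rd)
      qed
    qed
  qed
  moreover have "\<not> end_division Q M"
  proof
    assume div: "end_division Q M"
    \<comment> \<open>The nilpotent part of the Jordan block commutes with it, hence gives an
      endomorphism, of square zero.\<close>
    define g :: "'v \<Rightarrow> 'k mat" where "g v = (if v \<in> V then nil_mat else 0\<^sub>m 0 0)" for v
    have "is_hom Q M M g"
      unfolding is_hom_def
    proof (intro conjI ballI)
      fix v show "g v \<in> carrier_mat (rdim M v) (rdim M v)" using nil_jordan(1) by (auto simp: g_def rd)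
    next
      fix b assume b: "b \<in> arrs Q"
      have bc: "rmap M b \<in> carrier_mat (rdim M (tgt Q b)) (rdim M (src Q b))"
        using Mc b by (auto simp: rep_carrier_def)
      show "g (tgt Q b) * rmap M b = rmap M b * g (src Q b)"
      proof (cases "b \<in> E")
        case True
        then show ?thesis
          using EV[OF True] rm[OF True] nj(4) left_mult_one_mat[OF nj(1)] right_mult_one_mat[OF nj(1)] by (auto simp: g_def)
      next
        case False
        have gc: "g v \<in> carrier_mat (rdim M v) (rdim M v)" for v using nil_jordan(1) by (auto simp: g_def rd)
        show ?thesis unfolding rm0[OF False] left_mult_zero_mat[OF gc] right_mult_zero_mat[OF gc] ..
      qed
    qed
    then have "g (y 0) = 0\<^sub>m (rdim M (y 0)) (rdim M (y 0))"
      by (rule no_square_zero_endo[OF div _ _ y0(2)])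
        (auto simp: g_def rd nil_jordan(3) intro: mat_zero_cols_eq)
    then show False using nj(5) y0 by (simp add: g_def rd)
  qed
  ultimately show ?thesis by blast
qed

text \<open>Otherwise the cycle, read from its base point y 0, is a string whose two ends are the top
  and the socle of its string module, which therefore has a nilpotent endomorphism.\<close>
lemma wrapped_not_brick:
  assumes st: "s < d" "t < d" and rel: "[a s, a t] \<in> rels Q"
  shows "\<exists>M :: ('v, 'a, 'k::field) rep. indecomposable Q M \<and> \<not> end_division Q M"
proof -
  define E where "E = a ` {..<d}"
  define x where "x = y 0"
  define R :: "'v \<Rightarrow> nat" where "R v = (if v = x then 2 else if v \<in> V then 1 else 0)" for v
  \<comment> \<open>At the base point, vector 0 is the one that \<open>a t\<close> starts from and
    vector 1 the one that \<open>a s\<close> arrives at, so the relation holds. If d = 1, both are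
    the same arrow, which acts as \<open>nil_mat\<close>.\<close>
  define M :: "('v, 'a, 'k) rep" where "M = \<lparr> rdim = R,
    rmap = (\<lambda>b. mat (R (tgt Q b)) (R (src Q b))
       (\<lambda>(i, j). if b \<in> E \<and> (b = a s \<longrightarrow> i = 1) \<and> (b = a t \<longrightarrow> j = 0) then 1 else 0)) \<rparr>"
  have rd: "rdim M v = R v" for v by (simp add: M_def)
  have w: "e s \<and> e t \<and> s = d - 1 \<and> t = 0 \<or> \<not> e s \<and> \<not> e t \<and> s = 0 \<and> t = d - 1"
    by (rule rel_wrap[OF st rel])
  have E: "b \<in> E \<longleftrightarrow> (\<exists>m<d. b = a m)" for b by (auto simp: E_def)
  have EV: "src Q b \<in> V \<and> tgt Q b \<in> V" if "b \<in> E" for b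
    using that a_src a_tgt y_in_V unfolding E_def by (auto split: if_splits)
  have tx: "tgt Q (a s) = x" and sx: "src Q (a t) = x"
    using w a_src[OF st(2)] a_tgt[OF st(1)] y_closed d_pos by (auto simp: x_def)
  have yx: "y m = x \<longleftrightarrow> m = 0 \<or> m = d" if "m \<le> d" for m
    using y_eqD[of m 0] that y_closed by (auto simp: x_def)
  \<comment> \<open>The walk meets \<open>x\<close> only at its two ends, so \<open>a s\<close> is
    the only letter ending there and, by \<open>Es\<close>, \<open>a t\<close> the only one starting
    there.\<close>
  have Et: "b = a s" if b: "b \<in> E" "tgt Q b = x" for b
  proof -
    obtain m where m: "m < d" "b = a m" using b E by auto
    have "tgt Q (a m) = x" using b m by simp
    then have "(if e m then Suc m = d else m = 0)"
      using a_tgt[OF m(1)] yx[of m] yx[of "Suc m"] m(1) by (auto split: if_splits)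
    then have "m = s"
      using w by (cases "d = 1") (auto split: if_splits)
    then show ?thesis using m by simp
  qed
  have Es: "b = a t" if b: "b \<in> E" "src Q b = x" for b
  proof -
    obtain m where m: "m < d" "b = a m" using b E by auto
    have "src Q (a m) = x" using b m by simp
    then have "(if e m then m = 0 else Suc m = d)"
      using a_src[OF m(1)] yx[of m] yx[of "Suc m"] m(1) by (auto split: if_splits)
    then have "m = t"
      using w by (cases "d = 1") (auto split: if_splits)
    then show ?thesis using m by simp
  qed
  have Mc: "rep_carrier M" by (simp add: rep_carrier_def M_def)
  have rm: "rmap M b $$ (i, j) = (if b \<in> E \<and> (b = a s \<longrightarrow> i = 1) \<and> (b = a t \<longrightarrow> j = 0) then 1 else 0)"
    if "i < R (tgt Q b)" "j < R (src Q b)" for b i j using that by (simp add: M_def)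
  have bcar: "rmap M b \<in> carrier_mat (R (tgt Q b)) (R (src Q b))" for b by (simp add: M_def)
  have Mm: "M \<in> mods Q"
  proof (rule mods_of_quadratic[OF quadratic Mc])
    fix b c assume r: "[b, c] \<in> rels Q"
    have bc: "tgt Q b = src Q c" using rels_path[OF r] by (auto simp: is_path_def)
    have cc: "rmap M c \<in> carrier_mat (R (tgt Q c)) (R (tgt Q b))" using bcar[of c] bc by simp
    show "rmap M c * rmap M b = 0\<^sub>m (rdim M (tgt Q c)) (rdim M (src Q b))"
    proof (rule eq_matI)
      fix i j assume "i < dim_row (0\<^sub>m (rdim M (tgt Q c)) (rdim M (src Q b)) :: 'k mat)"
        "j < dim_col (0\<^sub>m (rdim M (tgt Q c)) (rdim M (src Q b)) :: 'k mat)"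
      then have ij: "i < R (tgt Q c)" "j < R (src Q b)" by (auto simp: rd)
      have "(rmap M c * rmap M b) $$ (i, j) = (\<Sum>k\<in>{0..<R (tgt Q b)}. rmap M c $$ (i, k) * rmap M b $$ (k, j))"
        by (rule mult_mat_index[OF cc bcar ij])
      also have "\<dots> = 0"
      proof (rule sum.neutral, rule ballI)
        fix k assume k: "k \<in> {0..<R (tgt Q b)}"
        show "rmap M c $$ (i, k) * rmap M b $$ (k, j) = 0"
        proof (cases "b \<in> E \<and> c \<in> E")
          case True
          then obtain m n where mn: "m < d" "n < d" "b = a m" "c = a n" using E by auto
          then have "m = s \<and> n = t" using rel_wrap[OF mn(1,2)] r w by auto
          then show ?thesis using rm[of k b j] rm[of i c k] k ij bc mn by auto
        next
          case False
          then show ?thesis using rm[of k b j] rm[of i c k] k ij bc by auto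
        qed
      qed
      finally show "(rmap M c * rmap M b) $$ (i, j) = 0\<^sub>m (rdim M (tgt Q c)) (rdim M (src Q b)) $$ (i, j)"
        using ij by (simp add: rd)
    qed (use bcar[of b] bcar[of c] in \<open>auto simp: rd\<close>)
  qed
  have nz: "\<not> is_zero_rep Q M" using y0 by (auto simp: is_zero_rep_def rd R_def x_def)
  have Rx: "R x = 2" by (simp add: R_def)
  have "indecomposable Q M"
  proof (rule indecomposable_of_endos[OF Mm nz])
    fix f assume f: "is_hom Q M M f"
    have fc: "f v \<in> carrier_mat (R v) (R v)" if "v \<in> V" for v using hom_carrier[OF f, of v] that V_verts by (auto simp: rd)
    have xV: "x \<in> V" using y0 by (simp add: x_def)
    have Fc: "f x \<in> carrier_mat 2 2" using fc[OF xV] Rx by simp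
    have "\<exists>p. f x $$ (0, 1) = 0 \<and> f x $$ (0, 0) = p \<and> f x $$ (1, 1) = p \<and> (\<forall>v\<in>V. v \<noteq> x \<longrightarrow> f v $$ (0, 0) = p)"
    proof (cases "d = 1")
      case True
      then have st0: "s = 0" "t = 0" using st by auto
      have "{..<d} = {0}" using True by auto
      then have Vx: "V = {x}" by (simp add: V_def x_def)
      have a0: "src Q (a 0) = x" "tgt Q (a 0) = x" using tx sx st0 by auto
      have "a 0 \<in> E" using True by (auto simp: E)
      then have "rmap M (a 0) = nil_mat"
        using a0 Rx st0 by (intro eq_matI) (auto simp: M_def nil_mat_def)
      then have "f x * nil_mat = nil_mat * f x" using hom_arr[OF f a_arr[of 0]] True a0 by simp
      from commute_nil[OF Fc this] show ?thesis using Vx by auto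
    next
      case False
      then have d2: "2 \<le> d" using d_pos by simp
      have R1: "R (y m) = 1" if "0 < m" "m < d" for m
        using that yx[of m] y_in_V[of m] by (auto simp: R_def)
      have ne: "a s \<noteq> a t" using a_inj[OF st] w d2 by auto
      have aE: "a m \<in> E" if "m < d" for m using that E by auto
      have step: "f (y (Suc m)) $$ (0, 0) = f (y m) $$ (0, 0)" if m: "0 < m" "Suc m < d" for m
      proof -
        let ?b = "a m"
        have b: "?b \<noteq> a s" "?b \<noteq> a t" using a_inj[of m s] a_inj[of m t] m st w by auto
        have md: "m < d" using m by simp
        have R11: "R (src Q ?b) = 1" "R (tgt Q ?b) = 1" using a_src[OF md] a_tgt[OF md] R1[of m] R1[of "Suc m"] m by auto
        have c: "f (tgt Q ?b) \<in> carrier_mat 1 1" "f (src Q ?b) \<in> carrier_mat 1 1" "rmap M ?b \<in> carrier_mat 1 1"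
          using fc EV[OF aE[OF md]] R11 bcar[of ?b] by fastforce+
        have one: "rmap M ?b $$ (0, 0) = 1" using rm[of 0 ?b 0] R11 b aE[OF md] by simp
        have "(f (tgt Q ?b) * rmap M ?b) $$ (0, 0) = (rmap M ?b * f (src Q ?b)) $$ (0, 0)"
          using hom_arr[OF f a_arr[OF md]] by simp
        then have "f (tgt Q ?b) $$ (0, 0) = f (src Q ?b) $$ (0, 0)"
          using mult_mat_index[OF c(1,3), of 0 0] mult_mat_index[OF c(3,2), of 0 0] one by simp
        then show ?thesis using a_src[OF md] a_tgt[OF md] by (auto split: if_splits)
      qed
      define p where "p = f (y 1) $$ (0, 0)"
      have fy: "f (y (Suc m)) $$ (0, 0) = p" if "Suc m < d" for m
        using that by (induction m) (auto simp: p_def step)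
      have fv: "f v $$ (0, 0) = p" if v: "v \<in> V" "v \<noteq> x" for v
      proof -
        obtain m where m: "m < d" "v = y m" using v by (auto simp: V_def)
        then obtain m' where "m = Suc m'" using v by (cases m) (auto simp: x_def)
        then show ?thesis using fy m by simp
      qed
      have ends: "src Q (a s) \<in> V" "src Q (a s) \<noteq> x" "tgt Q (a t) \<in> V" "tgt Q (a t) \<noteq> x"
        using EV aE st Es[OF aE[OF st(1)]] Et[OF aE[OF st(2)]] ne by auto
      have Re: "R (src Q (a s)) = 1" "R (tgt Q (a t)) = 1" using ends by (auto simp: R_def)
      have cs: "rmap M (a s) \<in> carrier_mat 2 1" "f (src Q (a s)) \<in> carrier_mat 1 1"
        and ct: "rmap M (a t) \<in> carrier_mat 1 2" "f (tgt Q (a t)) \<in> carrier_mat 1 1"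
        using bcar[of "a s"] bcar[of "a t"] fc[OF ends(1)] fc[OF ends(3)] Re tx sx Rx by auto
      have rs: "rmap M (a s) $$ (0, 0) = 0" "rmap M (a s) $$ (1, 0) = 1"
        using rm[of 0 "a s" 0] rm[of 1 "a s" 0] tx Rx Re ne aE[OF st(1)] by auto
      have rt: "rmap M (a t) $$ (0, 0) = 1" "rmap M (a t) $$ (0, 1) = 0"
        using rm[of 0 "a t" 0] rm[of 0 "a t" 1] sx Rx Re ne aE[OF st(2)] by auto
      have hs: "(f x * rmap M (a s)) $$ (i, 0) = (rmap M (a s) * f (src Q (a s))) $$ (i, 0)" for i
        using hom_arr[OF f a_arr[OF st(1)]] tx by simp
      have ht: "(f (tgt Q (a t)) * rmap M (a t)) $$ (0, j) = (rmap M (a t) * f x) $$ (0, j)" for j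
        using hom_arr[OF f a_arr[OF st(2)]] sx by simp
      \<comment> \<open>Commuting with \<open>a s\<close> determines the second column of
        \<open>f x\<close>; commuting with \<open>a t\<close> determines its upper left
        entry.\<close>
      have "f x $$ (0, 1) = 0" "f x $$ (1, 1) = p"
        using hs[of 0] hs[of 1] mult_mat_index[OF Fc cs(1), of 0 0] mult_mat_index[OF Fc cs(1), of 1 0]
          mult_mat_index[OF cs, of 0 0] mult_mat_index[OF cs, of 1 0] rs fv[OF ends(1,2)]
        by (simp_all add: sum_upto_2)
      moreover have "f x $$ (0, 0) = p"
        using ht[of 0] mult_mat_index[OF ct(2,1), of 0 0] mult_mat_index[OF ct(1) Fc, of 0 0]
          rt fv[OF ends(3,4)] by (simp add: sum_upto_2)
      ultimately show ?thesis using fv by blast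
    qed
    then obtain p where p: "f x $$ (0, 1) = 0" "f x $$ (0, 0) = p" "f x $$ (1, 1) = p"
      "\<And>v. v \<in> V \<Longrightarrow> v \<noteq> x \<Longrightarrow> f v $$ (0, 0) = p" by blast
    show "\<exists>p. \<forall>v\<in>verts Q. \<forall>x\<in>carrier_vec (rdim M v).
        f v *\<^sub>v (f v *\<^sub>v x) = (2 * p) \<cdot>\<^sub>v (f v *\<^sub>v x) - (p * p) \<cdot>\<^sub>v x"
    proof (intro exI[of _ p] ballI)
      fix v and z :: "'k vec" assume v: "v \<in> verts Q" and z: "z \<in> carrier_vec (rdim M v)"
      show "f v *\<^sub>v (f v *\<^sub>v z) = (2 * p) \<cdot>\<^sub>v (f v *\<^sub>v z) - (p * p) \<cdot>\<^sub>v z"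
      proof (cases "v = x")
        case True
        then show ?thesis using char_eq_lower_triangular[OF Fc p(1-3)] z Rx by (simp add: rd)
      next
        case nx: False
        show ?thesis
        proof (cases "v \<in> V")
          case True
          have R1: "R v = 1" using True nx by (simp add: R_def)
          have c: "f v \<in> carrier_mat 1 1" and z1: "z \<in> carrier_vec 1" using fc[OF True] z R1 by (auto simp: rd)
          have r: "(f v *\<^sub>v u) $ 0 = p * u $ 0" if "u \<in> carrier_vec 1" for u
            using that c p(4)[OF True nx] by (auto simp: scalar_prod_def)
          have fz: "f v *\<^sub>v z \<in> carrier_vec 1" using c z1 by simp
          show ?thesis
            by (rule eq_vecI) (use r[OF z1] r[OF fz] c z1 fz in \<open>auto simp: algebra_simps\<close>)
        next
          case False
          then show ?thesis using hom_carrier[OF f v] z nx by (intro char_eq_dim_zero) (simp_all add: rd R_def)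
        qed
      qed
    qed
  qed
  moreover have "\<not> end_division Q M"
  proof
    assume div: "end_division Q M"
    define g :: "'v \<Rightarrow> 'k mat" where "g v = (if v = x then nil_mat else 0\<^sub>m (R v) (R v))" for v
    have gc: "g v \<in> carrier_mat (R v) (R v)" for v using nil_jordan(1) Rx by (auto simp: g_def)
    have gi: "g v $$ (i, j) = (if v = x \<and> i = 1 \<and> j = 0 then 1 else 0)" if "i < R v" "j < R v" for v i j
      using that Rx by (auto simp: g_def nil_mat_def)
    have "is_hom Q M M g"
      unfolding is_hom_def
    proof (intro conjI ballI)
      fix v show "g v \<in> carrier_mat (rdim M v) (rdim M v)" using gc by (simp add: rd)
    next
      fix b assume b: "b \<in> arrs Q"
      let ?z = "0\<^sub>m (R (tgt Q b)) (R (src Q b)) :: 'k mat"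
      \<comment> \<open>At \<open>x\<close>, \<open>g\<close> sends vector 0 to vector 1. What
        arrives at \<open>x\<close> is a multiple of vector 1, which \<open>g\<close> kills, and
        every arrow kills vector 1; so both sides of the commutation are zero.\<close>
      have "g (tgt Q b) * rmap M b = ?z"
      proof (rule eq_matI)
        fix i j assume "i < dim_row ?z" "j < dim_col ?z"
        then have ij: "i < R (tgt Q b)" "j < R (src Q b)" by auto
        have "(g (tgt Q b) * rmap M b) $$ (i, j) = (\<Sum>k\<in>{0..<R (tgt Q b)}. g (tgt Q b) $$ (i, k) * rmap M b $$ (k, j))"
          by (rule mult_mat_index[OF gc bcar ij])
        also have "\<dots> = 0" by (rule sum.neutral) (use ij gi rm Et in auto)
        finally show "(g (tgt Q b) * rmap M b) $$ (i, j) = ?z $$ (i, j)" using ij by simp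
      qed (use gc[of "tgt Q b"] bcar[of b] in auto)
      moreover have "rmap M b * g (src Q b) = ?z"
      proof (rule eq_matI)
        fix i j assume "i < dim_row ?z" "j < dim_col ?z"
        then have ij: "i < R (tgt Q b)" "j < R (src Q b)" by auto
        have "(rmap M b * g (src Q b)) $$ (i, j) = (\<Sum>k\<in>{0..<R (src Q b)}. rmap M b $$ (i, k) * g (src Q b) $$ (k, j))"
          by (rule mult_mat_index[OF bcar gc ij])
        also have "\<dots> = 0" by (rule sum.neutral) (use ij gi rm Es in auto)
        finally show "(rmap M b * g (src Q b)) $$ (i, j) = ?z $$ (i, j)" using ij by simp
      qed (use gc[of "src Q b"] bcar[of b] in auto)
      ultimately show "g (tgt Q b) * rmap M b = rmap M b * g (src Q b)" by simp
    qed
    then have "g x = 0\<^sub>m (rdim M x) (rdim M x)"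
      by (rule no_square_zero_endo[OF div])
        (use y0 nil_jordan(3) Rx in \<open>auto simp: g_def rd x_def\<close>)
    then show False using nil_jordan(5)[where ?'k = 'k] Rx by (simp add: g_def rd)
  qed
  ultimately show ?thesis by blast
qed

lemma cycle_not_brick:
  "\<exists>M :: ('v, 'a, 'k::field) rep. indecomposable Q M \<and> \<not> end_division Q M"
  using band_not_brick wrapped_not_brick by blast

end

section \<open>Extracting a simple cycle from a string\<close>

lemma word_verts_nth:
  assumes "is_string Q w" "i < length (snd w)"
  shows "word_verts Q w ! i = letter_src Q (snd w ! i)" "word_verts Q w ! Suc i = letter_tgt Q (snd w ! i)"
proof -
  show "word_verts Q w ! Suc i = letter_tgt Q (snd w ! i)" using assms(2) by (simp add: word_verts_def)
  show "word_verts Q w ! i = letter_src Q (snd w ! i)"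
    using assms by (cases i) (auto simp: word_verts_def is_string_def Let_def)
qed

lemma length_word_verts [simp]: "length (word_verts Q w) = Suc (length (snd w))"
  by (simp add: word_verts_def)

lemma string_letter:
  assumes "is_string Q w" "i < length (snd w)"
  shows "fst (snd w ! i) \<in> arrs Q"
    "src Q (fst (snd w ! i)) = (if snd (snd w ! i) then word_verts Q w ! i else word_verts Q w ! Suc i)"
    "tgt Q (fst (snd w ! i)) = (if snd (snd w ! i) then word_verts Q w ! Suc i else word_verts Q w ! i)"
  using word_verts_nth[OF assms] assms
  by (auto simp: is_string_def Let_def letter_src_def letter_tgt_def)

lemma no_rel_subword_pair:
  assumes "no_rel_subword Q ws" "Suc i < length ws" "snd (ws ! i)" "snd (ws ! Suc i)"
  shows "[fst (ws ! i), fst (ws ! Suc i)] \<notin> rels Q"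
proof -
  have "drop i ws = ws ! i # ws ! Suc i # drop (Suc (Suc i)) ws"
    using assms(2) by (simp add: Cons_nth_drop_Suc)
  then have td: "take 2 (drop i ws) = [ws ! i, ws ! Suc i]" by simp
  have "i < i + 2 \<and> i + 2 \<le> length ws \<and> (\<forall>l\<in>set (take (i + 2 - i) (drop i ws)). snd l) \<longrightarrow>
      map fst (take (i + 2 - i) (drop i ws)) \<notin> rels Q"
    using assms(1) unfolding no_rel_subword_def by blast
  moreover have "i + 2 - i = (2 :: nat)" by simp
  ultimately show ?thesis using td assms(2-4) by simp
qed

lemma string_no_rel:
  assumes w: "is_string Q w" and "Suc i < length (snd w)" "snd (snd w ! i)" "snd (snd w ! Suc i)"
  shows "[fst (snd w ! i), fst (snd w ! Suc i)] \<notin> rels Q"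
  by (rule no_rel_subword_pair[OF _ assms(2-4)]) (use w in \<open>simp add: is_string_def Let_def\<close>)

lemma string_no_rel_inv:
  assumes w: "is_string Q w" and i: "Suc i < length (snd w)" and dir: "\<not> snd (snd w ! i)" "\<not> snd (snd w ! Suc i)"
  shows "[fst (snd w ! Suc i), fst (snd w ! i)] \<notin> rels Q"
proof -
  let ?v = "snd (inv_word Q w)" and ?n = "length (snd w)"
  have len: "length ?v = ?n" by (simp add: inv_word_def)
  have nth: "?v ! k = (fst (snd w ! (?n - Suc k)), \<not> snd (snd w ! (?n - Suc k)))" if "k < ?n" for k
    using that by (simp add: inv_word_def rev_nth case_prod_unfold)
  let ?k = "?n - Suc (Suc i)"
  have k: "?k < ?n" "Suc ?k < ?n" "?n - Suc ?k = Suc i" "?n - Suc (Suc ?k) = i" using i by auto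
  have v: "?v ! ?k = (fst (snd w ! Suc i), True)" "?v ! Suc ?k = (fst (snd w ! i), True)"
    using nth[OF k(1)] nth[OF k(2)] k dir by simp_all
  have "no_rel_subword Q ?v" using w by (simp add: is_string_def Let_def)
  from no_rel_subword_pair[OF this, of ?k] show ?thesis using v k(2) len by simp
qed

lemma string_reduced:
  assumes "is_string Q w" "Suc i < length (snd w)" "fst (snd w ! i) = fst (snd w ! Suc i)"
  shows "snd (snd w ! i) = snd (snd w ! Suc i)"
  using assms by (auto simp: is_string_def Let_def)

text \<open>Choose a repetition at the least distance; any repetition among the positions from
  \<open>i\<close> to \<open>j - 1\<close> would be closer.\<close>

lemma minimal_repetition:
  assumes "\<not> distinct xs"
  obtains i j where "i < j" "j < length xs" "xs ! i = xs ! j"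
    "\<forall>m n. i \<le> m \<and> m < n \<and> n < j \<longrightarrow> xs ! m \<noteq> xs ! n"
proof -
  define P where "P k \<longleftrightarrow> (\<exists>i. i + k < length xs \<and> 0 < k \<and> xs ! i = xs ! (i + k))" for k
  obtain i j where ij: "i < j" "j < length xs" "xs ! i = xs ! j"
    using assms by (metis distinct_conv_nth linorder_neq_iff)
  then have "P (j - i)" unfolding P_def by (intro exI[of _ i]) auto
  then have L: "P (LEAST k. P k)" by (rule LeastI)
  then obtain i where i: "i + (LEAST k. P k) < length xs" "0 < (LEAST k. P k)" "xs ! i = xs ! (i + (LEAST k. P k))"
    by (auto simp: P_def)
  have "xs ! m \<noteq> xs ! n" if "i \<le> m" "m < n" "n < i + (LEAST k. P k)" for m n
  proof
    assume "xs ! m = xs ! n"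
    then have "P (n - m)" unfolding P_def using that i(1) by (intro exI[of _ m]) auto
    then have "(LEAST k. P k) \<le> n - m" by (rule Least_le)
    then show False using that by simp
  qed
  then have "\<forall>m n. i \<le> m \<and> m < n \<and> n < i + (LEAST k. P k) \<longrightarrow> xs ! m \<noteq> xs ! n" by blast
  then show thesis using i by (intro that[of i "i + (LEAST k. P k)"]) simp_all
qed

lemma bound_quiver_admissible: "admissible_path_bquiver Q \<Longrightarrow> bound_quiver Q"
  by unfold_locales (auto simp: admissible_path_bquiver_def)

text \<open>The letters between two occurrences of a vertex at least distance form a cycle as in
  \<open>simple_cycle\<close>. This is the only place where the condition on endomorphism rings
  enters.\<close>

lemma string_self_avoiding:
  assumes bg: "brick_gentle TYPE('k::field) Q" and w: "is_string Q w"
  shows "distinct (word_verts Q w)"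
proof (rule ccontr)
  assume nd: "\<not> distinct (word_verts Q w)"
  define xs where "xs = word_verts Q w"
  have len: "length xs = Suc (length (snd w))" by (simp add: xs_def)
  obtain i j where ij: "i < j" "j < length xs" "xs ! i = xs ! j"
    "\<forall>m n. i \<le> m \<and> m < n \<and> n < j \<longrightarrow> xs ! m \<noteq> xs ! n"
    by (rule minimal_repetition[OF nd[folded xs_def]]) 
  have adm: "admissible_path_bquiver Q" and gen: "gentle Q" using bg by (auto simp: brick_gentle_def)
  interpret bound_quiver Q by (rule bound_quiver_admissible[OF adm])
  have b: "i + m < length (snd w)" if "m < j - i" for m using that ij len by simp
  have "simple_cycle Q (\<lambda>m. xs ! (i + m)) (\<lambda>m. fst (snd w ! (i + m))) (\<lambda>m. snd (snd w ! (i + m))) (j - i)"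
  proof (unfold_locales, goal_cases)
    case 1 then show ?case using ij by simp
  next
    case 2 
    show ?case
    proof (rule inj_onI)
      fix m n assume mn: "m \<in> {..<j - i}" "n \<in> {..<j - i}" "xs ! (i + m) = xs ! (i + n)"
      have lt: "i + m < j" "i + n < j" using mn by auto
      show "m = n"
        using ij(4)[rule_format, of "i + m" "i + n"] ij(4)[rule_format, of "i + n" "i + m"] mn(3) lt
        by (cases m n rule: linorder_cases) simp_all
    qed
  next
    case 3 then show ?case using ij by simp
  next
    case (4 m) then show ?case using string_letter(1)[OF w b] by simp
  next
    case (5 m) then show ?case using string_letter(2)[OF w b] by (simp add: xs_def)
  next
    case (6 m) then show ?case using string_letter(3)[OF w b] by (simp add: xs_def)
  next
    case (7 m) then show ?case using string_reduced[OF w, of "i + m"] b[of "Suc m"] by simp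
  next
    case (8 m) then show ?case using string_no_rel[OF w, of "i + m"] b[of "Suc m"] by simp
  next
    case (9 m) then show ?case using string_no_rel_inv[OF w, of "i + m"] b[of "Suc m"] by simp
  next
    case (10 p)
    have "\<exists>u a b v. p = u @ [a, b] @ v \<and> [a, b] \<in> rels Q" using gen 10 unfolding gentle_def by blast
    then show ?case by blast
  qed
  then interpret simple_cycle Q "\<lambda>m. xs ! (i + m)" "\<lambda>m. fst (snd w ! (i + m))" "\<lambda>m. snd (snd w ! (i + m))" "j - i" .
  obtain M :: "('a, 'b, 'k) rep" where "indecomposable Q M" "\<not> end_division Q M" using cycle_not_brick by blast
  then show False using bg unfolding brick_gentle_def by blast
qed

section \<open>Thin modules\<close>

lemma inj_mat_one_row:
  assumes A: "(A :: 'k::field mat) \<in> carrier_mat 1 n" and inj: "inj_mat A" and n: "0 < n"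
  shows "n = 1" "surj_mat A"
proof -
  show n1: "n = 1" using inj_mat_dim_le[OF A inj] n by simp
  obtain P where P: "P \<in> carrier_mat n 1" "P * A = 1\<^sub>m n" using inj_mat_left_inverse[OF A inj] by blast
  have "A * P = 1\<^sub>m 1" using mat_mult_left_right_inverse[of P 1 A] P A n1 by simp
  then show "surj_mat A" using right_inverse_surj_mat[OF A P(1)] by simp
qed

lemma surj_mat_one_col:
  assumes A: "(A :: 'k::field mat) \<in> carrier_mat m 1" and surj: "surj_mat A" and m: "0 < m"
  shows "m = 1" "inj_mat A"
proof -
  obtain S where S: "S \<in> carrier_mat 1 m" "A * S = 1\<^sub>m m" using surj_mat_right_inverse[OF A surj] by blast
  show m1: "m = 1" using inj_mat_dim_le[OF S(1) left_inverse_inj_mat[OF S(1) A S(2)]] m by simp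
  have "S * A = 1\<^sub>m 1" using mat_mult_left_right_inverse[of A 1 S] S A m1 by simp
  then show "inj_mat A" using left_inverse_inj_mat[OF A S(1)] by simp
qed

lemma length_filter_eq_distinct: "distinct xs \<Longrightarrow> length (filter (\<lambda>u. u = v) xs) = of_bool (v \<in> set xs)"
  by (induction xs) auto

definition total_dim :: "('v, 'a) bquiver \<Rightarrow> ('v, 'a, 'k::field) rep \<Rightarrow> nat" where
  "total_dim Q M = (\<Sum>v\<in>verts Q. rdim M v)"

text \<open>The shape of the string module of a string without repeated vertices. The order of the
  letters is forgotten, so that submodules and quotients become restrictions to subsets of
  \<open>V\<close>.\<close>

definition thin :: "('v, 'a) bquiver \<Rightarrow> 'v set \<Rightarrow> 'a set \<Rightarrow> ('v, 'a, 'k::field) rep" where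
  "thin Q V E = \<lparr> rdim = (\<lambda>v. of_bool (v \<in> V)),
     rmap = (\<lambda>b. mat (of_bool (tgt Q b \<in> V)) (of_bool (src Q b \<in> V)) (\<lambda>_. of_bool (b \<in> E))) \<rparr>"

definition thin_map :: "'v set \<Rightarrow> 'v set \<Rightarrow> 'v \<Rightarrow> 'k::field mat" where
  "thin_map V V' v = mat (of_bool (v \<in> V')) (of_bool (v \<in> V)) (\<lambda>_. 1)"

lemma rdim_thin [simp]: "rdim (thin Q V E) v = of_bool (v \<in> V)"
  by (simp add: thin_def)

lemma thin_map_app:
  assumes "(x :: 'k::field vec) \<in> carrier_vec (of_bool (v \<in> V))"
  shows "v \<in> V \<Longrightarrow> v \<in> V' \<Longrightarrow> thin_map V V' v *\<^sub>v x = x"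
    "v \<notin> V \<or> v \<notin> V' \<Longrightarrow> thin_map V V' v *\<^sub>v x = 0\<^sub>v (of_bool (v \<in> V'))"
  using assms by (auto simp: thin_map_def scalar_prod_def intro!: eq_vecI)

lemma carrier_vec_0: "(x :: 'k::field vec) \<in> carrier_vec 0 \<longleftrightarrow> x = 0\<^sub>v 0"
  by (auto intro!: eq_vecI)

lemma rmap_thin_app:
  "b \<in> E \<Longrightarrow> src Q b \<in> V \<Longrightarrow> tgt Q b \<in> V \<Longrightarrow> (x :: 'k::field vec) \<in> carrier_vec 1 \<Longrightarrow>
    rmap (thin Q V E) b *\<^sub>v x = x"
  by (intro eq_vecI) (auto simp: thin_def scalar_prod_def)

context bound_quiver
begin

lemma thin_carrier: "rep_carrier (thin Q V E)"
  by (simp add: rep_carrier_def thin_def)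

text \<open>Only arrows from \<open>V\<close> to \<open>V'\<close> matter, for otherwise the square
  starts or ends in a zero space. For these arrows each of the two composites is 0 or 1, and the
  condition says that they agree.\<close>

lemma thin_map_hom:
  assumes "\<And>b. b \<in> arrs Q \<Longrightarrow> src Q b \<in> V \<Longrightarrow> tgt Q b \<in> V' \<Longrightarrow>
    (tgt Q b \<in> V \<and> b \<in> E) \<longleftrightarrow> (src Q b \<in> V' \<and> b \<in> E')"
  shows "is_hom Q (thin Q V E) (thin Q V' E') (thin_map V V' :: 'v \<Rightarrow> 'k::field mat)"
  unfolding is_hom_def
proof (intro conjI ballI)
  fix v show "(thin_map V V' v :: 'k mat) \<in> carrier_mat (rdim (thin Q V' E' :: ('v, 'a, 'k) rep) v) (rdim (thin Q V E :: ('v, 'a, 'k) rep) v)"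
    by (simp add: thin_map_def)
next
  fix b assume b: "b \<in> arrs Q"
  show "thin_map V V' (tgt Q b) * rmap (thin Q V E) b = rmap (thin Q V' E') b * (thin_map V V' (src Q b) :: 'k mat)"
    using assms[OF b]
    by (cases "src Q b \<in> V"; cases "tgt Q b \<in> V'")
      (auto simp: thin_def thin_map_def scalar_prod_def intro!: eq_matI)
qed

lemma thin_map_retract:
  assumes "V' \<subseteq> V" "is_hom Q (thin Q V' E') (thin Q V E) (thin_map V' V :: 'v \<Rightarrow> 'k::field mat)"
    "is_hom Q (thin Q V E) (thin Q V' E') (thin_map V V' :: 'v \<Rightarrow> 'k mat)"
  shows "retract (thin Q V' E' :: ('v, 'a, 'k) rep) (thin Q V E)"
  unfolding retract_def
proof (intro exI conjI ballI)
  fix v and x :: "'k vec" assume x: "x \<in> carrier_vec (rdim (thin Q V' E' :: ('v, 'a, 'k) rep) v)"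
  show "thin_map V V' v *\<^sub>v (thin_map V' V v *\<^sub>v x) = x"
  proof (cases "v \<in> V'")
    case True
    then show ?thesis using thin_map_app(1)[of x v V' V] thin_map_app(1)[of x v V V'] assms(1) x by auto
  next
    case False
    then show ?thesis using thin_map_app(2)[of x v V' V] thin_map_app(2)[of "0\<^sub>v (of_bool (v \<in> V))" v V V'] x
      by (auto simp: carrier_vec_0)
  qed
qed (fact assms(2,3))+

lemma thin_map_mono:
  assumes "V' \<subseteq> V" "is_hom Q (thin Q V' E') (thin Q V E) (thin_map V' V :: 'v \<Rightarrow> 'k::field mat)"
  shows "is_mono Q (thin Q V' E') (thin Q V E) (thin_map V' V :: 'v \<Rightarrow> 'k mat)"
proof (rule monoI[OF assms(2)])
  fix v and x :: "'k vec" assume x: "x \<in> carrier_vec (rdim (thin Q V' E' :: ('v, 'a, 'k) rep) v)"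
    and z: "thin_map V' V v *\<^sub>v x = 0\<^sub>v (rdim (thin Q V E :: ('v, 'a, 'k) rep) v)"
  show "x = 0\<^sub>v (rdim (thin Q V' E' :: ('v, 'a, 'k) rep) v)"
    using thin_map_app(1)[of x v V' V] x z assms(1) by (cases "v \<in> V'") (auto simp: carrier_vec_0)
qed

lemma thin_map_epi:
  assumes "V' \<subseteq> V" "is_hom Q (thin Q V E) (thin Q V' E') (thin_map V V' :: 'v \<Rightarrow> 'k::field mat)"
  shows "is_epi Q (thin Q V E) (thin Q V' E') (thin_map V V' :: 'v \<Rightarrow> 'k mat)"
proof (rule epiI[OF assms(2)])
  fix v and y :: "'k vec" assume y: "y \<in> carrier_vec (rdim (thin Q V' E' :: ('v, 'a, 'k) rep) v)"
  show "\<exists>x\<in>carrier_vec (rdim (thin Q V E :: ('v, 'a, 'k) rep) v). thin_map V V' v *\<^sub>v x = y"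
  proof (cases "v \<in> V'")
    case True
    then show ?thesis using thin_map_app(1)[of y v V V'] assms(1) y by (intro bexI[of _ y]) auto
  next
    case False
    then show ?thesis using thin_map_app(2)[of "0\<^sub>v (of_bool (v \<in> V))" v V V'] y
      by (intro bexI[of _ "0\<^sub>v (of_bool (v \<in> V))"]) (auto simp: carrier_vec_0)
  qed
qed

lemma thin_map_range:
  assumes "V' \<subseteq> V" "is_hom Q (thin Q V' E') (thin Q V E) (thin_map V' V :: 'v \<Rightarrow> 'k::field mat)" "v \<in> verts Q"
  shows "mat_range (thin_map V' V v :: 'k mat) = (if v \<in> V' then carrier_vec 1 else {0\<^sub>v (of_bool (v \<in> V))})"
proof -
  have "y \<in> mat_range (thin_map V' V v :: 'k mat) \<longleftrightarrow> y \<in> (if v \<in> V' then carrier_vec 1 else {0\<^sub>v (of_bool (v \<in> V))})" for y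
  proof (cases "v \<in> V'")
    case True
    then have V: "v \<in> V" using assms(1) by auto
    have "thin_map V' V v *\<^sub>v x = x" if "x \<in> carrier_vec 1" for x :: "'k vec"
      using thin_map_app(1)[of x v V' V] True V that by simp
    then have "(\<exists>x\<in>carrier_vec 1. y = thin_map V' V v *\<^sub>v x) \<longleftrightarrow> (\<exists>x\<in>carrier_vec 1. y = x)"
      by (intro bex_cong refl) simp
    then show ?thesis using hom_range[OF assms(2,3), of y] True by simp
  next
    case False
    then show ?thesis
      using hom_range[OF assms(2,3), of y] thin_map_app(2)[of "0\<^sub>v 0" v V' V] by (auto simp: carrier_vec_0)
  qed
  then show ?thesis by blast
qed

lemma thin_map_ker:
  assumes "V' \<subseteq> V" "is_hom Q (thin Q V E) (thin Q V' E') (thin_map V V' :: 'v \<Rightarrow> 'k::field mat)" "v \<in> verts Q"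
  shows "mat_ker (thin_map V V' v :: 'k mat) = (if v \<in> V' then {0\<^sub>v 1} else carrier_vec (of_bool (v \<in> V)))"
proof -
  have "y \<in> mat_ker (thin_map V V' v :: 'k mat) \<longleftrightarrow> y \<in> (if v \<in> V' then {0\<^sub>v 1} else carrier_vec (of_bool (v \<in> V)))" for y
  proof (cases "v \<in> V'")
    case True
    then show ?thesis
      using hom_ker[OF assms(2,3), of y] thin_map_app(1)[of y v V V'] assms(1) by auto
  next
    case False
    then show ?thesis
      using hom_ker[OF assms(2,3), of y] thin_map_app(2)[of y v V V'] by auto
  qed
  then show ?thesis by blast
qed

lemma total_dim_thin: "V \<subseteq> verts Q \<Longrightarrow> total_dim Q (thin Q V E :: ('v, 'a, 'k::field) rep) = card V"
proof -
  assume V: "V \<subseteq> verts Q"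
  have "total_dim Q (thin Q V E :: ('v, 'a, 'k) rep) = (\<Sum>v\<in>verts Q. if v \<in> V then 1 else 0)"
    unfolding total_dim_def by (intro sum.cong) auto
  also have "\<dots> = card (verts Q \<inter> V)" using finite_verts by (simp add: sum.If_cases)
  finally show ?thesis using V by (simp add: Int_absorb1)
qed

text \<open>A subspace of a line is zero or the whole line, so a submodule of a thin module is
  determined by its support; arrows in \<open>E\<close> act as 1 and cannot lead out of it.\<close>

lemma thin_sub_of_mono:
  fixes N :: "('v, 'a, 'k::field) rep"
  assumes N: "N \<in> mods Q" and X: "(thin Q V E :: ('v, 'a, 'k) rep) \<in> mods Q" and i: "is_mono Q N (thin Q V E) i"
    and V: "V \<subseteq> verts Q" and E: "\<forall>b\<in>E. b \<in> arrs Q \<and> src Q b \<in> V \<and> tgt Q b \<in> V"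
  defines "V' \<equiv> {v \<in> V. rdim N v \<noteq> 0}"
  defines "E' \<equiv> {b \<in> E. src Q b \<in> V' \<and> tgt Q b \<in> V'}"
  shows "is_hom Q (thin Q V' E') (thin Q V E) (thin_map V' V :: 'v \<Rightarrow> 'k mat)"
    "(thin Q V' E' :: ('v, 'a, 'k) rep) \<in> mods Q" "retract N (thin Q V' E')" "retract (thin Q V' E') N"
    "\<forall>v\<in>verts Q. mat_range (i v) = mat_range (thin_map V' V v)"
proof -
  note ih = mono_hom[OF i]
  have inj: "inj_mat (i v)" "i v \<in> carrier_mat (of_bool (v \<in> V)) (rdim N v)" if "v \<in> verts Q" for v
    using i that hom_carrier[OF ih that] by (auto simp: is_mono_def)
  have cl: "tgt Q b \<in> V'" if b: "b \<in> E" "src Q b \<in> V'" for b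
  proof (rule ccontr)
    assume nt: "tgt Q b \<notin> V'"
    have bE: "b \<in> arrs Q" "src Q b \<in> V" "tgt Q b \<in> V" using bspec[OF E b(1)] by auto
    then have t0: "rdim N (tgt Q b) = 0" using nt by (simp add: V'_def)
    have s: "0 < rdim N (src Q b)" using b(2) by (simp add: V'_def)
    let ?x = "unit_vec (rdim N (src Q b)) 0 :: 'k vec"
    have sv: "src Q b \<in> verts Q" and tv: "tgt Q b \<in> verts Q" using bE src_in tgt_in by auto
    have ix: "i (src Q b) *\<^sub>v ?x \<in> carrier_vec 1" using hom_app[OF ih sv unit_vec_carrier] bE by simp
    have "i (tgt Q b) *\<^sub>v (rmap N b *\<^sub>v ?x) = rmap (thin Q V E) b *\<^sub>v (i (src Q b) *\<^sub>v ?x)"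
      by (rule hom_arr_app[OF N X ih bE(1) unit_vec_carrier])
    moreover have "rmap (thin Q V E) b *\<^sub>v (i (src Q b) *\<^sub>v ?x) = i (src Q b) *\<^sub>v ?x"
      by (rule rmap_thin_app[OF b(1) bE(2,3) ix])
    moreover have "rmap N b *\<^sub>v ?x \<in> carrier_vec (rdim N (tgt Q b))"
      using mods_carrier[OF N] bE(1) by (auto simp: rep_carrier_def intro: mult_mat_vec_carrier)
    then have "i (tgt Q b) *\<^sub>v (rmap N b *\<^sub>v ?x) = 0\<^sub>v 1"
      using t0 hom_app_zero[OF ih tv] bE by (simp add: carrier_vec_0)
    ultimately have "i (src Q b) *\<^sub>v ?x = i (src Q b) *\<^sub>v 0\<^sub>v (rdim N (src Q b))"
      using hom_app_zero[OF ih sv] bE by simp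
    then have "?x = 0\<^sub>v (rdim N (src Q b))" by (rule mono_eqD[OF i sv unit_vec_carrier zero_carrier_vec])
    then show False using s by (simp add: unit_vec_nonzero)
  qed
  show h: "is_hom Q (thin Q V' E') (thin Q V E) (thin_map V' V :: 'v \<Rightarrow> 'k mat)"
    by (rule thin_map_hom) (use cl E in \<open>auto simp: E'_def V'_def\<close>)
  have sub: "V' \<subseteq> V" by (auto simp: V'_def)
  note m = thin_map_mono[OF sub h]
  show V'm: "(thin Q V' E' :: ('v, 'a, 'k) rep) \<in> mods Q" by (rule rep_of_mono[OF thin_carrier X m])
  show im: "\<forall>v\<in>verts Q. mat_range (i v) = mat_range (thin_map V' V v)"
  proof
    fix v assume v: "v \<in> verts Q"
    show "mat_range (i v) = mat_range (thin_map V' V v)"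
    proof (cases "v \<in> V'")
      case True
      then have c: "i v \<in> carrier_mat 1 (rdim N v)" "0 < rdim N v" using inj[OF v] by (auto simp: V'_def)
      then have "surj_mat (i v)" using inj_mat_one_row(2)[OF c(1) inj(1)[OF v] c(2)] by simp
      then show ?thesis using surj_mat_range[OF c(1)] thin_map_range[OF sub h v] True by simp
    next
      case False
      have r0: "rdim N v = 0"
        using False inj_mat_dim_le[OF inj(2)[OF v] inj(1)[OF v]] by (cases "v \<in> V") (auto simp: V'_def)
      then have c: "i v \<in> carrier_mat (of_bool (v \<in> V)) 0" using inj(2)[OF v] by simp
      have "mat_range (i v) = {0\<^sub>v (of_bool (v \<in> V))}"
        using mult_mat_vec_zero[OF c] c by (auto simp: mat_range_def carrier_vec_0)
      then show ?thesis using thin_map_range[OF sub h v] False by simp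
    qed
  qed
  show "retract N (thin Q V' E')" "retract (thin Q V' E') N"
    using retract_of_same_image[OF N i V'm m X] retract_of_same_image[OF V'm m N i X] im by simp_all
qed

text \<open>Dual to \<open>thin_sub_of_mono\<close>: at each vertex the kernel is zero or
  everything, and the support of a quotient is closed under predecessors along
  \<open>E\<close>.\<close>

lemma thin_quotient_of_epi:
  fixes N :: "('v, 'a, 'k::field) rep"
  assumes N: "N \<in> mods Q" and X: "(thin Q V E :: ('v, 'a, 'k) rep) \<in> mods Q" and p: "is_epi Q (thin Q V E) N p"
    and V: "V \<subseteq> verts Q" and E: "\<forall>b\<in>E. b \<in> arrs Q \<and> src Q b \<in> V \<and> tgt Q b \<in> V"
  defines "V' \<equiv> {v \<in> V. rdim N v \<noteq> 0}"
  defines "E' \<equiv> {b \<in> E. src Q b \<in> V' \<and> tgt Q b \<in> V'}"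
  shows "(thin Q V' E' :: ('v, 'a, 'k) rep) \<in> mods Q" "retract N (thin Q V' E')" "retract (thin Q V' E') N"
    "\<forall>v\<in>verts Q. mat_ker (p v) = (if v \<in> V' then {0\<^sub>v 1} else carrier_vec (of_bool (v \<in> V)))"
proof -
  note ph = epi_hom[OF p]
  have surj: "surj_mat (p v)" "p v \<in> carrier_mat (rdim N v) (of_bool (v \<in> V))" if "v \<in> verts Q" for v
    using p that hom_carrier[OF ph that] by (auto simp: is_epi_def)
  have ker: "mat_ker (p v) = (if v \<in> V' then {0\<^sub>v 1} else carrier_vec (of_bool (v \<in> V)))" if v: "v \<in> verts Q" for v
  proof (cases "v \<in> V'")
    case True
    then have c: "p v \<in> carrier_mat (rdim N v) 1" "0 < rdim N v" using surj[OF v] by (auto simp: V'_def)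
    then have "inj_mat (p v)" using surj_mat_one_col(2)[OF c(1) surj(1)[OF v] c(2)] by simp
    then have "mat_ker (p v) \<subseteq> {0\<^sub>v 1}" using inj_mat_ker[OF c(1)] by simp
    moreover have "0\<^sub>v 1 \<in> mat_ker (p v)" using mem_mat_ker[OF c(1)] mult_mat_vec_zero[OF c(1)] by simp
    ultimately have "mat_ker (p v) = {0\<^sub>v 1}" by blast
    then show ?thesis using True by simp
  next
    case False
    show ?thesis
    proof (cases "v \<in> V")
      case True
      then have c: "p v \<in> carrier_mat 0 1" using surj(2)[OF v] False by (auto simp: V'_def)
      have "p v *\<^sub>v x = 0\<^sub>v 0" if "x \<in> carrier_vec 1" for x
        using mult_mat_vec_carrier[OF c that] by (simp add: carrier_vec_0)
      then have "mat_ker (p v) = carrier_vec 1" using mem_mat_ker[OF c] by blast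
      then show ?thesis using False True by simp
    next
      case nV: False
      then have c: "p v \<in> carrier_mat (rdim N v) 0" using surj(2)[OF v] by simp
      have "mat_ker (p v) = carrier_vec 0"
        using mult_mat_vec_zero[OF c] by (auto simp: mem_mat_ker[OF c] carrier_vec_0)
      then show ?thesis using False nV by simp
    qed
  qed
  then show ker': "\<forall>v\<in>verts Q. mat_ker (p v) = (if v \<in> V' then {0\<^sub>v 1} else carrier_vec (of_bool (v \<in> V)))" by blast
  have cl: "src Q b \<in> V'" if b: "b \<in> E" "tgt Q b \<in> V'" for b
  proof (rule ccontr)
    assume ns: "src Q b \<notin> V'"
    have bE: "b \<in> arrs Q" "src Q b \<in> V" "tgt Q b \<in> V" using bspec[OF E b(1)] by auto
    then have s0: "rdim N (src Q b) = 0" using ns by (simp add: V'_def)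
    have sv: "src Q b \<in> verts Q" and tv: "tgt Q b \<in> verts Q" using bE src_in tgt_in by auto
    let ?x = "unit_vec 1 0 :: 'k vec"
    have xc: "?x \<in> carrier_vec (rdim (thin Q V E :: ('v, 'a, 'k) rep) (src Q b))" using bE by simp
    have xt: "?x \<in> carrier_vec (rdim (thin Q V E :: ('v, 'a, 'k) rep) (tgt Q b))" using bE by simp
    have "p (tgt Q b) *\<^sub>v (rmap (thin Q V E) b *\<^sub>v ?x) = rmap N b *\<^sub>v (p (src Q b) *\<^sub>v ?x)"
      by (rule hom_arr_app[OF X N ph bE(1) xc])
    moreover have "rmap (thin Q V E) b *\<^sub>v ?x = ?x"
      by (rule rmap_thin_app[OF b(1) bE(2,3) unit_vec_carrier])
    moreover have "p (src Q b) *\<^sub>v ?x = 0\<^sub>v 0"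
      using hom_app[OF ph sv xc] s0 by (simp add: carrier_vec_0)
    moreover have "rmap N b \<in> carrier_mat (rdim N (tgt Q b)) 0"
      using mods_carrier[OF N] bE(1) s0 unfolding rep_carrier_def by metis
    then have "rmap N b *\<^sub>v 0\<^sub>v 0 = 0\<^sub>v (rdim N (tgt Q b))" by (rule mult_mat_vec_zero)
    ultimately have "?x \<in> mat_ker (p (tgt Q b))" using hom_ker[OF ph tv] xt by simp
    then have "?x = 0\<^sub>v 1" using ker[OF tv] b(2) by simp
    then show False by (simp add: unit_vec_nonzero)
  qed
  have h: "is_hom Q (thin Q V E) (thin Q V' E') (thin_map V V' :: 'v \<Rightarrow> 'k mat)"
    by (rule thin_map_hom) (use cl E in \<open>auto simp: E'_def V'_def\<close>)
  have sub: "V' \<subseteq> V" by (auto simp: V'_def)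
  note e = thin_map_epi[OF sub h]
  show V'm: "(thin Q V' E' :: ('v, 'a, 'k) rep) \<in> mods Q" by (rule rep_of_epi[OF thin_carrier X e])
  have "mat_ker (p v) = mat_ker (thin_map V V' v)" if "v \<in> verts Q" for v
    using ker[OF that] thin_map_ker[OF sub h that] by simp
  then show "retract N (thin Q V' E')" "retract (thin Q V' E') N"
    using retract_of_same_kernel[OF N p V'm e X] retract_of_same_kernel[OF V'm e N p X] by simp_all
qed

end

text \<open>\<open>W\<close> stands for the strings of \<open>Pi_quiver\<close> that specialize to
  strings of A. Closure under factors keeps the summands of submodules and quotients of string
  modules inside the same family.\<close>

locale avoiding_strings = bound_quiver Q
  for Q :: "('v, 'a) bquiver" +
  fixes W :: "('v \<times> ('a \<times> bool) list) set"
  assumes quadratic: "p \<in> rels Q \<Longrightarrow> \<exists>u b c w. p = u @ [b, c] @ w \<and> [b, c] \<in> rels Q"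
    and W_string: "w \<in> W \<Longrightarrow> is_string Q w"
    and W_distinct: "w \<in> W \<Longrightarrow> distinct (word_verts Q w)"
    and W_factor: "w \<in> W \<Longrightarrow> i + n \<le> length (snd w) \<Longrightarrow> (word_verts Q w ! i, take n (drop i (snd w))) \<in> W"
begin

section \<open>String modules of self-avoiding strings\<close>

definition str_mods :: "('v, 'a, 'k::field) rep set" where
  "str_mods = string_module Q ` W"

definition vset :: "'v \<times> ('a \<times> bool) list \<Rightarrow> 'v set" where
  "vset w = set (word_verts Q w)"

definition eset :: "'v \<times> ('a \<times> bool) list \<Rightarrow> 'a set" where
  "eset w = fst ` set (snd w)"

text \<open>\<open>U\<close> may consist of several separate stretches of \<open>w\<close>; the
  module is then the direct sum of the string modules of these stretches.\<close>

definition res :: "'v \<times> ('a \<times> bool) list \<Rightarrow> 'v set \<Rightarrow> ('v, 'a, 'k::field) rep" where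
  "res w U = thin Q U {b \<in> eset w. src Q b \<in> U \<and> tgt Q b \<in> U}"

lemma vset_verts: "w \<in> W \<Longrightarrow> vset w \<subseteq> verts Q"
proof
  fix v assume w: "w \<in> W" and "v \<in> vset w"
  then obtain k where k: "k < Suc (length (snd w))" "v = word_verts Q w ! k"
    unfolding vset_def by (metis in_set_conv_nth length_word_verts)
  show "v \<in> verts Q"
  proof (cases k)
    case 0
    then show ?thesis using W_string[OF w] k by (auto simp: is_string_def Let_def word_verts_def)
  next
    case (Suc m)
    then have m: "m < length (snd w)" using k by simp
    note l = string_letter[OF W_string[OF w] m]
    show ?thesis
      using l(2,3) src_in[OF l(1)] tgt_in[OF l(1)] k(2) Suc by (cases "snd (snd w ! m)") simp_all
  qed
qed

lemma eset_nth: "b \<in> eset w \<longleftrightarrow> (\<exists>k<length (snd w). b = fst (snd w ! k))"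
  unfolding eset_def by (metis (no_types, lifting) image_iff in_set_conv_nth)

lemma eset_ends:
  assumes w: "w \<in> W" and b: "b \<in> eset w"
  shows "b \<in> arrs Q" "src Q b \<in> vset w" "tgt Q b \<in> vset w"
proof -
  obtain k where k: "k < length (snd w)" "b = fst (snd w ! k)" using b eset_nth by blast
  have "word_verts Q w ! k \<in> vset w" "word_verts Q w ! Suc k \<in> vset w"
    using k(1) unfolding vset_def by (auto intro!: nth_mem)
  then show "b \<in> arrs Q" "src Q b \<in> vset w" "tgt Q b \<in> vset w"
    using string_letter[OF W_string[OF w] k(1)] k(2) by (auto split: if_splits)
qed

lemma vset_nonempty: "vset w \<noteq> {}"
  by (simp add: vset_def word_verts_def)

text \<open>As no vertex is repeated, every occurrence has index 0 among the basis vectors at its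
  vertex.\<close>

lemma string_module_thin:
  assumes w: "w \<in> W"
  shows "string_module Q w = thin Q (vset w) (eset w)"
proof -
  let ?xs = "word_verts Q w" and ?ws = "snd w"
  note dist = W_distinct[OF w]
  have dm: "length (filter (\<lambda>u. u = v) ?xs) = of_bool (v \<in> vset w)" for v
    unfolding vset_def by (rule length_filter_eq_distinct[OF dist])
  have idx: "length (filter (\<lambda>u. u = ?xs ! j) (take j ?xs)) = 0" if j: "j < length ?xs" for j
  proof -
    have "?xs ! j \<notin> set (take j ?xs)"
      using dist j by (auto simp: in_set_conv_nth nth_eq_iff_index_eq)
    then show ?thesis by (auto simp: filter_empty_conv)
  qed
  have key: "(\<exists>i<length ?ws. fst (?ws ! i) = a \<and>
      (if snd (?ws ! i) then r = length (filter (\<lambda>u. u = ?xs ! Suc i) (take (Suc i) ?xs)) \<and> c = length (filter (\<lambda>u. u = ?xs ! i) (take i ?xs))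
       else r = length (filter (\<lambda>u. u = ?xs ! i) (take i ?xs)) \<and> c = length (filter (\<lambda>u. u = ?xs ! Suc i) (take (Suc i) ?xs))))
    \<longleftrightarrow> r = 0 \<and> c = 0 \<and> a \<in> eset w" for a r c
  proof -
    have "i < length ?ws \<Longrightarrow> (if snd (?ws ! i) then r = length (filter (\<lambda>u. u = ?xs ! Suc i) (take (Suc i) ?xs)) \<and> c = length (filter (\<lambda>u. u = ?xs ! i) (take i ?xs))
       else r = length (filter (\<lambda>u. u = ?xs ! i) (take i ?xs)) \<and> c = length (filter (\<lambda>u. u = ?xs ! Suc i) (take (Suc i) ?xs)))
       \<longleftrightarrow> r = 0 \<and> c = 0" for i
      using idx[of i] idx[of "Suc i"] by simp
    then show ?thesis unfolding eset_nth by blast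
  qed
  show ?thesis
    unfolding string_module_def Let_def dm key thin_def
    by (auto intro!: ext eq_matI simp: of_bool_def split: if_splits)
qed

lemma word_verts_eqD:
  assumes "w \<in> W" "word_verts Q w ! m = word_verts Q w ! n" "m \<le> length (snd w)" "n \<le> length (snd w)"
  shows "m = n"
  using W_distinct[OF assms(1)] assms(2-4) by (simp add: nth_eq_iff_index_eq)

text \<open>The thin description forgets which letters are neighbours. Since the vertices are
  distinct, composable letters are neighbours with the same direction, and there the string
  condition applies.\<close>

lemma no_rel_eset:
  assumes w: "w \<in> W" and bc: "b \<in> eset w" "c \<in> eset w"
  shows "[b, c] \<notin> rels Q"
proof
  assume r: "[b, c] \<in> rels Q"
  note s = W_string[OF w]
  obtain m where m: "m < length (snd w)" "b = fst (snd w ! m)" using bc eset_nth by blast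
  obtain n where n: "n < length (snd w)" "c = fst (snd w ! n)" using bc eset_nth by blast
  have eq: "tgt Q (fst (snd w ! m)) = src Q (fst (snd w ! n))" using rels_path[OF r] m n by (auto simp: is_path_def)
  note l = string_letter(3)[OF s m(1)] string_letter(2)[OF s n(1)]
  consider "snd (snd w ! m)" "snd (snd w ! n)" | "snd (snd w ! m)" "\<not> snd (snd w ! n)"
    | "\<not> snd (snd w ! m)" "snd (snd w ! n)" | "\<not> snd (snd w ! m)" "\<not> snd (snd w ! n)" by blast
  then show False
  proof cases
    case 1
    then have "Suc m = n" using word_verts_eqD[OF w, of "Suc m" n] eq l m(1) n(1) by simp
    then show False using string_no_rel[OF s, of m] 1 r m n by auto
  next
    case 2
    then have "m = n" using word_verts_eqD[OF w, of "Suc m" "Suc n"] eq l m(1) n(1) by simp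
    then show False using 2 by simp
  next
    case 3
    then have "m = n" using word_verts_eqD[OF w, of m n] eq l m(1) n(1) by simp
    then show False using 3 by simp
  next
    case 4
    then have "m = Suc n" using word_verts_eqD[OF w, of m "Suc n"] eq l m(1) n(1) by simp
    then show False using string_no_rel_inv[OF s, of n] 4 r m n by auto
  qed
qed

lemma string_module_mods: "w \<in> W \<Longrightarrow> (string_module Q w :: ('v, 'a, 'k::field) rep) \<in> mods Q"
  unfolding string_module_thin
proof (rule mods_of_quadratic[OF quadratic thin_carrier])
  fix b c assume w: "w \<in> W" and r: "[b, c] \<in> rels Q"
  have "b \<notin> eset w \<or> c \<notin> eset w" using no_rel_eset[OF w] r by blast
  moreover have "tgt Q b = src Q c" using rels_path[OF r] by (auto simp: is_path_def)
  ultimately show "rmap (thin Q (vset w) (eset w)) c * rmap (thin Q (vset w) (eset w)) b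
    = 0\<^sub>m (rdim (thin Q (vset w) (eset w) :: ('v, 'a, 'k) rep) (tgt Q c)) (rdim (thin Q (vset w) (eset w) :: ('v, 'a, 'k) rep) (src Q b))"
    by (intro eq_matI) (auto simp: thin_def scalar_prod_def)
qed

lemma str_mods_mods: "str_mods \<subseteq> mods Q"
  using string_module_mods by (auto simp: str_mods_def)

text \<open>Each component is a scalar, and every letter acts as 1, so the scalars at its two ends
  agree.\<close>

lemma scalar_endos_string:
  assumes w: "w \<in> W"
  shows "scalar_endos (string_module Q w :: ('v, 'a, 'k::field) rep)"
  unfolding scalar_endos_def
proof (intro allI impI)
  let ?M = "string_module Q w :: ('v, 'a, 'k) rep" and ?xs = "word_verts Q w"
  fix f assume f: "is_hom Q ?M ?M f"
  have rd: "rdim ?M v = of_bool (v \<in> vset w)" for v by (simp add: string_module_thin[OF w])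
  have fc: "f v \<in> carrier_mat 1 1" if "v \<in> vset w" for v
    using hom_carrier[OF f, of v] that vset_verts[OF w] by (auto simp: rd)
  have step: "f (?xs ! Suc k) $$ (0, 0) = f (?xs ! k) $$ (0, 0)" if k: "k < length (snd w)" for k
  proof -
    let ?b = "fst (snd w ! k)"
    have b: "?b \<in> eset w" using k eset_nth by blast
    note e = eset_ends[OF w b]
    have one: "rmap ?M ?b = 1\<^sub>m 1"
      using e b by (intro eq_matI) (auto simp: string_module_thin[OF w] thin_def)
    have "f (tgt Q ?b) = f (src Q ?b)"
      using hom_arr[OF f e(1)] unfolding one left_mult_one_mat[OF fc[OF e(2)]] right_mult_one_mat[OF fc[OF e(3)]] .
    then show ?thesis using string_letter(2,3)[OF W_string[OF w] k] by (auto split: if_splits)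
  qed
  have const: "f (?xs ! k) $$ (0, 0) = f (?xs ! 0) $$ (0, 0)" if "k \<le> length (snd w)" for k
    using that by (induction k) (simp_all add: step)
  have c: "f v $$ (0, 0) = f (?xs ! 0) $$ (0, 0)" if "v \<in> vset w" for v
  proof -
    obtain k where "k < length ?xs" "v = ?xs ! k" using \<open>v \<in> vset w\<close> unfolding vset_def in_set_conv_nth by blast
    then show ?thesis using const[of k] by simp
  qed
  show "\<exists>c. \<forall>v\<in>verts Q. \<forall>x\<in>carrier_vec (rdim ?M v). f v *\<^sub>v x = c \<cdot>\<^sub>v x"
  proof (intro exI ballI)
    fix v and x :: "'k vec" assume v: "v \<in> verts Q" and x: "x \<in> carrier_vec (rdim ?M v)"
    show "f v *\<^sub>v x = f (?xs ! 0) $$ (0, 0) \<cdot>\<^sub>v x"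
    proof (cases "v \<in> vset w")
      case True
      then show ?thesis using c[OF True] fc[OF True] x by (intro eq_vecI) (auto simp: rd scalar_prod_def)
    next
      case False
      then show ?thesis using hom_carrier[OF f v] x by (intro eq_vecI) (auto simp: rd)
    qed
  qed
qed

lemma scalar_endos_str_mods: "\<forall>M\<in>str_mods. scalar_endos M"
  using scalar_endos_string by (auto simp: str_mods_def)

text \<open>\<open>u\<close> is the first maximal stretch of consecutive positions of
  \<open>w\<close> whose vertices lie in \<open>U\<close>. By maximality and the absence of repeated
  vertices, no letter with both ends in \<open>U\<close> joins \<open>u\<close> to the rest of
  \<open>U\<close>.\<close>

lemma first_run:
  assumes w: "w \<in> W" and U: "U \<subseteq> vset w" "U \<noteq> {}"
  obtains u where "u \<in> W" "vset u \<subseteq> U" "eset u = {b \<in> eset w. src Q b \<in> vset u \<and> tgt Q b \<in> vset u}"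
    "\<forall>b\<in>eset w. src Q b \<in> U \<and> tgt Q b \<in> U \<longrightarrow> (src Q b \<in> vset u \<longleftrightarrow> tgt Q b \<in> vset u)"
proof -
  let ?xs = "word_verts Q w" and ?L = "length (snd w)"
  define A where "A i \<longleftrightarrow> i \<le> ?L \<and> ?xs ! i \<in> U" for i
  have "\<exists>i. A i"
  proof -
    obtain v where v: "v \<in> U" using U by blast
    then have "v \<in> set ?xs" using U by (auto simp: vset_def)
    then obtain k where "k < length ?xs" "v = ?xs ! k" unfolding in_set_conv_nth by blast
    then show ?thesis using v unfolding A_def by (intro exI[of _ k]) auto
  qed
  define i where "i = (LEAST i. A i)"
  have Ai: "A i" unfolding i_def by (rule LeastI_ex[OF \<open>\<exists>i. A i\<close>])
  have i_min: "i \<le> k" if "A k" for k unfolding i_def using that by (rule Least_le)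
  define n where "n = (LEAST n. \<not> A (i + n))"
  have ex: "\<exists>n. \<not> A (i + n)" by (rule exI[of _ "Suc ?L"]) (simp add: A_def)
  have An: "\<not> A (i + n)" unfolding n_def by (rule LeastI_ex[OF ex])
  have n_min: "A (i + k)" if "k < n" for k using that not_less_Least unfolding n_def by blast
  have n0: "0 < n" using An Ai by (cases n) auto
  have le: "i + (n - 1) \<le> ?L" using n_min[of "n - 1"] n0 by (auto simp: A_def)
  \<comment> \<open>\<open>n\<close> counts the vertices of the stretch, which therefore has
    \<open>n - 1\<close> letters.\<close>
  define u where "u = (?xs ! i, take (n - 1) (drop i (snd w)))"
  have u: "u \<in> W" unfolding u_def by (rule W_factor[OF w le])
  have "drop i ?xs = ?xs ! i # drop (Suc i) ?xs" using le by (intro Cons_nth_drop_Suc[symmetric]) simp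
  then have "take n (drop i ?xs) = ?xs ! i # take (n - 1) (drop (Suc i) ?xs)" using n0 by (cases n) auto
  then have wv: "word_verts Q u = take n (drop i ?xs)" by (simp add: u_def word_verts_def take_map drop_map)
  have vu: "v \<in> vset u \<longleftrightarrow> (\<exists>k. i \<le> k \<and> k < i + n \<and> v = ?xs ! k)" for v
  proof
    assume "v \<in> vset u"
    then obtain k where "k < n" "k < length (drop i ?xs)" "v = drop i ?xs ! k"
      unfolding vset_def wv in_set_conv_nth by auto
    then show "\<exists>k. i \<le> k \<and> k < i + n \<and> v = ?xs ! k" using le by (intro exI[of _ "i + k"]) auto
  next
    assume "\<exists>k. i \<le> k \<and> k < i + n \<and> v = ?xs ! k"
    then obtain k where k: "i \<le> k" "k < i + n" "v = ?xs ! k" by blast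
    then show "v \<in> vset u"
      unfolding vset_def wv in_set_conv_nth using le by (intro exI[of _ "k - i"]) auto
  qed
  have vk: "?xs ! k \<in> vset u \<longleftrightarrow> i \<le> k \<and> k < i + n" if k: "k \<le> ?L" for k
  proof
    assume "?xs ! k \<in> vset u"
    then obtain l where l: "i \<le> l" "l < i + n" "?xs ! k = ?xs ! l" using vu by blast
    have "l \<le> ?L" using l(2) le by simp
    then show "i \<le> k \<and> k < i + n" using word_verts_eqD[OF w l(3) k] l(1,2) by simp
  qed (use vu in blast)
  have eu: "b \<in> eset u \<longleftrightarrow> (\<exists>k. i \<le> k \<and> Suc k < i + n \<and> b = fst (snd w ! k))" for b
  proof
    assume "b \<in> eset u"
    then obtain k where "k < n - 1" "i + k < ?L" "b = fst (snd w ! (i + k))"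
      unfolding eset_nth u_def using le by auto
    then show "\<exists>k. i \<le> k \<and> Suc k < i + n \<and> b = fst (snd w ! k)" by (intro exI[of _ "i + k"]) auto
  next
    assume "\<exists>k. i \<le> k \<and> Suc k < i + n \<and> b = fst (snd w ! k)"
    then obtain k where "i \<le> k" "Suc k < i + n" "b = fst (snd w ! k)" by blast
    then show "b \<in> eset u" unfolding eset_nth u_def using le by (intro exI[of _ "k - i"]) auto
  qed
  have both: "src Q (fst (snd w ! k)) \<in> S \<and> tgt Q (fst (snd w ! k)) \<in> S \<longleftrightarrow> ?xs ! k \<in> S \<and> ?xs ! Suc k \<in> S"
    "(src Q (fst (snd w ! k)) \<in> S \<longleftrightarrow> tgt Q (fst (snd w ! k)) \<in> S) \<longleftrightarrow> (?xs ! k \<in> S \<longleftrightarrow> ?xs ! Suc k \<in> S)"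
    if "k < ?L" for k S using string_letter(2,3)[OF W_string[OF w] that] by auto
  show thesis
  proof (rule that[OF u])
    show "vset u \<subseteq> U"
    proof
      fix v assume "v \<in> vset u"
      then obtain k where "i \<le> k" "k < i + n" "v = ?xs ! k" using vu by blast
      then show "v \<in> U" using n_min[of "k - i"] by (auto simp: A_def)
    qed
    show "eset u = {b \<in> eset w. src Q b \<in> vset u \<and> tgt Q b \<in> vset u}"
    proof (intro equalityI subsetI)
      fix b assume "b \<in> eset u"
      then obtain k where k: "i \<le> k" "Suc k < i + n" "b = fst (snd w ! k)" using eu by blast
      then have kL: "k < ?L" using le by simp
      then have "b \<in> eset w" using k eset_nth by blast
      then show "b \<in> {b \<in> eset w. src Q b \<in> vset u \<and> tgt Q b \<in> vset u}"
        using both(1)[OF kL, of "vset u"] vk[of k] vk[of "Suc k"] k kL by simp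
    next
      fix b assume b: "b \<in> {b \<in> eset w. src Q b \<in> vset u \<and> tgt Q b \<in> vset u}"
      then obtain k where k: "k < ?L" "b = fst (snd w ! k)" using eset_nth by blast
      then have "i \<le> k \<and> Suc k < i + n"
        using both(1)[OF k(1), of "vset u"] vk[of k] vk[of "Suc k"] b by simp
      then show "b \<in> eset u" using eu k by blast
    qed
    show "\<forall>b\<in>eset w. src Q b \<in> U \<and> tgt Q b \<in> U \<longrightarrow> (src Q b \<in> vset u \<longleftrightarrow> tgt Q b \<in> vset u)"
    proof (intro ballI impI)
      fix b assume "b \<in> eset w" and bU: "src Q b \<in> U \<and> tgt Q b \<in> U"
      then obtain k where k: "k < ?L" "b = fst (snd w ! k)" using eset_nth by blast
      have A: "A k" "A (Suc k)" using both(1)[OF k(1), of U] bU k by (auto simp: A_def)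
      have "k \<noteq> i + n" "Suc k \<noteq> i + n" using An A by metis+
      then have "?xs ! k \<in> vset u \<longleftrightarrow> ?xs ! Suc k \<in> vset u"
        using vk[of k] vk[of "Suc k"] k(1) i_min[OF A(1)] by auto
      then show "src Q b \<in> vset u \<longleftrightarrow> tgt Q b \<in> vset u" using both(2)[OF k(1)] k(2) by simp
    qed
  qed
qed

section \<open>Strings as extensions of shorter strings\<close>

lemma total_dim_string: "w \<in> W \<Longrightarrow> total_dim Q (string_module Q w :: ('v, 'a, 'k::field) rep) = card (vset w)"
  by (simp add: total_dim_thin vset_verts string_module_thin)

text \<open>The first stretch of \<open>U\<close> splits off. It and the rest are retracts, hence in
  \<open>C\<close>; the stretch is a string module of dimension at most the size of \<open>U\<close>
  and passes to \<open>C'\<close> by hypothesis, the rest passes by induction, and their extension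
  follows.\<close>

lemma res_in:
  fixes C :: "('v, 'a, 'k::field) rep set"
  assumes C: "summand_ext_closed C" and C': "summand_ext_closed C'" and w: "w \<in> W"
  shows "U \<subseteq> vset w \<Longrightarrow> res w U \<in> C \<Longrightarrow>
    (\<And>Y. Y \<in> str_mods \<Longrightarrow> Y \<in> C \<Longrightarrow> total_dim Q Y \<le> card U \<Longrightarrow> Y \<in> C') \<Longrightarrow> res w U \<in> C'"
proof (induction "card U" arbitrary: U rule: less_induct)
  case less
  have resm: "(res w U :: ('v, 'a, 'k) rep) \<in> mods Q" using less.prems(2) summand_ext_closedD(1)[OF C] by blast
  show ?case
  proof (cases "U = {}")
    case True
    then have "is_zero_rep Q (res w U :: ('v, 'a, 'k) rep)" by (simp add: is_zero_rep_def res_def)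
    then show ?thesis using summand_ext_closedD(2)[OF C' resm] by simp
  next
    case False
    obtain u where u: "u \<in> W" "vset u \<subseteq> U" "eset u = {b \<in> eset w. src Q b \<in> vset u \<and> tgt Q b \<in> vset u}"
      "\<forall>b\<in>eset w. src Q b \<in> U \<and> tgt Q b \<in> U \<longrightarrow> (src Q b \<in> vset u \<longleftrightarrow> tgt Q b \<in> vset u)"
      by (rule first_run[OF w less.prems(1) False])
    let ?V = "vset u" and ?U = "U - vset u"
    have finU: "finite U" using less.prems(1) by (rule finite_subset) (simp add: vset_def)
    have sm: "res w ?V = (string_module Q u :: ('v, 'a, 'k) rep)"
      unfolding res_def string_module_thin[OF u(1)] u(3)[symmetric] ..
    have h: "is_hom Q (res w ?V :: ('v, 'a, 'k) rep) (res w U) (thin_map ?V U)"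
      "is_hom Q (res w U :: ('v, 'a, 'k) rep) (res w ?V) (thin_map U ?V)"
      "is_hom Q (res w ?U :: ('v, 'a, 'k) rep) (res w U) (thin_map ?U U)"
      "is_hom Q (res w U :: ('v, 'a, 'k) rep) (res w ?U) (thin_map U ?U)"
      unfolding res_def by (rule thin_map_hom; use u(2,4) in blast)+
    note m1 = thin_map_mono[OF u(2) h(1)[unfolded res_def], folded res_def]
    note m2 = thin_map_mono[OF Diff_subset h(3)[unfolded res_def], folded res_def]
    note e2 = thin_map_epi[OF Diff_subset h(4)[unfolded res_def], folded res_def]
    have c: "rep_carrier (res w S :: ('v, 'a, 'k) rep)" for S unfolding res_def by (rule thin_carrier)
    have m: "(res w ?V :: ('v, 'a, 'k) rep) \<in> mods Q" "(res w ?U :: ('v, 'a, 'k) rep) \<in> mods Q"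
      by (rule rep_of_mono[OF c resm m1], rule rep_of_mono[OF c resm m2])
    note r1 = thin_map_retract[OF u(2) h(1,2)[unfolded res_def], folded res_def]
    note r2 = thin_map_retract[OF Diff_subset h(3,4)[unfolded res_def], folded res_def]
    have inC: "(res w ?V :: ('v, 'a, 'k) rep) \<in> C" "(res w ?U :: ('v, 'a, 'k) rep) \<in> C"
      by (rule summand_ext_closedD(3)[OF C m(1) less.prems(2) r1], rule summand_ext_closedD(3)[OF C m(2) less.prems(2) r2])
    have V: "res w ?V \<in> C'"
      using less.prems(3)[of "string_module Q u"] inC(1) u(1) card_mono[OF finU u(2)]
      by (simp add: sm str_mods_def total_dim_string)
    have card: "card ?U < card U"
      using finU u(2) vset_nonempty[of u] by (intro psubset_card_mono) auto
    have U': "res w ?U \<in> C'"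
    proof (rule less.hyps[OF card _ inC(2)])
      show "?U \<subseteq> vset w" using less.prems(1) by blast
      show "Y \<in> C'" if "Y \<in> str_mods" "Y \<in> C" "total_dim Q Y \<le> card ?U" for Y
        using less.prems(3)[OF that(1,2)] that(3) card by simp
    qed
    have "mat_range (thin_map ?V U v :: 'k mat) = mat_ker (thin_map U ?U v)" if v: "v \<in> verts Q" for v
      unfolding thin_map_range[OF u(2) h(1)[unfolded res_def] v] thin_map_ker[OF Diff_subset h(4)[unfolded res_def] v]
      using u(2) by (cases "v \<in> U"; cases "v \<in> ?V") (auto simp: carrier_vec_0)
    then show ?thesis
      using ext_closedD[OF _ V U' resm m1 e2] C' by (simp add: summand_ext_closed_def)
  qed
qed

text \<open>The induction step shared by torsion classes and wide subcategories. A map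
  \<open>h\<close> to \<open>X\<close> that is neither zero nor surjective cuts \<open>X\<close>
  into its image and its cokernel, both nonzero and in \<open>C\<close>. They live on complementary
  vertex sets, so they are sums of shorter strings, and \<open>X\<close> is an extension of
  them.\<close>

lemma string_ext_in:
  fixes X :: "('v, 'a, 'k::field) rep"
  assumes C: "summand_ext_closed C" and C': "summand_ext_closed C'" and X: "X \<in> str_mods"
    and small: "\<And>Y. Y \<in> str_mods \<Longrightarrow> Y \<in> C \<Longrightarrow> total_dim Q Y < total_dim Q X \<Longrightarrow> Y \<in> C'"
    and Z: "Z \<in> mods Q" and h: "is_hom Q Z X h" and nz: "\<not> zero_hom Z X h" and ne: "\<not> is_epi Q Z X h"
    and sub: "sub_in C X (\<lambda>v. mat_range (h v))"
    and quot: "\<And>M p. M \<in> mods Q \<Longrightarrow> is_epi Q X M p \<Longrightarrow> \<forall>v\<in>verts Q. mat_range (h v) = mat_ker (p v) \<Longrightarrow> M \<in> C"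
  shows "X \<in> C'"
proof -
  obtain w where w: "w \<in> W" "X = string_module Q w" using X by (auto simp: str_mods_def)
  have Xt: "X = thin Q (vset w) (eset w)" using w string_module_thin by simp
  have Xm: "X \<in> mods Q" using X str_mods_mods by blast
  have E: "\<forall>b\<in>eset w. b \<in> arrs Q \<and> src Q b \<in> vset w \<and> tgt Q b \<in> vset w"
    using eset_ends[OF w(1)] by blast
  note V = vset_verts[OF w(1)]
  note sr = subrep_range[OF Z Xm h]
  obtain N i where N: "N \<in> mods Q" "N \<in> C" "is_mono Q N X i" "has_image i (\<lambda>v. mat_range (h v))"
    by (rule sub_inE[OF sub Xm sr])
  obtain M p where M: "M \<in> mods Q" "is_epi Q X M p" "has_kernel p (\<lambda>v. mat_range (h v))"
    using quotient_exists[OF Xm sr] by blast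
  have hp: "\<forall>v\<in>verts Q. mat_range (h v) = mat_ker (p v)" using M(3) by (simp add: has_kernel_def)
  have MC: "M \<in> C" by (rule quot[OF M(1,2) hp])
  let ?V1 = "{v \<in> vset w. rdim N v \<noteq> 0}" and ?V2 = "{v \<in> vset w. rdim M v \<noteq> 0}"
  note s = thin_sub_of_mono[OF N(1) Xm[unfolded Xt] N(3)[unfolded Xt] V E, folded res_def]
  note q = thin_quotient_of_epi[OF M(1) Xm[unfolded Xt] M(2)[unfolded Xt] V E, folded res_def]
  have range: "mat_range (h v) = (if v \<in> ?V1 then carrier_vec 1 else {0\<^sub>v (of_bool (v \<in> vset w))})"
    if v: "v \<in> verts Q" for v
  proof -
    have "mat_range (h v) = mat_range (i v)" using N(4) v by (simp add: has_image_def)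
    also have "\<dots> = mat_range (thin_map ?V1 (vset w) v)" by (rule bspec[OF s(5) v])
    also have "\<dots> = (if v \<in> ?V1 then carrier_vec 1 else {0\<^sub>v (of_bool (v \<in> vset w))})"
      by (rule thin_map_range[OF _ s(1)[unfolded res_def] v]) blast
    finally show ?thesis .
  qed
  have ker: "mat_range (h v) = (if v \<in> ?V2 then {0\<^sub>v 1} else carrier_vec (of_bool (v \<in> vset w)))"
    if v: "v \<in> verts Q" for v using q(4) hp v by simp
  have one: "carrier_vec 1 \<noteq> {0\<^sub>v 1 :: 'k vec}"
  proof
    assume eq: "carrier_vec 1 = {0\<^sub>v 1 :: 'k vec}"
    have "(unit_vec 1 0 :: 'k vec) \<in> carrier_vec 1" by (rule unit_vec_carrier)
    also note eq
    finally show False by (simp add: unit_vec_nonzero)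
  qed
  have flip: "P \<longleftrightarrow> \<not> R" if "(if P then A else B) = (if R then B else A)" "A \<noteq> B" for P R and A B :: "'k vec set"
    using that by (cases P; cases R) simp_all
  \<comment> \<open>At a vertex of the string the image of \<open>h\<close> is zero or the whole
    line, and it is both the subspace \<open>N\<close> and the kernel of the map to
    \<open>M\<close>.\<close>
  have compl: "v \<in> ?V1 \<longleftrightarrow> v \<notin> ?V2" if v: "v \<in> vset w" for v
  proof (rule flip[OF _ one])
    have vv: "v \<in> verts Q" using v V by blast
    have b: "of_bool (v \<in> vset w) = (1 :: nat)" using v by simp
    show "(if v \<in> ?V1 then carrier_vec 1 else {0\<^sub>v 1 :: 'k vec}) = (if v \<in> ?V2 then {0\<^sub>v 1} else carrier_vec 1)"
      by (rule trans[OF range[OF vv, symmetric] ker[OF vv], unfolded b])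
  qed
  have V1: "?V1 \<noteq> {}"
  proof
    assume e: "?V1 = {}"
    have "zero_hom Z X h"
      unfolding zero_hom_def
    proof (intro ballI)
      fix v and z :: "'k vec" assume v: "v \<in> verts Q" and z: "z \<in> carrier_vec (rdim Z v)"
      have "h v *\<^sub>v z \<in> mat_range (h v)" using hom_range[OF h v] z by blast
      moreover have "v \<notin> ?V1" using e by blast
      ultimately have "h v *\<^sub>v z \<in> {0\<^sub>v (of_bool (v \<in> vset w))}" unfolding range[OF v] by metis
      then show "h v *\<^sub>v z = 0\<^sub>v (rdim X v)" by (simp add: Xt)
    qed
    then show False using nz by simp
  qed
  have V2: "?V2 \<noteq> {}"
  proof
    assume e: "?V2 = {}"
    have "is_epi Q Z X h"
    proof (rule epiI[OF h])
      fix v and y :: "'k vec" assume v: "v \<in> verts Q" and y: "y \<in> carrier_vec (rdim X v)"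
      have "v \<notin> ?V2" using e by blast
      then have "y \<in> mat_range (h v)" using y unfolding ker[OF v] Xt rdim_thin by metis
      then obtain x where "x \<in> carrier_vec (rdim Z v)" "y = h v *\<^sub>v x" using hom_range[OF h v] by blast
      then show "\<exists>x\<in>carrier_vec (rdim Z v). h v *\<^sub>v x = y" by blast
    qed
    then show False using ne by simp
  qed
  have fin: "finite (vset w)" by (simp add: vset_def)
  have card: "card ?V1 < card (vset w)" "card ?V2 < card (vset w)"
    using V1 V2 compl by (intro psubset_card_mono[OF fin]; blast)+
  have dX: "total_dim Q X = card (vset w)" using total_dim_string[OF w(1)] w(2) by simp
  have "res w ?V1 \<in> C" "res w ?V2 \<in> C"
    by (rule summand_ext_closedD(3)[OF C s(2) N(2) s(4)], rule summand_ext_closedD(3)[OF C q(1) MC q(3)])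
  then have "res w ?V1 \<in> C'" "res w ?V2 \<in> C'"
  proof -
    have s: "Y \<in> C'" if "Y \<in> str_mods" "Y \<in> C" "total_dim Q Y \<le> card U" "card U < card (vset w)" for Y and U :: "'v set"
      using small[OF that(1,2)] that(3,4) dX by simp
    assume a: "res w ?V1 \<in> C" "res w ?V2 \<in> C"
    show "res w ?V1 \<in> C'" by (rule res_in[OF C C' w(1) _ a(1)]) (use s card(1) in blast)+
    show "res w ?V2 \<in> C'" by (rule res_in[OF C C' w(1) _ a(2)]) (use s card(2) in blast)+
  qed
  then have "N \<in> C'" "M \<in> C'"
    by - (rule summand_ext_closedD(3)[OF C' N(1) _ s(3)], assumption, rule summand_ext_closedD(3)[OF C' M(1) _ q(2)])
  then show ?thesis
    using ext_closedD[OF _ _ _ Xm N(3) M(2)] N(4) hp C' by (simp add: summand_ext_closed_def has_image_def)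
qed

end

section \<open>Semibricks\<close>

context bound_quiver
begin

section \<open>Generated torsion classes and wide subcategories\<close>

lemma torsion_class_mods: "torsion_class Q (mods Q)"
  unfolding torsion_class_def quot_closed_def ext_closed_def using zero_rep_mods by blast

lemma wide_subcat_mods: "wide_subcat Q (mods Q)"
  unfolding wide_subcat_def iso_closed_def ker_closed_def coker_closed_def ext_closed_def
  using zero_rep_mods by blast

lemma torsion_class_Inter:
  assumes "\<T> \<noteq> {}" and T: "\<And>T. T \<in> \<T> \<Longrightarrow> torsion_class Q (T :: ('v, 'a, 'k::field) rep set)"
  shows "torsion_class Q (\<Inter>\<T>)"
  unfolding torsion_class_def
proof (intro conjI)
  show "\<Inter>\<T> \<subseteq> mods Q" using assms torsion_classD(1) by blast
  show "\<Inter>\<T> \<noteq> {}" using torsion_classD(4)[OF T zero_rep_mods is_zero_zero_rep] by blast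
  show "quot_closed Q (\<Inter>\<T>)" using T unfolding torsion_class_def quot_closed_def by blast
  show "ext_closed Q (\<Inter>\<T>)" using T unfolding torsion_class_def ext_closed_def by blast
qed

lemma wide_subcat_Inter:
  assumes "\<W> \<noteq> {}" and W: "\<And>W. W \<in> \<W> \<Longrightarrow> wide_subcat Q (W :: ('v, 'a, 'k::field) rep set)"
  shows "wide_subcat Q (\<Inter>\<W>)"
  unfolding wide_subcat_def
proof (intro conjI)
  show "\<Inter>\<W> \<subseteq> mods Q" using assms unfolding wide_subcat_def by blast
  show "\<Inter>\<W> \<noteq> {}"
    using summand_ext_closedD(2)[OF wide_summand_ext_closed[OF W] zero_rep_mods is_zero_zero_rep] by blast
  show "iso_closed Q (\<Inter>\<W>)" using W unfolding wide_subcat_def iso_closed_def by blast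
  show "ker_closed Q (\<Inter>\<W>)"
    unfolding ker_closed_def
  proof (intro ballI allI impI InterI)
    fix X Y K :: "('v, 'a, 'k) rep" and h i and A
    assume "X \<in> \<Inter>\<W>" "Y \<in> \<Inter>\<W>" "is_hom Q X Y h" "K \<in> mods Q"
      "is_mono Q K X i \<and> (\<forall>v\<in>verts Q. exact_mat (i v) (h v))" and A: "A \<in> \<W>"
    moreover have "ker_closed Q A" using W[OF A] by (simp add: wide_subcat_def)
    ultimately show "K \<in> A" unfolding ker_closed_def by blast
  qed
  show "coker_closed Q (\<Inter>\<W>)"
    unfolding coker_closed_def
  proof (intro ballI allI impI InterI)
    fix X Y K :: "('v, 'a, 'k) rep" and h p and A
    assume "X \<in> \<Inter>\<W>" "Y \<in> \<Inter>\<W>" "is_hom Q X Y h" "K \<in> mods Q"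
      "is_epi Q Y K p \<and> (\<forall>v\<in>verts Q. exact_mat (h v) (p v))" and A: "A \<in> \<W>"
    moreover have "coker_closed Q A" using W[OF A] by (simp add: wide_subcat_def)
    ultimately show "K \<in> A" unfolding coker_closed_def by blast
  qed
  show "ext_closed Q (\<Inter>\<W>)"
    unfolding ext_closed_def
  proof (intro ballI allI impI InterI)
    fix X Z Y :: "('v, 'a, 'k) rep" and f g and A
    assume "X \<in> \<Inter>\<W>" "Z \<in> \<Inter>\<W>" "Y \<in> mods Q" "short_exact Q X Y Z f g" and A: "A \<in> \<W>"
    moreover have "ext_closed Q A" using W[OF A] by (simp add: wide_subcat_def)
    ultimately show "Y \<in> A" unfolding ext_closed_def by blast
  qed
qed

definition tors_gen :: "('v, 'a, 'k::field) rep set \<Rightarrow> ('v, 'a, 'k) rep set" where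
  "tors_gen S = \<Inter>{T. torsion_class Q T \<and> S \<subseteq> T}"

definition wide_gen :: "('v, 'a, 'k::field) rep set \<Rightarrow> ('v, 'a, 'k) rep set" where
  "wide_gen S = \<Inter>{W. wide_subcat Q W \<and> S \<subseteq> W}"

lemma torsion_tors_gen: "S \<subseteq> mods Q \<Longrightarrow> torsion_class Q (tors_gen S)"
  unfolding tors_gen_def by (rule torsion_class_Inter) (use torsion_class_mods in auto)

lemma wide_wide_gen: "S \<subseteq> mods Q \<Longrightarrow> wide_subcat Q (wide_gen S)"
  unfolding wide_gen_def by (rule wide_subcat_Inter) (use wide_subcat_mods in auto)

lemma tors_gen_superset: "S \<subseteq> tors_gen S"
  by (auto simp: tors_gen_def)

lemma wide_gen_superset: "S \<subseteq> wide_gen S"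
  by (auto simp: wide_gen_def)

lemma tors_gen_least: "torsion_class Q T \<Longrightarrow> S \<subseteq> T \<Longrightarrow> tors_gen S \<subseteq> T"
  by (auto simp: tors_gen_def)

lemma wide_gen_least: "wide_subcat Q W \<Longrightarrow> S \<subseteq> W \<Longrightarrow> wide_gen S \<subseteq> W"
  by (auto simp: wide_gen_def)

lemma epi_zero_kernel_iso:
  fixes X :: "('v, 'a, 'k::field) rep"
  assumes f: "is_epi Q X Y f" and i: "is_mono Q K X i" and ker: "\<forall>v\<in>verts Q. mat_range (i v) = mat_ker (f v)"
    and z: "zero_hom K X i"
  shows "is_iso Q X Y f"
proof -
  note ka = kernel_app[OF i epi_hom[OF f] ker]
  have "is_mono Q X Y f"
  proof (rule monoI[OF epi_hom[OF f]])
    fix v and x :: "'k vec" assume v: "v \<in> verts Q" and x: "x \<in> carrier_vec (rdim X v)" "f v *\<^sub>v x = 0\<^sub>v (rdim Y v)"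
    obtain k where "k \<in> carrier_vec (rdim K v)" "x = i v *\<^sub>v k" using ka(2)[OF v x] by blast
    then show "x = 0\<^sub>v (rdim X v)" using z v by (simp add: zero_hom_def)
  qed
  then show ?thesis using f by (simp add: is_iso_def)
qed

lemma zero_of_epi_kernel:
  fixes X :: "('v, 'a, 'k::field) rep"
  assumes f: "is_hom Q X Y f" and i: "is_mono Q K X i" and ker: "\<forall>v\<in>verts Q. mat_range (i v) = mat_ker (f v)"
    and e: "is_epi Q K X i"
  shows "zero_hom X Y f"
  unfolding zero_hom_def
proof (intro ballI)
  fix v and x :: "'k vec" assume v: "v \<in> verts Q" and x: "x \<in> carrier_vec (rdim X v)"
  obtain k where k: "k \<in> carrier_vec (rdim K v)" "i v *\<^sub>v k = x" by (rule epiE[OF e v x])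
  then show "f v *\<^sub>v x = 0\<^sub>v (rdim Y v)" using kernel_app(1)[OF i f ker v k(1)] by simp
qed

lemma mono_comp_zero_epi:
  fixes X :: "('v, 'a, 'k::field) rep"
  assumes g: "is_hom Q Z Y g" and m: "is_mono Q Y X m"
  shows "zero_hom Z X (\<lambda>v. m v * g v) \<Longrightarrow> zero_hom Z Y g"
    "is_epi Q Z X (\<lambda>v. m v * g v) \<Longrightarrow> is_epi Q Z Y g"
proof -
  note mh = mono_hom[OF m]
  show "zero_hom Z Y g" if z: "zero_hom Z X (\<lambda>v. m v * g v)"
    unfolding zero_hom_def
  proof (intro ballI)
    fix v and x :: "'k vec" assume v: "v \<in> verts Q" and x: "x \<in> carrier_vec (rdim Z v)"
    have "m v *\<^sub>v (g v *\<^sub>v x) = m v *\<^sub>v 0\<^sub>v (rdim Y v)"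
      using z v x hom_comp_app[OF g mh v x] hom_app_zero[OF mh v] by (simp add: zero_hom_def)
    then show "g v *\<^sub>v x = 0\<^sub>v (rdim Y v)" by (rule mono_eqD[OF m v hom_app[OF g v x] zero_carrier_vec])
  qed
  show "is_epi Q Z Y g" if e: "is_epi Q Z X (\<lambda>v. m v * g v)"
  proof (rule epiI[OF g])
    fix v and y :: "'k vec" assume v: "v \<in> verts Q" and y: "y \<in> carrier_vec (rdim Y v)"
    obtain z where z: "z \<in> carrier_vec (rdim Z v)" "(m v * g v) *\<^sub>v z = m v *\<^sub>v y"
      by (rule epiE[OF e v hom_app[OF mh v y]])
    have "g v *\<^sub>v z = y"
      by (rule mono_eqD[OF m v hom_app[OF g v z(1)] y]) (use z(2) hom_comp_app[OF g mh v z(1)] in simp)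
    then show "\<exists>z\<in>carrier_vec (rdim Z v). g v *\<^sub>v z = y" using z(1) by blast
  qed
qed

lemma id_zero_hom:
  assumes "X \<in> mods Q" "zero_hom X X (\<lambda>v. 1\<^sub>m (rdim X v))"
  shows "is_zero_rep Q X"
  by (rule zero_repI) (use assms(2) in \<open>simp add: zero_hom_def\<close>)

lemma epi_rdim_le:
  assumes e: "is_epi Q X Y f" and v: "v \<in> verts Q"
  shows "rdim Y v \<le> rdim X v"
proof -
  have c: "f v \<in> carrier_mat (rdim Y v) (rdim X v)" "surj_mat (f v)"
    using e v hom_carrier[OF epi_hom[OF e] v] by (auto simp: is_epi_def)
  obtain S where S: "S \<in> carrier_mat (rdim X v) (rdim Y v)" "f v * S = 1\<^sub>m (rdim Y v)"
    using surj_mat_right_inverse[OF c] by blast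
  show ?thesis by (rule inj_mat_dim_le[OF S(1) left_inverse_inj_mat[OF S(1) c(1) S(2)]])
qed

lemma epi_total_dim:
  assumes e: "is_epi Q X Y f"
  shows "total_dim Q Y \<le> total_dim Q X" "total_dim Q Y = total_dim Q X \<Longrightarrow> is_mono Q X Y f"
proof -
  show "total_dim Q Y \<le> total_dim Q X"
    unfolding total_dim_def by (rule sum_mono) (rule epi_rdim_le[OF e])
  assume eq: "total_dim Q Y = total_dim Q X"
  have d: "rdim Y v = rdim X v" if v: "v \<in> verts Q" for v
  proof (rule ccontr)
    assume "rdim Y v \<noteq> rdim X v"
    then have "rdim Y v < rdim X v" using epi_rdim_le[OF e v] by simp
    then have "total_dim Q Y < total_dim Q X"
      unfolding total_dim_def using v by (intro sum_strict_mono_ex1[OF finite_verts]) (use epi_rdim_le[OF e] in auto)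
    then show False using eq by simp
  qed
  have "inj_mat (f v)" if v: "v \<in> verts Q" for v
  proof -
    have c: "f v \<in> carrier_mat (rdim X v) (rdim X v)" "surj_mat (f v)"
      using e v hom_carrier[OF epi_hom[OF e] v] d[OF v] by (auto simp: is_epi_def)
    obtain S where S: "S \<in> carrier_mat (rdim X v) (rdim X v)" "f v * S = 1\<^sub>m (rdim X v)"
      using surj_mat_right_inverse[OF c] by blast
    show ?thesis by (rule left_inverse_inj_mat[OF c(1) S(1) mat_mult_left_right_inverse[OF c(1) S]])
  qed
  then show "is_mono Q X Y f" using epi_hom[OF e] by (simp add: is_mono_def)
qed

end

section \<open>Semibricks as relative simple objects\<close>

context avoiding_strings
begin

text \<open>Closure under isomorphism lets a string module be recognised as a member from an
  isomorphism with one. The case X = Y of the last condition says that the members are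
  bricks.\<close>

definition semibricks :: "('v, 'a, 'k::field) rep set set" where
  "semibricks = {B. B \<subseteq> str_mods \<and> (\<forall>X\<in>B. \<forall>Y\<in>str_mods. isomorphic Q X Y \<longrightarrow> Y \<in> B) \<and>
     (\<forall>X\<in>B. \<forall>Y\<in>B. \<forall>f. is_hom Q X Y f \<longrightarrow> zero_hom X Y f \<or> is_iso Q X Y f)}"

definition tors_simples :: "('v, 'a, 'k::field) rep set \<Rightarrow> ('v, 'a, 'k) rep set" where
  "tors_simples T = {X \<in> str_mods \<inter> T. T \<subseteq> epi_ker_class T X}"

definition wide_simples :: "('v, 'a, 'k::field) rep set \<Rightarrow> ('v, 'a, 'k) rep set" where
  "wide_simples C = {X \<in> str_mods \<inter> C. C \<subseteq> epi_class C X}"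

text \<open>Schur's lemma relative to \<open>C\<close>: a nonzero \<open>f\<close> to
  \<open>Y\<close> is surjective. Its kernel lies in \<open>C\<close>, so the inclusion into
  \<open>X\<close> is zero or surjective, and the latter would make \<open>f\<close> zero.\<close>

lemma semibricksI:
  fixes C :: "('v, 'a, 'k::field) rep set"
  assumes C: "summand_ext_closed C" and B: "B \<subseteq> str_mods \<inter> C"
    and simple: "\<And>X. X \<in> B \<Longrightarrow> C \<subseteq> epi_class C X"
    and iso: "\<And>X Y. X \<in> B \<Longrightarrow> Y \<in> str_mods \<Longrightarrow> isomorphic Q X Y \<Longrightarrow> Y \<in> B"
    and ker: "\<And>X Y f. X \<in> B \<Longrightarrow> Y \<in> B \<Longrightarrow> is_hom Q X Y f \<Longrightarrow> ker_in C X f"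
  shows "B \<in> semibricks"
proof -
  have "zero_hom X Y f \<or> is_iso Q X Y f" if X: "X \<in> B" and Y: "Y \<in> B" and f: "is_hom Q X Y f" for X Y f
  proof (cases "zero_hom X Y f")
    case False
    have m: "X \<in> mods Q" "Y \<in> mods Q" using X Y B str_mods_mods by blast+
    have e: "is_epi Q X Y f" using simple[OF Y] X B f False unfolding epi_class_def by blast
    obtain K i where K: "K \<in> mods Q" "K \<in> C" "is_mono Q K X i" "\<forall>v\<in>verts Q. mat_range (i v) = mat_ker (f v)"
      by (rule ker_inE[OF ker[OF X Y f] m f])
    have "zero_hom K X i \<or> is_epi Q K X i"
      using simple[OF X] K(2) mono_hom[OF K(3)] unfolding epi_class_def by blast
    moreover have "\<not> is_epi Q K X i" using zero_of_epi_kernel[OF f K(3,4)] False by blast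
    ultimately show ?thesis using epi_zero_kernel_iso[OF e K(3,4)] by blast
  qed simp
  then show ?thesis unfolding semibricks_def using B iso by blast
qed

lemma iso_backwards:
  assumes X: "X \<in> mods Q" and Y: "Y \<in> mods Q" and "isomorphic Q X Y"
  obtains f m where "is_epi Q X Y f" "is_mono Q Y X m"
proof -
  obtain f where f: "is_iso Q X Y f" using \<open>isomorphic Q X Y\<close> by (auto simp: isomorphic_def)
  have fh: "is_hom Q X Y f" and fe: "is_epi Q X Y f" using f by (auto simp: is_iso_def is_mono_def)
  obtain g where g: "is_hom Q Y X g" "\<forall>v\<in>verts Q. \<forall>y\<in>carrier_vec (rdim Y v). f v *\<^sub>v (g v *\<^sub>v y) = y"
    by (rule iso_inverse[OF X Y f]) blast
  show thesis by (rule that[OF fe section_mono[OF g(1) fh g(2)]])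
qed

lemma tors_simples_semibricks:
  fixes T :: "('v, 'a, 'k::field) rep set"
  assumes T: "torsion_class Q T"
  shows "tors_simples T \<in> semibricks"
proof (rule semibricksI[OF torsion_summand_ext_closed[OF T]])
  show "T \<subseteq> epi_class T X" if "X \<in> tors_simples T" for X
    using that unfolding tors_simples_def epi_ker_class_def epi_class_def by blast
  show "ker_in T X f" if "X \<in> tors_simples T" "Y \<in> tors_simples T" "is_hom Q X Y f" for X Y f
    using that unfolding tors_simples_def epi_ker_class_def by blast
  fix X Y :: "('v, 'a, 'k) rep"
  assume X: "X \<in> tors_simples T" and Y: "Y \<in> str_mods" and XY: "isomorphic Q X Y"
  have Xm: "X \<in> mods Q" "X \<in> T" and Ym: "Y \<in> mods Q" using X Y str_mods_mods by (auto simp: tors_simples_def)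
  obtain f m where f: "is_epi Q X Y f" and m: "is_mono Q Y X m" by (rule iso_backwards[OF Xm(1) Ym XY])
  have "Z \<in> epi_ker_class T Y" if Z: "Z \<in> T" for Z
  proof -
    have Zm: "Z \<in> mods Q" using Z torsion_classD(1)[OF T] by blast
    have "(zero_hom Z Y g \<or> is_epi Q Z Y g) \<and> ker_in T Z g" if g: "is_hom Q Z Y g" for g
    proof -
      have "(zero_hom Z X (\<lambda>v. m v * g v) \<or> is_epi Q Z X (\<lambda>v. m v * g v)) \<and> ker_in T Z (\<lambda>v. m v * g v)"
        using X Z hom_comp[OF Zm Ym Xm(1) g mono_hom[OF m]] unfolding tors_simples_def epi_ker_class_def by blast
      then show ?thesis using mono_comp_zero_epi[OF g m] ker_in_mono_comp[OF g m] by blast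
    qed
    then show ?thesis using Z by (simp add: epi_ker_class_def)
  qed
  then show "Y \<in> tors_simples T" using Y torsion_quot[OF T Xm(2) Ym f] by (auto simp: tors_simples_def)
qed (auto simp: tors_simples_def)

lemma wide_simples_semibricks:
  fixes W' :: "('v, 'a, 'k::field) rep set"
  assumes W: "wide_subcat Q W'"
  shows "wide_simples W' \<in> semibricks"
proof (rule semibricksI[OF wide_summand_ext_closed[OF W]])
  show "W' \<subseteq> epi_class W' X" if "X \<in> wide_simples W'" for X
    using that unfolding wide_simples_def by blast
  show "ker_in W' X f" if "X \<in> wide_simples W'" "Y \<in> wide_simples W'" and f: "is_hom Q X Y f" for X Y f
    unfolding sub_in_def has_image_def
    using wide_ker[OF W _ _ f] that(1,2) unfolding wide_simples_def by blast
  fix X Y :: "('v, 'a, 'k) rep"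
  assume X: "X \<in> wide_simples W'" and Y: "Y \<in> str_mods" and XY: "isomorphic Q X Y"
  have Xm: "X \<in> mods Q" "X \<in> W'" and Ym: "Y \<in> mods Q" using X Y str_mods_mods by (auto simp: wide_simples_def)
  obtain f m where m: "is_mono Q Y X m" by (rule iso_backwards[OF Xm(1) Ym XY])
  have YW: "Y \<in> W'" using W Xm(2) Ym XY unfolding wide_subcat_def iso_closed_def by blast
  have "Z \<in> epi_class W' Y" if Z: "Z \<in> W'" for Z
  proof -
    have Zm: "Z \<in> mods Q" using Z W unfolding wide_subcat_def by blast
    have "zero_hom Z Y g \<or> is_epi Q Z Y g" if g: "is_hom Q Z Y g" for g
    proof -
      have "zero_hom Z X (\<lambda>v. m v * g v) \<or> is_epi Q Z X (\<lambda>v. m v * g v)"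
        using X Z hom_comp[OF Zm Ym Xm(1) g mono_hom[OF m]] unfolding wide_simples_def epi_class_def by blast
      then show ?thesis using mono_comp_zero_epi[OF g m] by blast
    qed
    then show ?thesis using Z by (simp add: epi_class_def)
  qed
  then show "Y \<in> wide_simples W'" using Y YW by (auto simp: wide_simples_def)
qed (auto simp: wide_simples_def)

lemma semibricksD:
  assumes "B \<in> semibricks"
  shows "B \<subseteq> str_mods" "B \<subseteq> mods Q"
    "\<And>X Y f. X \<in> B \<Longrightarrow> Y \<in> B \<Longrightarrow> is_hom Q X Y f \<Longrightarrow> zero_hom X Y f \<or> is_iso Q X Y f"
    "\<And>X Y. X \<in> B \<Longrightarrow> Y \<in> str_mods \<Longrightarrow> isomorphic Q X Y \<Longrightarrow> Y \<in> B"
  using assms str_mods_mods unfolding semibricks_def by blast+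

lemma str_mod_nonzero: "X \<in> str_mods \<Longrightarrow> \<not> is_zero_rep Q X"
proof -
  assume "X \<in> str_mods"
  then obtain w where w: "w \<in> W" "X = string_module Q w" by (auto simp: str_mods_def)
  obtain v where v: "v \<in> vset w" using vset_nonempty by blast
  then have "v \<in> verts Q" "rdim X v \<noteq> 0" using vset_verts[OF w(1)] w by (auto simp: string_module_thin)
  then show ?thesis by (auto simp: is_zero_rep_def)
qed

text \<open>\<open>left_perp X\<close> is a torsion class. If it contained \<open>B\<close>, it
  would contain \<open>X\<close>, whose identity is not zero.\<close>

lemma hom_from_semibrick:
  assumes B: "B \<subseteq> mods Q" and X: "X \<in> str_mods" "X \<in> tors_gen B"
  shows "\<exists>Y\<in>B. \<exists>g. is_hom Q Y X g \<and> \<not> zero_hom Y X g"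
proof (rule ccontr)
  assume n: "\<not> ?thesis"
  have Xm: "X \<in> mods Q" using X str_mods_mods by blast
  have "B \<subseteq> left_perp X" using n B unfolding left_perp_def by blast
  then have "X \<in> left_perp X" using tors_gen_least[OF torsion_left_perp[OF Xm]] X(2) by blast
  then have "zero_hom X X (\<lambda>v. 1\<^sub>m (rdim X v))" using hom_id[OF Xm] by (simp add: left_perp_def)
  then show False using id_zero_hom[OF Xm] str_mod_nonzero[OF X(1)] by blast
qed

text \<open>By minimality of \<open>tors_gen B\<close> the condition is checked on sources in
  \<open>B\<close>. There a map is zero, with kernel its source, or an isomorphism, with kernel
  zero.\<close>

lemma semibrick_tors_gen_subset:
  assumes B: "B \<in> semibricks" and X: "X \<in> B"
  shows "tors_gen B \<subseteq> epi_ker_class (tors_gen B) X"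
proof (rule tors_gen_least)
  note m = semibricksD(2)[OF B]
  have Xm: "X \<in> mods Q" using X m by blast
  note T = torsion_tors_gen[OF m] 
  note C = torsion_summand_ext_closed[OF T]
  show "torsion_class Q (epi_ker_class (tors_gen B) X)" by (rule torsion_epi_ker_class[OF T Xm])
  show "B \<subseteq> epi_ker_class (tors_gen B) X"
  proof
    fix Y assume Y: "Y \<in> B"
    have YT: "Y \<in> tors_gen B" "Y \<in> mods Q" using Y tors_gen_superset m by blast+
    have "(zero_hom Y X g \<or> is_epi Q Y X g) \<and> ker_in (tors_gen B) Y g" if g: "is_hom Q Y X g" for g
    proof (cases "zero_hom Y X g")
      case True
      then show ?thesis using ker_in_zero[OF C YT(1) g True] by simp
    next
      case False
      then have "is_iso Q Y X g" using semibricksD(3)[OF B Y X g] by blast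
      then show ?thesis using ker_in_mono[OF C YT(2) Xm] by (auto simp: is_iso_def)
    qed
    then show "Y \<in> epi_ker_class (tors_gen B) X" using YT by (simp add: epi_ker_class_def)
  qed
qed

text \<open>A relative simple \<open>X\<close> receives a nonzero map from some \<open>Y\<close> in
  \<open>B\<close>. Both belong to the semibrick \<open>tors_simples (tors_gen B)\<close>, so this
  map is an isomorphism.\<close>

lemma tors_simples_tors_gen:
  assumes B: "B \<in> semibricks"
  shows "tors_simples (tors_gen B) = B"
proof
  show sub: "B \<subseteq> tors_simples (tors_gen B)"
    using semibrick_tors_gen_subset[OF B] semibricksD(1)[OF B] tors_gen_superset unfolding tors_simples_def by blast
  show "tors_simples (tors_gen B) \<subseteq> B"
  proof
    fix X assume X: "X \<in> tors_simples (tors_gen B)"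
    then have XT: "X \<in> str_mods" "X \<in> tors_gen B" by (auto simp: tors_simples_def)
    obtain Y g where Y: "Y \<in> B" "is_hom Q Y X g" "\<not> zero_hom Y X g"
      using hom_from_semibrick[OF semibricksD(2)[OF B] XT] by blast
    have "is_iso Q Y X g"
      using semibricksD(3)[OF tors_simples_semibricks[OF torsion_tors_gen[OF semibricksD(2)[OF B]]] _ X Y(2)]
        Y sub by blast
    then show "X \<in> B" using semibricksD(4)[OF B Y(1) XT(1)] by (auto simp: isomorphic_def)
  qed
qed

text \<open>Not immediate, since a torsion class need not contain kernels.
  \<open>stable_kernels (tors_gen B)\<close> is a wide subcategory inside the torsion class, and it
  contains \<open>B\<close>.\<close>

lemma wide_gen_subset_tors_gen:
  assumes B: "B \<in> semibricks"
  shows "wide_gen B \<subseteq> tors_gen B"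
proof -
  note T = torsion_tors_gen[OF semibricksD(2)[OF B]]
  have "B \<subseteq> stable_kernels (tors_gen B)"
    using semibrick_tors_gen_subset[OF B] tors_gen_superset unfolding stable_kernels_def epi_ker_class_def by blast
  then have "wide_gen B \<subseteq> stable_kernels (tors_gen B)" by (rule wide_gen_least[OF wide_stable_kernels[OF T]])
  then show ?thesis by (auto simp: stable_kernels_def)
qed

text \<open>The argument of \<open>tors_simples_tors_gen\<close> applies; the inclusion in
  \<open>tors_gen B\<close> provides the nonzero map from \<open>B\<close>.\<close>

lemma wide_simples_wide_gen:
  assumes B: "B \<in> semibricks"
  shows "wide_simples (wide_gen B) = B"
proof
  note W = wide_wide_gen[OF semibricksD(2)[OF B]] and sub' = wide_gen_subset_tors_gen[OF B]
  show sub: "B \<subseteq> wide_simples (wide_gen B)"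
    using semibrick_tors_gen_subset[OF B] semibricksD(1)[OF B] wide_gen_superset sub'
    unfolding wide_simples_def epi_ker_class_def epi_class_def by blast
  show "wide_simples (wide_gen B) \<subseteq> B"
  proof
    fix X assume X: "X \<in> wide_simples (wide_gen B)"
    then have XT: "X \<in> str_mods" "X \<in> tors_gen B" using sub' by (auto simp: wide_simples_def)
    obtain Y g where Y: "Y \<in> B" "is_hom Q Y X g" "\<not> zero_hom Y X g"
      using hom_from_semibrick[OF semibricksD(2)[OF B] XT] by blast
    have "is_iso Q Y X g"
      using semibricksD(3)[OF wide_simples_semibricks[OF W] _ X Y(2)] Y sub by blast
    then show "X \<in> B" using semibricksD(4)[OF B Y(1) XT(1)] by (auto simp: isomorphic_def)
  qed
qed

section \<open>String modules are generated by the relative simples\<close>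

lemma torsion_string_ext_in:
  fixes T :: "('v, 'a, 'k::field) rep set"
  assumes T: "torsion_class Q T" and C': "summand_ext_closed C'" and X: "X \<in> str_mods" "X \<in> T"
    and small: "\<And>Y. Y \<in> str_mods \<Longrightarrow> Y \<in> T \<Longrightarrow> total_dim Q Y < total_dim Q X \<Longrightarrow> Y \<in> C'"
    and n: "\<not> T \<subseteq> epi_class T X"
  shows "X \<in> C'"
proof -
  have Xm: "X \<in> mods Q" using X str_mods_mods by blast
  obtain Z h where Z: "Z \<in> T" "is_hom Q Z X h" "\<not> zero_hom Z X h" "\<not> is_epi Q Z X h"
    using n unfolding epi_class_def by blast
  have Zm: "Z \<in> mods Q" using Z torsion_classD(1)[OF T] by blast
  show ?thesis
    by (rule string_ext_in[OF torsion_summand_ext_closed[OF T] C' X(1) small Zm Z(2-4) torsion_image_in[OF T Z(1) Xm Z(2)]])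
      (auto intro: torsion_quot[OF T X(2)])
qed

lemma wide_string_ext_in:
  fixes W' :: "('v, 'a, 'k::field) rep set"
  assumes W: "wide_subcat Q W'" and C': "summand_ext_closed C'" and X: "X \<in> str_mods" "X \<in> W'"
    and small: "\<And>Y. Y \<in> str_mods \<Longrightarrow> Y \<in> W' \<Longrightarrow> total_dim Q Y < total_dim Q X \<Longrightarrow> Y \<in> C'"
    and n: "\<not> W' \<subseteq> epi_class W' X"
  shows "X \<in> C'"
proof -
  obtain Z h where Z: "Z \<in> W'" "is_hom Q Z X h" "\<not> zero_hom Z X h" "\<not> is_epi Q Z X h"
    using n unfolding epi_class_def by blast
  have Zm: "Z \<in> mods Q" using Z W unfolding wide_subcat_def by blast
  show ?thesis
  proof (rule string_ext_in[OF wide_summand_ext_closed[OF W] C' X(1) small Zm Z(2-4) wide_image_in[OF W Z(1) X(2) Z(2)]])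
    fix M p assume "M \<in> mods Q" "is_epi Q X M p" "\<forall>v\<in>verts Q. mat_range (h v) = mat_ker (p v)"
    then show "M \<in> W'" using wide_coker[OF W Z(1) X(2) Z(2)] by blast
  qed
qed

text \<open>Induction on dimension with \<open>wide_string_ext_in\<close>. A wide subcategory
  contains its kernels, so the strings that receive only zero or surjective maps already form
  \<open>wide_simples\<close>.\<close>

lemma wide_strings_generated:
  fixes W' :: "('v, 'a, 'k::field) rep set"
  assumes W: "wide_subcat Q W'"
  shows "str_mods \<inter> W' \<subseteq> wide_gen (wide_simples W')"
proof
  have m: "wide_simples W' \<subseteq> mods Q" using str_mods_mods by (auto simp: wide_simples_def)
  note C' = wide_summand_ext_closed[OF wide_wide_gen[OF m]]
  fix X assume "X \<in> str_mods \<inter> W'"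
  then show "X \<in> wide_gen (wide_simples W')"
  proof (induction "total_dim Q X" arbitrary: X rule: less_induct)
    case less
    show ?case
    proof (cases "W' \<subseteq> epi_class W' X")
      case True
      then have "X \<in> wide_simples W'" using less.prems by (simp add: wide_simples_def)
      then show ?thesis using wide_gen_superset by blast
    next
      case False
      show ?thesis
        by (rule wide_string_ext_in[OF W C' _ _ _ False]) (use less in auto)
    qed
  qed
qed

text \<open>Take a counterexample X of maximal dimension among those onto which every nonzero map from T is
  surjective. Among the strings Y in T with a map to X whose kernel is not in T, one of minimal
  dimension is again such a counterexample, and it is strictly larger than X.\<close>
lemma torsion_strings_generated:
  fixes T :: "('v, 'a, 'k::field) rep set"
  assumes T: "torsion_class Q T" and gen: "T = tors_gen (str_mods \<inter> T)"
  shows "str_mods \<inter> T \<subseteq> tors_gen (tors_simples T)"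
proof (rule ccontr)
  let ?D = "tors_gen (tors_simples T)"
  assume "\<not> str_mods \<inter> T \<subseteq> ?D"
  then obtain X0 where X0: "X0 \<in> str_mods" "X0 \<in> T" "X0 \<notin> ?D" by blast
  have m: "tors_simples T \<subseteq> mods Q" using str_mods_mods by (auto simp: tors_simples_def)
  note D = torsion_tors_gen[OF m]
  define P where "P n \<longleftrightarrow> (\<exists>X. X \<in> str_mods \<and> X \<in> T \<and> X \<notin> ?D \<and> T \<subseteq> epi_class T X \<and> total_dim Q X = n)" for n
  \<comment> \<open>A string of \<open>T\<close> outside \<open>?D\<close> of least dimension
    qualifies: a map to it from \<open>T\<close> that is neither zero nor surjective would build it
    from shorter strings, which lie in \<open>?D\<close>.\<close>
  have "\<exists>n. P n"
  proof -
    define R where "R X \<longleftrightarrow> X \<in> str_mods \<and> X \<in> T \<and> X \<notin> ?D" for X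
    have "R X0" using X0 by (simp add: R_def)
    then obtain X where X: "R X" "\<forall>Y. R Y \<longrightarrow> total_dim Q X \<le> total_dim Q Y"
      using ex_has_least_nat[of R X0 "total_dim Q"] by blast
    have small: "Y \<in> ?D" if "Y \<in> str_mods" "Y \<in> T" "total_dim Q Y < total_dim Q X" for Y
      using spec[OF X(2), of Y] that by (auto simp: R_def)
    have "T \<subseteq> epi_class T X"
    proof (rule ccontr)
      assume n: "\<not> T \<subseteq> epi_class T X"
      have "X \<in> ?D"
        by (rule torsion_string_ext_in[OF T torsion_summand_ext_closed[OF D] _ _ small n])
          (use X(1) in \<open>simp_all add: R_def\<close>)
      then show False using X(1) by (simp add: R_def)
    qed
    then have "P (total_dim Q X)" using X(1) unfolding P_def R_def by blast
    then show ?thesis by blast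
  qed
  \<comment> \<open>Strings repeat no vertex, so their dimensions are bounded and a maximal one
    exists.\<close>
  moreover have "n \<le> card (verts Q)" if "P n" for n
  proof -
    obtain X :: "('v, 'a, 'k) rep" where "X \<in> str_mods" "total_dim Q X = n" using \<open>P n\<close> unfolding P_def by blast
    then obtain w where "w \<in> W" "n = card (vset w)" by (auto simp: str_mods_def total_dim_string)
    then show ?thesis using card_mono[OF finite_verts vset_verts] by simp
  qed
  ultimately have "\<exists>n. P n \<and> (\<forall>k. P k \<longrightarrow> k \<le> n)"
    using Nat.ex_has_greatest_nat[of P _ "card (verts Q)"] by blast
  then obtain n where n: "P n" "\<forall>k. P k \<longrightarrow> k \<le> n" by blast
  from n(1) obtain X where X: "X \<in> str_mods" "X \<in> T" "X \<notin> ?D" "T \<subseteq> epi_class T X" "total_dim Q X = n"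
    unfolding P_def by blast
  have Xm: "X \<in> mods Q" using X str_mods_mods by blast
  let ?E = "epi_ker_class T X"
  note E = torsion_epi_ker_class[OF T Xm]
  have n_sub: "\<not> T \<subseteq> ?E"
  proof
    assume "T \<subseteq> ?E"
    then have "X \<in> tors_simples T" using X(1,2) by (simp add: tors_simples_def)
    then show False using X(3) tors_gen_superset by blast
  qed
  \<comment> \<open>Generation of \<open>T\<close> by its string modules enters here: a failure of
    the kernel condition at some source is then witnessed by a string.\<close>
  have "\<not> str_mods \<inter> T \<subseteq> ?E"
  proof
    assume "str_mods \<inter> T \<subseteq> ?E"
    then have "tors_gen (str_mods \<inter> T) \<subseteq> ?E" by (rule tors_gen_least[OF E])
    then show False using n_sub by (simp only: gen[symmetric])
  qed
  then obtain Y0 where Y0: "Y0 \<in> str_mods" "Y0 \<in> T" "Y0 \<notin> ?E" by blast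
  define R where "R Y \<longleftrightarrow> Y \<in> str_mods \<and> Y \<in> T \<and> Y \<notin> ?E" for Y
  have "R Y0" using Y0 by (simp add: R_def)
  then obtain Y where Y: "R Y" "\<forall>Z. R Z \<longrightarrow> total_dim Q Y \<le> total_dim Q Z"
    using ex_has_least_nat[of R Y0 "total_dim Q"] by blast
  have small: "Z \<in> ?E" if "Z \<in> str_mods" "Z \<in> T" "total_dim Q Z < total_dim Q Y" for Z
    using spec[OF Y(2), of Z] that by (auto simp: R_def)
  have YT: "Y \<in> str_mods" "Y \<in> T" "Y \<notin> ?E" "Y \<in> mods Q" using Y(1) str_mods_mods by (auto simp: R_def)
  have Ye: "T \<subseteq> epi_class T Y"
  proof (rule ccontr)
    assume n: "\<not> T \<subseteq> epi_class T Y"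
    have "Y \<in> ?E"
      by (rule torsion_string_ext_in[OF T torsion_summand_ext_closed[OF E] YT(1,2) small n])
    then show False using YT by simp
  qed
  note C = torsion_summand_ext_closed[OF T]
  obtain g where g: "is_hom Q Y X g" "\<not> ((zero_hom Y X g \<or> is_epi Q Y X g) \<and> ker_in T Y g)"
    using YT unfolding epi_ker_class_def by blast
  have ze: "zero_hom Y X g \<or> is_epi Q Y X g" using X(4) YT(2) g(1) unfolding epi_class_def by blast
  then have nk: "\<not> ker_in T Y g" using g(2) by blast
  then have e: "is_epi Q Y X g" using ze ker_in_zero[OF C YT(2) g(1)] by blast
  \<comment> \<open>\<open>Y\<close> has the quotient \<open>X\<close> outside the torsion class
    \<open>?D\<close>, so it competes for the maximal dimension. Equality of dimensions makes
    \<open>g\<close> injective, and its zero kernel contradicts \<open>nk\<close>.\<close>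
  have "Y \<notin> ?D" using torsion_quot[OF D _ Xm e] X(3) by blast
  then have "P (total_dim Q Y)" using YT Ye unfolding P_def by blast
  then have "total_dim Q Y \<le> n" using n(2) by blast
  then have "total_dim Q X = total_dim Q Y" using epi_total_dim(1)[OF e] X(5) by simp
  then have "is_mono Q Y X g" by (rule epi_total_dim(2)[OF e])
  then show False using ker_in_mono[OF C YT(4) Xm] nk by blast
qed

section \<open>The two parametrizations of shadows\<close>

abbreviation "string_closure \<equiv> add_closure Q str_mods"

lemma str_mods_Int_closure: "str_mods \<inter> (C \<inter> string_closure) = str_mods \<inter> C"
  using subset_add_closure[OF str_mods_mods] by blast

text \<open>Injectivity: equal shadows contain the same string modules, so each of the two
  semibricks lies in the torsion class generated by the other. The torsion classes agree, and with
  them the semibricks.\<close>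

lemma bij_betw_tors:
  "bij_betw (\<lambda>B. tors_gen B \<inter> string_closure) semibricks
     {T \<inter> string_closure | T. torsion_class Q (T :: ('v, 'a, 'k::field) rep set)}"
proof (rule bij_betwI')
  fix B B' :: "('v, 'a, 'k) rep set" assume B: "B \<in> semibricks" and B': "B' \<in> semibricks"
  show "tors_gen B \<inter> string_closure = tors_gen B' \<inter> string_closure \<longleftrightarrow> B = B'"
  proof
    assume eq: "tors_gen B \<inter> string_closure = tors_gen B' \<inter> string_closure"
    have "str_mods \<inter> (tors_gen B \<inter> string_closure) = str_mods \<inter> (tors_gen B' \<inter> string_closure)" unfolding eq ..
    then have s: "str_mods \<inter> tors_gen B = str_mods \<inter> tors_gen B'" unfolding str_mods_Int_closure .
    have "B \<subseteq> str_mods \<inter> tors_gen B" "B' \<subseteq> str_mods \<inter> tors_gen B'"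
      using semibricksD(1)[OF B] semibricksD(1)[OF B'] tors_gen_superset[of B] tors_gen_superset[of B'] by auto
    then have sub: "B \<subseteq> tors_gen B'" "B' \<subseteq> tors_gen B" using s by blast+
    have "tors_gen B = tors_gen B'"
      by (rule equalityI[OF tors_gen_least[OF torsion_tors_gen[OF semibricksD(2)[OF B']] sub(1)]
        tors_gen_least[OF torsion_tors_gen[OF semibricksD(2)[OF B]] sub(2)]])
    then have "tors_simples (tors_gen B) = tors_simples (tors_gen B')" by (rule arg_cong)
    then show "B = B'" unfolding tors_simples_tors_gen[OF B] tors_simples_tors_gen[OF B'] .
  qed simp
next
  fix B :: "('v, 'a, 'k) rep set" assume B: "B \<in> semibricks"
  have "torsion_class Q (tors_gen B)" by (rule torsion_tors_gen[OF semibricksD(2)[OF B]])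
  then show "tors_gen B \<inter> string_closure \<in> {T \<inter> string_closure | T. torsion_class Q T}" by blast
next
  fix S :: "('v, 'a, 'k) rep set" assume "S \<in> {T \<inter> string_closure | T. torsion_class Q T}"
  then obtain T' where T': "torsion_class Q T'" "S = T' \<inter> string_closure" by blast
  \<comment> \<open>\<open>T'\<close> may have objects that its string modules do not generate.
    Passing to \<open>T\<close> keeps the strings and supplies the hypothesis \<open>gen\<close> of
    \<open>torsion_strings_generated\<close>.\<close>
  define T where "T = tors_gen (str_mods \<inter> T')"
  have T: "torsion_class Q T" unfolding T_def by (rule torsion_tors_gen[OF le_infI1[OF str_mods_mods]])
  have sub: "T \<subseteq> T'" unfolding T_def by (rule tors_gen_least[OF T'(1)]) blast
  have eq: "str_mods \<inter> T = str_mods \<inter> T'" 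
  proof -
    have "str_mods \<inter> T' \<subseteq> T" unfolding T_def by (rule tors_gen_superset)
    then show ?thesis using sub by blast
  qed
  let ?D = "tors_gen (tors_simples T)"
  have m: "tors_simples T \<subseteq> mods Q" using str_mods_mods by (auto simp: tors_simples_def)
  have gen: "T = tors_gen (str_mods \<inter> T)" unfolding eq by (rule T_def)
  have "str_mods \<inter> T' \<subseteq> ?D" using torsion_strings_generated[OF T gen] unfolding eq .
  then have "T' \<inter> string_closure \<subseteq> ?D"
    by (rule add_closure_Int_subset[OF torsion_summand_ext_closed[OF T'(1)]
      torsion_summand_ext_closed[OF torsion_tors_gen[OF m]] str_mods_mods scalar_endos_str_mods])
  moreover have "tors_simples T \<subseteq> T" by (auto simp: tors_simples_def)
  then have "?D \<subseteq> T'" using subset_trans[OF tors_gen_least[OF T] sub] by simp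
  ultimately have S: "S = ?D \<inter> string_closure" unfolding T'(2) by blast
  show "\<exists>B\<in>semibricks. S = tors_gen B \<inter> string_closure" by (intro bexI[of _ "tors_simples T"] S tors_simples_semibricks[OF T])
qed

lemma bij_betw_wide:
  "bij_betw (\<lambda>B. wide_gen B \<inter> string_closure) semibricks
     {C \<inter> string_closure | C. wide_subcat Q (C :: ('v, 'a, 'k::field) rep set)}"
proof (rule bij_betwI')
  fix B B' :: "('v, 'a, 'k) rep set" assume B: "B \<in> semibricks" and B': "B' \<in> semibricks"
  show "wide_gen B \<inter> string_closure = wide_gen B' \<inter> string_closure \<longleftrightarrow> B = B'"
  proof
    assume eq: "wide_gen B \<inter> string_closure = wide_gen B' \<inter> string_closure"
    have "str_mods \<inter> (wide_gen B \<inter> string_closure) = str_mods \<inter> (wide_gen B' \<inter> string_closure)" unfolding eq ..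
    then have s: "str_mods \<inter> wide_gen B = str_mods \<inter> wide_gen B'" unfolding str_mods_Int_closure .
    have "B \<subseteq> str_mods \<inter> wide_gen B" "B' \<subseteq> str_mods \<inter> wide_gen B'"
      using semibricksD(1)[OF B] semibricksD(1)[OF B'] wide_gen_superset[of B] wide_gen_superset[of B'] by auto
    then have sub: "B \<subseteq> wide_gen B'" "B' \<subseteq> wide_gen B" using s by blast+
    have "wide_gen B = wide_gen B'"
      by (rule equalityI[OF wide_gen_least[OF wide_wide_gen[OF semibricksD(2)[OF B']] sub(1)]
        wide_gen_least[OF wide_wide_gen[OF semibricksD(2)[OF B]] sub(2)]])
    then have "wide_simples (wide_gen B) = wide_simples (wide_gen B')" by (rule arg_cong)
    then show "B = B'" unfolding wide_simples_wide_gen[OF B] wide_simples_wide_gen[OF B'] .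
  qed simp
next
  fix B :: "('v, 'a, 'k) rep set" assume B: "B \<in> semibricks"
  have "wide_subcat Q (wide_gen B)" by (rule wide_wide_gen[OF semibricksD(2)[OF B]])
  then show "wide_gen B \<inter> string_closure \<in> {C \<inter> string_closure | C. wide_subcat Q C}" by blast
next
  fix S :: "('v, 'a, 'k) rep set" assume "S \<in> {C \<inter> string_closure | C. wide_subcat Q C}"
  then obtain C where C: "wide_subcat Q C" "S = C \<inter> string_closure" by blast
  let ?D = "wide_gen (wide_simples C)"
  have m: "wide_simples C \<subseteq> mods Q" using str_mods_mods by (auto simp: wide_simples_def)
  have "C \<inter> string_closure \<subseteq> ?D"
    by (rule add_closure_Int_subset[OF wide_summand_ext_closed[OF C(1)]
      wide_summand_ext_closed[OF wide_wide_gen[OF m]] str_mods_mods scalar_endos_str_mods wide_strings_generated[OF C(1)]])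
  moreover have "wide_simples C \<subseteq> C" by (auto simp: wide_simples_def)
  then have "?D \<subseteq> C" by (rule wide_gen_least[OF C(1)])
  ultimately have S: "S = ?D \<inter> string_closure" unfolding C(2) by blast
  show "\<exists>B\<in>semibricks. S = wide_gen B \<inter> string_closure" by (intro bexI[of _ "wide_simples C"] S wide_simples_semibricks[OF C(1)])
qed

lemma tors_wide_bij:
  "\<exists>f. bij_betw f {T \<inter> string_closure | T. torsion_class Q (T :: ('v, 'a, 'k::field) rep set)}
     {C \<inter> string_closure | C. wide_subcat Q (C :: ('v, 'a, 'k) rep set)}"
  by (rule exI, rule bij_betw_trans[OF bij_betw_inv_into[OF bij_betw_tors] bij_betw_wide])

end

section \<open>The algebra Pi(A)\<close>

lemma no_rel_subword_factor:
  assumes "no_rel_subword Q (u @ v @ w)"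
  shows "no_rel_subword Q v"
  unfolding no_rel_subword_def
proof (intro allI impI, elim conjE)
  fix i j assume ij: "i < j" "j \<le> length v" and dir: "\<forall>l\<in>set (take (j - i) (drop i v)). snd l"
  have eq: "take (length u + j - (length u + i)) (drop (length u + i) (u @ v @ w)) = take (j - i) (drop i v)"
    using ij by simp
  have "length u + i < length u + j \<and> length u + j \<le> length (u @ v @ w) \<and>
      (\<forall>l\<in>set (take (length u + j - (length u + i)) (drop (length u + i) (u @ v @ w))). snd l) \<longrightarrow>
      map fst (take (length u + j - (length u + i)) (drop (length u + i) (u @ v @ w))) \<notin> rels Q"
    using assms unfolding no_rel_subword_def by blast
  then show "map fst (take (j - i) (drop i v)) \<notin> rels Q" unfolding eq using ij dir by simp
qed

lemma (in bound_quiver) word_verts_in: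
  assumes w: "is_string Q w" and i: "i \<le> length (snd w)"
  shows "word_verts Q w ! i \<in> verts Q"
proof (cases i)
  case 0
  then show ?thesis using w by (simp add: is_string_def Let_def word_verts_def)
next
  case (Suc m)
  then have m: "m < length (snd w)" using i by simp
  note l = string_letter[OF w m]
  show ?thesis
    using l(2,3) src_in[OF l(1)] tgt_in[OF l(1)] Suc by (cases "snd (snd w ! m)") simp_all
qed

lemma (in bound_quiver) is_string_factor:
  assumes w: "is_string Q w" and i: "i + n \<le> length (snd w)"
  shows "is_string Q (word_verts Q w ! i, take n (drop i (snd w)))"
proof -
  let ?ws = "snd w" and ?v = "take n (drop i (snd w))"
  have split: "?ws = take i ?ws @ ?v @ drop (i + n) ?ws"
    by (metis append_take_drop_id drop_drop add.commute)
  have nth: "?v ! k = ?ws ! (i + k)" if "k < n" for k using that i by simp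
  have len: "length ?v = n" using i by simp
  let ?r = "\<lambda>ws. rev (map (\<lambda>(a, e). (a, \<not> e)) ws)"
  have "no_rel_subword Q (take i ?ws @ ?v @ drop (i + n) ?ws)"
    using w split by (simp add: is_string_def Let_def)
  then have 1: "no_rel_subword Q ?v" by (rule no_rel_subword_factor)
  \<comment> \<open>The formal inverse of a factor is a factor of the formal inverse, so the
    condition on the inverse word passes to factors as well.\<close>
  have "?r ?ws = ?r (drop (i + n) ?ws) @ ?r ?v @ ?r (take i ?ws)"
    by (subst split) (simp only: map_append rev_append append_assoc)
  moreover have "no_rel_subword Q (?r ?ws)" using w by (simp add: is_string_def Let_def inv_word_def)
  ultimately have "no_rel_subword Q (?r (drop (i + n) ?ws) @ ?r ?v @ ?r (take i ?ws))" by metis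
  then have 2: "no_rel_subword Q (?r ?v)" by (rule no_rel_subword_factor)
  have 3: "letter_src Q (?v ! 0) = word_verts Q w ! i" if "?v \<noteq> []"
  proof -
    have "0 < n" using that by (cases n) auto
    then show ?thesis using nth[of 0] word_verts_nth(1)[OF w, of i] i by simp
  qed
  have 4: "letter_tgt Q (?v ! k) = letter_src Q (?v ! Suc k)"
    "\<not> (fst (?v ! k) = fst (?v ! Suc k) \<and> snd (?v ! k) \<noteq> snd (?v ! Suc k))" if k: "Suc k < length ?v" for k
  proof -
    have s: "Suc (i + k) < length ?ws" "?v ! k = ?ws ! (i + k)" "?v ! Suc k = ?ws ! Suc (i + k)"
      using nth[of k] nth[of "Suc k"] k len i by simp_all
    show "letter_tgt Q (?v ! k) = letter_src Q (?v ! Suc k)"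
      "\<not> (fst (?v ! k) = fst (?v ! Suc k) \<and> snd (?v ! k) \<noteq> snd (?v ! Suc k))"
      unfolding s(2,3) using w s(1) by (simp_all add: is_string_def Let_def)
  qed
  have 5: "fst l \<in> arrs Q" if "l \<in> set ?v" for l
    using that w set_take_subset[of n "drop i ?ws"] set_drop_subset[of i ?ws] by (auto simp: is_string_def Let_def)
  have 6: "word_verts Q w ! i \<in> verts Q" using word_verts_in[OF w] i by simp
  show ?thesis
    unfolding is_string_def Let_def inv_word_def fst_conv snd_conv
    using 1 2 3 4 5 6 by blast
qed

lemma Pi_quiver_simps [simp]:
  "verts (Pi_quiver Q) = verts Q" "arrs (Pi_quiver Q) = Inl ` arrs Q \<union> Inr ` arrs Q"
  "src (Pi_quiver Q) = case_sum (src Q) (tgt Q)" "tgt (Pi_quiver Q) = case_sum (tgt Q) (src Q)"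
  by (simp_all add: Pi_quiver_def Let_def)

lemma rels_Pi_quiver:
  "p \<in> rels (Pi_quiver Q) \<longleftrightarrow> is_path (Pi_quiver Q) p \<and> (\<exists>u x y v. p = u @ [x, y] @ v \<and>
     (\<exists>\<alpha> \<beta>. [\<alpha>, \<beta>] \<in> rels Q \<and> ([x, y] = [Inl \<alpha>, Inl \<beta>] \<or> [x, y] = [Inr \<beta>, Inr \<alpha>])))"
proof -
  have "is_path (Pi_quiver Q) p \<longleftrightarrow> is_path \<lparr> verts = verts Q, arrs = Inl ` arrs Q \<union> Inr ` arrs Q,
        src = case_sum (src Q) (tgt Q), tgt = case_sum (tgt Q) (src Q), rels = {} \<rparr> p" for p
    by (simp add: is_path_def)
  then show ?thesis by (simp add: Pi_quiver_def Let_def)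
qed

lemma bound_quiver_Pi:
  assumes "bound_quiver Q"
  shows "bound_quiver (Pi_quiver Q)"
proof -
  interpret bound_quiver Q by fact
  show ?thesis
    by unfold_locales (use src_in tgt_in finite_verts in \<open>auto simp: rels_Pi_quiver\<close>)
qed

lemma letter_tgt_specialize:
  "letter_tgt (Pi_quiver Q) l = letter_tgt Q (case l of (b, e) \<Rightarrow> (case b of Inl g \<Rightarrow> (g, e) | Inr g \<Rightarrow> (g, \<not> e)))"
  by (cases l; cases "fst l") (auto simp: letter_tgt_def)

text \<open>Starring an arrow and inverting a letter both exchange source and target, so
  specialization keeps the sequence of vertices; self-avoidance thus passes from strings of A to
  their lifts.\<close>

lemma word_verts_specialize: "word_verts (Pi_quiver Q) w = word_verts Q (specialize w)"
  by (simp add: word_verts_def specialize_def letter_tgt_specialize comp_def)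

definition lifted_strings :: "('v, 'a) bquiver \<Rightarrow> ('v \<times> (('a + 'a) \<times> bool) list) set" where
  "lifted_strings Q = {w. is_string (Pi_quiver Q) w \<and> is_string Q (specialize w)}"

lemma avoiding_strings_Pi:
  assumes bg: "brick_gentle TYPE('k::field) Q"
  shows "avoiding_strings (Pi_quiver Q) (lifted_strings Q)"
proof -
  have adm: "admissible_path_bquiver Q" using bg by (simp add: brick_gentle_def)
  note bq = bound_quiver_admissible[OF adm]
  interpret P: bound_quiver "Pi_quiver Q" by (rule bound_quiver_Pi[OF bq])
  show ?thesis
  proof (unfold_locales, goal_cases)
    \<comment> \<open>A relation is defined as a path through a suitable pair; cutting the path down
      to that pair leaves a relation of length two.\<close>
    case (1 p)
    then obtain u x y v \<alpha> \<beta> where p: "is_path (Pi_quiver Q) p" "p = u @ [x, y] @ v" "[\<alpha>, \<beta>] \<in> rels Q"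
      "[x, y] = [Inl \<alpha>, Inl \<beta>] \<or> [x, y] = [Inr \<beta>, Inr \<alpha>]" unfolding rels_Pi_quiver by blast
    have "is_path (Pi_quiver Q) ([x, y] @ v)" using p(1,2) P.is_path_appendD(2)[of u "[x, y] @ v"] by simp
    then have "is_path (Pi_quiver Q) [x, y]" by (rule P.is_path_appendD(1)) simp
    moreover have "[x, y] = [] @ [x, y] @ []" by simp
    ultimately have "[x, y] \<in> rels (Pi_quiver Q)" unfolding rels_Pi_quiver using p(3,4) by blast
    then show ?case using p(2) by blast
  next
    case (2 w)
    then show ?case by (simp add: lifted_strings_def)
  next
    case (3 w)
    then show ?case using string_self_avoiding[OF bg] by (simp add: lifted_strings_def word_verts_specialize)
  next
    case (4 w i n)
    have s: "specialize (word_verts (Pi_quiver Q) w ! i, take n (drop i (snd w)))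
      = (word_verts Q (specialize w) ! i, take n (drop i (snd (specialize w))))"
      by (simp add: word_verts_specialize) (simp add: specialize_def take_map drop_map)
    have len: "length (snd (specialize w)) = length (snd w)" by (simp add: specialize_def)
    show ?case
      using 4 P.is_string_factor[of w i n] bound_quiver.is_string_factor[OF bq, of "specialize w" i n]
      unfolding lifted_strings_def mem_Collect_eq s len by blast
  qed
qed

theorem theorem7p3:
  fixes Q :: "('v, 'a) bquiver"
  assumes "brick_gentle TYPE('k::field) Q"
  shows "\<exists>f. bij_betw f (torshad TYPE('k) Q) (widshad TYPE('k) Q)"
proof -
  interpret avoiding_strings "Pi_quiver Q" "lifted_strings Q" by (rule avoiding_strings_Pi[OF assms])
  have "(str_mods :: ('v, 'a + 'a, 'k) rep set) =
      {string_module (Pi_quiver Q) w | w. is_string (Pi_quiver Q) w \<and> is_string Q (specialize w)}"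
    unfolding str_mods_def unfolding lifted_strings_def by blast
  then have "Mcat TYPE('k) Q = string_closure" by (simp only: Mcat_def)
  then show ?thesis
    unfolding torshad_def widshad_def by (simp only: tors_wide_bij)
qed

end
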